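(* Let $\phi\in\mathcal{H}_d^*$ and suppose that every point of $\Omega(\phi)=\{\xi_1,\dots,\xi_K\}$ is of positive-homogeneous type for $\widehat\phi$. For $k=1,\dots,K$, let $\alpha_k$, $P_k$, $R_k=\operatorname{Re}P_k$, $\mu_k$, $\Upsilon_k$ be the associated data at $\xi_k$, let $A_k\in\mathrm{GL}_d(\mathbb{R})$ be such that $\xi\mapsto P_k(A_k\xi)$ is positive semi-elliptic with $\mathbf{m}_k=(m_{1,k},\dots,m_{d,k})\in\mathbb{N}_+^d$, set $m_k=\operatorname{lcm}(m_{1,k},\dots,m_{d,k})$, let $S_{\lambda,k}$ ($\lambda\in\mathbb{N}_+$) be the polynomials $S_\lambda$ constructed from $(P_k,\Upsilon_k)$ and $A_k$, and define $$\gamma_k=\min\{\gamma\in\mathbb{N}_+:S_{\gamma,k}\neq0\}.$$ Then, for any $L>0$, there are positive constants $M_1,\dots,M_K$ and $C_1,\dots,C_K$ for which $$\left|\phi^{(n)}(x)-\sum_{k=1}^Ke^{-ix\cdot\xi_k}\widehat\phi(\xi_k)^nH_{P_k}^n(x-n\alpha_k)\right|\leq\sum_{k=1}^K\frac{C_k}{n^{\mu_k+\gamma_k/2m_k}}\exp\left(-nM_kR_k^{\#}\left(\frac{x-n\alpha_k}{n}\right)\right)\leq\sum_{k=1}^K\frac{C_k}{n^{\mu_k+1/2m_k}}\exp\left(-nM_kR_k^{\#}\left(\frac{x-n\alpha_k}{n}\right)\right)$$ for all $n\in\mathbb{N}_+$ and $x\in\mathbb{Z}^d$ with $|x|\leq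 nL$. In the case that $\phi$ is finitely supported, for appropriately chosen positive constants $C_1,\dots,C_K$ and $M_1,\dots,M_K$ the estimates $$\left|\phi^{(n)}(x)-\sum_{k=1}^Ke^{-ix\cdot\xi_k}\widehat\phi(\xi_k)^nH_{P_k}^n(x-n\alpha_k)\right|\leq\sum_{k=1}^K\frac{C_k}{n^{\mu_k+\gamma_k/2m_k}}\exp\left(-nM_kR_k^{\#}\left(\frac{x-n\alpha_k}{n}\right)\right)\leq\sum_{k=1}^K\frac{C_k}{n^{\mu_k+1/2m_k}}\exp\left(-nM_kR_k^{\#}\left(\frac{x-n\alpha_k}{n}\right)\right)$$ hold for all $n\in\mathbb{N}_+$ and all $x\in\mathbb{Z}^d$.
   Context: $\mathbb{N}=\{0,1,2,\dots\}$, $\mathbb{N}_+=\{1,2,\dots\}$, $|\cdot|$ is the Euclidean norm on $\mathbb{R}^d$, $\mathbb{T}^d=(-\pi,\pi]^d$; $\gamma_k/2m_k$ means $\gamma_k/(2m_k)$, etc. Convolution powers. For $\phi\in\ell^1(\mathbb{Z}^d)$ (complex-valued, absolutely summable), $(\phi*\lambda)(x)=\sum_{y\in\mathbb{Z}^d}\phi(x-y)\lambda(y)$, $\phi^{(1)}=\phi$ and $\phi^{(n)}=\phi^{(n-1)}*\phi$ for $n\ge 2$. $\widehat{\phi}(\xi)=\sum_{x\in\mathbb{Z}^d}\phi(x)e^{ix\cdot\xi}$. $\mathcal{H}_d$ is the set of $\phi\in\ell^1(\mathbb{Z}^d)$ for which $\widehat\phi$ is holomorphic on (extends holomorphically to)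 a neighborhood of $\mathbb{T}^d$ in $\mathbb{C}^d$; $\mathcal{H}_d^*$ is the set of $\phi\in\mathcal{H}_d$ with $\sup_{\xi\in\mathbb{T}^d}|\widehat\phi(\xi)|=1$; $\Omega(\phi)=\{\xi\in\mathbb{T}^d:|\widehat\phi(\xi)|=1\}$. Positive-homogeneous polynomials. For a real $d\times d$ matrix $E$ and $t>0$, $t^E=\exp((\ln t)E)$. For $P:\mathbb{R}^d\to\mathbb{C}$, $\operatorname{Exp}(P)$ is the set of real $d\times d$ matrices $E$ with $tP(\xi)=P(t^E\xi)$ for all $t>0$, $\xi\in\mathbb{R}^d$. A complex polynomial $P$ in $d$ variables is positive-homogeneous if $\operatorname{Exp}(P)\neq\varnothing$ and $R=\operatorname{Re}P$ on $\mathbb{R}^d$ is positive-definite ($R\geq0$ and $R(\xi)=0$ only when $\xi=0$). Its homogeneous order is $\mu_P=\operatorname{tr}E$ for any $E\in\operatorname{Exp}(P)$ (positive and independent of $E$). $R^{\#}(x)=\sup_{\xi\in\mathbb{R}^d}\{x\cdot\xi-R(\xi)\}$. For $\mathbf{n}\in\mathbb{N}_+^d$ and a multi-index $\beta\in\mathbb{N}^d$, $|\beta:\mathbf{n}|=\sum_j\beta_j/n_j$. A polynomial is positive semi-elliptic with $\mathbf{m}\in\mathbb{N}_+^d$ if it has the form $\sum_{|\beta:\mathbf{m}|=2}a_\beta\xi^\beta$, $a_\beta\in\mathbb{C}$, with positive-definite real part $\sum_{|\beta:\mathbf{m}|=2}\operatorname{Re}(a_\beta)\xi^\beta$. For every positive-homogeneous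 polynomial $P$ there is $A\in\mathrm{GL}_d(\mathbb{R})$ such that $P_A(\xi)=P(A\xi)$ is positive semi-elliptic with some $\mathbf{m}$. Type of points. For $\xi_0\in\Omega(\phi)$, $\Gamma_{\xi_0}(\xi)=\operatorname{Log}(\widehat\phi(\xi+\xi_0)/\widehat\phi(\xi_0))$ (principal branch), holomorphic near $0\in\mathbb{C}^d$. $\xi_0$ is of positive-homogeneous type for $\widehat\phi$ if $\Gamma_{\xi_0}(\xi)=i\alpha_{\xi_0}\cdot\xi-P_{\xi_0}(\xi)+\Upsilon_{\xi_0}(\xi)$ with $\alpha_{\xi_0}\in\mathbb{R}^d$, $P_{\xi_0}$ a positive-homogeneous polynomial, and $\Upsilon_{\xi_0}(\xi)=o(\operatorname{Re}P_{\xi_0}(\xi))$ as $\xi\to0$ in $\mathbb{R}^d$. If all points of $\Omega(\phi)$ are of this type, $\Omega(\phi)$ is finite and one writes $\alpha_k=\alpha_{\xi_k}$, $P_k=P_{\xi_k}$, $\Upsilon_k=\Upsilon_{\xi_k}$, $\mu_k=\mu_{P_k}$. Attractors. For a positive-homogeneous polynomial $P$, $H_P^t(x)=\frac{1}{(2\pi)^d}\int_{\mathbb{R}^d}e^{-tP(\xi)}e^{-ix\cdot\xi}\,d\xi$ for $t>0$, $x\in\mathbb{R}^d$. Polynomials $S_\lambda$. Let $P$ be positive-homogeneous with $R=\operatorname{Re}P$, $\Upsilon$ holomorphic near $0\in\mathbb{C}^d$ with $\Upsilon(\xi)=o(R(\xi))$ as $\xi\to0$ in $\mathbb{R}^d$,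 and $A$ such that $P_A$ is positive semi-elliptic with $\mathbf{m}$. Set $m=\operatorname{lcm}(m_1,\dots,m_d)$, $\kappa=(\kappa_1,\dots,\kappa_d)\in\mathbb{N}_+^d$ with $m_j\kappa_j=m$, $\Lambda(\beta)=\beta\cdot\kappa-2m$. Then $\Upsilon_A(z)=\Upsilon(Az)=\sum_{|\beta:2\mathbf{m}|>1}b_\beta z^\beta$ near $0$ (all other Maclaurin coefficients vanish), and for $\lambda\in\mathbb{N}_+$ one sets $S_\lambda(z)=\lambda!\sum_{\Lambda(\beta)=\lambda}b_\beta z^\beta$. In the setting of the claim the set $\{\gamma\in\mathbb{N}_+:S_{\gamma,k}\neq0\}$ is non-empty, since otherwise $\Upsilon_k\equiv0$, which is incompatible with the $2\pi$-periodicity of $\widehat\phi$. *)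

theory Defs
  imports "HOL-Analysis.Analysis" "HOL-Library.Landau_Symbols"
begin

section \<open>Lattice points and complexified vectors\<close>

definition rvec :: "int ^ 'd \<Rightarrow> real ^ 'd" where
  "rvec x = (\<chi> j. real_of_int (x $ j))"

definition cvec :: "real ^ 'd \<Rightarrow> complex ^ 'd" where
  "cvec \<xi> = (\<chi> j. complex_of_real (\<xi> $ j))"

definition cmat :: "real ^ 'd ^ 'd \<Rightarrow> complex ^ 'd ^ 'd" where
  "cmat A = (\<chi> i j. complex_of_real (A $ i $ j))"

text \<open>Holomorphy in several variables: Fr\'echet differentiability with complex-linear
  derivative at every point of an open set.\<close>

definition holomorphic_cn :: "(complex ^ 'd \<Rightarrow> complex) \<Rightarrow> (complex ^ 'd) set \<Rightarrow> bool" where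
  "holomorphic_cn F U \<longleftrightarrow>
     open U \<and>
     (\<forall>z\<in>U. \<exists>D. (F has_derivative D) (at z) \<and> (\<forall>c v. D (c *s v) = c * D v))"


section \<open>Convolution powers and the Fourier transform\<close>

definition conv :: "(int ^ 'd \<Rightarrow> complex) \<Rightarrow> (int ^ 'd \<Rightarrow> complex) \<Rightarrow> int ^ 'd \<Rightarrow> complex" where
  "conv \<phi> \<psi> x = infsum (\<lambda>y. \<phi> (x - y) * \<psi> y) UNIV"

text \<open>The value at exponent \<open>0\<close> (the convolution unit) is a convention and plays no role.\<close>

fun conv_pow :: "(int ^ 'd \<Rightarrow> complex) \<Rightarrow> nat \<Rightarrow> int ^ 'd \<Rightarrow> complex" where
  "conv_pow \<phi> 0 = (\<lambda>x. if x = 0 then 1 else 0)"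
| "conv_pow \<phi> (Suc 0) = \<phi>"
| "conv_pow \<phi> (Suc (Suc n)) = conv (conv_pow \<phi> (Suc n)) \<phi>"

definition fhat :: "(int ^ 'd \<Rightarrow> complex) \<Rightarrow> real ^ 'd \<Rightarrow> complex" where
  "fhat \<phi> \<xi> = infsum (\<lambda>x. \<phi> x * exp (\<i> * complex_of_real (rvec x \<bullet> \<xi>))) UNIV"

definition torus :: "(real ^ 'd) set" where
  "torus = {\<xi>. \<forall>j. - pi < \<xi> $ j \<and> \<xi> $ j \<le> pi}"

text \<open>The extension \<open>F\<close> has to agree with the (periodic) function \<open>fhat \<phi>\<close> at all real points
  of the neighbourhood \<open>U\<close>, not only at those lying in the half-open cube.\<close>

definition H_class :: "(int ^ 'd \<Rightarrow> complex) set" where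
  "H_class = {\<phi>. (\<lambda>x. norm (\<phi> x)) summable_on UNIV \<and>
     (\<exists>U F. holomorphic_cn F U \<and> cvec ` torus \<subseteq> U \<and>
        (\<forall>\<xi>. cvec \<xi> \<in> U \<longrightarrow> F (cvec \<xi>) = fhat \<phi> \<xi>))}"

definition H_star :: "(int ^ 'd \<Rightarrow> complex) set" where
  "H_star = {\<phi> \<in> H_class. (SUP \<xi>\<in>torus. norm (fhat \<phi> \<xi>)) = 1}"

definition Omega :: "(int ^ 'd \<Rightarrow> complex) \<Rightarrow> (real ^ 'd) set" where
  "Omega \<phi> = {\<xi> \<in> torus. norm (fhat \<phi> \<xi>) = 1}"


section \<open>Positive-homogeneous polynomials\<close>

definition cmonom :: "complex ^ 'd \<Rightarrow> nat ^ 'd \<Rightarrow> complex" where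
  "cmonom z \<beta> = (\<Prod>j\<in>UNIV. (z $ j) ^ (\<beta> $ j))"

text \<open>Polynomials in \<open>d\<close> variables with complex coefficients are represented by the
  functions they induce on real vectors.\<close>

definition is_polynomial :: "(real ^ 'd \<Rightarrow> complex) \<Rightarrow> bool" where
  "is_polynomial P \<longleftrightarrow>
     (\<exists>a. finite {\<beta>. a \<beta> \<noteq> 0} \<and> (\<forall>\<xi>. P \<xi> = (\<Sum>\<beta> | a \<beta> \<noteq> 0. a \<beta> * cmonom (cvec \<xi>) \<beta>)))"

definition pos_definite :: "(real ^ 'd \<Rightarrow> real) \<Rightarrow> bool" where
  "pos_definite R \<longleftrightarrow> (\<forall>\<xi>. R \<xi> \<ge> 0) \<and> (\<forall>\<xi>. R \<xi> = 0 \<longrightarrow> \<xi> = 0)"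

definition mat_exp :: "real ^ 'd ^ 'd \<Rightarrow> real ^ 'd ^ 'd" where
  "mat_exp A = (\<Sum>k. (1 / fact k) *\<^sub>R (((**) A ^^ k) (mat 1)))"

definition mat_powr :: "real \<Rightarrow> real ^ 'd ^ 'd \<Rightarrow> real ^ 'd ^ 'd" where
  "mat_powr t E = mat_exp (ln t *\<^sub>R E)"

definition Exp_set :: "(real ^ 'd \<Rightarrow> complex) \<Rightarrow> (real ^ 'd ^ 'd) set" where
  "Exp_set P = {E. \<forall>t>0. \<forall>\<xi>. complex_of_real t * P \<xi> = P (mat_powr t E *v \<xi>)}"

definition pos_homogeneous :: "(real ^ 'd \<Rightarrow> complex) \<Rightarrow> bool" where
  "pos_homogeneous P \<longleftrightarrow>
     is_polynomial P \<and> Exp_set P \<noteq> {} \<and> pos_definite (\<lambda>\<xi>. Re (P \<xi>))"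

text \<open>For positive-homogeneous \<open>P\<close> the trace does not depend on the chosen exponent.\<close>

definition hom_order :: "(real ^ 'd \<Rightarrow> complex) \<Rightarrow> real" where
  "hom_order P = trace (SOME E. E \<in> Exp_set P)"

text \<open>Legendre--Fenchel transform; the supremum is finite for the real part of a
  positive-homogeneous polynomial.\<close>

definition legendre :: "(real ^ 'd \<Rightarrow> real) \<Rightarrow> real ^ 'd \<Rightarrow> real" where
  "legendre R x = (SUP \<xi>. x \<bullet> \<xi> - R \<xi>)"

definition wlen :: "nat ^ 'd \<Rightarrow> nat ^ 'd \<Rightarrow> real" where
  "wlen \<beta> n = (\<Sum>j\<in>UNIV. real (\<beta> $ j) / real (n $ j))"

definition pos_semi_elliptic :: "(real ^ 'd \<Rightarrow> complex) \<Rightarrow> nat ^ 'd \<Rightarrow> bool" where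
  "pos_semi_elliptic Q m \<longleftrightarrow>
     (\<forall>j. m $ j > 0) \<and>
     (\<exists>a. \<forall>\<xi>. Q \<xi> = (\<Sum>\<beta> | wlen \<beta> m = 2. a \<beta> * cmonom (cvec \<xi>) \<beta>)) \<and>
     pos_definite (\<lambda>\<xi>. Re (Q \<xi>))"

definition attractor :: "(real ^ 'd \<Rightarrow> complex) \<Rightarrow> real \<Rightarrow> real ^ 'd \<Rightarrow> complex" where
  "attractor P t x =
     complex_of_real (1 / (2 * pi) ^ CARD('d)) *
     (\<integral>\<xi>. exp (- complex_of_real t * P \<xi>) * exp (- \<i> * complex_of_real (x \<bullet> \<xi>)) \<partial>lborel)"


section \<open>Points of positive-homogeneous type\<close>

definition Gam :: "(int ^ 'd \<Rightarrow> complex) \<Rightarrow> real ^ 'd \<Rightarrow> real ^ 'd \<Rightarrow> complex" where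
  "Gam \<phi> \<xi>\<^sub>0 \<xi> = Ln (fhat \<phi> (\<xi> + \<xi>\<^sub>0) / fhat \<phi> \<xi>\<^sub>0)"

text \<open>\<open>\<xi>\<^sub>0\<close> is of positive-homogeneous type with data \<open>\<alpha>\<close>, \<open>P\<close>, \<open>\<Upsilon>\<close>.  The remainder \<open>\<Upsilon>\<close> is a
  function of complex vectors, holomorphic near \<open>0\<close>; by the identity theorem its germ at \<open>0\<close>
  is determined by its values at real points.\<close>

definition pos_hom_type_with ::
  "(int ^ 'd \<Rightarrow> complex) \<Rightarrow> real ^ 'd \<Rightarrow> real ^ 'd \<Rightarrow> (real ^ 'd \<Rightarrow> complex) \<Rightarrow>
   (complex ^ 'd \<Rightarrow> complex) \<Rightarrow> bool" where
  "pos_hom_type_with \<phi> \<xi>\<^sub>0 \<alpha> P \<Upsilon> \<longleftrightarrow>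
     pos_homogeneous P \<and>
     (\<exists>U. 0 \<in> U \<and> holomorphic_cn \<Upsilon> U) \<and>
     (\<forall>\<^sub>F \<xi> in nhds 0.
        Gam \<phi> \<xi>\<^sub>0 \<xi> = \<i> * complex_of_real (\<alpha> \<bullet> \<xi>) - P \<xi> + \<Upsilon> (cvec \<xi>)) \<and>
     (\<lambda>\<xi>. \<Upsilon> (cvec \<xi>)) \<in> o[at 0](\<lambda>\<xi>. complex_of_real (Re (P \<xi>)))"


section \<open>The polynomials $S_\lambda$\<close>

definition lcm_of :: "nat ^ 'd \<Rightarrow> nat" where
  "lcm_of m = Lcm (range (\<lambda>j. m $ j))"

text \<open>\<open>m $ j * kappa m $ j = lcm_of m\<close>, the division being exact.\<close>

definition kappa :: "nat ^ 'd \<Rightarrow> nat ^ 'd" where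
  "kappa m = (\<chi> j. lcm_of m div (m $ j))"

definition Lam :: "nat ^ 'd \<Rightarrow> nat ^ 'd \<Rightarrow> int" where
  "Lam m \<beta> = (\<Sum>j\<in>UNIV. int (\<beta> $ j) * int (kappa m $ j)) - 2 * int (lcm_of m)"

text \<open>The (unique) family of Maclaurin coefficients of a function holomorphic near \<open>0\<close>.\<close>

definition maclaurin_coeff :: "(complex ^ 'd \<Rightarrow> complex) \<Rightarrow> nat ^ 'd \<Rightarrow> complex" where
  "maclaurin_coeff f =
     (THE b. \<forall>\<^sub>F z in nhds 0. ((\<lambda>\<beta>. b \<beta> * cmonom z \<beta>) has_sum f z) UNIV)"

definition S_poly ::
  "(complex ^ 'd \<Rightarrow> complex) \<Rightarrow> real ^ 'd ^ 'd \<Rightarrow> nat ^ 'd \<Rightarrow> nat \<Rightarrow> complex ^ 'd \<Rightarrow> complex" where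
  "S_poly \<Upsilon> A m l z =
     fact l * (\<Sum>\<beta> | Lam m \<beta> = int l.
       maclaurin_coeff (\<lambda>w. \<Upsilon> (cmat A *v w)) \<beta> * cmonom z \<beta>)"

definition gamma_ord :: "(complex ^ 'd \<Rightarrow> complex) \<Rightarrow> real ^ 'd ^ 'd \<Rightarrow> nat ^ 'd \<Rightarrow> nat" where
  "gamma_ord \<Upsilon> A m = (LEAST g. g > 0 \<and> S_poly \<Upsilon> A m g \<noteq> (\<lambda>z. 0))"


section \<open>The two sides of the estimate\<close>

definition llt_error ::
  "(int ^ 'd \<Rightarrow> complex) \<Rightarrow> (real ^ 'd \<Rightarrow> real ^ 'd) \<Rightarrow> (real ^ 'd \<Rightarrow> real ^ 'd \<Rightarrow> complex) \<Rightarrow>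
   nat \<Rightarrow> int ^ 'd \<Rightarrow> real" where
  "llt_error \<phi> \<alpha> P n x =
     norm (conv_pow \<phi> n x -
       (\<Sum>\<eta>\<in>Omega \<phi>. exp (- \<i> * complex_of_real (rvec x \<bullet> \<eta>)) * fhat \<phi> \<eta> ^ n *
          attractor (P \<eta>) (real n) (rvec x - real n *\<^sub>R \<alpha> \<eta>)))"

text \<open>\<open>g \<eta>\<close> is the numerator of the exponent gain \<open>g \<eta> / (2 m\<^sub>\<eta>)\<close>.\<close>

definition llt_bound ::
  "(int ^ 'd \<Rightarrow> complex) \<Rightarrow> (real ^ 'd \<Rightarrow> real ^ 'd) \<Rightarrow> (real ^ 'd \<Rightarrow> real ^ 'd \<Rightarrow> complex) \<Rightarrow>
   (real ^ 'd \<Rightarrow> nat ^ 'd) \<Rightarrow> (real ^ 'd \<Rightarrow> nat) \<Rightarrow>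
   (real ^ 'd \<Rightarrow> real) \<Rightarrow> (real ^ 'd \<Rightarrow> real) \<Rightarrow> nat \<Rightarrow> int ^ 'd \<Rightarrow> real" where
  "llt_bound \<phi> \<alpha> P m g C M n x =
     (\<Sum>\<eta>\<in>Omega \<phi>.
        C \<eta> / real n powr (hom_order (P \<eta>) + real (g \<eta>) / (2 * real (lcm_of (m \<eta>)))) *
        exp (- real n * M \<eta> *
          legendre (\<lambda>\<xi>. Re (P \<eta> \<xi>)) ((1 / real n) *\<^sub>R (rvec x - real n *\<^sub>R \<alpha> \<eta>))))"

end

theory Submission
  imports Defs "HOL-Complex_Analysis.Conformal_Mappings"
begin

text \<open>
  Fourier inversion writes \<open>\<phi>\<^sup>(\<^sup>n\<^sup>)(x)\<close> as \<open>(2\<pi>)\<^sup>-\<^sup>d\<close> times the integral of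
  \<open>(fhat \<phi> \<xi>)\<^sup>n exp (- i x \<xi>)\<close> over a period cell.  The modulus of \<open>fhat \<phi>\<close> is at most \<open>1\<close>, and the
  points where it is \<open>1\<close> are isolated because there \<open>Re P\<close> dominates \<open>\<Upsilon>\<close>; so there are finitely many,
  and away from them the integrand is bounded by \<open>q\<^sup>n\<close> with \<open>q < 1\<close>.  Lipschitz cutoffs split off one
  integral for each \<open>\<eta> \<in> Omega \<phi>\<close> (lemma \<open>localization\<close>).  In the linear coordinates in which \<open>P\<close> is
  positive semi-elliptic, and with \<open>y = A\<^sup>T (x - n \<alpha>)\<close>, that integral has the integrand
  \<open>exp (- i y z - n P z) exp (n U z)\<close>, while the attractor is the full integral of the first factor.

  The local comparison (theorem \<open>local_limit\<close>) rests on two ideas.  First, the coefficients of \<open>U\<close> of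
  weight at most \<open>2m\<close> vanish and \<open>\<gamma>\<close> is the first excess weight that occurs, so that \<open>\<bar>U z\<bar>\<close> is bounded by
  a multiple of \<open>N z\<^sup>2\<^sup>m\<^sup>+\<^sup>\<gamma>\<close> for a quasi-norm \<open>N\<close> that is homogeneous of degree one under the dilations
  of \<open>P\<close>.  As \<open>\<bar>exp w - 1\<bar> \<le> \<bar>w\<bar> exp \<bar>w\<bar>\<close>, replacing \<open>exp (n U z)\<close> by \<open>1\<close> gains the factor
  \<open>n powr (- \<gamma> / 2m)\<close> on top of the factor \<open>n powr (- \<mu>)\<close> that the dilations give for the integral of
  \<open>exp (- c n N\<^sup>2\<^sup>m)\<close>.  Secondly, the spatial decay comes from moving the contour to \<open>\<xi> - i e w\<close>, where
  \<open>w\<close> nearly maximizes \<open>w \<mapsto> (y / n) w - R w\<close> and \<open>e\<close> is a small constant.  The shift gains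
  \<open>e (y / n) w\<close> in the exponent per unit of \<open>n\<close> and costs at most \<open>e R w\<close>, because the cost is of
  order \<open>e\<^sup>2\<close>; the net gain is \<open>e/2\<close> times the Legendre transform \<open>R\<^sup>#(y / n)\<close>.

  The contour has to be moved in the presence of a cutoff \<open>\<chi>\<close>.  The integral of \<open>\<chi>(x) g(x + \<tau> v)\<close> is
  holomorphic in the single complex variable \<open>\<tau>\<close>, and its derivative may be computed along real
  increments, which translate \<open>x\<close> and therefore fall on \<open>\<chi>\<close> (lemma \<open>integral_cutoff_shift\<close>).  The
  resulting error lives on an annulus and is exponentially small.

  For \<open>\<bar>x\<bar> \<le> n L\<close> the numbers \<open>R\<^sup>#((x - n \<alpha>) / n)\<close> are bounded, so that every exponentially small error
  is absorbed by the right-hand side.  If \<open>\<phi>\<close> has finite support, then \<open>\<phi>\<^sup>(\<^sup>n\<^sup>)(x)\<close> vanishes beyond some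
  \<open>n L\<close>, and there \<open>R\<^sup>#\<close> is at least a positive constant, so that half of the decay of the
  attractors pays for the extra power of \<open>n\<close>.  That \<open>\<gamma>\<close> exists and is positive, which gives the second inequality, needs \<open>U\<close> not to vanish
  identically: otherwise \<open>fhat \<phi>\<close> would equal \<open>exp (i \<alpha> \<xi> - P \<xi>)\<close> times a constant along a whole line by
  analytic continuation, contradicting its periodicity.  Finally, \<open>hom_order\<close> is the trace of an
  arbitrary exponent of \<open>P\<close>; comparing volumes identifies it with the dilation exponent \<open>\<mu>\<close>.
\<close>

section \<open>Linear changes of variables in Lebesgue integrals\<close>

lemma Basis_vec_real: "(Basis :: (real^'d) set) = range (\<lambda>i. axis i 1)"
  by (auto simp: Basis_vec_def)

lemma
  shows sum_Basis_vec: "sum g (Basis :: (real^'d) set) = (\<Sum>i\<in>UNIV. g (axis i 1))"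
    and prod_Basis_vec: "prod h (Basis :: (real^'d) set) = (\<Prod>i\<in>UNIV. h (axis i 1))"
  unfolding Basis_vec_real by (simp_all add: sum.reindex prod.reindex inj_on_def axis_eq_axis)

text \<open>Lebesgue measure is determined by its values on boxes.  The preimage of a box under the inverse of a
  shear is the image of the box under the shear, and this image has the volume of the box.\<close>

lemma nn_integral_shear:
  fixes m n :: "'d::finite" and h :: "real^'d \<Rightarrow> ennreal"
  assumes mn: "m \<noteq> n" and h: "h \<in> borel_measurable borel"
  shows "(\<integral>\<^sup>+x. h x \<partial>lborel) =
    (\<integral>\<^sup>+x. h (\<chi> i. if i = m then x$m + x$n else x$i) \<partial>lborel)"
proof -
  let ?f = "\<lambda>x::real^'d. \<chi> i. if i = m then x$m + x$n else x$i"
  let ?g = "\<lambda>x::real^'d. \<chi> i. if i = m then x$m - x$n else x$i"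
  have lin: "linear ?f" "linear ?g"
    by (rule linearI; simp add: vec_eq_iff algebra_simps)+
  have fg: "?f (?g x) = x" "?g (?f x) = x" for x
    using mn by (simp_all add: vec_eq_iff)
  have fm[measurable]: "?f \<in> borel_measurable borel" and gm[measurable]: "?g \<in> borel_measurable borel"
    by (intro borel_measurable_continuous_onI linear_continuous_on linear_conv_bounded_linear[THEN iffD1] lin)+
  have cb: "measure lebesgue (?f ` cbox a b) = 1 * measure lebesgue (cbox a b)" for a b
  proof (cases "cbox a b = {}")
    case False
    \<comment> \<open>the volume formula for sheared boxes asks for \<open>a $ n \<ge> 0\<close>; a translation by \<open>?v\<close> makes it \<open>0\<close>\<close>
    let ?v = "\<chi> i. if i = n then - a $ n else 0"
    have *: "?f ` cbox a b = (+) (- ?f ?v) ` ?f ` cbox (?v + a) (?v + b)"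
      unfolding cbox_translation image_comp o_def
      by (intro image_cong refl) (simp add: vec_eq_iff)
    have "measure lebesgue (?f ` cbox a b) = measure lebesgue (?f ` cbox (?v + a) (?v + b))"
      unfolding * by (rule measure_translation)
    also have "\<dots> = measure lebesgue (cbox (?v + a) (?v + b))"
      by (rule measure_shear_interval) (use mn False in \<open>auto simp: cbox_translation\<close>)
    also have "\<dots> = measure lebesgue (cbox a b)"
      unfolding cbox_translation by (rule measure_translation)
    finally show ?thesis by simp
  qed simp
  have "lborel = distr lborel borel ?g"
  proof (rule lborel_eqI)
    fix l u :: "real^'d" assume le: "\<And>b. b \<in> Basis \<Longrightarrow> l \<bullet> b \<le> u \<bullet> b"
    have S: "?f ` box l u = ?g -` box l u"
    proof (intro set_eqI iffI)
      fix x assume "x \<in> ?f ` box l u" then obtain y where y: "y \<in> box l u" "x = ?f y" by blast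
      have "?g x = y" unfolding y(2) by (rule fg(2))
      with y(1) show "x \<in> ?g -` box l u" by (simp only: vimage_eq)
    next
      fix x assume "x \<in> ?g -` box l u" then have "?g x \<in> box l u" by (simp only: vimage_eq)
      then show "x \<in> ?f ` box l u" by (rule image_eqI[rotated]) (rule fg(1)[symmetric])
    qed
    have "box l u \<in> lmeasurable" by simp
    from measure_linear_sufficient[OF lin(1) this cb]
    have m: "?f ` box l u \<in> lmeasurable" "measure lebesgue (?f ` box l u) = measure lebesgue (box l u)" by auto
    have mb: "?g -` box l u \<in> sets borel" using measurable_sets[OF gm, of "box l u"] by simp
    have "emeasure (distr lborel borel ?g) (box l u) = emeasure lborel (?g -` box l u)"
      by (simp add: emeasure_distr)
    also have "\<dots> = emeasure lebesgue (?f ` box l u)"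
      unfolding S using mb by simp
    also have "\<dots> = emeasure lebesgue (box l u)"
      using fmeasurableD2[OF m(1)] fmeasurableD2[OF lmeasurable_box] m(2)
      by (subst (1 2) emeasure_eq_ennreal_measure) (auto simp del: emeasure_completion)
    also have "\<dots> = (\<Prod>b\<in>Basis. (u - l) \<bullet> b)" using le by (simp add: emeasure_lborel_box_eq inner_simps)
    finally show "emeasure (distr lborel borel ?g) (box l u) = ennreal (\<Prod>b\<in>Basis. (u - l) \<bullet> b)" .
  qed simp
  then have "(\<integral>\<^sup>+x. h (?f x) \<partial>lborel) = (\<integral>\<^sup>+x. h (?f x) \<partial>distr lborel borel ?g)" by simp
  also have "\<dots> = (\<integral>\<^sup>+x. h (?f (?g x)) \<partial>lborel)"
    using h by (intro nn_integral_distr) auto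
  finally show ?thesis by (simp only: fg)
qed

lemma nn_integral_swap:
  fixes m n :: "'d::finite" and h :: "real^'d \<Rightarrow> ennreal"
  assumes h: "h \<in> borel_measurable borel"
  shows "(\<integral>\<^sup>+x. h x \<partial>lborel) = (\<integral>\<^sup>+x. h (\<chi> i. x $ Transposition.transpose m n i) \<partial>lborel)"
proof -
  let ?f = "\<lambda>x::real^'d. \<chi> i. x $ Transposition.transpose m n i"
  have fm[measurable]: "?f \<in> borel_measurable borel"
    by (intro borel_measurable_continuous_onI continuous_intros)
  have "lborel = distr lborel borel ?f"
  proof (rule lborel_eqI)
    fix l u :: "real^'d" assume le: "\<And>b. b \<in> Basis \<Longrightarrow> l \<bullet> b \<le> u \<bullet> b"
    then have le': "l $ i \<le> u $ i" for i by (simp add: cart_eq_inner_axis Basis_vec_real)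
    have "?f -` box l u = box (?f l) (?f u)"
      by (auto simp: mem_box_cart) (metis transpose_involutory)+
    then have "emeasure (distr lborel borel ?f) (box l u) = emeasure lborel (box (?f l) (?f u))"
      by (simp add: emeasure_distr)
    also have "\<dots> = (\<Prod>b\<in>Basis. (?f u - ?f l) \<bullet> b)"
      by (subst emeasure_lborel_box) (auto simp: Basis_vec_def inner_axis le')
    also have "(\<Prod>b\<in>Basis. (?f u - ?f l) \<bullet> b) = (\<Prod>i\<in>UNIV. (?f u - ?f l) $ i)"
      by (simp add: prod_Basis_vec cart_eq_inner_axis)
    also have "\<dots> = (\<Prod>i\<in>UNIV. (u - l) $ i)"
      using prod.permute [OF permutes_swap_id[of m UNIV n], where g="\<lambda>i. (u - l)$i"] by (simp add: o_def)
    also have "\<dots> = (\<Prod>b\<in>Basis. (u - l) \<bullet> b)"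
      by (simp add: prod_Basis_vec cart_eq_inner_axis)
    finally show "emeasure (distr lborel borel ?f) (box l u) = ennreal (\<Prod>b\<in>Basis. (u - l) \<bullet> b)" .
  qed simp
  then have "(\<integral>\<^sup>+x. h x \<partial>lborel) = (\<integral>\<^sup>+x. h x \<partial>distr lborel borel ?f)" by simp
  also have "\<dots> = (\<integral>\<^sup>+x. h (?f x) \<partial>lborel)"
    using h by (intro nn_integral_distr) auto
  finally show ?thesis .
qed

lemma nn_integral_diagonal:
  fixes c :: "'d::finite \<Rightarrow> real" and h :: "real^'d \<Rightarrow> ennreal"
  assumes c: "\<And>i. c i \<noteq> 0" and h: "h \<in> borel_measurable borel"
  shows "(\<integral>\<^sup>+x. h x \<partial>lborel) = ennreal \<bar>\<Prod>i\<in>UNIV. c i\<bar> * (\<integral>\<^sup>+x. h (\<chi> i. c i * x $ i) \<partial>lborel)"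
proof -
  define c' where "c' b = c (SOME i. b = axis i 1)" for b :: "real^'d"
  have c'[simp]: "c' (axis i 1) = c i" for i unfolding c'_def by (simp add: axis_eq_axis)
  have T: "0 + (\<Sum>j\<in>Basis. (c' j * (x \<bullet> j)) *\<^sub>R j) = (\<chi> i. c i * x $ i)" for x :: "real^'d"
    by (simp add: sum_Basis_vec vec_eq_iff inner_axis) (simp add: axis_def if_distrib cong: if_cong)
  have P: "(\<Prod>j\<in>(Basis::(real^'d) set). \<bar>c' j\<bar>) = \<bar>\<Prod>i\<in>UNIV. c i\<bar>"
    by (simp add: prod_Basis_vec abs_prod)
  have [measurable]: "(\<lambda>x::real^'d. \<chi> i. c i * x $ i) \<in> borel_measurable borel"
    by (intro borel_measurable_continuous_onI continuous_intros)
  note h[measurable]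
  have "lborel = density (distr lborel borel (\<lambda>x. \<chi> i. c i * x $ i)) (\<lambda>_. \<bar>\<Prod>i\<in>UNIV. c i\<bar>)"
    using lborel_affine_euclidean[of c' "0::real^'d", unfolded T P] c by (force simp: Basis_vec_real)
  then have "(\<integral>\<^sup>+x. h x \<partial>lborel) = (\<integral>\<^sup>+x. h x \<partial>density (distr lborel borel (\<lambda>x. \<chi> i. c i * x $ i)) (\<lambda>_. \<bar>\<Prod>i\<in>UNIV. c i\<bar>))"
    by simp
  also have "\<dots> = (\<integral>\<^sup>+x. ennreal \<bar>\<Prod>i\<in>UNIV. c i\<bar> * h (\<chi> i. c i * x $ i) \<partial>lborel)"
    by (subst nn_integral_density) (auto intro!: nn_integral_distr)
  finally show ?thesis
    by (subst (asm) nn_integral_cmult) auto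
qed

text \<open>Every linear map is a composition of coordinate scalings, transpositions and shears, and the formula is
  multiplicative under composition.  A map with a vanishing row has determinant \<open>0\<close>.\<close>

lemma nn_integral_linear:
  fixes f :: "real^'d \<Rightarrow> real^'d" and h :: "real^'d \<Rightarrow> ennreal"
  assumes f: "linear f" and det: "det (matrix f) \<noteq> 0" and h: "h \<in> borel_measurable borel"
  shows "(\<integral>\<^sup>+x. h x \<partial>lborel) = ennreal \<bar>det (matrix f)\<bar> * (\<integral>\<^sup>+x. h (f x) \<partial>lborel)"
proof -
  define Q where "Q f \<longleftrightarrow> (det (matrix f) \<noteq> 0 \<longrightarrow> (\<forall>h\<in>borel_measurable borel.
     (\<integral>\<^sup>+x. h x \<partial>lborel) = ennreal \<bar>det (matrix f)\<bar> * (\<integral>\<^sup>+x. h (f x) \<partial>lborel)))"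
    for f :: "real^'d \<Rightarrow> real^'d"
  have "Q f"
  proof (rule induct_linear_elementary[OF f])
    fix f g :: "real^'d \<Rightarrow> real^'d" assume fg: "linear f" "linear g" "Q f" "Q g"
    have fm: "f \<in> borel_measurable borel"
      using fg(1) by (intro borel_measurable_continuous_onI linear_continuous_on linear_conv_bounded_linear[THEN iffD1])
    have d: "det (matrix (f \<circ> g)) = det (matrix f) * det (matrix g)"
      using matrix_compose[OF fg(2,1)] by (simp add: det_mul)
    show "Q (f \<circ> g)" unfolding Q_def
    proof (intro impI ballI)
      fix h :: "real^'d \<Rightarrow> ennreal" assume nz: "det (matrix (f \<circ> g)) \<noteq> 0" and h: "h \<in> borel_measurable borel"
      have "(\<integral>\<^sup>+x. h x \<partial>lborel) = ennreal \<bar>det (matrix f)\<bar> * (\<integral>\<^sup>+x. h (f x) \<partial>lborel)"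
        using fg(3) nz d h unfolding Q_def by auto
      also have "(\<integral>\<^sup>+x. h (f x) \<partial>lborel) = ennreal \<bar>det (matrix g)\<bar> * (\<integral>\<^sup>+x. h (f (g x)) \<partial>lborel)"
        using fg(4) nz d measurable_compose[OF fm h] unfolding Q_def by auto
      finally show "(\<integral>\<^sup>+x. h x \<partial>lborel) = ennreal \<bar>det (matrix (f \<circ> g))\<bar> * (\<integral>\<^sup>+x. h ((f \<circ> g) x) \<partial>lborel)"
        by (simp add: d abs_mult ennreal_mult mult.assoc)
    qed
  next
    fix f :: "real^'d \<Rightarrow> real^'d" and i assume "linear f" "\<And>x. f x $ i = 0"
    then have "row i (matrix f) = 0" by (simp add: row_def matrix_def vec_eq_iff)
    then show "Q f" unfolding Q_def by (simp add: det_zero_row)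
  next
    fix c :: "'d \<Rightarrow> real"
    have "matrix (\<lambda>x. \<chi> i. c i * x $ i) = (\<chi> i j. if i = j then c i else 0)"
      by (auto simp: matrix_def vec_eq_iff axis_def)
    then have "det (matrix (\<lambda>x. \<chi> i. c i * x $ i)) = prod c UNIV" by (simp add: det_diagonal)
    then show "Q (\<lambda>x. \<chi> i. c i * x $ i)" unfolding Q_def
      using nn_integral_diagonal[of c] by auto
  next
    fix m n :: 'd assume "m \<noteq> n"
    have "matrix (\<lambda>x::real^'d. \<chi> i. x $ Transposition.transpose m n i) = (\<chi> i. mat 1 $ Transposition.transpose m n i)"
      by (auto simp: matrix_def vec_eq_iff axis_def mat_def)
    then have "\<bar>det (matrix (\<lambda>x::real^'d. \<chi> i. x $ Transposition.transpose m n i))\<bar> = 1"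
      by (simp add: det_permute_rows permutes_swap_id sign_swap_id abs_mult)
    then show "Q (\<lambda>x. \<chi> i. x $ Transposition.transpose m n i)" unfolding Q_def
      using nn_integral_swap[where m=m and n=n] by (auto simp del: transpose_eq_id_iff)
    have "matrix (\<lambda>x::real^'d. \<chi> i. if i = m then x$m + x$n else x$i) =
        (\<chi> k. if k = m then row m (mat 1) + 1 *s row n (mat 1) else row k (mat 1))"
      by (auto simp: matrix_def vec_eq_iff axis_def mat_def row_def)
    then have "det (matrix (\<lambda>x::real^'d. \<chi> i. if i = m then x$m + x$n else x$i)) = 1"
      by (simp only: det_row_operation[OF \<open>m \<noteq> n\<close>] det_I)
    then show "Q (\<lambda>x. \<chi> i. if i = m then x$m + x$n else x$i)" unfolding Q_def
      using nn_integral_shear[OF \<open>m \<noteq> n\<close>] by auto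
  qed
  then show ?thesis using det h unfolding Q_def by auto
qed

lemma lborel_linear:
  fixes B :: "real^'d^'d"
  assumes "det B \<noteq> 0"
  shows "lborel = density (distr lborel borel ((*v) B)) (\<lambda>_. ennreal \<bar>det B\<bar>)"
proof (rule measure_eqI)
  have m[measurable]: "(*v) B \<in> borel_measurable borel"
    by (intro borel_measurable_continuous_onI linear_continuous_on linear_conv_bounded_linear[THEN iffD1] matrix_vector_mul_linear)
  fix S :: "(real^'d) set" assume "S \<in> sets lborel"
  then have S[measurable]: "S \<in> sets borel" by simp
  have "emeasure lborel S = (\<integral>\<^sup>+x. indicator S x \<partial>lborel)" by simp
  also have "\<dots> = ennreal \<bar>det B\<bar> * (\<integral>\<^sup>+x. indicator S (B *v x) \<partial>lborel)"
    using nn_integral_linear[of "(*v) B" "indicator S"] assms by auto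
  also have "\<dots> = ennreal \<bar>det B\<bar> * (\<integral>\<^sup>+x. indicator S x \<partial>distr lborel borel ((*v) B))"
    by (subst nn_integral_distr) auto
  finally show "emeasure lborel S = emeasure (density (distr lborel borel ((*v) B)) (\<lambda>_. ennreal \<bar>det B\<bar>)) S"
    by (simp add: emeasure_density nn_integral_cmult)
qed simp

lemma integral_linear:
  fixes B :: "real^'d^'d" and f :: "real^'d \<Rightarrow> 'b::{banach, second_countable_topology}"
  assumes B: "det B \<noteq> 0" and f: "f \<in> borel_measurable borel"
  shows "integral\<^sup>L lborel f = \<bar>det B\<bar> *\<^sub>R (\<integral>x. f (B *v x) \<partial>lborel)"
proof -
  have m[measurable]: "(*v) B \<in> borel_measurable borel"
    by (intro borel_measurable_continuous_onI linear_continuous_on linear_conv_bounded_linear[THEN iffD1] matrix_vector_mul_linear)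
  note f[measurable]
  have "integral\<^sup>L lborel f = integral\<^sup>L (density (distr lborel borel ((*v) B)) (\<lambda>_. ennreal \<bar>det B\<bar>)) f"
    using lborel_linear[OF B] by simp
  also have "\<dots> = (\<integral>x. \<bar>det B\<bar> *\<^sub>R f (B *v x) \<partial>lborel)"
    by (subst integral_density) (auto simp: integral_distr)
  finally show ?thesis by simp
qed

section \<open>Fourier inversion on the integer lattice\<close>

lemma
  fixes f :: "'d::finite \<Rightarrow> real \<Rightarrow> 'b::{real_normed_field, banach, second_countable_topology}"
  assumes f: "\<And>i. integrable lborel (f i)"
  shows integrable_prod_vec: "integrable lborel (\<lambda>x::real^'d. \<Prod>i\<in>UNIV. f i (x $ i))"
    and integral_prod_vec: "(\<integral>x. (\<Prod>i\<in>UNIV. f i ((x::real^'d) $ i)) \<partial>lborel) = (\<Prod>i\<in>UNIV. integral\<^sup>L lborel (f i))"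
proof -
  interpret product_sigma_finite "\<lambda>_::real^'d. lborel::real measure" by standard
  define f' where "f' b = f (SOME i. b = axis i 1)" for b :: "real^'d"
  have f'[simp]: "f' (axis i 1) = f i" for i unfolding f'_def by (simp add: axis_eq_axis)
  have f'i: "integrable lborel (f' b)" for b unfolding f'_def by (rule f)
  let ?S = "\<lambda>g. \<Sum>b\<in>(Basis::(real^'d) set). g b *\<^sub>R b"
  have S: "?S g $ i = g (axis i 1)" for g i
    by (simp add: sum_Basis_vec) (simp add: axis_def if_distrib cong: if_cong)
  have P: "(\<Prod>i\<in>UNIV. f i (?S g $ i)) = (\<Prod>b\<in>Basis. f' b (g b))" for g
    unfolding S by (simp add: prod_Basis_vec)
  have [measurable]: "f i \<in> borel_measurable borel" for i using borel_measurable_integrable[OF f] by simp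
  have [measurable]: "?S \<in> measurable (Pi\<^sub>M Basis (\<lambda>_. lborel)) borel"
    by (intro borel_measurable_sum borel_measurable_scaleR measurable_component_singleton) auto
  have m[measurable]: "(\<lambda>x::real^'d. \<Prod>i\<in>UNIV. f i (x $ i)) \<in> borel_measurable borel"
  proof (rule borel_measurable_prod)
    fix i
    have "(\<lambda>x::real^'d. x $ i) \<in> borel_measurable borel"
      by (intro borel_measurable_continuous_onI continuous_intros)
    then show "(\<lambda>x::real^'d. f i (x $ i)) \<in> borel_measurable borel"
      by (rule measurable_compose) measurable
  qed
  show "integrable lborel (\<lambda>x::real^'d. \<Prod>i\<in>UNIV. f i (x $ i))"
    by (subst lborel_eq, subst integrable_distr_eq) (simp_all add: P product_integrable_prod f'i del: sum_component vector_scaleR_component)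
  have "(\<integral>x. (\<Prod>i\<in>UNIV. f i ((x::real^'d) $ i)) \<partial>lborel) = (\<Prod>b\<in>Basis. integral\<^sup>L lborel (f' b))"
    by (subst lborel_eq, subst integral_distr) (simp_all add: P product_integral_prod f'i del: sum_component vector_scaleR_component)
  also have "\<dots> = (\<Prod>i\<in>UNIV. integral\<^sup>L lborel (f i))"
    by (simp add: prod_Basis_vec)
  finally show "(\<integral>x. (\<Prod>i\<in>UNIV. f i ((x::real^'d) $ i)) \<partial>lborel) = (\<Prod>i\<in>UNIV. integral\<^sup>L lborel (f i))" .
qed

text \<open>A closed period cell whose position \<open>e\<close> is left free: it is chosen later so that the finitely many
  maximum points of the transform lie in the interior.\<close>

definition cube :: "real \<Rightarrow> (real^'d) set" where
  "cube e = {\<xi>. \<forall>j. e - pi \<le> \<xi> $ j \<and> \<xi> $ j \<le> e + pi}"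

lemma compact_cube: "compact (cube e :: (real^'d) set)"
proof -
  have "cube e = (cbox (\<chi> j. e - pi) (\<chi> j. e + pi) :: (real^'d) set)"
    by (auto simp: cube_def mem_box_cart)
  then show ?thesis by simp
qed

definition chr :: "int^'d \<Rightarrow> real^'d \<Rightarrow> complex" where
  "chr x \<xi> = exp (\<i> * complex_of_real (rvec x \<bullet> \<xi>))"

lemma norm_chr[simp]: "norm (chr x \<xi>) = 1" by (simp add: chr_def)

lemma continuous_chr[continuous_intros]: "continuous_on S (chr x)"
  unfolding chr_def by (intro continuous_intros)

lemma rvec_add: "rvec (x + y) = rvec x + rvec y" and rvec_minus: "rvec (- x) = - rvec x"
  and rvec_0[simp]: "rvec 0 = 0"
  by (simp_all add: rvec_def vec_eq_iff)

lemma chr_add: "chr (x + y) \<xi> = chr x \<xi> * chr y \<xi>"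
  by (simp add: chr_def rvec_add inner_add_left distrib_left exp_add)

lemma chr_minus: "chr (- x) \<xi> = exp (- \<i> * complex_of_real (rvec x \<bullet> \<xi>))"
  by (simp add: chr_def rvec_minus)

lemma integral_exp_period:
  fixes k :: int
  shows "integrable lborel (\<lambda>t. indicator {e - pi..e + pi} t *\<^sub>R exp (\<i> * complex_of_real (of_int k * t)))" (is ?I)
    and "(\<integral>t. indicator {e - pi..e + pi} t *\<^sub>R exp (\<i> * complex_of_real (of_int k * t)) \<partial>lborel) =
      (if k = 0 then 2 * pi else 0)" (is ?E)
proof -
  have c: "continuous_on {e - pi..e + pi} (\<lambda>t. exp (\<i> * complex_of_real (of_int k * t)))"
    by (intro continuous_intros)
  show ?I using borel_integrable_atLeastAtMost'[OF c] by (simp add: set_integrable_def)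
  show ?E
  proof (cases "k = 0")
    case False
    let ?F = "\<lambda>t::real. exp (\<i> * complex_of_real (of_int k * t)) / (\<i> * of_int k)"
    have d: "(?F has_vector_derivative exp (\<i> * complex_of_real (of_int k * t))) (at t within {e - pi..e + pi})" for t
    proof -
      have "((\<lambda>z. exp (\<i> * (of_int k * z)) / (\<i> * of_int k)) has_field_derivative exp (\<i> * (of_int k * complex_of_real t))) (at (complex_of_real t))"
        by (rule derivative_eq_intros refl)+ (use False in \<open>simp_all add: divide_simps, simp add: algebra_simps\<close>)
      from has_vector_derivative_real_field[OF this] show ?thesis by (simp add: o_def)
    qed
    have "(\<integral>t. indicator {e - pi..e + pi} t *\<^sub>R exp (\<i> * complex_of_real (of_int k * t)) \<partial>lborel) = ?F (e + pi) - ?F (e - pi)"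
      by (rule integral_FTC_atLeastAtMost[OF _ d c]) (use pi_gt_zero in linarith)
    also have "exp (\<i> * complex_of_real (of_int k * (e + pi))) = exp (\<i> * complex_of_real (of_int k * (e - pi))) * exp (of_int (2*k) * (of_real pi * \<i>))"
      by (subst exp_add[symmetric]) (simp add: algebra_simps)
    also have "exp (of_int (2*k) * (of_real pi * \<i>)) = 1"
      using exp_integer_2pi[of "of_int k"] by (simp add: algebra_simps)
    finally show ?thesis using False by simp
  qed (simp add: scaleR_conv_of_real)
qed

lemma integral_chr_cube:
  fixes x :: "int^'d"
  shows "integrable lborel (\<lambda>\<xi>. indicator (cube e) \<xi> *\<^sub>R chr x \<xi>)" (is ?I)
    and "(\<integral>\<xi>. indicator (cube e) \<xi> *\<^sub>R chr x \<xi> \<partial>lborel) = (if x = 0 then (2 * pi) ^ CARD('d) else 0)" (is ?E)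
proof -
  let ?f = "\<lambda>j t. indicator {e - pi..e + pi} t *\<^sub>R exp (\<i> * complex_of_real (of_int (x $ j) * t))"
  have ind: "indicator (cube e) \<xi> = (\<Prod>j\<in>UNIV. indicator {e - pi..e + pi} (\<xi> $ j) :: real)" for \<xi> :: "real^'d"
  proof (cases "\<xi> \<in> cube e")
    case True then show ?thesis by (simp add: cube_def)
  next
    case False then obtain j where "\<xi> $ j \<notin> {e - pi..e + pi}" by (auto simp: cube_def)
    then show ?thesis using False by (auto intro!: exI[of _ j])
  qed
  have *: "indicator (cube e) \<xi> *\<^sub>R chr x \<xi> = (\<Prod>j\<in>UNIV. ?f j (\<xi> $ j))" for \<xi>
    unfolding chr_def ind scaleR_conv_of_real
    by (simp add: prod.distrib inner_vec_def rvec_def sum_distrib_left exp_sum)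
  show ?I unfolding * by (rule integrable_prod_vec) (rule integral_exp_period)
  have "(\<integral>\<xi>. indicator (cube e) \<xi> *\<^sub>R chr x \<xi> \<partial>lborel) = (\<Prod>j\<in>UNIV. if x $ j = 0 then 2 * complex_of_real pi else 0)"
    unfolding * integral_prod_vec[OF integral_exp_period(1)] integral_exp_period(2) by (intro prod.cong) auto
  also have "\<dots> = (if x = 0 then (2 * pi) ^ CARD('d) else 0)"
    by (auto simp: vec_eq_iff)
  finally show ?E .
qed

abbreviation l1 :: "(int^'d \<Rightarrow> complex) \<Rightarrow> bool" where
  "l1 \<phi> \<equiv> (\<lambda>x. norm (\<phi> x)) summable_on UNIV"

lemma fhat_chr: "fhat \<phi> \<xi> = (\<Sum>\<^sub>\<infinity>x. \<phi> x * chr x \<xi>)"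
  by (simp add: fhat_def chr_def)

lemma uniform_limit_fhat:
  assumes "l1 \<phi>"
  shows "uniform_limit UNIV (\<lambda>F \<xi>. \<Sum>x\<in>F. \<phi> x * chr x \<xi>) (fhat \<phi>) (finite_subsets_at_top UNIV)"
  using Weierstrass_m_test_general[where f="\<lambda>x \<xi>. \<phi> x * chr x \<xi>" and M="\<lambda>x. norm (\<phi> x)" and X=UNIV and Y=UNIV] assms
  by (simp add: norm_mult fhat_chr[abs_def])

lemma continuous_fhat:
  assumes "l1 \<phi>" shows "continuous_on S (fhat \<phi>)"
proof -
  have "continuous_on UNIV (fhat \<phi>)"
    by (rule uniform_limit_theorem[OF _ uniform_limit_fhat[OF assms]])
       (auto intro!: always_eventually continuous_intros)
  then show ?thesis by (rule continuous_on_subset) auto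
qed

text \<open>Finite partial sums of the Fourier series converge uniformly, and for them the formula is the
  orthogonality of the characters.\<close>

theorem fourier_inversion:
  fixes \<phi> :: "int^'d \<Rightarrow> complex"
  assumes l: "l1 \<phi>"
  shows "(\<integral>\<xi>. indicator (cube e) \<xi> *\<^sub>R (fhat \<phi> \<xi> * chr (- x) \<xi>) \<partial>lborel) = (2 * pi) ^ CARD('d) * \<phi> x"
    (is "?L = ?R")
proof -
  let ?V = "(2 * pi) ^ CARD('d)"
  have cub: "(\<integral>\<xi>. indicator (cube e :: (real^'d) set) \<xi> \<partial>lborel) = ?V" "integrable lborel (indicator (cube e :: (real^'d) set) :: _ \<Rightarrow> real)"
  proof -
    have "compact (cube e :: (real^'d) set)" by (rule compact_cube)
    then show i: "integrable lborel (indicator (cube e :: (real^'d) set) :: _ \<Rightarrow> real)"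
      by (intro integrable_real_indicator) (use emeasure_bounded_finite[OF compact_imp_bounded] in \<open>auto simp: compact_imp_closed\<close>)
    have "complex_of_real (\<integral>\<xi>. indicator (cube e :: (real^'d) set) \<xi> \<partial>lborel) = ?V"
      using integral_chr_cube(2)[of e "0::int^'d"] by (simp add: chr_def scaleR_conv_of_real)
    then show "(\<integral>\<xi>. indicator (cube e :: (real^'d) set) \<xi> \<partial>lborel) = ?V"
      using of_real_eq_iff by fastforce
  qed
  have int: "integrable lborel (\<lambda>\<xi>. indicator (cube e) \<xi> *\<^sub>R g \<xi>)" if "continuous_on UNIV g" for g :: "real^'d \<Rightarrow> complex"
    using borel_integrable_compact[OF compact_cube continuous_on_subset[OF that]] by (simp add: indicator_def if_distrib cong: if_cong)
  have "norm (?L - ?R) \<le> \<epsilon> * ?V" if "\<epsilon> > 0" for \<epsilon>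
  proof -
    have "\<forall>\<^sub>F F in finite_subsets_at_top UNIV. finite F \<and> x \<in> F \<and> (\<forall>\<xi>\<in>UNIV. dist (\<Sum>x\<in>F. \<phi> x * chr x \<xi>) (fhat \<phi> \<xi>) < \<epsilon>)"
    proof (intro eventually_conj uniform_limitD[OF uniform_limit_fhat[OF l] that])
      show "\<forall>\<^sub>F F in finite_subsets_at_top UNIV. x \<in> F"
        unfolding eventually_finite_subsets_at_top by (rule exI[of _ "{x}"]) auto
    qed (rule eventually_finite_subsets_at_top_weakI)
    then obtain F where F: "finite F" "x \<in> F" and d: "\<And>\<xi>. dist (\<Sum>x\<in>F. \<phi> x * chr x \<xi>) (fhat \<phi> \<xi>) < \<epsilon>"
      by (rule eventually_happens'[OF finite_subsets_at_top_neq_bot, elim_format]) auto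
    let ?G = "\<lambda>\<xi>. (\<Sum>x\<in>F. \<phi> x * chr x \<xi>)"
    have "(\<integral>\<xi>. indicator (cube e) \<xi> *\<^sub>R (?G \<xi> * chr (- x) \<xi>) \<partial>lborel)
      = (\<integral>\<xi>. (\<Sum>y\<in>F. \<phi> y * (indicator (cube e) \<xi> *\<^sub>R chr (y - x) \<xi>)) \<partial>lborel)"
    proof (intro Bochner_Integration.integral_cong refl)
      fix \<xi> :: "real^'d"
      have "chr y \<xi> * chr (- x) \<xi> = chr (y - x) \<xi>" for y using chr_add[of y "- x" \<xi>] by simp
      then show "indicator (cube e) \<xi> *\<^sub>R (?G \<xi> * chr (- x) \<xi>) = (\<Sum>y\<in>F. \<phi> y * (indicator (cube e) \<xi> *\<^sub>R chr (y - x) \<xi>))"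
        by (simp only: sum_distrib_right scaleR_sum_right mult.assoc mult_scaleR_right)
    qed
    also have "\<dots> = (\<Sum>y\<in>F. \<phi> y * (\<integral>\<xi>. (indicator (cube e) \<xi> *\<^sub>R chr (y - x) \<xi>) \<partial>lborel))"
      by (subst Bochner_Integration.integral_sum) (auto intro!: integrable_mult_right integral_chr_cube simp del: mult_scaleR_right)
    also have "\<dots> = (\<Sum>y\<in>F. if y = x then ?R else 0)"
      by (rule sum.cong) (auto simp: integral_chr_cube)
    also have "\<dots> = ?R" using F by simp
    finally have R: "?R = (\<integral>\<xi>. indicator (cube e) \<xi> *\<^sub>R (?G \<xi> * chr (- x) \<xi>) \<partial>lborel)" by simp
    have "?L - ?R = (\<integral>\<xi>. indicator (cube e) \<xi> *\<^sub>R ((fhat \<phi> \<xi> - ?G \<xi>) * chr (- x) \<xi>) \<partial>lborel)"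
      unfolding R by (subst Bochner_Integration.integral_diff[symmetric])
        (auto intro!: int continuous_intros continuous_fhat[OF l] simp: algebra_simps scaleR_diff_right)
    also have "norm \<dots> \<le> (\<integral>\<xi>. \<epsilon> * indicator (cube e :: (real^'d) set) \<xi> \<partial>lborel)"
    proof (rule Bochner_Integration.integral_norm_bound_integral)
      show "integrable lborel (\<lambda>\<xi>. indicator (cube e) \<xi> *\<^sub>R ((fhat \<phi> \<xi> - ?G \<xi>) * chr (- x) \<xi>))"
        by (intro int continuous_intros continuous_fhat[OF l])
      show "norm (indicator (cube e) \<xi> *\<^sub>R ((fhat \<phi> \<xi> - ?G \<xi>) * chr (- x) \<xi>)) \<le> \<epsilon> * indicator (cube e :: (real^'d) set) \<xi>" for \<xi>
        using d[of \<xi>] by (auto simp: norm_mult dist_norm norm_minus_commute indicator_def)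
    qed (use cub in auto)
    also have "\<dots> = \<epsilon> * ?V" using cub by simp
    finally show ?thesis .
  qed
  then have "norm (?L - ?R) \<le> \<epsilon>" if "\<epsilon> > 0" for \<epsilon>
    using that by (metis (no_types, lifting) divide_pos_pos mult_pos_pos nonzero_eq_divide_eq order_less_irrefl pi_gt_zero zero_less_numeral zero_less_power)
  then have "norm (?L - ?R) \<le> 0" by (meson field_le_epsilon add_increasing order_refl le_less_linear less_irrefl dense_ge)
  then show ?thesis by simp
qed

text \<open>Fubini for the absolutely summable family \<open>\<phi> u * \<psi> y\<close>, reindexed by \<open>x = u + y\<close>.\<close>

lemma
  fixes \<phi> \<psi> :: "int^'d \<Rightarrow> complex"
  assumes "l1 \<phi>" "l1 \<psi>"
  shows l1_conv: "l1 (conv \<phi> \<psi>)"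
    and fhat_conv: "fhat (conv \<phi> \<psi>) \<xi> = fhat \<phi> \<xi> * fhat \<psi> \<xi>"
proof -
  define a where "a u = \<phi> u * chr u \<xi>" for u
  define b where "b u = \<psi> u * chr u \<xi>" for u
  have na: "norm (a u) = norm (\<phi> u)" and nb: "norm (b u) = norm (\<psi> u)" for u by (simp_all add: a_def b_def norm_mult)
  have ab: "(\<lambda>p. norm ((\<lambda>(u, y). a u * b y) p)) summable_on UNIV \<times> UNIV"
    unfolding Infinite_Sum.abs_summable_on_Sigma_iff
    using assms by (auto simp: norm_mult na nb infsum_cmult_right' abs_mult infsum_nonneg intro!: summable_on_cmult_right summable_on_cmult_left)
  let ?g = "\<lambda>(x, y). \<phi> (x - y) * \<psi> y * chr x \<xi>"
  have g: "?g (u + y, y) = a u * b y" for u y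
    by (simp add: a_def b_def chr_add)
  have bij: "bij_betw (\<lambda>(u, y). (u + y, y)) (UNIV \<times> UNIV) (UNIV \<times> (UNIV :: (int^'d) set))"
    by (rule bij_betwI[where g="\<lambda>(x, y). (x - y, y)"]) auto
  have gs: "(\<lambda>p. norm (?g p)) summable_on UNIV \<times> UNIV"
    using summable_on_reindex_bij_betw[OF bij, of "\<lambda>p. norm (?g p)"] ab g
    by (simp add: case_prod_unfold)
  have c1: "(\<Sum>\<^sub>\<infinity>y. \<phi> (x - y) * \<psi> y * chr x \<xi>) = conv \<phi> \<psi> x * chr x \<xi>" for x
    unfolding conv_def by (rule infsum_cmult_left')
  have "(\<lambda>x. norm (\<Sum>\<^sub>\<infinity>y. norm (?g (x, y)))) summable_on UNIV"
    using gs unfolding Infinite_Sum.abs_summable_on_Sigma_iff by auto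
  then show "l1 (conv \<phi> \<psi>)"
  proof (rule Infinite_Sum.abs_summable_on_comparison_test)
    fix x
    have s: "(\<lambda>y. norm (?g (x, y))) summable_on UNIV"
      using gs unfolding Infinite_Sum.abs_summable_on_Sigma_iff by auto
    have "norm (conv \<phi> \<psi> x) = norm (\<Sum>\<^sub>\<infinity>y. ?g (x, y))" using c1[of x] by (simp add: norm_mult)
    also have "\<dots> \<le> (\<Sum>\<^sub>\<infinity>y. norm (?g (x, y)))" by (rule norm_infsum_bound[OF s])
    finally show "norm (conv \<phi> \<psi> x) \<le> norm (\<Sum>\<^sub>\<infinity>y. norm (?g (x, y)))" by simp
  qed
  have "fhat \<phi> \<xi> * fhat \<psi> \<xi> = (\<Sum>\<^sub>\<infinity>u. \<Sum>\<^sub>\<infinity>y. a u * b y)"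
    by (simp add: fhat_chr a_def b_def infsum_cmult_left' infsum_cmult_right')
  also have "\<dots> = (\<Sum>\<^sub>\<infinity>(u, y)\<in>UNIV \<times> UNIV. a u * b y)"
    by (rule infsum_Sigma'_banach) (rule abs_summable_summable[OF ab])
  also have "\<dots> = (\<Sum>\<^sub>\<infinity>p\<in>UNIV \<times> UNIV. ?g ((\<lambda>(u, y). (u + y, y)) p))"
    by (rule infsum_cong) (auto simp: a_def b_def chr_add)
  also have "\<dots> = infsum ?g (UNIV \<times> UNIV)" by (rule infsum_reindex_bij_betw[OF bij])
  also have "\<dots> = (\<Sum>\<^sub>\<infinity>x. \<Sum>\<^sub>\<infinity>y. \<phi> (x - y) * \<psi> y * chr x \<xi>)"
    using infsum_Sigma'_banach[of "\<lambda>x y. \<phi> (x - y) * \<psi> y * chr x \<xi>" UNIV "\<lambda>_. UNIV"] abs_summable_summable[OF gs]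
    by simp
  also have "\<dots> = fhat (conv \<phi> \<psi>) \<xi>" unfolding c1 fhat_chr ..
  finally show "fhat (conv \<phi> \<psi>) \<xi> = fhat \<phi> \<xi> * fhat \<psi> \<xi>" ..
qed

lemma l1_conv_pow_aux:
  "l1 \<phi> \<Longrightarrow> n \<ge> 1 \<Longrightarrow> l1 (conv_pow \<phi> n) \<and> (\<forall>\<xi>. fhat (conv_pow \<phi> n) \<xi> = fhat \<phi> \<xi> ^ n)"
  by (induction \<phi> n rule: conv_pow.induct) (auto simp: l1_conv fhat_conv)

lemma l1_conv_pow: "l1 \<phi> \<Longrightarrow> n \<ge> 1 \<Longrightarrow> l1 (conv_pow \<phi> n)"
  and fhat_conv_pow: "l1 \<phi> \<Longrightarrow> n \<ge> 1 \<Longrightarrow> fhat (conv_pow \<phi> n) \<xi> = fhat \<phi> \<xi> ^ n"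
  using l1_conv_pow_aux[of \<phi> n] by auto

lemma conv_pow_support:
  assumes "\<And>x. \<phi> x \<noteq> 0 \<Longrightarrow> norm (rvec x) \<le> r" "n \<ge> 1" "conv_pow \<phi> n x \<noteq> 0"
  shows "norm (rvec x) \<le> real n * r"
  using assms
proof (induction \<phi> n arbitrary: x rule: conv_pow.induct)
  case (3 \<phi> n)
  have "\<exists>y. conv_pow \<phi> (Suc n) (x - y) * \<phi> y \<noteq> 0"
  proof (rule ccontr)
    assume "\<not> ?thesis"
    then have "(\<lambda>y. conv_pow \<phi> (Suc n) (x - y) * \<phi> y) = (\<lambda>y. 0)" by auto
    then have "conv_pow \<phi> (Suc (Suc n)) x = 0" by (simp add: conv_def)
    then show False using 3 by blast
  qed
  then obtain y where y: "conv_pow \<phi> (Suc n) (x - y) \<noteq> 0" "\<phi> y \<noteq> 0" by auto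
  have "norm (rvec x) = norm (rvec (x - y) + rvec y)" using rvec_add[of "x - y" y] by simp
  also have "\<dots> \<le> norm (rvec (x - y)) + norm (rvec y)" by (rule norm_triangle_ineq)
  also have "\<dots> \<le> real (Suc n) * r + r" using 3 y by (intro add_mono) auto
  finally show ?case by (simp add: algebra_simps)
qed (auto)

lemma chr_periodic: "chr x (\<xi> + (2 * pi) *\<^sub>R rvec k) = chr x \<xi>"
proof -
  have "rvec x \<bullet> rvec k = of_int (\<Sum>j\<in>UNIV. x $ j * k $ j)" by (simp add: inner_vec_def rvec_def)
  then have "exp (\<i> * complex_of_real (2 * pi * (rvec x \<bullet> rvec k))) = 1"
    using exp_integer_2pi[of "of_int (\<Sum>j\<in>UNIV. x $ j * k $ j)", OF Ints_of_int] by (simp add: algebra_simps del: of_int_sum)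
  then show ?thesis by (simp add: chr_def inner_add_right distrib_left exp_add)
qed

lemma fhat_periodic: "fhat \<phi> (\<xi> + (2 * pi) *\<^sub>R rvec k) = fhat \<phi> \<xi>"
  by (simp add: fhat_chr chr_periodic)

section \<open>Holomorphic functions of several variables\<close>

lemma norm_cvec[simp]: "norm (cvec v) = norm v" for v :: "real^'d"
  by (simp add: cvec_def norm_vec_def)

lemma norm_vector_smult: "norm (w *s v) = norm w * norm v" for w and v :: "complex^'d"
  by (simp add: norm_vec_def norm_mult L2_set_right_distrib)

lemma cvec_add: "cvec (x + y) = cvec x + cvec y" and cvec_scaleR: "cvec (t *\<^sub>R x) = of_real t *s cvec x"
  and cvec_0[simp]: "cvec 0 = 0" and cvec_nth[simp]: "cvec x $ j = of_real (x $ j)"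
  by (simp_all add: cvec_def vec_eq_iff)

lemma continuous_on_cvec[continuous_intros]: "continuous_on S f \<Longrightarrow> continuous_on S (\<lambda>x. cvec (f x))"
  unfolding cvec_def by (intro continuous_intros)

lemma continuous_on_smult[continuous_intros]:
  fixes f :: "_ \<Rightarrow> complex" and g :: "_ \<Rightarrow> complex^'d"
  shows "continuous_on S f \<Longrightarrow> continuous_on S g \<Longrightarrow> continuous_on S (\<lambda>x. f x *s g x)"
  unfolding vector_scalar_mult_def by (intro continuous_intros)

definition reV :: "complex^'d \<Rightarrow> real^'d" where "reV z = (\<chi> j. Re (z $ j))"
definition imV :: "complex^'d \<Rightarrow> real^'d" where "imV z = (\<chi> j. Im (z $ j))"

lemma continuous_reV[continuous_intros]: "continuous_on S f \<Longrightarrow> continuous_on S (\<lambda>x. reV (f x))"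
  and continuous_imV[continuous_intros]: "continuous_on S f \<Longrightarrow> continuous_on S (\<lambda>x. imV (f x))"
  unfolding reV_def imV_def by (intro continuous_intros; assumption)+

text \<open>Cauchy's inequality on discs of a fixed radius \<open>d\<close> turns the bound \<open>h\<close> on the integrand into the bound
  \<open>h / d\<close> on its difference quotients, so that dominated convergence differentiates under the integral.\<close>

lemma holomorphic_integral:
  fixes F :: "complex \<Rightarrow> 'a \<Rightarrow> complex" and h :: "'a \<Rightarrow> real"
  assumes S: "open S"
    and hol: "\<And>x. x \<in> space M \<Longrightarrow> (\<lambda>\<tau>. F \<tau> x) holomorphic_on S"
    and int: "\<And>\<tau>. \<tau> \<in> S \<Longrightarrow> integrable M (F \<tau>)"
    and h: "integrable M h"
    and le: "\<And>\<tau> x. \<tau> \<in> S \<Longrightarrow> x \<in> space M \<Longrightarrow> norm (F \<tau> x) \<le> h x"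
  shows "(\<lambda>\<tau>. \<integral>x. F \<tau> x \<partial>M) holomorphic_on S"
  unfolding holomorphic_on_open[OF S]
proof (intro ballI exI)
  fix t assume t: "t \<in> S"
  then obtain e where e: "e > 0" "ball t e \<subseteq> S" using S openE by blast
  define d where "d = e / 3"
  have d: "d > 0" using e by (simp add: d_def)
  have lip: "norm (F (t + k) x - F t x) \<le> h x / d * norm k" if k: "norm k < d" and x: "x \<in> space M" for k x
  proof -
    have "norm (F (t + k) x - F t x) \<le> h x / d * norm (t + k - t)"
    proof (rule field_differentiable_bound[OF convex_ball[of t d], where f' = "deriv (\<lambda>\<tau>. F \<tau> x)"])
      fix u assume u: "u \<in> ball t d"
      have sub: "cball u d \<subseteq> S"
      proof
        fix w assume "w \<in> cball u d"
        then have "dist t w \<le> dist t u + d" using dist_triangle[of t w u] by (simp add: dist_commute)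
        then show "w \<in> S" using u e d unfolding d_def by (intro subsetD[OF e(2)]) (simp add: d_def)
      qed
      have uS: "u \<in> S" using sub d by auto
      show "((\<lambda>\<tau>. F \<tau> x) has_field_derivative deriv (\<lambda>\<tau>. F \<tau> x) u) (at u within ball t d)"
        by (rule has_field_derivative_at_within) (rule holomorphic_derivI[OF hol[OF x] S uS])
      have "norm ((deriv ^^ 1) (\<lambda>\<tau>. F \<tau> x) u) \<le> fact 1 * h x / d ^ 1"
      proof (rule Cauchy_inequality)
        show "(\<lambda>\<tau>. F \<tau> x) holomorphic_on ball u d"
          by (rule holomorphic_on_subset[OF hol[OF x]]) (use sub in auto)
        show "continuous_on (cball u d) (\<lambda>\<tau>. F \<tau> x)"
          by (rule holomorphic_on_imp_continuous_on, rule holomorphic_on_subset[OF hol[OF x]]) (use sub in auto)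
        show "norm (F y x) \<le> h x" if "norm (u - y) = d" for y
          using that sub by (intro le x) (auto simp: dist_norm)
      qed (use d in auto)
      then show "norm (deriv (\<lambda>\<tau>. F \<tau> x) u) \<le> h x / d" by simp
    qed (use d k in \<open>auto simp: dist_norm\<close>)
    then show ?thesis by simp
  qed
  let ?D = "\<lambda>x. deriv (\<lambda>\<tau>. F \<tau> x) t"
  have tends: "((\<lambda>k. (F (t + k) x - F t x) / k) \<longlongrightarrow> ?D x) (at 0)" if "x \<in> space M" for x
    using holomorphic_derivI[OF hol[OF that] S t, of UNIV] unfolding DERIV_def by simp
  show "((\<lambda>\<tau>. \<integral>x. F \<tau> x \<partial>M) has_field_derivative (\<integral>x. ?D x \<partial>M)) (at t)"
    unfolding DERIV_def
  proof (rule LIMSEQ_SEQ_conv[THEN iffD1], intro allI impI)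
    fix s :: "nat \<Rightarrow> complex" assume s: "(\<forall>i. s i \<noteq> 0) \<and> s \<longlonglongrightarrow> 0"
    then have "\<forall>\<^sub>F n in sequentially. norm (s n) < d"
      using d by (auto simp: tendsto_iff dist_norm)
    then obtain N where N: "\<And>n. n \<ge> N \<Longrightarrow> norm (s n) < d" by (auto simp: eventually_sequentially)
    define s' where "s' n = s (n + N)" for n
    have s': "s' n \<noteq> 0" "norm (s' n) < d" for n using s N by (auto simp: s'_def)
    have s'0: "filterlim s' (at 0) sequentially"
    proof -
      have "s' \<longlonglongrightarrow> 0" unfolding s'_def using s by (intro LIMSEQ_ignore_initial_segment) auto
      then show ?thesis using s' by (auto simp: filterlim_at)
    qed
    have tS: "t + s' n \<in> S" for n
      using s'(2)[of n] e d by (intro subsetD[OF e(2)]) (simp add: dist_norm d_def)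
    have lim: "(\<lambda>n. (F (t + s' n) x - F t x) / s' n) \<longlonglongrightarrow> ?D x" if "x \<in> space M" for x
      using filterlim_compose[OF tends[OF that] s'0] .
    have meas: "(\<lambda>x. (F (t + s' n) x - F t x) / s' n) \<in> borel_measurable M" for n
      using int[OF tS[of n]] int[OF t] by (auto intro!: borel_measurable_integrable)
    have "(\<lambda>n. \<integral>x. (F (t + s' n) x - F t x) / s' n \<partial>M) \<longlonglongrightarrow> (\<integral>x. ?D x \<partial>M)"
    proof (rule integral_dominated_convergence[where w="\<lambda>x. h x / d"])
      show "?D \<in> borel_measurable M"
        by (rule borel_measurable_LIMSEQ_metric[OF meas lim])
      show "AE x in M. norm ((F (t + s' n) x - F t x) / s' n) \<le> h x / d" for n
        using lip[OF s'(2)[of n]] s'(1)[of n] by (auto simp: norm_divide divide_simps mult.commute)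
    qed (use meas lim h in auto)
    moreover have "(\<integral>x. (F (t + s' n) x - F t x) / s' n \<partial>M) = ((\<integral>x. F (t + s' n) x \<partial>M) - (\<integral>x. F t x \<partial>M)) / s' n" for n
      using int[OF tS[of n]] int[OF t]
      by (subst integral_divide_zero, subst Bochner_Integration.integral_diff) auto
    ultimately have "(\<lambda>n. ((\<integral>x. F (t + s (n + N)) x \<partial>M) - (\<integral>x. F t x \<partial>M)) / s (n + N)) \<longlonglongrightarrow> (\<integral>x. ?D x \<partial>M)"
      by (simp only: s'_def)
    then show "(\<lambda>n. ((\<integral>x. F (t + s n) x \<partial>M) - (\<integral>x. F t x \<partial>M)) / s n) \<longlonglongrightarrow> (\<integral>x. ?D x \<partial>M)"
      by (rule LIMSEQ_offset)
  qed
qed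

text \<open>Restriction to complex lines is how one-variable complex analysis enters.\<close>

lemma holomorphic_line:
  fixes F :: "complex^'d \<Rightarrow> complex"
  assumes "holomorphic_cn F U"
  shows "(\<lambda>w. F (a + w *s v)) holomorphic_on {w. a + w *s v \<in> U}"
proof -
  have c: "continuous_on UNIV (\<lambda>w. a + w *s v)"
    unfolding vector_scalar_mult_def by (intro continuous_intros)
  have U: "open U" using assms by (simp add: holomorphic_cn_def)
  have op: "open {w. a + w *s v \<in> U}"
    using continuous_open_vimage[OF U, of "\<lambda>w. a + w *s v"] c by (simp add: vimage_def continuous_on_eq_continuous_at)
  show ?thesis unfolding holomorphic_on_open[OF op]
  proof
    fix w assume "w \<in> {w. a + w *s v \<in> U}"
    then obtain D where D: "(F has_derivative D) (at (a + w *s v))" "\<And>c u. D (c *s u) = c * D u"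
      using assms by (auto simp: holomorphic_cn_def)
    have "((\<lambda>w. a + w *s v) has_derivative (\<lambda>h. h *s v)) (at w)"
    proof -
      have "bounded_linear (\<lambda>h::complex. h *s v)"
        unfolding linear_conv_bounded_linear[symmetric]
        by (rule linearI) (auto simp: vec_eq_iff algebra_simps)
      from bounded_linear_imp_has_derivative[OF this] show ?thesis
        by (auto intro!: derivative_eq_intros)
    qed
    from has_derivative_compose[OF this D(1)]
    have "((\<lambda>w. F (a + w *s v)) has_derivative (\<lambda>h. D v * h)) (at w)" by (simp add: D(2) mult.commute)
    then show "\<exists>f'. ((\<lambda>w. F (a + w *s v)) has_field_derivative f') (at w)"
      unfolding has_field_derivative_def by blast
  qed
qed

lemma holomorphic_cn_continuous: "holomorphic_cn F U \<Longrightarrow> continuous_on U F"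
  unfolding holomorphic_cn_def
  by (metis continuous_at_imp_continuous_on has_derivative_continuous)

definition polydisc :: "real \<Rightarrow> (complex^'d) set" where
  "polydisc r = {z. \<forall>j. norm (z $ j) < r}"

lemma polydisc_subset_ball:
  assumes e: "e > 0"
  obtains r where "r > 0" "polydisc r \<subseteq> ball (0::complex^'d) e"
proof (rule that)
  show "e / (1 + real CARD('d)) > 0" using e by (simp add: add_pos_nonneg)
  show "polydisc (e / (1 + real CARD('d))) \<subseteq> ball (0::complex^'d) e"
  proof
    fix z :: "complex^'d" assume z: "z \<in> polydisc (e / (1 + real CARD('d)))"
    have "norm z \<le> (\<Sum>j\<in>UNIV. norm (z $ j))" unfolding norm_vec_def by (rule L2_set_le_sum) auto
    also have "\<dots> \<le> (\<Sum>j\<in>(UNIV::'d set). e / (1 + real CARD('d)))" using z by (intro sum_mono) (auto simp: polydisc_def less_imp_le)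
    also have "\<dots> < e" using e by (simp add: divide_simps)
    finally show "z \<in> ball 0 e" by simp
  qed
qed

definition upd :: "'a^'d \<Rightarrow> 'd \<Rightarrow> 'a \<Rightarrow> 'a^'d" where
  "upd z j w = (\<chi> i. if i = j then w else z $ i)"

lemma upd_nth[simp]: "upd z j w $ i = (if i = j then w else z $ i)" by (simp add: upd_def)

lemma upd_upd[simp]: "upd (upd z j w) j w' = upd z j w'" by (simp add: vec_eq_iff)
lemma upd_swap: "i \<noteq> j \<Longrightarrow> upd (upd z i w) j w' = upd (upd z j w') i w" by (simp add: vec_eq_iff)
lemma upd_id[simp]: "upd z j (z $ j) = z" by (simp add: vec_eq_iff)

lemma upd_polydisc: "z \<in> polydisc r \<Longrightarrow> norm w < r \<Longrightarrow> upd z j w \<in> polydisc r"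
  by (simp add: polydisc_def)

text \<open>Holomorphy in each coordinate separately.  Together with boundedness this suffices for a power series
  expansion, and it is inherited by the Taylor coefficients in any one coordinate.\<close>

definition sep_holomorphic :: "real \<Rightarrow> (complex^'d \<Rightarrow> complex) \<Rightarrow> bool" where
  "sep_holomorphic r f \<longleftrightarrow> (\<forall>z\<in>polydisc r. \<forall>j. (\<lambda>w. f (upd z j w)) holomorphic_on ball 0 r)"

text \<open>Cauchy's formula as a Lebesgue integral over a parameter interval: in this form the Taylor coefficients
  depend holomorphically on further variables by \<open>holomorphic_integral\<close>.\<close>

lemma circle_integral_higher_deriv:
  fixes r s :: real
  assumes f: "f holomorphic_on ball 0 r" and s: "0 < s" "s < r"
  shows "integrable lborel (\<lambda>t. indicator {0..1} t *\<^sub>R (f (s * exp (2 * pi * \<i> * of_real t)) / (s * exp (2 * pi * \<i> * of_real t)) ^ k))" (is ?I)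
    and "(deriv ^^ k) f 0 / fact k = (\<integral>t. indicator {0..1} t *\<^sub>R (f (s * exp (2 * pi * \<i> * of_real t)) / (s * exp (2 * pi * \<i> * of_real t)) ^ k) \<partial>lborel)" (is ?E)
proof -
  let ?g = "\<lambda>t::real. f (s * exp (2 * pi * \<i> * of_real t)) / (s * exp (2 * pi * \<i> * of_real t)) ^ k"
  have fc: "continuous_on (ball 0 r) f" by (rule holomorphic_on_imp_continuous_on[OF f])
  have n: "norm (s * exp (2 * pi * \<i> * of_real t)) = s" for t :: real
  proof -
    have "norm (exp (2 * pi * \<i> * complex_of_real t)) = 1" using norm_exp_i_times[of "2 * pi * t"] by (simp add: algebra_simps)
    then show ?thesis using s by (simp add: norm_mult)
  qed
  have "continuous_on {0..1} (\<lambda>t::real. f (s * exp (2 * pi * \<i> * of_real t)))"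
    by (rule continuous_on_compose2[OF fc]) (use s n in \<open>auto intro!: continuous_intros\<close>)
  then have c: "continuous_on {0..1} ?g"
    using s by (intro continuous_intros) auto
  from borel_integrable_atLeastAtMost'[OF this]
  have i: "set_integrable lborel {0..1} ?g" .
  then show ?I by (simp add: set_integrable_def)
  have "((\<lambda>u. f u / (u - 0) ^ (Suc k)) has_contour_integral (2 * pi * \<i> / fact k * (deriv ^^ k) f 0)) (circlepath 0 s)"
    by (rule Cauchy_has_contour_integral_higher_derivative_circlepath)
       (use s in \<open>auto intro: holomorphic_on_subset[OF f] continuous_on_subset[OF fc]\<close>)
  then have "((\<lambda>t. 2 * pi * \<i> * ?g t) has_integral (2 * pi * \<i> / fact k * (deriv ^^ k) f 0)) {0..1}"
    unfolding has_contour_integral_def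
  proof (rule has_integral_eq[rotated])
    fix t :: real assume t: "t \<in> {0..1}"
    have v: "vector_derivative (circlepath 0 s) (at t within {0..1}) = 2 * pi * \<i> * s * exp (2 * pi * \<i> * t)"
      using t by (subst vector_derivative_circlepath01) (auto simp: mult_ac)
    have c: "circlepath 0 s t = s * exp (2 * pi * \<i> * of_real t)" by (simp add: circlepath)
    have "s * exp (2 * pi * \<i> * of_real t) \<noteq> 0" using s by simp
    then show "f (circlepath 0 s t) / (circlepath 0 s t - 0) ^ Suc k * vector_derivative (circlepath 0 s) (at t within {0..1})
      = 2 * pi * \<i> * ?g t"
      unfolding v c by simp
  qed
  from has_integral_mult_right[OF this, of "1 / (2 * pi * \<i>)"]
  have "(?g has_integral ((deriv ^^ k) f 0 / fact k)) {0..1}" by simp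
  then show ?E using set_borel_integral_eq_integral(2)[OF i]
    by (simp add: integral_unique set_lebesgue_integral_def)
qed

text \<open>One step of the expansion: Taylor coefficients in the coordinate \<open>j\<close> satisfy Cauchy's estimate and are
  again separately holomorphic, since they are Cauchy integrals.\<close>

lemma sep_holomorphic_coeff:
  fixes f :: "complex^'d \<Rightarrow> complex" and j :: 'd
  assumes f: "sep_holomorphic r f" and b: "\<And>z. z \<in> polydisc r \<Longrightarrow> norm (f z) \<le> M" and s: "0 < s" "s < r"
  defines "c \<equiv> \<lambda>k z. (deriv ^^ k) (\<lambda>w. f (upd z j w)) 0 / fact k"
  shows "sep_holomorphic r (c k)" and "z \<in> polydisc r \<Longrightarrow> norm (c k z) \<le> M / s ^ k"
    and "z \<in> polydisc r \<Longrightarrow> (\<lambda>k. c k z * (z $ j) ^ k) sums f z"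
proof -
  have h: "(\<lambda>w. f (upd z j w)) holomorphic_on ball 0 r" if "z \<in> polydisc r" for z j
    using f that by (auto simp: sep_holomorphic_def)
  show "(\<lambda>k. c k z * (z $ j) ^ k) sums f z" if z: "z \<in> polydisc r"
    using holomorphic_power_series[OF h[OF z], of "z $ j" j] z by (simp add: polydisc_def c_def)
  show "norm (c k z) \<le> M / s ^ k" if z: "z \<in> polydisc r"
  proof -
    have "norm ((deriv ^^ k) (\<lambda>w. f (upd z j w)) 0) \<le> fact k * M / s ^ k"
    proof (rule Cauchy_inequality)
      show "continuous_on (cball 0 s) (\<lambda>w. f (upd z j w))"
        by (rule holomorphic_on_imp_continuous_on, rule holomorphic_on_subset[OF h[OF z]]) (use s in auto)
    qed (use s in \<open>auto intro!: b upd_polydisc z intro: holomorphic_on_subset[OF h[OF z]]\<close>)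
    then have "norm ((deriv ^^ k) (\<lambda>w. f (upd z j w)) 0) / fact k \<le> (fact k * M / s ^ k) / fact k"
      by (rule divide_right_mono) simp
    then show ?thesis by (simp add: c_def norm_divide)
  qed
  show "sep_holomorphic r (c k)" unfolding sep_holomorphic_def
  proof (intro ballI allI)
    fix z :: "complex^'d" and i :: 'd assume z: "z \<in> polydisc r"
    show "(\<lambda>w. c k (upd z i w)) holomorphic_on ball 0 r"
    proof (cases "i = j")
      case True then show ?thesis by (simp add: c_def)
    next
      case False
      let ?E = "\<lambda>t::real. s * exp (2 * pi * \<i> * of_real t)"
      let ?F = "\<lambda>w t. indicator {0..1} t *\<^sub>R (f (upd (upd z i w) j (?E t)) / (?E t) ^ k)"
      have nE: "norm (?E t) = s" for t :: real
      proof -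
        have "norm (exp (2 * pi * \<i> * complex_of_real t)) = 1" using norm_exp_i_times[of "2 * pi * t"] by (simp add: algebra_simps)
        then show ?thesis using s by (simp add: norm_mult)
      qed
      have up: "upd z i w \<in> polydisc r" if "w \<in> ball 0 r" for w
        using that by (intro upd_polydisc z) auto
      have "(\<lambda>w. \<integral>t. ?F w t \<partial>lborel) holomorphic_on ball 0 r"
      proof (rule holomorphic_integral[where h="\<lambda>t. M / s ^ k * indicator {0..1} t"])
        fix t :: real
        have "(\<lambda>w. f (upd (upd z j (?E t)) i w)) holomorphic_on ball 0 r"
          by (rule h) (use nE[of t] s in \<open>auto intro!: upd_polydisc z\<close>)
        then have "(\<lambda>w. f (upd (upd z i w) j (?E t))) holomorphic_on ball 0 r"
          by (simp add: upd_swap[OF False])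
        then show "(\<lambda>w. ?F w t) holomorphic_on ball 0 r"
          unfolding scaleR_conv_of_real using s by (intro holomorphic_intros) auto
        show "norm (?F w t) \<le> M / s ^ k * indicator {0..1} t" if "w \<in> ball 0 r" for w
        proof -
          have "norm (f (upd (upd z i w) j (?E t))) \<le> M"
            by (rule b, rule upd_polydisc[OF up[OF that]]) (use nE[of t] s in auto)
          then show ?thesis using nE[of t] s
            by (auto simp: norm_divide norm_power indicator_def divide_right_mono)
        qed
      next
        show "integrable lborel (?F w)" if "w \<in> ball 0 r" for w
          by (rule circle_integral_higher_deriv(1)[OF h[OF up[OF that], of j] s])
      qed auto
      then show ?thesis
      proof (rule holomorphic_transform)
        fix w :: complex assume w: "w \<in> ball 0 r"
        show "(\<integral>t. ?F w t \<partial>lborel) = c k (upd z i w)"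
          unfolding c_def by (rule circle_integral_higher_deriv(2)[OF h[OF up[OF w], of j] s, symmetric])
      qed
    qed
  qed
qed

lemma cmonom_norm: "norm (cmonom z \<beta>) = (\<Prod>j\<in>UNIV. norm (z $ j) ^ (\<beta> $ j))"
  by (simp add: cmonom_def prod_norm[symmetric] norm_power)

lemma cmonom_upd: "cmonom z \<beta> = (z $ j) ^ (\<beta> $ j) * cmonom z (upd \<beta> j 0)"
  unfolding cmonom_def by (subst (1 2) prod.remove[of _ j]) (auto intro!: prod.cong)

lemma summable_on_geometric_vec:
  fixes q :: "real^'d"
  assumes q: "\<And>j. 0 \<le> q $ j" "\<And>j. q $ j < 1"
  shows "(\<lambda>\<beta>::nat^'d. \<Prod>j\<in>UNIV. (q $ j) ^ (\<beta> $ j)) summable_on UNIV"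
proof (rule nonneg_bdd_above_summable_on)
  show "bdd_above (sum (\<lambda>\<beta>::nat^'d. \<Prod>j\<in>UNIV. (q $ j) ^ (\<beta> $ j)) ` {F. F \<subseteq> UNIV \<and> finite F})"
  proof (rule bdd_aboveI2)
    fix F :: "(nat^'d) set" assume "F \<in> {F. F \<subseteq> UNIV \<and> finite F}"
    then have F: "finite F" by simp
    define N where "N = Suc (Max (insert 0 ((\<lambda>(\<beta>, j). \<beta> $ j) ` (F \<times> UNIV))))"
    have N: "\<beta> $ j < N" if "\<beta> \<in> F" for \<beta> j
      unfolding N_def less_Suc_eq_le using that F by (intro Max_ge) force+
    let ?P = "\<Pi>\<^sub>E j\<in>(UNIV::'d set). {..<N}"
    have "(\<Sum>\<beta>\<in>F. \<Prod>j\<in>UNIV. (q $ j) ^ (\<beta> $ j)) = (\<Sum>g\<in>vec_nth ` F. \<Prod>j\<in>UNIV. (q $ j) ^ (g j))"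
      by (subst sum.reindex) (auto simp: inj_on_def vec_nth_inject)
    also have "\<dots> \<le> (\<Sum>g\<in>?P. \<Prod>j\<in>UNIV. (q $ j) ^ (g j))"
      by (rule sum_mono2) (auto simp: N q prod_nonneg intro!: finite_PiE)
    also have "\<dots> = (\<Prod>j\<in>UNIV. \<Sum>k<N. (q $ j) ^ k)"
      by (rule prod_sum_PiE[symmetric]) auto
    also have "\<dots> \<le> (\<Prod>j\<in>UNIV. 1 / (1 - q $ j))"
    proof (rule prod_mono, intro conjI)
      fix j
      have "(\<Sum>k<N. (q $ j) ^ k) \<le> (\<Sum>k. (q $ j) ^ k)"
        using q[of j] by (intro sum_le_suminf summable_geometric) auto
      then show "(\<Sum>k<N. (q $ j) ^ k) \<le> 1 / (1 - q $ j)" using q[of j] by (simp add: suminf_geometric)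
    qed (auto intro!: sum_nonneg simp: q)
    finally show "(\<Sum>\<beta>\<in>F. \<Prod>j\<in>UNIV. (q $ j) ^ (\<beta> $ j)) \<le> (\<Prod>j\<in>UNIV. 1 / (1 - q $ j))" .
  qed
qed (auto simp: prod_nonneg q)

lemma summable_on_cmonom:
  fixes b :: "nat^'d \<Rightarrow> complex"
  assumes b: "\<And>\<beta>. norm (b \<beta>) \<le> M / (\<Prod>j\<in>UNIV. s ^ (\<beta> $ j))" and s: "s > 0" and z: "z \<in> polydisc s"
  shows "(\<lambda>\<beta>. norm (b \<beta> * cmonom z \<beta>)) summable_on UNIV"
proof (rule summable_on_comparison_test)
  show "(\<lambda>\<beta>::nat^'d. M * (\<Prod>j\<in>UNIV. ((\<chi> j. norm (z $ j) / s) $ j) ^ (\<beta> $ j))) summable_on UNIV"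
    by (intro summable_on_cmult_right summable_on_geometric_vec) (use s z in \<open>auto simp: polydisc_def\<close>)
  fix \<beta> :: "nat^'d"
  have "norm (b \<beta> * cmonom z \<beta>) \<le> M / (\<Prod>j\<in>UNIV. s ^ (\<beta> $ j)) * (\<Prod>j\<in>UNIV. norm (z $ j) ^ (\<beta> $ j))"
    unfolding norm_mult cmonom_norm using b by (intro mult_right_mono) (auto intro: prod_nonneg)
  also have "\<dots> = M * (\<Prod>j\<in>UNIV. ((\<chi> j. norm (z $ j) / s) $ j) ^ (\<beta> $ j))"
    by (simp add: power_divide prod_dividef)
  finally show "norm (b \<beta> * cmonom z \<beta>) \<le> M * (\<Prod>j\<in>UNIV. ((\<chi> j. norm (z $ j) / s) $ j) ^ (\<beta> $ j))" .
qed auto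

text \<open>Induction on the set \<open>J\<close> of coordinates on which \<open>f\<close> depends: the Taylor coefficients in one of them
  depend on one coordinate fewer.  Keeping the same radius \<open>s\<close> in all estimates makes the multiple series
  absolutely summable, which allows the iterated sums to be rearranged into one.\<close>

lemma sep_holomorphic_expansion:
  fixes f :: "complex^'d \<Rightarrow> complex"
  assumes "finite J" and s: "0 < s" "s < r"
    and "sep_holomorphic r f" "\<And>z. z \<in> polydisc r \<Longrightarrow> norm (f z) \<le> M"
    and "\<And>z z'. z \<in> polydisc r \<Longrightarrow> z' \<in> polydisc r \<Longrightarrow> (\<forall>j\<in>J. z $ j = z' $ j) \<Longrightarrow> f z = f z'"
  shows "\<exists>b. (\<forall>\<beta>. norm (b \<beta>) \<le> M / (\<Prod>j\<in>UNIV. s ^ (\<beta> $ j))) \<and>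
    (\<forall>\<beta> j. j \<notin> J \<longrightarrow> \<beta> $ j \<noteq> 0 \<longrightarrow> b \<beta> = 0) \<and>
    (\<forall>z\<in>polydisc s. ((\<lambda>\<beta>. b \<beta> * cmonom z \<beta>) has_sum f z) UNIV)"
  using assms(1,4,5,6)
proof (induction J arbitrary: f M rule: finite_induct)
  case empty
  define b where "b \<beta> = (if \<beta> = 0 then f 0 else 0)" for \<beta> :: "nat^'d"
  have 0: "0 \<in> polydisc r" using s by (simp add: polydisc_def)
  have M: "M \<ge> 0" using empty.prems(2)[OF 0] norm_ge_zero order_trans by blast
  have "((\<lambda>\<beta>. b \<beta> * cmonom z \<beta>) has_sum f z) UNIV" if "z \<in> polydisc s" for z
  proof -
    have "f z = f 0" by (rule empty.prems(3)) (use that s in \<open>auto simp: polydisc_def intro: less_trans\<close>)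
    moreover have "((\<lambda>\<beta>. b \<beta> * cmonom z \<beta>) has_sum f 0) {0}"
      by (rule has_sum_finiteI) (auto simp: b_def cmonom_def)
    moreover have "((\<lambda>\<beta>. b \<beta> * cmonom z \<beta>) has_sum f 0) UNIV \<longleftrightarrow> ((\<lambda>\<beta>. b \<beta> * cmonom z \<beta>) has_sum f 0) {0}"
      by (rule has_sum_cong_neutral) (auto simp: b_def)
    ultimately show ?thesis by simp
  qed
  moreover have "norm (b \<beta>) \<le> M / (\<Prod>j\<in>UNIV. s ^ (\<beta> $ j))" for \<beta>
    using empty.prems(2)[OF 0] M s by (auto simp: b_def intro!: divide_nonneg_nonneg prod_nonneg)
  ultimately show ?case by (intro exI[of _ b]) (auto simp: b_def)
next
  case (insert j J)
  define c where "c k z = (deriv ^^ k) (\<lambda>w. f (upd z j w)) 0 / fact k" for k z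
  note co = sep_holomorphic_coeff[OF insert.prems(1,2) s, where j=j]
  have ck: "c k = (\<lambda>z. (deriv ^^ k) (\<lambda>w. f (upd z j w)) 0 / fact k)" for k by (simp add: c_def fun_eq_iff)
  have co': "sep_holomorphic r (c k)" "\<And>z. z \<in> polydisc r \<Longrightarrow> norm (c k z) \<le> M / s ^ k"
    "\<And>z. z \<in> polydisc r \<Longrightarrow> (\<lambda>k. c k z * (z $ j) ^ k) sums f z" for k
    unfolding ck by (rule co; assumption)+
  have dep: "c k z = c k z'" if "z \<in> polydisc r" "z' \<in> polydisc r" "\<forall>j\<in>J. z $ j = z' $ j" for k z z'
  proof -
    have "\<forall>\<^sub>F w in nhds 0. f (upd z j w) = f (upd z' j w)"
      unfolding eventually_nhds_metric
      by (rule exI[of _ r]) (use s that in \<open>auto intro!: insert.prems(3) upd_polydisc\<close>)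
    then show ?thesis unfolding c_def by (subst higher_deriv_cong_ev) auto
  qed
  have "\<forall>k. \<exists>b. (\<forall>\<beta>. norm (b \<beta>) \<le> (M / s ^ k) / (\<Prod>j\<in>UNIV. s ^ (\<beta> $ j))) \<and>
    (\<forall>\<beta> j. j \<notin> J \<longrightarrow> \<beta> $ j \<noteq> 0 \<longrightarrow> b \<beta> = 0) \<and>
    (\<forall>z\<in>polydisc s. ((\<lambda>\<beta>. b \<beta> * cmonom z \<beta>) has_sum c k z) UNIV)"
    by (intro allI insert.IH co' dep)
  from choice[OF this] obtain B where B': "\<forall>k. (\<forall>\<beta>. norm (B k \<beta>) \<le> (M / s ^ k) / (\<Prod>j\<in>UNIV. s ^ (\<beta> $ j))) \<and>
    (\<forall>\<beta> j. j \<notin> J \<longrightarrow> \<beta> $ j \<noteq> 0 \<longrightarrow> B k \<beta> = 0) \<and>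
    (\<forall>z\<in>polydisc s. ((\<lambda>\<beta>. B k \<beta> * cmonom z \<beta>) has_sum c k z) UNIV)" ..
  have B: "\<And>k \<beta>. norm (B k \<beta>) \<le> (M / s ^ k) / (\<Prod>j\<in>UNIV. s ^ (\<beta> $ j))"
      "\<And>k \<beta> j. j \<notin> J \<Longrightarrow> \<beta> $ j \<noteq> 0 \<Longrightarrow> B k \<beta> = 0"
      "\<And>k z. z \<in> polydisc s \<Longrightarrow> ((\<lambda>\<beta>. B k \<beta> * cmonom z \<beta>) has_sum c k z) UNIV"
    using B' by blast+
  define b where "b \<beta> = B (\<beta> $ j) (upd \<beta> j 0)" for \<beta> :: "nat^'d"
  have bb: "norm (b \<beta>) \<le> M / (\<Prod>j\<in>UNIV. s ^ (\<beta> $ j))" for \<beta>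
  proof -
    have "s ^ (\<beta> $ j) * (\<Prod>i\<in>UNIV. s ^ (upd \<beta> j 0 $ i)) = (\<Prod>i\<in>UNIV. s ^ (\<beta> $ i))"
      by (subst (1 2) prod.remove[of _ j]) (auto intro!: prod.cong)
    then show ?thesis using B(1)[of "\<beta> $ j" "upd \<beta> j 0"] by (simp add: b_def)
  qed
  have z0: "b \<beta> = 0" if "i \<notin> insert j J" "\<beta> $ i \<noteq> 0" for \<beta> i
    unfolding b_def using that by (intro B(2)[of i]) auto
  have "((\<lambda>\<beta>. b \<beta> * cmonom z \<beta>) has_sum f z) UNIV" if z: "z \<in> polydisc s" for z
  proof -
    have zr: "z \<in> polydisc r" using z s by (auto simp: polydisc_def intro: less_trans)
    let ?g = "\<lambda>(k, \<beta>'). z $ j ^ k * (B k \<beta>' * cmonom z \<beta>')"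
    let ?S = "SIGMA k:UNIV. {\<beta>'::nat^'d. \<beta>' $ j = 0}"
    have bij: "bij_betw (\<lambda>\<beta>. (\<beta> $ j, upd \<beta> j 0)) UNIV ?S"
      by (rule bij_betwI[where g="\<lambda>(k, \<beta>'). upd \<beta>' j k"]) (auto simp: vec_eq_iff)
    have eq: "?g (\<beta> $ j, upd \<beta> j 0) = b \<beta> * cmonom z \<beta>" for \<beta>
      unfolding b_def cmonom_upd[of z \<beta> j] by simp
    have abs: "(\<lambda>\<beta>. b \<beta> * cmonom z \<beta>) summable_on UNIV"
      by (rule abs_summable_summable[OF summable_on_cmonom[OF bb s(1) z]])
    have "(?g has_sum f z) ?S"
    proof (rule has_sum_SigmaI)
      show "?g summable_on ?S"
        using summable_on_reindex_bij_betw[OF bij, of ?g] abs unfolding eq by simp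
      show "((\<lambda>y. ?g (k, y)) has_sum (z $ j ^ k * c k z)) {\<beta>'. \<beta>' $ j = 0}" for k
      proof -
        have "((\<lambda>\<beta>. B k \<beta> * cmonom z \<beta>) has_sum c k z) {\<beta>'. \<beta>' $ j = 0}"
        proof -
          have "((\<lambda>\<beta>. B k \<beta> * cmonom z \<beta>) has_sum c k z) {\<beta>'. \<beta>' $ j = 0} \<longleftrightarrow> ((\<lambda>\<beta>. B k \<beta> * cmonom z \<beta>) has_sum c k z) UNIV"
            by (rule has_sum_cong_neutral) (auto simp: B(2)[OF insert.hyps(2)])
          with B(3)[OF z, of k] show ?thesis by simp
        qed
        from has_sum_cmult_right[OF this] show ?thesis by simp
      qed
      have "(\<lambda>k. c k z * (z $ j) ^ k) sums f z" by (rule co'(3)[OF zr])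
      moreover have "summable (\<lambda>k. norm (c k z * (z $ j) ^ k))"
      proof (rule summable_comparison_test_ev)
        show "\<forall>\<^sub>F k in sequentially. norm (norm (c k z * (z $ j) ^ k)) \<le> M * (norm (z $ j) / s) ^ k"
        proof (intro always_eventually allI)
          fix k
          have "norm (c k z * (z $ j) ^ k) \<le> M / s ^ k * norm (z $ j) ^ k"
            unfolding norm_mult norm_power by (intro mult_right_mono co'(2)[OF zr]) auto
          then show "norm (norm (c k z * (z $ j) ^ k)) \<le> M * (norm (z $ j) / s) ^ k"
            by (simp add: power_divide)
        qed
        show "summable (\<lambda>k. M * (norm (z $ j) / s) ^ k)"
          using z s by (intro summable_mult summable_geometric) (auto simp: polydisc_def)
      qed
      ultimately have "((\<lambda>k. c k z * (z $ j) ^ k) has_sum f z) UNIV"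
        by (intro norm_summable_imp_has_sum)
      then show "((\<lambda>k. z $ j ^ k * c k z) has_sum f z) UNIV" by (simp add: mult.commute)
    qed
    then show ?thesis using has_sum_reindex_bij_betw[OF bij, of ?g] unfolding eq by simp
  qed
  with bb z0 show ?case by (intro exI[of _ b]) blast
qed

theorem holomorphic_cn_power_series:
  fixes F :: "complex^'d \<Rightarrow> complex"
  assumes F: "holomorphic_cn F U" and 0: "0 \<in> U"
  shows "\<exists>b s. s > 0 \<and> (\<forall>z\<in>polydisc s. ((\<lambda>\<beta>. b \<beta> * cmonom z \<beta>) has_sum F z) UNIV)"
proof -
  have U: "open U" using F by (simp add: holomorphic_cn_def)
  then obtain e where e: "e > 0" "cball 0 e \<subseteq> U" using 0 open_contains_cball by blast
  obtain r where r: "r > 0" and pdb: "polydisc r \<subseteq> ball (0::complex^'d) e" by (rule polydisc_subset_ball[OF e(1)])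
  have pd: "polydisc r \<subseteq> cball (0::complex^'d) e" using pdb ball_subset_cball by blast
  have "compact (F ` cball 0 e)"
    by (intro compact_continuous_image continuous_on_subset[OF holomorphic_cn_continuous[OF F] e(2)] compact_cball)
  then obtain M where M: "\<And>z. z \<in> cball 0 e \<Longrightarrow> norm (F z) \<le> M"
    using compact_imp_bounded by (metis bounded_iff imageI)
  have sep: "sep_holomorphic r F" unfolding sep_holomorphic_def
  proof (intro ballI allI)
    fix z :: "complex^'d" and j :: 'd assume z: "z \<in> polydisc r"
    have "(\<lambda>w. F (upd z j 0 + w *s axis j 1)) holomorphic_on {w. upd z j 0 + w *s axis j 1 \<in> U}"
      by (rule holomorphic_line[OF F])
    moreover have eq: "upd z j 0 + w *s axis j 1 = upd z j w" for w by (simp add: vec_eq_iff axis_def)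
    moreover have "upd z j w \<in> U" if "w \<in> ball 0 r" for w
      using upd_polydisc[OF z, of w j] pd e(2) that by auto
    ultimately show "(\<lambda>w. F (upd z j w)) holomorphic_on ball 0 r"
      unfolding eq by (auto elim!: holomorphic_on_subset)
  qed
  have "\<exists>b. (\<forall>\<beta>. norm (b \<beta>) \<le> M / (\<Prod>j\<in>UNIV. (r/2) ^ (\<beta> $ j))) \<and>
    (\<forall>\<beta> j. j \<notin> UNIV \<longrightarrow> \<beta> $ j \<noteq> 0 \<longrightarrow> b \<beta> = 0) \<and>
    (\<forall>z\<in>polydisc (r/2). ((\<lambda>\<beta>. b \<beta> * cmonom z \<beta>) has_sum F z) UNIV)"
    by (rule sep_holomorphic_expansion[OF _ _ _ sep]) (use r M pd in \<open>auto simp: vec_eq_iff[symmetric]\<close>)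
  then show ?thesis using r by (metis half_gt_zero)
qed

lemma eventually_polydisc:
  assumes "\<forall>\<^sub>F z in nhds (0::complex^'d). Q z"
  obtains r where "r > 0" "\<And>z. z \<in> polydisc r \<Longrightarrow> Q z"
proof -
  obtain e where e: "e > 0" "\<And>z. dist z 0 < e \<Longrightarrow> Q z"
    using assms by (auto simp: eventually_nhds_metric)
  obtain r where "r > 0" "polydisc r \<subseteq> ball (0::complex^'d) e" by (rule polydisc_subset_ball[OF e(1)])
  then show thesis using e(2) by (intro that[of r]) auto
qed

lemma polydisc_eventually: "r > 0 \<Longrightarrow> \<forall>\<^sub>F z in nhds (0::complex^'d). z \<in> polydisc r"
  unfolding eventually_nhds_metric polydisc_def
  by (rule exI[of _ r]) (auto simp: le_less_trans[OF component_le_norm_cart] intro: le_less_trans[OF Finite_Cartesian_Product.norm_nth_le])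

text \<open>On the torus \<open>\<bar>z\<^sub>j\<bar> = \<rho>\<close> the power series is the Fourier series of a summable function supported on the
  nonnegative lattice points.  Its transform vanishes, hence so do all coefficients by Fourier inversion.\<close>

theorem power_series_unique_0:
  fixes b :: "nat^'d \<Rightarrow> complex"
  assumes "\<forall>\<^sub>F z in nhds 0. ((\<lambda>\<beta>. b \<beta> * cmonom z \<beta>) has_sum 0) UNIV"
  shows "b \<beta> = 0"
proof -
  obtain r where r: "r > 0" and sm: "\<And>z. z \<in> polydisc r \<Longrightarrow> ((\<lambda>\<beta>. b \<beta> * cmonom z \<beta>) has_sum 0) UNIV"
    by (rule eventually_polydisc[OF assms]) blast
  define \<rho> where "\<rho> = r / 2"
  have \<rho>: "0 < \<rho>" "\<rho> < r" using r by (auto simp: \<rho>_def)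
  define \<iota> where "\<iota> \<beta> = (\<chi> j. int (\<beta> $ j))" for \<beta> :: "nat^'d"
  define \<pi> where "\<pi> x = (\<chi> j. nat (x $ j))" for x :: "int^'d"
  have \<pi>\<iota>: "\<pi> (\<iota> \<beta>) = \<beta>" for \<beta> by (simp add: \<pi>_def \<iota>_def vec_eq_iff)
  have inj: "inj \<iota>" by (metis \<pi>\<iota> injI)
  define \<psi> where "\<psi> x = (if x \<in> range \<iota> then b (\<pi> x) * (\<Prod>j\<in>UNIV. of_real \<rho> ^ (\<pi> x $ j)) else 0)" for x
  define zz where "zz \<theta> = (\<chi> j. of_real \<rho> * exp (\<i> * of_real (\<theta> $ j)))" for \<theta> :: "real^'d"
  have zz: "zz \<theta> \<in> polydisc r" for \<theta> using \<rho> by (simp add: zz_def polydisc_def norm_mult)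
  have term_eq: "\<psi> (\<iota> \<beta>) * chr (\<iota> \<beta>) \<theta> = b \<beta> * cmonom (zz \<theta>) \<beta>" for \<beta> \<theta>
  proof -
    have "\<psi> (\<iota> \<beta>) = b \<beta> * (\<Prod>j\<in>UNIV. of_real \<rho> ^ (\<beta> $ j))" by (simp add: \<psi>_def \<pi>\<iota>)
    moreover have "chr (\<iota> \<beta>) \<theta> = (\<Prod>j\<in>UNIV. exp (\<i> * of_real (\<theta> $ j)) ^ (\<beta> $ j))"
      by (simp add: chr_def \<iota>_def rvec_def inner_vec_def sum_distrib_left exp_sum exp_of_nat_mult[symmetric] mult_ac)
    ultimately show ?thesis by (simp add: zz_def cmonom_def power_mult_distrib prod.distrib)
  qed
  have l1: "l1 \<psi>"
  proof -
    have "(\<lambda>\<beta>. norm (b \<beta> * cmonom (zz 0) \<beta>)) summable_on UNIV"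
      using has_sum_imp_summable[OF sm[OF zz[of 0]]] by (simp add: summable_on_iff_abs_summable_on_complex)
    then have "(\<lambda>\<beta>. norm (\<psi> (\<iota> \<beta>))) summable_on UNIV"
      unfolding term_eq[symmetric] by (simp add: norm_mult)
    then have "(\<lambda>x. norm (\<psi> x)) summable_on range \<iota>"
      using summable_on_reindex[OF inj, of "\<lambda>x. norm (\<psi> x)"] by (simp add: o_def)
    moreover have "(\<lambda>x. norm (\<psi> x)) summable_on range \<iota> \<longleftrightarrow> l1 \<psi>"
      by (rule summable_on_cong_neutral) (auto simp: \<psi>_def)
    ultimately show ?thesis by simp
  qed
  have fh: "fhat \<psi> \<theta> = 0" for \<theta>
  proof -
    have "((\<lambda>x. \<psi> x * chr x \<theta>) has_sum 0) (range \<iota>)"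
      using sm[OF zz[of \<theta>]] unfolding term_eq[symmetric] has_sum_reindex[OF inj] by (simp add: o_def)
    moreover have "((\<lambda>x. \<psi> x * chr x \<theta>) has_sum 0) (range \<iota>) \<longleftrightarrow> ((\<lambda>x. \<psi> x * chr x \<theta>) has_sum 0) UNIV"
      by (rule has_sum_cong_neutral) (auto simp: \<psi>_def)
    ultimately have "((\<lambda>x. \<psi> x * chr x \<theta>) has_sum 0) UNIV" by simp
    then show ?thesis unfolding fhat_chr by (rule infsumI)
  qed
  have "(2 * pi) ^ CARD('d) * \<psi> (\<iota> \<beta>) = 0"
    using fourier_inversion[OF l1, of 0 "\<iota> \<beta>"] by (simp add: fh)
  then have "\<psi> (\<iota> \<beta>) = 0" by simp
  then show ?thesis using \<rho> by (simp add: \<psi>_def \<pi>\<iota>)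
qed

text \<open>Uniqueness is what makes the description in \<open>maclaurin_coeff\<close> proper.\<close>

lemma maclaurin_coeff_eqI:
  fixes f :: "complex^'d \<Rightarrow> complex"
  assumes "\<forall>\<^sub>F z in nhds 0. ((\<lambda>\<beta>. b \<beta> * cmonom z \<beta>) has_sum f z) UNIV"
  shows "maclaurin_coeff f = b"
  unfolding maclaurin_coeff_def
proof (rule the_equality)
  fix c assume "\<forall>\<^sub>F z in nhds 0. ((\<lambda>\<beta>. c \<beta> * cmonom z \<beta>) has_sum f z) UNIV"
  with assms have "\<forall>\<^sub>F z in nhds 0. ((\<lambda>\<beta>. (c \<beta> - b \<beta>) * cmonom z \<beta>) has_sum 0) UNIV"
  proof eventually_elim
    case (elim z)
    from has_sum_add[OF elim(2) has_sum_uminusI[OF elim(1)]] show ?case by (simp add: algebra_simps)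
  qed
  from power_series_unique_0[OF this] show "c = b" by auto
qed (rule assms)

text \<open>With \<open>x\<close> and \<open>y\<close> the real and imaginary parts of \<open>z\<close>, the function \<open>w \<mapsto> F (x + w y)\<close> of one complex
  variable vanishes for small real \<open>w\<close>, hence at \<open>w = \<i>\<close>.\<close>

lemma holomorphic_cn_identity:
  fixes F :: "complex^'d \<Rightarrow> complex"
  assumes F: "holomorphic_cn F U" and 0: "0 \<in> U"
    and real: "\<forall>\<^sub>F \<xi> in nhds 0. F (cvec \<xi>) = 0"
  shows "\<forall>\<^sub>F z in nhds 0. F z = 0"
proof -
  have U: "open U" using F by (simp add: holomorphic_cn_def)
  then obtain e where e: "e > 0" "ball 0 e \<subseteq> U" using 0 openE by blast
  obtain d where d: "d > 0" "\<And>\<xi>. norm \<xi> < d \<Longrightarrow> F (cvec \<xi>) = 0"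
    using real by (auto simp: eventually_nhds_metric)
  define c where "c = min e d / 4"
  have c: "c > 0" "4 * c \<le> e" "4 * c \<le> d" using e d by (auto simp: c_def)
  show ?thesis unfolding eventually_nhds_metric
  proof (intro exI conjI allI impI)
    show "c > 0" by (rule c)
    fix z :: "complex^'d" assume "dist z 0 < c"
    then have z: "norm z < c" by simp
    define x where "x = reV z"
    define y where "y = imV z"
    have x: "norm x < c" by (rule le_less_trans[OF norm_le_componentwise_cart z]) (simp add: x_def reV_def abs_Re_le_cmod)
    have y: "norm y < c" by (rule le_less_trans[OF norm_le_componentwise_cart z]) (simp add: y_def imV_def abs_Im_le_cmod)
    let ?h = "\<lambda>w. F (cvec x + w *s cvec y)"
    have sub: "ball 0 2 \<subseteq> {w. cvec x + w *s cvec y \<in> U}"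
    proof
      fix w :: complex assume w: "w \<in> ball 0 2"
      have "norm (cvec x + w *s cvec y) \<le> norm x + norm w * norm y"
        using norm_triangle_ineq[of "cvec x" "w *s cvec y"] by (simp add: norm_vector_smult)
      also have "norm w * norm y \<le> 2 * c" using w y by (intro mult_mono) auto
      finally show "w \<in> {w. cvec x + w *s cvec y \<in> U}" using x c e(2) by (auto intro!: subsetD[OF e(2)])
    qed
    have hol: "?h holomorphic_on ball 0 2" by (rule holomorphic_on_subset[OF holomorphic_line[OF F] sub])
    have hz: "?h (of_real t) = 0" if "\<bar>t\<bar> < 2" for t
    proof -
      have "cvec x + of_real t *s cvec y = cvec (x + t *\<^sub>R y)" by (simp add: cvec_def vec_eq_iff)
      moreover have "norm (x + t *\<^sub>R y) < d"
      proof -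
        have "norm (x + t *\<^sub>R y) \<le> norm x + \<bar>t\<bar> * norm y" using norm_triangle_ineq[of x "t *\<^sub>R y"] by simp
        also have "\<bar>t\<bar> * norm y \<le> 2 * c" using that y by (intro mult_mono) auto
        finally show ?thesis using x c by linarith
      qed
      ultimately show ?thesis using d(2) by simp
    qed
    have "?h \<i> = 0"
    proof (rule analytic_continuation[OF hol, where U="of_real ` {0<..<1}" and \<xi>=0])
      show "(0::complex) islimpt of_real ` {0<..<1}"
      proof (rule islimptI)
        fix T :: "complex set" assume "0 \<in> T" "open T"
        then obtain \<epsilon> where \<epsilon>: "\<epsilon> > 0" "ball 0 \<epsilon> \<subseteq> T" using openE by blast
        define t where "t = min \<epsilon> 1 / 2"
        have "0 < t" "t < \<epsilon>" "t < 1" using \<epsilon> by (auto simp: t_def)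
        then show "\<exists>y\<in>complex_of_real ` {0<..<1}. y \<in> T \<and> y \<noteq> 0"
          using \<epsilon> by (intro bexI[of _ "of_real t"]) auto
      qed
    qed (use hz in \<open>auto\<close>)
    moreover have "cvec x + \<i> *s cvec y = z"
      by (simp add: vec_eq_iff x_def y_def reV_def imV_def complex_eq[symmetric])
    ultimately show "F z = 0" by simp
  qed
qed

section \<open>Shifting the contour under a cutoff\<close>

text \<open>Piecewise linear in the radius, so that its Lipschitz constant \<open>1 / \<delta>\<close> is explicit.\<close>

definition cutoff :: "real \<Rightarrow> real^'d \<Rightarrow> real" where
  "cutoff \<delta> x = max 0 (min 1 (2 - norm x / \<delta>))"

lemma cutoff_bounds: "0 \<le> cutoff \<delta> x" "cutoff \<delta> x \<le> 1"
  by (auto simp: cutoff_def)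

lemma cutoff_eq_1: "\<delta> > 0 \<Longrightarrow> norm x \<le> \<delta> \<Longrightarrow> cutoff \<delta> x = 1"
  and cutoff_eq_0: "\<delta> > 0 \<Longrightarrow> norm x \<ge> 2 * \<delta> \<Longrightarrow> cutoff \<delta> x = 0"
  by (auto simp: cutoff_def field_simps max_def min_def)

lemma continuous_cutoff[continuous_intros]: "\<delta> > 0 \<Longrightarrow> continuous_on S (cutoff \<delta>)"
  unfolding cutoff_def by (intro continuous_intros) auto

lemma cutoff_lipschitz:
  assumes "\<delta> > 0" shows "\<bar>cutoff \<delta> x - cutoff \<delta> y\<bar> \<le> norm (x - y) / \<delta>"
proof -
  have "\<bar>cutoff \<delta> x - cutoff \<delta> y\<bar> \<le> \<bar>norm x / \<delta> - norm y / \<delta>\<bar>" unfolding cutoff_def by linarith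
  also have "\<dots> = \<bar>norm x - norm y\<bar> / \<delta>" using assms by (simp add: diff_divide_distrib[symmetric])
  also have "\<dots> \<le> norm (x - y) / \<delta>" using assms by (intro divide_right_mono norm_triangle_ineq3) auto
  finally show ?thesis .
qed

lemma integral_translate:
  fixes f :: "real^'d \<Rightarrow> complex"
  assumes "f \<in> borel_measurable borel"
  shows "(\<integral>x. f (x + c) \<partial>lborel) = integral\<^sup>L lborel f"
proof -
  have "integral\<^sup>L lborel f = integral\<^sup>L (distr lborel borel ((+) c)) f" by (simp add: lborel_distr_plus)
  also have "\<dots> = (\<integral>x. f (c + x) \<partial>lborel)" using assms by (intro integral_distr) auto
  finally show ?thesis by (simp add: add.commute)
qed

lemma integrable_continuous_cutoff:
  fixes f :: "real^'d \<Rightarrow> complex"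
  assumes f: "continuous_on (cball 0 r) f" and out: "\<And>x. norm x > r \<Longrightarrow> f x = 0"
  shows "integrable lborel f"
proof -
  have "integrable lborel (\<lambda>x. indicator (cball 0 r) x *\<^sub>R f x)"
    using borel_integrable_compact[OF compact_cball f] .
  moreover have "(\<lambda>x. indicator (cball 0 r) x *\<^sub>R f x) = f" using out by (auto simp: indicator_def fun_eq_iff)
  ultimately show ?thesis by simp
qed

text \<open>A substitute for Cauchy's theorem.  \<open>\<Psi> \<tau>\<close>, the integral of \<open>cutoff \<delta> x *\<^sub>R g (x + \<tau> v)\<close>, is a
  holomorphic function of one complex variable.  Its derivative at a point of the imaginary axis can be
  computed along real increments \<open>\<sigma>\<close> of \<open>\<tau>\<close>; these amount to a translation of \<open>x\<close>, which a change of variables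
  moves onto the cutoff.  Only the annulus where the cutoff is not locally constant contributes to the
  difference quotient, with the factor \<open>norm v / \<delta>\<close> from the Lipschitz bound.\<close>

lemma integral_cutoff_shift:
  fixes g :: "complex^'d \<Rightarrow> complex" and v :: "real^'d"
  assumes g: "holomorphic_cn g V" and V: "ball 0 (4 * \<delta>) \<subseteq> V" and \<delta>: "\<delta> > 0"
    and v: "norm v \<le> \<delta>"
    and B: "\<And>s. 0 \<le> s \<Longrightarrow> s \<le> 1 \<Longrightarrow>
      (\<integral>x. indicator {x. \<delta>/2 \<le> norm x \<and> norm x \<le> 5/2 * \<delta>} x * norm (g (cvec x - (\<i> * of_real s) *s cvec v)) \<partial>lborel) \<le> B"
  shows "norm ((\<integral>x. cutoff \<delta> x *\<^sub>R g (cvec x - \<i> *s cvec v) \<partial>lborel) - (\<integral>x. cutoff \<delta> x *\<^sub>R g (cvec x) \<partial>lborel))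
    \<le> norm v / \<delta> * B"
proof -
  let ?z = "\<lambda>\<tau> x. cvec x + \<tau> *s cvec v"
  define \<Psi> where "\<Psi> \<tau> = (\<integral>x. cutoff \<delta> x *\<^sub>R g (?z \<tau> x) \<partial>lborel)" for \<tau>
  have gc: "continuous_on (ball 0 (4 * \<delta>)) g"
    by (rule continuous_on_subset[OF holomorphic_cn_continuous[OF g] V])
  have zn: "norm (?z \<tau> x) \<le> norm x + norm \<tau> * \<delta>" for \<tau> x
  proof -
    have "norm (?z \<tau> x) \<le> norm x + norm \<tau> * norm v"
      using norm_triangle_ineq[of "cvec x" "\<tau> *s cvec v"] by (simp add: norm_vector_smult)
    also have "norm \<tau> * norm v \<le> norm \<tau> * \<delta>" using v by (intro mult_left_mono) auto
    finally show ?thesis by simp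
  qed
  have zin: "?z \<tau> x \<in> ball 0 (4 * \<delta>)" if "norm x \<le> 5/2 * \<delta>" "norm \<tau> < 5/4" for \<tau> x
  proof -
    have "norm \<tau> * \<delta> < 5/4 * \<delta>" using that \<delta> by (intro mult_strict_right_mono) auto
    then have "norm (?z \<tau> x) < 4 * \<delta>" using zn[where x=x and \<tau>=\<tau>] that(1) \<delta> by linarith
    then show ?thesis by simp
  qed
  have gz: "continuous_on (cball 0 (5/2 * \<delta>)) (\<lambda>x. g (?z \<tau> x))" if "norm \<tau> < 5/4" for \<tau>
    by (rule continuous_on_compose2[OF gc]) (use zin that in \<open>auto intro!: continuous_intros\<close>)
  have cg: "continuous_on (cball 0 (5/2 * \<delta>)) (\<lambda>x. cutoff \<delta> x *\<^sub>R g (?z \<tau> x))" if "norm \<tau> < 5/4" for \<tau>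
    by (intro continuous_intros gz that \<delta>)
  have int: "integrable lborel (\<lambda>x. cutoff \<delta> x *\<^sub>R g (?z \<tau> x))" if "norm \<tau> < 5/4" for \<tau>
    by (rule integrable_continuous_cutoff[OF cg[OF that]]) (use \<delta> in \<open>auto simp: cutoff_eq_0\<close>)
  have "compact (g ` cball 0 (7/2 * \<delta>))"
    by (intro compact_continuous_image continuous_on_subset[OF gc] compact_cball) (use \<delta> in auto)
  from compact_imp_bounded[OF this] obtain M where M: "\<And>z. z \<in> cball 0 (7/2 * \<delta>) \<Longrightarrow> norm (g z) \<le> M"
    unfolding bounded_iff by blast
  have M0: "M \<ge> 0" by (rule order_trans[OF norm_ge_zero M[of 0]]) (use \<delta> in simp)
  \<comment> \<open>the segment from \<open>0\<close> to \<open>- \<i>\<close> together with real increments below \<open>1/4\<close> stays in this disc\<close>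
  have hol: "\<Psi> holomorphic_on ball 0 (5/4)" unfolding \<Psi>_def
  proof (rule holomorphic_integral[where h="\<lambda>x. M * indicator (cball 0 (2 * \<delta>)) x"])
    fix x :: "real^'d"
    show "(\<lambda>\<tau>. cutoff \<delta> x *\<^sub>R g (?z \<tau> x)) holomorphic_on ball 0 (5/4)"
    proof (cases "norm x \<le> 2 * \<delta>")
      case True
      have "(\<lambda>\<tau>. g (?z \<tau> x)) holomorphic_on ball 0 (5/4)"
        by (rule holomorphic_on_subset[OF holomorphic_line[OF g]]) (use zin[where x=x] True \<delta> V in \<open>auto intro!: subsetD[OF V]\<close>)
      then show ?thesis unfolding scaleR_conv_of_real by (intro holomorphic_intros)
    qed (use \<delta> in \<open>simp add: cutoff_eq_0\<close>)
    fix \<tau> :: complex assume \<tau>: "\<tau> \<in> ball 0 (5/4)"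
    show "norm (cutoff \<delta> x *\<^sub>R g (?z \<tau> x)) \<le> M * indicator (cball 0 (2 * \<delta>)) x"
    proof (cases "norm x \<le> 2 * \<delta>")
      case True
      have "norm \<tau> * \<delta> \<le> 5/4 * \<delta>" using \<tau> \<delta> by (intro mult_right_mono) auto
      then have "norm (?z \<tau> x) \<le> 7/2 * \<delta>" using zn[where x=x and \<tau>=\<tau>] True \<delta> by linarith
      then have "norm (g (?z \<tau> x)) \<le> M" by (intro M) simp
      then have "cutoff \<delta> x * norm (g (?z \<tau> x)) \<le> 1 * M" using cutoff_bounds[of \<delta> x] M0 by (intro mult_mono) auto
      then show ?thesis using True cutoff_bounds[of \<delta> x] by simp
    qed (use \<delta> in \<open>simp add: cutoff_eq_0\<close>)
  next
    show "integrable lborel (\<lambda>x. M * indicator (cball 0 (2 * \<delta>)) (x::real^'d))"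
      by (intro integrable_mult_right integrable_real_indicator) (use emeasure_bounded_finite[OF bounded_cball, of "0::real^'d" "2 * \<delta>"] in auto)
  qed (auto intro: int)
  have der: "norm (deriv \<Psi> (- (\<i> * of_real s))) \<le> norm v / \<delta> * B" if s: "0 \<le> s" "s \<le> 1" for s
  proof -
    let ?\<tau> = "- (\<i> * of_real s)"
    have n\<tau>: "norm ?\<tau> \<le> 1" using s by (simp add: norm_mult)
    have "(\<Psi> has_field_derivative deriv \<Psi> ?\<tau>) (at ?\<tau>)"
      by (rule holomorphic_derivI[OF hol]) (use n\<tau> in auto)
    then have L: "((\<lambda>h. (\<Psi> (?\<tau> + h) - \<Psi> ?\<tau>) / h) \<longlongrightarrow> deriv \<Psi> ?\<tau>) (at 0)" by (simp add: DERIV_def)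
    have "filterlim complex_of_real (at 0) (at_right 0)"
    proof -
      have "(complex_of_real \<longlongrightarrow> complex_of_real 0) (at_right 0)" by (intro tendsto_intros)
      moreover have "\<forall>\<^sub>F \<sigma> in at_right 0. complex_of_real \<sigma> \<noteq> 0"
        by (simp add: eventually_at_filter)
      ultimately show ?thesis by (simp add: filterlim_at)
    qed
    from filterlim_compose[OF L this]
    have L': "((\<lambda>\<sigma>. (\<Psi> (?\<tau> + of_real \<sigma>) - \<Psi> ?\<tau>) / of_real \<sigma>) \<longlongrightarrow> deriv \<Psi> ?\<tau>) (at_right 0)" .
    have "\<forall>\<^sub>F \<sigma> in at_right 0. norm ((\<Psi> (?\<tau> + of_real \<sigma>) - \<Psi> ?\<tau>) / of_real \<sigma>) \<le> norm v / \<delta> * B"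
    proof -
      have "\<forall>\<^sub>F \<sigma> in at_right (0::real). 0 < \<sigma> \<and> \<sigma> < 1/4"
        by (auto simp: eventually_at_right[of 0 1] intro!: exI[of _ "1/4"])
      then show ?thesis
      proof eventually_elim
        case (elim \<sigma>)
        have n\<tau>\<sigma>: "norm (?\<tau> + of_real \<sigma>) < 5/4"
          using norm_triangle_ineq[of ?\<tau> "of_real \<sigma>"] n\<tau> elim by simp
        let ?A = "{x::real^'d. \<delta>/2 \<le> norm x \<and> norm x \<le> 5/2 * \<delta>}"
        let ?G = "\<lambda>x. g (?z ?\<tau> x)"
        have sh: "?z (?\<tau> + of_real \<sigma>) x = ?z ?\<tau> (x + \<sigma> *\<^sub>R v)" for x
          by (simp add: cvec_add cvec_scaleR vec_eq_iff algebra_simps)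
        have \<sigma>v: "norm (\<sigma> *\<^sub>R v) \<le> \<delta> / 4"
        proof -
          have "\<sigma> * norm v \<le> (1/4) * \<delta>" using elim v by (intro mult_mono) auto
          then show ?thesis using elim by simp
        qed
        let ?f = "\<lambda>x. cutoff \<delta> (x - \<sigma> *\<^sub>R v) *\<^sub>R ?G x"
        have fi: "integrable lborel ?f"
        proof (rule integrable_continuous_cutoff)
          show "continuous_on (cball 0 (5/2 * \<delta>)) ?f"
            by (intro continuous_intros gz continuous_on_compose2[OF continuous_cutoff[of \<delta> UNIV]]) (use n\<tau> \<delta> in auto)
          show "?f x = 0" if "norm x > 5/2 * \<delta>" for x
          proof -
            have "norm x \<le> norm (x - \<sigma> *\<^sub>R v) + norm (\<sigma> *\<^sub>R v)" by (metis norm_triangle_sub add.commute)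
            then have "norm (x - \<sigma> *\<^sub>R v) \<ge> 2 * \<delta>" using that \<sigma>v \<delta> by linarith
            then show ?thesis using \<delta> by (simp add: cutoff_eq_0)
          qed
        qed
        have "\<Psi> (?\<tau> + of_real \<sigma>) = (\<integral>x. ?f (x + \<sigma> *\<^sub>R v) \<partial>lborel)"
          unfolding \<Psi>_def sh by simp
        also have "\<dots> = integral\<^sup>L lborel ?f"
          by (rule integral_translate) (use fi borel_measurable_integrable in auto)
        finally have "\<Psi> (?\<tau> + of_real \<sigma>) - \<Psi> ?\<tau> = (\<integral>x. ?f x - cutoff \<delta> x *\<^sub>R ?G x \<partial>lborel)"
          unfolding \<Psi>_def using fi int[of ?\<tau>] n\<tau> by simp
        also have "norm \<dots> \<le> (\<integral>x. norm (\<sigma> *\<^sub>R v) / \<delta> * (indicator ?A x * norm (?G x)) \<partial>lborel)"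
        proof (rule Bochner_Integration.integral_norm_bound_integral)
          show "integrable lborel (\<lambda>x. ?f x - cutoff \<delta> x *\<^sub>R ?G x)" using fi int[of ?\<tau>] n\<tau> by simp
          have "integrable lborel (\<lambda>x. indicator (cball 0 (5/2 * \<delta>) \<inter> {x. \<delta>/2 \<le> norm x}) x *\<^sub>R norm (?G x))"
          proof (rule borel_integrable_compact)
            show "compact (cball 0 (5/2 * \<delta>) \<inter> {x::real^'d. \<delta>/2 \<le> norm x})"
              by (intro compact_Int_closed compact_cball closed_Collect_le continuous_intros)
            show "continuous_on (cball 0 (5/2 * \<delta>) \<inter> {x. \<delta>/2 \<le> norm x}) (\<lambda>x. norm (?G x))"
              by (intro continuous_intros continuous_on_subset[OF gz]) (use n\<tau> in auto)
          qed
          moreover have "(\<lambda>x. indicator (cball 0 (5/2 * \<delta>) \<inter> {x. \<delta>/2 \<le> norm x}) x *\<^sub>R norm (?G x)) = (\<lambda>x. indicator ?A x * norm (?G x))"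
            by (auto simp: indicator_def)
          ultimately have "integrable lborel (\<lambda>x. indicator ?A x * norm (?G x))" by simp
          then show "integrable lborel (\<lambda>x. norm (\<sigma> *\<^sub>R v) / \<delta> * (indicator ?A x * norm (?G x)))"
            by (rule integrable_mult_right)
          fix x :: "real^'d"
          have "?f x - cutoff \<delta> x *\<^sub>R ?G x = (cutoff \<delta> (x - \<sigma> *\<^sub>R v) - cutoff \<delta> x) *\<^sub>R ?G x"
            by (simp add: scaleR_diff_left)
          then have e: "norm (?f x - cutoff \<delta> x *\<^sub>R ?G x) = \<bar>cutoff \<delta> (x - \<sigma> *\<^sub>R v) - cutoff \<delta> x\<bar> * norm (?G x)"
            by simp
          show "norm (?f x - cutoff \<delta> x *\<^sub>R ?G x) \<le> norm (\<sigma> *\<^sub>R v) / \<delta> * (indicator ?A x * norm (?G x))"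
          proof (cases "x \<in> ?A")
            case True
            have "\<bar>cutoff \<delta> (x - \<sigma> *\<^sub>R v) - cutoff \<delta> x\<bar> \<le> norm (\<sigma> *\<^sub>R v) / \<delta>"
              using cutoff_lipschitz[OF \<delta>, of "x - \<sigma> *\<^sub>R v" x] by simp
            then have "\<bar>cutoff \<delta> (x - \<sigma> *\<^sub>R v) - cutoff \<delta> x\<bar> * norm (?G x) \<le> norm (\<sigma> *\<^sub>R v) / \<delta> * norm (?G x)"
              by (intro mult_right_mono) auto
            then show ?thesis using True unfolding e by simp
          next
            case False
            have n1: "norm (x - \<sigma> *\<^sub>R v) \<le> norm x + \<delta>/4" using \<sigma>v norm_triangle_ineq4[of x "\<sigma> *\<^sub>R v"] by linarith
            have n2: "norm x - \<delta>/4 \<le> norm (x - \<sigma> *\<^sub>R v)" using \<sigma>v norm_triangle_ineq2[of x "\<sigma> *\<^sub>R v"] by linarith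
            from False consider "norm x < \<delta>/2" | "norm x > 5/2 * \<delta>" by force
            then have "cutoff \<delta> (x - \<sigma> *\<^sub>R v) = cutoff \<delta> x"
            proof cases
              case 1 then show ?thesis using n1 \<delta> by (simp add: cutoff_eq_1)
            next
              case 2
              then have "norm x \<ge> 2 * \<delta>" "norm (x - \<sigma> *\<^sub>R v) \<ge> 2 * \<delta>" using n2 \<delta> by linarith+
              then show ?thesis using \<delta> by (simp add: cutoff_eq_0)
            qed
            then show ?thesis unfolding e using \<delta> by simp
          qed
        qed
        also have "\<dots> = norm (\<sigma> *\<^sub>R v) / \<delta> * (\<integral>x. indicator ?A x * norm (g (cvec x - (\<i> * of_real s) *s cvec v)) \<partial>lborel)"
        proof -
          have "?z ?\<tau> x = cvec x - (\<i> * of_real s) *s cvec v" for x by (simp add: vec_eq_iff)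
          then show ?thesis by simp
        qed
        also have "\<dots> \<le> norm (\<sigma> *\<^sub>R v) / \<delta> * B" using B[OF s] \<delta> by (intro mult_left_mono) auto
        finally have "norm (\<Psi> (?\<tau> + of_real \<sigma>) - \<Psi> ?\<tau>) \<le> (norm v / \<delta> * B) * \<sigma>"
          using elim by (simp add: mult_ac)
        then have "norm (\<Psi> (?\<tau> + of_real \<sigma>) - \<Psi> ?\<tau>) / \<sigma> \<le> norm v / \<delta> * B"
          using elim by (simp only: pos_divide_le_eq)
        then show ?case using elim by (simp only: norm_divide norm_of_real abs_of_pos)
      qed
    qed
    from tendsto_upperbound[OF tendsto_norm[OF L'] this] show ?thesis by simp
  qed
  have "norm (\<Psi> (- \<i>) - \<Psi> 0) \<le> norm v / \<delta> * B * norm (- \<i> - 0)"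
  proof (rule field_differentiable_bound[where S="closed_segment 0 (- \<i>)" and f'="deriv \<Psi>"])
    fix z assume "z \<in> closed_segment 0 (- \<i>)"
    then obtain u where u: "0 \<le> u" "u \<le> 1" "z = - (\<i> * of_real u)"
      by (auto simp: in_segment scaleR_conv_of_real)
    show "norm (deriv \<Psi> z) \<le> norm v / \<delta> * B" unfolding u(3) by (rule der[OF u(1,2)])
    show "(\<Psi> has_field_derivative deriv \<Psi> z) (at z within closed_segment 0 (- \<i>))"
      by (rule has_field_derivative_at_within, rule holomorphic_derivI[OF hol]) (use u in \<open>auto simp: norm_mult\<close>)
  qed auto
  moreover have "?z (- \<i>) x = cvec x - \<i> *s cvec v" "?z 0 x = cvec x" for x by (simp_all add: vec_eq_iff)
  ultimately show ?thesis unfolding \<Psi>_def by simp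
qed

section \<open>Weights, dilations and quasi-norms\<close>

lemma kappa_mult:
  assumes "\<And>j. m $ j > 0" shows "m $ j * kappa m $ j = lcm_of m"
  by (simp add: kappa_def lcm_of_def)

lemma lcm_of_pos: assumes "\<And>j. m $ j > 0" shows "lcm_of m > 0"
proof -
  have "lcm_of m \<noteq> 0" unfolding lcm_of_def
    using Lcm_0_iff[of "range (\<lambda>j. m $ j)"] assms by (metis finite_imageI finite imageE less_numeral_extra(3))
  then show ?thesis by simp
qed

lemma kappa_pos: assumes "\<And>j. m $ j > 0" shows "kappa m $ j > 0"
  using kappa_mult[OF assms, of j] lcm_of_pos[OF assms] by (metis gr0I mult_0_right)

text \<open>The weight of a monomial under the dilations \<open>dil\<close>.  The condition \<open>\<bar>\<beta>:m\<bar> = 2\<close> reads \<open>wdeg m \<beta> = 2 * lcm_of m\<close>,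
  and \<open>Lam m \<beta>\<close> is the excess over this value.\<close>

definition wdeg :: "nat^'d \<Rightarrow> nat^'d \<Rightarrow> nat" where
  "wdeg m \<beta> = (\<Sum>j\<in>UNIV. \<beta> $ j * kappa m $ j)"

lemma Lam_wdeg: "Lam m \<beta> = int (wdeg m \<beta>) - 2 * int (lcm_of m)"
  by (simp add: Lam_def wdeg_def)

lemma wlen_wdeg:
  assumes "\<And>j. m $ j > 0" shows "wlen \<beta> m = 2 \<longleftrightarrow> wdeg m \<beta> = 2 * lcm_of m"
proof -
  have "real (\<beta> $ j) / real (m $ j) = real (\<beta> $ j * kappa m $ j) / real (lcm_of m)" for j
    unfolding kappa_mult[OF assms, of j, symmetric] using kappa_pos[OF assms, of j] by simp
  then have "wlen \<beta> m = real (wdeg m \<beta>) / real (lcm_of m)"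
    by (simp add: wlen_def wdeg_def sum_divide_distrib)
  then have "wlen \<beta> m = 2 \<longleftrightarrow> real (wdeg m \<beta>) / real (lcm_of m) = 2" by simp
  also have "\<dots> \<longleftrightarrow> real (wdeg m \<beta>) = real (2 * lcm_of m)"
    using lcm_of_pos[OF assms] by (simp add: divide_eq_eq)
  finally have "wlen \<beta> m = 2 \<longleftrightarrow> real (wdeg m \<beta>) = real (2 * lcm_of m)" .
  then show ?thesis by (simp only: of_nat_eq_iff)
qed

lemma finite_wdeg:
  assumes "\<And>j. m $ j > 0" shows "finite {\<beta>. wdeg m \<beta> = l}"
proof (rule finite_subset)
  have "\<beta> $ j \<le> wdeg m \<beta>" for \<beta> j
  proof -
    have "\<beta> $ j \<le> \<beta> $ j * kappa m $ j" using kappa_pos[OF assms, of j] by simp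
    also have "\<dots> \<le> wdeg m \<beta>" unfolding wdeg_def by (rule member_le_sum) auto
    finally show ?thesis .
  qed
  then show "{\<beta>. wdeg m \<beta> = l} \<subseteq> vec_lambda ` (UNIV \<rightarrow>\<^sub>E {..l})"
    by (intro subsetI image_eqI[where x="vec_nth _"]) (auto simp: vec_lambda_eta)
qed (auto intro!: finite_PiE)

text \<open>\<open>rho\<close> is homogeneous of degree \<open>2 * lcm_of m\<close> under dilations, like the polynomials of interest; its root
  \<open>qnorm\<close> is homogeneous of degree one.\<close>

definition rho :: "nat^'d \<Rightarrow> complex^'d \<Rightarrow> real" where
  "rho m z = (\<Sum>j\<in>UNIV. norm (z $ j) ^ (2 * m $ j))"

definition qnorm :: "nat^'d \<Rightarrow> complex^'d \<Rightarrow> real" where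
  "qnorm m z = root (2 * lcm_of m) (rho m z)"

lemma rho_nonneg: "rho m z \<ge> 0" unfolding rho_def by (intro sum_nonneg) auto

lemma qnorm_nonneg: "qnorm m z \<ge> 0" unfolding qnorm_def by (rule real_root_ge_zero[OF rho_nonneg])

lemma qnorm_power: assumes "\<And>j. m $ j > 0" shows "qnorm m z ^ (2 * lcm_of m) = rho m z"
  unfolding qnorm_def using lcm_of_pos[OF assms] by (intro real_root_pow_pos2 rho_nonneg) auto

lemma nth_le_qnorm: assumes "\<And>j. m $ j > 0" shows "norm (z $ j) \<le> qnorm m z ^ kappa m $ j"
proof (rule power_le_imp_le_base[of _ "2 * m $ j - 1"])
  have "norm (z $ j) ^ (2 * m $ j) \<le> rho m z"
    unfolding rho_def by (rule member_le_sum) auto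
  also have "\<dots> = (qnorm m z ^ kappa m $ j) ^ (2 * m $ j)"
    unfolding qnorm_power[OF assms, symmetric] kappa_mult[OF assms, of j, symmetric] by (simp add: power_mult[symmetric] mult_ac)
  finally show "norm (z $ j) ^ Suc (2 * m $ j - 1) \<le> (qnorm m z ^ kappa m $ j) ^ Suc (2 * m $ j - 1)"
    using assms[of j] by simp
qed (simp add: qnorm_nonneg)

lemma cmonom_le_qnorm: assumes "\<And>j. m $ j > 0" shows "norm (cmonom z \<beta>) \<le> qnorm m z ^ wdeg m \<beta>"
proof -
  have "norm (cmonom z \<beta>) \<le> (\<Prod>j\<in>UNIV. (qnorm m z ^ kappa m $ j) ^ (\<beta> $ j))"
    unfolding cmonom_norm by (intro prod_mono conjI power_mono nth_le_qnorm[OF assms]) auto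
  also have "\<dots> = qnorm m z ^ wdeg m \<beta>"
    unfolding wdeg_def power_sum by (simp add: power_mult[symmetric] mult.commute)
  finally show ?thesis .
qed

definition dil :: "nat^'d \<Rightarrow> real \<Rightarrow> complex^'d \<Rightarrow> complex^'d" where
  "dil m s z = (\<chi> j. of_real (s ^ kappa m $ j) * z $ j)"

lemma cmonom_dil: "cmonom (dil m s z) \<beta> = of_real (s ^ wdeg m \<beta>) * cmonom z \<beta>"
  by (simp add: cmonom_def dil_def wdeg_def power_mult_distrib prod.distrib power_sum power_mult[symmetric] mult.commute)

lemma rho_dil: assumes "\<And>j. m $ j > 0" "s \<ge> 0" shows "rho m (dil m s z) = s ^ (2 * lcm_of m) * rho m z"
  unfolding rho_def sum_distrib_left dil_def
proof (rule sum.cong)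
  fix j
  have "(s ^ kappa m $ j) ^ (2 * m $ j) = s ^ (2 * lcm_of m)"
    unfolding kappa_mult[OF assms(1), of j, symmetric] by (simp add: power_mult[symmetric] mult_ac)
  then show "norm ((\<chi> j. of_real (s ^ kappa m $ j) * z $ j) $ j) ^ (2 * m $ j) = s ^ (2 * lcm_of m) * norm (z $ j) ^ (2 * m $ j)"
    using assms(2) by (simp add: norm_mult norm_power power_mult_distrib)
qed simp

lemma rho_0_iff: assumes "\<And>j. m $ j > 0" shows "rho m z = 0 \<longleftrightarrow> z = 0"
  unfolding rho_def by (subst sum_nonneg_eq_0_iff) (use assms in \<open>auto simp: vec_eq_iff\<close>)

lemma continuous_rho[continuous_intros]: "continuous_on S f \<Longrightarrow> continuous_on S (\<lambda>x. rho m (f x))"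
  unfolding rho_def by (intro continuous_intros)

lemma continuous_cmonom[continuous_intros]: "continuous_on S f \<Longrightarrow> continuous_on S (\<lambda>x. cmonom (f x) \<beta>)"
  unfolding cmonom_def by (intro continuous_intros)

definition hpoly :: "nat^'d \<Rightarrow> (nat^'d \<Rightarrow> complex) \<Rightarrow> complex^'d \<Rightarrow> complex" where
  "hpoly m a z = (\<Sum>\<beta> | wlen \<beta> m = 2. a \<beta> * cmonom z \<beta>)"

lemma continuous_hpoly[continuous_intros]: "continuous_on S f \<Longrightarrow> continuous_on S (\<lambda>x. hpoly m a (f x))"
  unfolding hpoly_def by (intro continuous_intros)

lemma hpoly_dil: assumes "\<And>j. m $ j > 0" shows "hpoly m a (dil m s z) = of_real (s ^ (2 * lcm_of m)) * hpoly m a z"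
  unfolding hpoly_def sum_distrib_left cmonom_dil by (rule sum.cong) (auto simp: wlen_wdeg[OF assms])

lemma hpoly_le_rho: assumes "\<And>j. m $ j > 0" shows "norm (hpoly m a z) \<le> (\<Sum>\<beta> | wlen \<beta> m = 2. norm (a \<beta>)) * rho m z"
proof -
  have "norm (hpoly m a z) \<le> (\<Sum>\<beta> | wlen \<beta> m = 2. norm (a \<beta>) * rho m z)"
    unfolding hpoly_def
  proof (rule sum_norm_le)
    fix \<beta> assume "\<beta> \<in> {\<beta>. wlen \<beta> m = 2}"
    then have "norm (cmonom z \<beta>) \<le> rho m z"
      using cmonom_le_qnorm[OF assms, of z \<beta>] qnorm_power[OF assms, of z] by (simp add: wlen_wdeg[OF assms])
    then show "norm (a \<beta> * cmonom z \<beta>) \<le> norm (a \<beta>) * rho m z" by (simp add: norm_mult mult_left_mono)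
  qed
  then show ?thesis by (simp add: sum_distrib_right)
qed

lemma reV_dil: "cvec (reV (dil m s z)) = dil m s (cvec (reV z))" and imV_dil: "cvec (imV (dil m s z)) = dil m s (cvec (imV z))"
  by (simp_all add: reV_def imV_def dil_def vec_eq_iff)

lemma rho_ge_norm:
  fixes z :: "complex^'d"
  assumes "\<And>j. m $ j > 0" shows "(norm z)\<^sup>2 - CARD('d) \<le> rho m z"
proof -
  have "t\<^sup>2 - 1 \<le> t ^ (2 * m $ j)" if "t \<ge> 0" for t :: real and j
  proof (cases "t \<le> 1")
    case True
    then have "t\<^sup>2 \<le> 1" using that by (simp add: power_le_one)
    then show ?thesis using that zero_le_power[of t "2 * m $ j"] by linarith
  next
    case False
    then have "t ^ 2 \<le> t ^ (2 * m $ j)" using assms[of j] by (intro power_increasing) auto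
    then show ?thesis by simp
  qed
  then have "(\<Sum>j\<in>UNIV. (norm (z $ j))\<^sup>2 - 1) \<le> rho m z" unfolding rho_def by (intro sum_mono) auto
  then show ?thesis by (simp add: norm_vec_def L2_set_def sum_subtractf real_sqrt_pow2 sum_nonneg)
qed

lemma rho_le_re_im: "rho m z \<le> (\<Sum>j\<in>UNIV. 2 ^ m $ j) * (rho m (cvec (reV z)) + rho m (cvec (imV z)))"
proof -
  have "norm (z $ j) ^ (2 * m $ j) \<le> (\<Sum>j\<in>UNIV. 2 ^ m $ j) * (norm (cvec (reV z) $ j) ^ (2 * m $ j) + norm (cvec (imV z) $ j) ^ (2 * m $ j))" for j
  proof -
    let ?a = "\<bar>Re (z $ j)\<bar>" and ?b = "\<bar>Im (z $ j)\<bar>"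
    have "norm (z $ j) ^ (2 * m $ j) = (?a\<^sup>2 + ?b\<^sup>2) ^ (m $ j)" by (simp add: power_mult cmod_power2)
    also have "\<dots> \<le> (2 * (max ?a ?b)\<^sup>2) ^ (m $ j)"
    proof (rule power_mono)
      have "?a\<^sup>2 \<le> (max ?a ?b)\<^sup>2" "?b\<^sup>2 \<le> (max ?a ?b)\<^sup>2" by (intro power_mono; simp)+
      then show "?a\<^sup>2 + ?b\<^sup>2 \<le> 2 * (max ?a ?b)\<^sup>2" by linarith
    qed simp
    also have "\<dots> = 2 ^ m $ j * (max ?a ?b) ^ (2 * m $ j)" by (simp add: power_mult_distrib power_mult)
    also have "\<dots> \<le> (\<Sum>j\<in>UNIV. 2 ^ m $ j) * (?a ^ (2 * m $ j) + ?b ^ (2 * m $ j))"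
      by (intro mult_mono member_le_sum) (auto simp: max_def sum_nonneg)
    finally show ?thesis by (simp add: reV_def imV_def)
  qed
  then show ?thesis unfolding rho_def sum.distrib[symmetric] by (subst sum_distrib_left) (intro sum_mono)
qed

lemma cvec_reV_imV: "imV z = 0 \<Longrightarrow> z = cvec (reV z)"
  by (simp add: vec_eq_iff imV_def reV_def complex_eq_iff)

text \<open>By homogeneity it is enough to find \<open>K\<close> on the compact set where \<open>rho (Re z) + rho (Im z) = 1\<close>.  On its real
  points \<open>Re P\<close> has a positive minimum \<open>c1\<close>.  If no natural number \<open>n\<close> would do for \<open>K\<close>, with \<open>c = c1 / 2\<close>, then the
  counterexamples would accumulate at a real point, where \<open>Re P\<close> would be at most \<open>c1 / 2\<close>.\<close>

lemma hpoly_coercive: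
  fixes a :: "nat^'d \<Rightarrow> complex"
  assumes m: "\<And>j. m $ j > 0" and pd: "pos_definite (\<lambda>\<xi>. Re (hpoly m a (cvec \<xi>)))"
  obtains c K where "c > 0" "K \<ge> 0" "\<And>z. Re (hpoly m a z) \<ge> c * rho m (cvec (reV z)) - K * rho m (cvec (imV z))"
proof -
  let ?N = "\<lambda>z. rho m (cvec (reV z)) + rho m (cvec (imV z))"
  let ?P = "\<lambda>z. Re (hpoly m a z)"
  let ?S = "{z::complex^'d. ?N z = 1}"
  have NS: "norm z \<le> 2 * (1 + real CARD('d))" if "z \<in> ?S" for z
  proof -
    have "norm (reV z) \<le> 1 + real CARD('d)" "norm (imV z) \<le> 1 + real CARD('d)"
    proof -
      have *: "norm x \<le> 1 + real CARD('d)" if "rho m (cvec x) \<le> 1" for x :: "real^'d"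
      proof (rule power2_le_imp_le)
        have "(norm x)\<^sup>2 \<le> 1 + real CARD('d)" using rho_ge_norm[OF m, of "cvec x"] that by simp
        also have "\<dots> \<le> (1 + real CARD('d))\<^sup>2" by (simp add: power2_eq_square algebra_simps)
        finally show "(norm x)\<^sup>2 \<le> (1 + real CARD('d))\<^sup>2" .
      qed simp
      show "norm (reV z) \<le> 1 + real CARD('d)" "norm (imV z) \<le> 1 + real CARD('d)"
        using that rho_nonneg[of m "cvec (reV z)"] rho_nonneg[of m "cvec (imV z)"] by (auto intro!: *)
    qed
    moreover have "z = cvec (reV z) + \<i> *s cvec (imV z)" by (simp add: vec_eq_iff reV_def imV_def complex_eq)
    then have "norm z \<le> norm (reV z) + norm (imV z)"
      by (metis norm_cvec norm_triangle_ineq norm_vector_smult norm_ii mult_1)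
    ultimately show ?thesis by simp
  qed
  have cS: "compact ?S"
    unfolding compact_eq_bounded_closed
    by (auto intro!: boundedI[OF NS] closed_Collect_eq continuous_intros)
  have cSr: "compact (?S \<inter> {z. imV z = 0})"
    by (intro compact_Int_closed cS closed_Collect_eq continuous_intros)
  obtain c1 where c1: "c1 > 0" "\<And>z. z \<in> ?S \<Longrightarrow> imV z = 0 \<Longrightarrow> ?P z \<ge> c1"
  proof (cases "?S \<inter> {z. imV z = 0} = {}")
    case True
    show ?thesis
    proof (rule that[of 1])
      fix z assume "z \<in> ?S" "imV z = 0"
      then have "z \<in> ?S \<inter> {z. imV z = 0}" by (simp only: Int_iff mem_Collect_eq)
      then have "z \<in> {}" by (simp only: True)
      then show "1 \<le> ?P z" by simp
    qed simp
  next
    case False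
    have "continuous_on (?S \<inter> {z. imV z = 0}) ?P" by (intro continuous_intros)
    from continuous_attains_inf[OF cSr False this] obtain z0 where zi: "z0 \<in> ?S \<inter> {z. imV z = 0}" and zm: "\<forall>z\<in>?S \<inter> {z. imV z = 0}. ?P z0 \<le> ?P z" by (rule bexE)
    note z0 = IntD1[OF zi] IntD2[OF zi, unfolded mem_Collect_eq] bspec[OF zm]
    have "reV z0 \<noteq> 0" using z0(1,2) rho_0_iff[OF m, of 0] by auto
    then have "?P (cvec (reV z0)) > 0" using pd unfolding pos_definite_def by (metis less_le)
    then have "?P z0 > 0" using cvec_reV_imV[OF z0(2)] by simp
    then show ?thesis using that[of "?P z0"] z0(3) by blast
  qed
  define C where "C = (\<Sum>\<beta> | wlen \<beta> m = 2. norm (a \<beta>)) * (\<Sum>j\<in>UNIV. 2 ^ m $ j)"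
  have PC: "norm (?P z) \<le> C" if "z \<in> ?S" for z
  proof -
    have "norm (?P z) \<le> norm (hpoly m a z)" by (simp add: abs_Re_le_cmod)
    also have "\<dots> \<le> (\<Sum>\<beta> | wlen \<beta> m = 2. norm (a \<beta>)) * rho m z" by (rule hpoly_le_rho[OF m])
    also have "\<dots> \<le> (\<Sum>\<beta> | wlen \<beta> m = 2. norm (a \<beta>)) * ((\<Sum>j\<in>UNIV. 2 ^ m $ j) * ?N z)"
      by (intro mult_left_mono rho_le_re_im sum_nonneg) auto
    finally show ?thesis using that by (simp add: C_def)
  qed
  define c where "c = c1 / 2"
  have "\<exists>n::nat. \<forall>z\<in>?S. ?P z \<ge> c * rho m (cvec (reV z)) - real n * rho m (cvec (imV z))"
  proof (rule ccontr)
    assume "\<not> ?thesis"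
    then have "\<forall>n. \<exists>z. z \<in> ?S \<and> ?P z < c * rho m (cvec (reV z)) - real n * rho m (cvec (imV z))" by (auto simp: not_le)
    from choice[OF this] obtain f where f: "\<And>n. f n \<in> ?S" "\<And>n. ?P (f n) < c * rho m (cvec (reV (f n))) - real n * rho m (cvec (imV (f n)))" by blast
    from cS[unfolded compact_def, rule_format, of f] f(1) obtain l r where l: "l \<in> ?S" "strict_mono r" "(f \<circ> r) \<longlonglongrightarrow> l" by blast
    have cont: "(\<lambda>n. h (f (r n))) \<longlonglongrightarrow> h l" if "continuous_on UNIV h" for h :: "complex^'d \<Rightarrow> real"
      using continuous_on_tendsto_compose[OF that l(3)] by (simp add: o_def)
    have up: "rho m (cvec (imV (f (r n)))) \<le> (C + c) / real n" if "n > 0" for n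
    proof -
      have rr: "rho m (cvec (reV (f (r n)))) \<le> 1" using f(1)[of "r n"] rho_nonneg[of m "cvec (imV (f (r n)))"] by simp
      have c0: "c > 0" using c1 by (simp add: c_def)
      have "real n * rho m (cvec (imV (f (r n)))) \<le> real (r n) * rho m (cvec (imV (f (r n))))"
        using seq_suble[OF l(2), of n] by (intro mult_right_mono rho_nonneg) auto
      also have "\<dots> \<le> c * rho m (cvec (reV (f (r n)))) - ?P (f (r n))" using f(2)[of "r n"] by linarith
      also have "\<dots> \<le> c * 1 + C" using PC[OF f(1)[of "r n"]] mult_left_mono[OF rr, of c] c0 unfolding real_norm_def by linarith
      finally show ?thesis using that by (simp add: field_simps)
    qed
    have "(\<lambda>n. (C + c) / real n) \<longlonglongrightarrow> 0" by (rule lim_const_over_n)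
    moreover have "\<forall>\<^sub>F n in sequentially. norm (rho m (cvec (imV (f (r n))))) \<le> (C + c) / real n"
      using eventually_gt_at_top[of 0] by eventually_elim (simp add: up abs_of_nonneg[OF rho_nonneg])
    ultimately have "(\<lambda>n. rho m (cvec (imV (f (r n))))) \<longlonglongrightarrow> 0" by (rule Lim_null_comparison[rotated])
    moreover have "(\<lambda>n. rho m (cvec (imV (f (r n))))) \<longlonglongrightarrow> rho m (cvec (imV l))"
      by (rule cont) (intro continuous_intros)
    ultimately have "rho m (cvec (imV l)) = 0" using LIMSEQ_unique by blast
    then have il: "imV l = 0" using rho_0_iff[OF m] by (auto simp: vec_eq_iff)
    have rl: "rho m (cvec (reV l)) = 1" using l(1) il \<open>rho m (cvec (imV l)) = 0\<close> by simp
    have "?P l \<le> c * rho m (cvec (reV l))"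
    proof (rule LIMSEQ_le)
      show "(\<lambda>n. ?P (f (r n))) \<longlonglongrightarrow> ?P l" by (rule cont) (intro continuous_intros)
      show "(\<lambda>n. c * rho m (cvec (reV (f (r n))))) \<longlonglongrightarrow> c * rho m (cvec (reV l))" by (rule cont) (intro continuous_intros)
      show "\<exists>N. \<forall>n\<ge>N. ?P (f (r n)) \<le> c * rho m (cvec (reV (f (r n))))"
        using f(2) rho_nonneg by (smt (verit) mult_nonneg_nonneg of_nat_0_le_iff)
    qed
    then show False using c1(2)[OF l(1) il] rl c1(1) by (simp add: c_def)
  qed
  then obtain n :: nat where n: "\<And>z. z \<in> ?S \<Longrightarrow> ?P z \<ge> c * rho m (cvec (reV z)) - real n * rho m (cvec (imV z))" by blast
  show thesis
  proof (rule that)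
    show "c > 0" using c1 by (simp add: c_def)
    show "real n \<ge> 0" by simp
    fix z
    show "?P z \<ge> c * rho m (cvec (reV z)) - real n * rho m (cvec (imV z))"
    proof (cases "?N z = 0")
      case True
      then have "rho m (cvec (reV z)) = 0" "rho m (cvec (imV z)) = 0"
        using rho_nonneg[of m "cvec (reV z)"] rho_nonneg[of m "cvec (imV z)"] by linarith+
      then have "reV z = 0" "imV z = 0" using rho_0_iff[OF m] by (auto simp: vec_eq_iff)
      then have "z = 0" using cvec_reV_imV by fastforce
      then have "norm (hpoly m a z) \<le> 0" using hpoly_le_rho[OF m, of a z] rho_0_iff[OF m, of z] by simp
      then show ?thesis using True rho_nonneg[of m "cvec (reV z)"] rho_nonneg[of m "cvec (imV z)"] by (simp add: add_nonneg_eq_0_iff)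
    next
      case False
      let ?p = "2 * lcm_of m"
      define s where "s = root ?p (?N z)"
      have p: "?p > 0" using lcm_of_pos[OF m] by simp
      have Np: "?N z > 0" using False rho_nonneg[of m "cvec (reV z)"] rho_nonneg[of m "cvec (imV z)"] by linarith
      have s: "s > 0" "s ^ ?p = ?N z" using Np p by (auto simp: s_def real_root_pow_pos2)
      define w where "w = dil m (1/s) z"
      have rw: "rho m (cvec (reV w)) = rho m (cvec (reV z)) / s ^ ?p" "rho m (cvec (imV w)) = rho m (cvec (imV z)) / s ^ ?p"
        unfolding w_def reV_dil imV_dil by (subst rho_dil[OF m]; use s in \<open>simp add: power_one_over\<close>)+
      have "w \<in> ?S" using rw s Np by (simp add: add_divide_distrib[symmetric])
      from n[OF this] have "c * rho m (cvec (reV z)) / s ^ ?p - real n * rho m (cvec (imV z)) / s ^ ?p \<le> ?P w" using rw by simp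
      also have "?P w = ?P z / s ^ ?p" unfolding w_def hpoly_dil[OF m] by (simp add: power_one_over)
      finally show ?thesis using s Np by (simp add: diff_divide_distrib[symmetric] divide_le_cancel)
    qed
  qed
qed

section \<open>Closure properties of holomorphic functions\<close>

lemma holomorphic_cnI:
  assumes "open U" "\<And>z. z \<in> U \<Longrightarrow> \<exists>D. (F has_derivative D) (at z) \<and> (\<forall>c v. D (c *s v) = c * D v)"
  shows "holomorphic_cn F U"
  using assms by (auto simp: holomorphic_cn_def)

lemma holomorphic_cn_const: "open U \<Longrightarrow> holomorphic_cn (\<lambda>_. c) U"
  by (rule holomorphic_cnI) (auto intro!: exI[of _ "\<lambda>_. 0"])

lemma holomorphic_cn_nth: "open U \<Longrightarrow> holomorphic_cn (\<lambda>z. z $ j) U"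
  by (rule holomorphic_cnI) (auto intro!: exI[of _ "\<lambda>z. z $ j"] bounded_linear_imp_has_derivative bounded_linear_vec_nth)

lemma holomorphic_cn_add:
  assumes "holomorphic_cn F U" "holomorphic_cn G U" shows "holomorphic_cn (\<lambda>z. F z + G z) U"
proof (rule holomorphic_cnI)
  fix z assume "z \<in> U"
  then obtain D E where "(F has_derivative D) (at z)" "\<forall>c v. D (c *s v) = c * D v"
    "(G has_derivative E) (at z)" "\<forall>c v. E (c *s v) = c * E v"
    using assms by (meson holomorphic_cn_def)
  then show "\<exists>D. ((\<lambda>z. F z + G z) has_derivative D) (at z) \<and> (\<forall>c v. D (c *s v) = c * D v)"
    by (intro exI[of _ "\<lambda>v. D v + E v"]) (auto intro!: has_derivative_add simp: distrib_left)
qed (use assms in \<open>simp add: holomorphic_cn_def\<close>)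

lemma holomorphic_cn_mult:
  assumes "holomorphic_cn F U" "holomorphic_cn G U" shows "holomorphic_cn (\<lambda>z. F z * G z) U"
proof (rule holomorphic_cnI)
  fix z assume "z \<in> U"
  then obtain D E where D: "(F has_derivative D) (at z)" "\<forall>c v. D (c *s v) = c * D v"
    and E: "(G has_derivative E) (at z)" "\<forall>c v. E (c *s v) = c * E v"
    using assms by (meson holomorphic_cn_def)
  have "\<forall>c v. F z * E (c *s v) + D (c *s v) * G z = c * (F z * E v + D v * G z)"
    using D(2) E(2) by (simp add: algebra_simps)
  with has_derivative_mult[OF D(1) E(1)]
  show "\<exists>D. ((\<lambda>z. F z * G z) has_derivative D) (at z) \<and> (\<forall>c v. D (c *s v) = c * D v)"
    by (intro exI[of _ "\<lambda>v. F z * E v + D v * G z"] conjI)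
qed (use assms in \<open>simp add: holomorphic_cn_def\<close>)

lemma holomorphic_cn_exp:
  assumes "holomorphic_cn F U" shows "holomorphic_cn (\<lambda>z. exp (F z)) U"
proof (rule holomorphic_cnI)
  fix z assume "z \<in> U"
  then obtain D where D: "(F has_derivative D) (at z)" "\<forall>c v. D (c *s v) = c * D v"
    using assms by (meson holomorphic_cn_def)
  have "((\<lambda>z. exp (F z)) has_derivative (\<lambda>v. exp (F z) * D v)) (at z)"
    using has_derivative_compose[OF D(1) DERIV_exp[unfolded has_field_derivative_def]] by simp
  then show "\<exists>D. ((\<lambda>z. exp (F z)) has_derivative D) (at z) \<and> (\<forall>c v. D (c *s v) = c * D v)"
    using D(2) by (intro exI[of _ "\<lambda>v. exp (F z) * D v"]) (auto simp: algebra_simps)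
qed (use assms in \<open>simp add: holomorphic_cn_def\<close>)

lemma holomorphic_cn_sum:
  assumes "open U" "\<And>i. i \<in> I \<Longrightarrow> holomorphic_cn (F i) U" shows "holomorphic_cn (\<lambda>z. \<Sum>i\<in>I. F i z) U"
  using assms(2) by (induction I rule: infinite_finite_induct) (auto intro!: holomorphic_cn_const[OF assms(1)] holomorphic_cn_add)

lemma holomorphic_cn_prod:
  assumes "open U" "\<And>i. i \<in> I \<Longrightarrow> holomorphic_cn (F i) U" shows "holomorphic_cn (\<lambda>z. \<Prod>i\<in>I. F i z) U"
  using assms(2) by (induction I rule: infinite_finite_induct) (auto intro!: holomorphic_cn_const[OF assms(1)] holomorphic_cn_mult)

lemma holomorphic_cn_power:
  assumes "open U" "holomorphic_cn F U" shows "holomorphic_cn (\<lambda>z. F z ^ n) U"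
  by (induction n) (auto intro!: holomorphic_cn_const[OF assms(1)] holomorphic_cn_mult[OF assms(2)])

lemma holomorphic_cn_cmonom: "open U \<Longrightarrow> holomorphic_cn (\<lambda>z. cmonom z \<beta>) U"
  unfolding cmonom_def by (intro holomorphic_cn_prod holomorphic_cn_power holomorphic_cn_nth)

lemma holomorphic_cn_hpoly: "open U \<Longrightarrow> holomorphic_cn (hpoly m a) U"
  unfolding hpoly_def by (intro holomorphic_cn_sum holomorphic_cn_mult holomorphic_cn_const holomorphic_cn_cmonom)

lemma holomorphic_cn_subset: "holomorphic_cn F U \<Longrightarrow> open W \<Longrightarrow> W \<subseteq> U \<Longrightarrow> holomorphic_cn F W"
  by (auto simp: holomorphic_cn_def)

text \<open>The inner product extended bilinearly, not sesquilinearly, so that it is holomorphic in \<open>z\<close>.\<close>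

definition bil :: "real^'d \<Rightarrow> complex^'d \<Rightarrow> complex" where
  "bil y z = (\<Sum>j\<in>UNIV. of_real (y $ j) * z $ j)"

lemma bil_cvec: "bil y (cvec x) = of_real (y \<bullet> x)"
  by (simp add: bil_def inner_vec_def)

lemma Re_ii_bil: "Re (- \<i> * bil y z) = y \<bullet> imV z"
  by (simp add: bil_def inner_vec_def imV_def)

lemma holomorphic_cn_bil: "open U \<Longrightarrow> holomorphic_cn (bil y) U"
  unfolding bil_def by (intro holomorphic_cn_sum holomorphic_cn_mult holomorphic_cn_const holomorphic_cn_nth)

section \<open>Elementary estimates\<close>

lemma powr_le_exp:
  fixes q \<kappa> :: real
  assumes "q > 0" "\<kappa> > 0"
  obtains C where "C > 0" "\<And>x. x \<ge> 0 \<Longrightarrow> x powr q \<le> C * exp (\<kappa> * x)"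
proof (rule that)
  show "exp (q * ln (q / \<kappa>)) > 0" by simp
  fix x :: real assume x: "x \<ge> 0"
  show "x powr q \<le> exp (q * ln (q / \<kappa>)) * exp (\<kappa> * x)"
  proof (cases "x = 0")
    case False
    then have x: "x > 0" using x by simp
    have "ln x = ln (\<kappa> * x / q) + ln (q / \<kappa>)" using assms x by (simp add: ln_mult ln_div)
    also have "ln (\<kappa> * x / q) \<le> \<kappa> * x / q - 1" using assms x by (intro ln_le_minus_one) simp
    finally have "q * ln x \<le> q * (\<kappa> * x / q + ln (q / \<kappa>))" using assms by (intro mult_left_mono) auto
    also have "\<dots> = \<kappa> * x + q * ln (q / \<kappa>)" using assms by (simp add: algebra_simps)
    finally show ?thesis using x by (simp add: powr_def exp_add[symmetric] add.commute)
  qed simp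
qed

lemma exp_absorbs_powr:
  fixes q \<kappa> :: real
  assumes "q > 0" "\<kappa> > 0"
  obtains C where "C > 0" "\<And>n. n \<ge> 1 \<Longrightarrow> exp (- \<kappa> * n) \<le> C * n powr (- q)"
proof -
  obtain C where C: "C > 0" "\<And>x. x \<ge> 0 \<Longrightarrow> x powr q \<le> C * exp (\<kappa> * x)"
    using powr_le_exp[OF assms] by blast
  show thesis
  proof (rule that[OF C(1)])
    fix n :: real assume "n \<ge> 1"
    then have "n powr q \<le> C * exp (\<kappa> * n)" "n powr q > 0" using C(2)[of n] by auto
    then show "exp (- \<kappa> * n) \<le> C * n powr (- q)" by (simp add: powr_minus exp_minus field_simps)
  qed
qed

text \<open>As long as \<open>l\<close> stays bounded, half of the exponent pays for the power of \<open>n\<close> and the other half for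
  \<open>exp (- n * M * l)\<close>.\<close>

lemma exponential_absorb:
  fixes \<kappa> B q :: real
  assumes "\<kappa> > 0" "B > 0" "q > 0"
  obtains C M where "C > 0" "M > 0" "\<And>n l. n \<ge> 1 \<Longrightarrow> l \<le> B \<Longrightarrow> exp (- \<kappa> * n) \<le> C * n powr (- q) * exp (- n * M * l)"
proof -
  obtain C where C: "C > 0" "\<And>n. n \<ge> 1 \<Longrightarrow> exp (- (\<kappa> / 2) * n) \<le> C * n powr (- q)"
    using exp_absorbs_powr[of q "\<kappa> / 2"] assms by auto
  define M where "M = \<kappa> / (2 * B)"
  show thesis
  proof (rule that[OF C(1), of M])
    show "M > 0" using assms by (simp add: M_def)
    fix n l :: real assume n: "n \<ge> 1" and l: "l \<le> B"
    have "M * l \<le> M * B" using l assms by (intro mult_left_mono) (auto simp: M_def)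
    also have "M * B = \<kappa> / 2" using assms by (simp add: M_def)
    finally have "n * (M * l) \<le> n * (\<kappa> / 2)" using n by (intro mult_left_mono) auto
    then have "exp (- \<kappa> * n) \<le> exp (- (\<kappa> / 2) * n + - n * M * l)" by (simp add: mult_ac)
    also have "\<dots> = exp (- (\<kappa> / 2) * n) * exp (- n * M * l)" by (rule exp_add)
    also have "\<dots> \<le> (C * n powr (- q)) * exp (- n * M * l)" by (intro mult_right_mono C(2) n) simp
    finally show "exp (- \<kappa> * n) \<le> C * n powr (- q) * exp (- n * M * l)" .
  qed
qed

lemma norm_exp_minus_1_le: "norm (exp w - 1) \<le> norm w * exp (norm w)" for w :: complex
proof -
  have "norm (exp w - exp 0) \<le> exp (norm w) * norm (w - 0)"
  proof (rule field_differentiable_bound[where S="cball 0 (norm w)" and f'=exp])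
    fix z :: complex assume z: "z \<in> cball 0 (norm w)"
    have "norm (exp z) \<le> exp (norm z)" by (rule norm_exp)
    also have "\<dots> \<le> exp (norm w)" using z by simp
    finally show "norm (exp z) \<le> exp (norm w)" .
  qed (auto intro!: derivative_eq_intros)
  then show ?thesis by (simp add: mult.commute)
qed

lemma integrable_exp_abs: fixes c :: real assumes c: "c > 0" shows "integrable lborel (\<lambda>t. exp (- c * \<bar>t\<bar>))"
proof -
  let ?f = "\<lambda>t. indicator {0..} t * exp (- c * t)"
  have i: "integrable lborel ?f"
  proof (rule integrableI_nonneg)
    have "(\<integral>\<^sup>+x. ennreal (exp (- c * x)) * indicator {0..} x \<partial>lborel) = ennreal (0 - (- exp (- c * 0) / c))"
    proof (rule nn_integral_FTC_atLeast)
      show "((\<lambda>x. - exp (- c * x) / c) \<longlongrightarrow> 0) at_top"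
      proof -
        have "((\<lambda>x. exp (- (c * x))) \<longlongrightarrow> 0) at_top"
          by (intro filterlim_compose[OF exp_at_bot] filterlim_compose[OF filterlim_uminus_at_bot_at_top] filterlim_tendsto_pos_mult_at_top[OF tendsto_const c filterlim_ident])
        then have "((\<lambda>x. - exp (- (c * x)) / c) \<longlongrightarrow> - 0 / c) at_top" using c by (intro tendsto_intros) auto
        then show ?thesis by simp
      qed
    qed (use c in \<open>auto intro!: derivative_eq_intros\<close>)
    moreover have "(\<lambda>x. ennreal (?f x)) = (\<lambda>x. ennreal (exp (- c * x)) * indicator {0..} x)"
      by (auto simp: indicator_def)
    ultimately show "(\<integral>\<^sup>+x. ennreal (?f x) \<partial>lborel) < \<infinity>" by simp
  qed auto
  have "integrable lborel (\<lambda>t. ?f (0 + (-1) * t))" by (rule lborel_integrable_real_affine[OF i]) simp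
  from Bochner_Integration.integrable_add[OF i this]
  show ?thesis
    by (rule Bochner_Integration.integrable_bound) (auto simp: indicator_def)
qed

section \<open>Positive semi-elliptic polynomials and their Legendre transforms\<close>

locale semi_elliptic =
  fixes m :: "nat^'d" and a :: "nat^'d \<Rightarrow> complex"
  assumes m_pos: "\<And>j. m $ j > 0" and pd: "pos_definite (\<lambda>\<xi>. Re (hpoly m a (cvec \<xi>)))"
begin

abbreviation R :: "real^'d \<Rightarrow> real" where "R \<xi> \<equiv> Re (hpoly m a (cvec \<xi>))"
abbreviation \<rho> :: "real^'d \<Rightarrow> real" where "\<rho> \<xi> \<equiv> rho m (cvec \<xi>)"
definition mu :: real where "mu = (\<Sum>j\<in>UNIV. 1 / (2 * real (m $ j)))"
abbreviation leg :: "real^'d \<Rightarrow> real" where "leg \<equiv> legendre R"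

lemma coercive:
  obtains c K where "c > 0" "K \<ge> 0"
    "\<And>z. Re (hpoly m a z) \<ge> c * \<rho> (reV z) - K * \<rho> (imV z)" "\<And>\<xi>. R \<xi> \<ge> c * \<rho> \<xi>"
proof -
  obtain c K where c: "c > 0" "K \<ge> 0" "\<And>z. Re (hpoly m a z) \<ge> c * \<rho> (reV z) - K * \<rho> (imV z)"
    using hpoly_coercive[OF m_pos pd] by blast
  have "R \<xi> \<ge> c * \<rho> \<xi>" for \<xi>
  proof -
    have "reV (cvec \<xi>) = \<xi>" "imV (cvec \<xi>) = 0" by (simp_all add: reV_def imV_def vec_eq_iff)
    then show ?thesis using c(3)[of "cvec \<xi>"] rho_0_iff[OF m_pos, of 0] by simp
  qed
  then show thesis using c by (intro that)
qed

text \<open>Every exponent \<open>2 * m $ j\<close> is at least \<open>2\<close>: short multiples of a vector cost only quadratically.  This is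
  what makes small contour shifts profitable.\<close>

lemma rho_scale: assumes "0 \<le> e" "e \<le> 1" shows "\<rho> (e *\<^sub>R w) \<le> e\<^sup>2 * \<rho> w"
  unfolding rho_def sum_distrib_left
proof (rule sum_mono)
  fix j
  have "e ^ (2 * m $ j) \<le> e\<^sup>2" using assms m_pos[of j] by (intro power_decreasing) auto
  then show "norm (cvec (e *\<^sub>R w) $ j) ^ (2 * m $ j) \<le> e\<^sup>2 * norm (cvec w $ j) ^ (2 * m $ j)"
    using assms by (simp add: norm_mult power_mult_distrib mult_right_mono)
qed

lemma rho_minus: "\<rho> (- w) = \<rho> w" by (simp add: rho_def)

lemma rho_lower: assumes "\<delta> > 0"
  obtains r where "r > 0" "\<And>x. norm x \<ge> \<delta> \<Longrightarrow> \<rho> x \<ge> r"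
proof -
  define \<eta> where "\<eta> = min 1 (\<delta> / (2 * CARD('d)))"
  have \<eta>: "0 < \<eta>" "\<eta> \<le> 1" using assms by (auto simp: \<eta>_def)
  show thesis
  proof (rule that[of "\<eta> ^ (2 * lcm_of m)"])
    fix x :: "real^'d" assume x: "norm x \<ge> \<delta>"
    have "\<exists>j. \<bar>x $ j\<bar> \<ge> \<eta>"
    proof (rule ccontr)
      assume "\<not> ?thesis"
      then have "\<And>j. \<bar>x $ j\<bar> \<le> \<delta> / (2 * CARD('d))" by (auto simp: not_le \<eta>_def intro: less_imp_le)
      then have "(\<Sum>j\<in>UNIV. \<bar>x $ j\<bar>) \<le> (\<Sum>j\<in>(UNIV::'d set). \<delta> / (2 * CARD('d)))" by (intro sum_mono)
      also have "\<dots> = \<delta> / 2" by simp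
      finally show False using norm_le_l1_cart[of x] x assms by linarith
    qed
    then obtain j where j: "\<bar>x $ j\<bar> \<ge> \<eta>" by blast
    have "m $ j \<le> lcm_of m" using kappa_mult[OF m_pos, of j] kappa_pos[OF m_pos, of j] by (metis dvd_imp_le dvd_triv_left lcm_of_pos m_pos)
    then have "\<eta> ^ (2 * lcm_of m) \<le> \<eta> ^ (2 * m $ j)" using \<eta> by (intro power_decreasing) auto
    also have "\<dots> \<le> \<bar>x $ j\<bar> ^ (2 * m $ j)" using j \<eta> by (intro power_mono) auto
    also have "\<dots> \<le> \<rho> x" unfolding rho_def using member_le_sum[of j UNIV "\<lambda>j. norm (cvec x $ j) ^ (2 * m $ j)"] by simp
    finally show "\<rho> x \<ge> \<eta> ^ (2 * lcm_of m)" .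
  qed (use \<eta> in simp)
qed

lemma integrable_exp_rho: assumes c: "c > 0" shows "integrable lborel (\<lambda>x. exp (- c * \<rho> x))"
proof (rule Bochner_Integration.integrable_bound)
  show "integrable lborel (\<lambda>x::real^'d. \<Prod>j\<in>UNIV. exp (2 * c) * exp (- c * \<bar>x $ j\<bar>))"
    by (rule integrable_prod_vec[where f="\<lambda>j t. exp (2 * c) * exp (- c * \<bar>t\<bar>)"]) (intro integrable_mult_right integrable_exp_abs c)
  show "(\<lambda>x. exp (- c * \<rho> x)) \<in> borel_measurable lborel"
    by (simp, intro borel_measurable_continuous_onI continuous_intros)
  show "AE x in lborel. norm (exp (- c * \<rho> x)) \<le> norm (\<Prod>j\<in>UNIV. exp (2 * c) * exp (- c * \<bar>x $ j\<bar>))"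
  proof (intro always_eventually allI)
    fix x :: "real^'d"
    have t: "\<bar>t\<bar> - 2 \<le> \<bar>t\<bar> ^ (2 * k)" if "k > 0" for t :: real and k
    proof (cases "\<bar>t\<bar> \<le> 1")
      case False
      then have "\<bar>t\<bar> ^ 1 \<le> \<bar>t\<bar> ^ (2 * k)" using that by (intro power_increasing) auto
      then show ?thesis by simp
    qed (use zero_le_power[of "\<bar>t\<bar>" "2 * k"] in linarith)
    have "(\<Sum>j\<in>UNIV. \<bar>x $ j\<bar> - 2) \<le> \<rho> x" unfolding rho_def using t m_pos by (intro sum_mono) auto
    then have "- c * \<rho> x \<le> - c * (\<Sum>j\<in>UNIV. \<bar>x $ j\<bar> - 2)" using c by simp
    also have "\<dots> = (\<Sum>j\<in>UNIV. 2 * c + (- c * \<bar>x $ j\<bar>))" unfolding sum_distrib_left by (rule sum.cong) (auto simp: algebra_simps)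
    finally have "exp (- c * \<rho> x) \<le> exp (\<Sum>j\<in>UNIV. 2 * c + (- c * \<bar>x $ j\<bar>))" by simp
    also have "\<dots> = (\<Prod>j\<in>UNIV. exp (2 * c) * exp (- c * \<bar>x $ j\<bar>))" by (simp add: exp_sum exp_add[symmetric])
    finally show "norm (exp (- c * \<rho> x)) \<le> norm (\<Prod>j\<in>UNIV. exp (2 * c) * exp (- c * \<bar>x $ j\<bar>))"
      by (simp add: abs_prod abs_mult)
  qed
qed

definition rdil :: "real \<Rightarrow> real^'d \<Rightarrow> real^'d" where "rdil s x = (\<chi> j. s ^ kappa m $ j * x $ j)"

lemma cvec_rdil: "cvec (rdil s x) = dil m s (cvec x)"
  by (simp add: vec_eq_iff rdil_def dil_def)

text \<open>The substitution by the dilation with factor \<open>n powr (- 1 / (2 * lcm_of m))\<close>, whose determinant is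
  \<open>n powr (- mu)\<close>.\<close>

lemma integral_dil_scale:
  fixes h :: "real^'d \<Rightarrow> real"
  assumes n: "n > 0" and h: "h \<in> borel_measurable borel"
    and hom: "\<And>s x. s \<ge> 0 \<Longrightarrow> h (rdil s x) = s ^ (2 * lcm_of m) * h x"
  shows "(\<integral>x. exp (- n * h x) \<partial>lborel) = n powr (- mu) * (\<integral>x. exp (- h x) \<partial>lborel)"
proof -
  define s where "s = n powr (- 1 / real (2 * lcm_of m))"
  define B :: "real^'d^'d" where "B = (\<chi> i j. if i = j then s ^ kappa m $ i else 0)"
  have sk: "s ^ kappa m $ j = n powr (- 1 / (2 * real (m $ j)))" for j
  proof -
    have "s ^ kappa m $ j = n powr (real (kappa m $ j) * (- 1 / real (2 * lcm_of m)))"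
      unfolding s_def using n by (intro powr_power) simp
    also have "real (kappa m $ j) * (- 1 / real (2 * lcm_of m)) = - 1 / (2 * real (m $ j))"
      unfolding kappa_mult[OF m_pos, of j, symmetric] using kappa_pos[OF m_pos, of j] by simp
    finally show ?thesis .
  qed
  have det: "det B = n powr (- mu)"
  proof -
    have "det B = (\<Prod>j\<in>UNIV. s ^ kappa m $ j)" unfolding B_def by (subst det_diagonal) auto
    also have "\<dots> = n powr (\<Sum>j\<in>UNIV. - 1 / (2 * real (m $ j)))"
      unfolding sk using n by (simp add: powr_sum)
    finally show ?thesis by (simp add: mu_def sum_negf)
  qed
  have sp: "s ^ (2 * lcm_of m) = 1 / n"
  proof -
    have "s ^ (2 * lcm_of m) = n powr (real (2 * lcm_of m) * (- 1 / real (2 * lcm_of m)))"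
      unfolding s_def using n by (intro powr_power) simp
    also have "real (2 * lcm_of m) * (- 1 / real (2 * lcm_of m)) = - 1" using lcm_of_pos[OF m_pos] by simp
    finally show ?thesis using n by (simp add: powr_minus_divide)
  qed
  have "B *v x = rdil s x" for x
    unfolding vec_eq_iff rdil_def B_def matrix_vector_mult_def by (simp add: if_distrib[of "\<lambda>t. t * _"] cong: if_cong)
  moreover have "s \<ge> 0" by (simp add: s_def)
  ultimately have "n * h (B *v x) = h x" for x using hom[of s x] n by (simp add: sp)
  then have "exp (- n * h (B *v x)) = exp (- h x)" for x by simp
  moreover have "(\<integral>x. exp (- n * h x) \<partial>lborel) = \<bar>det B\<bar> *\<^sub>R (\<integral>x. exp (- n * h (B *v x)) \<partial>lborel)"
    by (rule integral_linear) (use n h in \<open>auto simp: det\<close>)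
  ultimately show ?thesis using n by (simp add: det)
qed

lemma integral_exp_rho_scale:
  assumes n: "n > 0"
  shows "(\<integral>x. exp (- n * c * \<rho> x) \<partial>lborel) = n powr (- mu) * (\<integral>x. exp (- c * \<rho> x) \<partial>lborel)"
proof -
  have "(\<lambda>x. c * \<rho> x) \<in> borel_measurable borel" by (intro borel_measurable_continuous_onI continuous_intros)
  from integral_dil_scale[OF n this] show ?thesis by (simp add: cvec_rdil rho_dil[OF m_pos] mult.assoc)
qed

lemma hpoly_0[simp]: "hpoly m a 0 = 0"
  using hpoly_le_rho[OF m_pos, of a 0] rho_0_iff[OF m_pos, of 0] by simp

text \<open>\<open>R\<close> grows at least quadratically, so the points at which the Legendre functional is nonnegative stay
  bounded when \<open>y\<close> does.  This keeps the shift vectors inside the domain of the perturbation \<open>U\<close>.\<close>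

lemma maximizer_bounded:
  assumes c: "c > 0" "\<And>\<xi>. R \<xi> \<ge> c * \<rho> \<xi>" and w: "y \<bullet> w - R w \<ge> 0" and y: "norm y \<le> L"
  shows "norm w \<le> L / c + CARD('d)"
proof (rule ccontr)
  assume "\<not> ?thesis"
  then have gt: "norm w > L / c + CARD('d)" by simp
  have L: "L \<ge> 0" using y norm_ge_zero order_trans by blast
  have d1: "real CARD('d) \<ge> 1" by simp
  have w1: "norm w > 1" using gt d1 L c divide_nonneg_pos[OF L c(1)] by linarith
  have "c * ((norm w)\<^sup>2 - CARD('d)) \<le> c * \<rho> w" using rho_ge_norm[OF m_pos, of "cvec w"] c by (intro mult_left_mono) auto
  also have "\<dots> \<le> y \<bullet> w" using c(2)[of w] w by linarith
  also have "\<dots> \<le> L * norm w" using norm_cauchy_schwarz[of y w] mult_right_mono[OF y norm_ge_zero[of w]] by linarith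
  finally have "(norm w)\<^sup>2 - CARD('d) \<le> L / c * norm w" using c by (simp add: field_simps)
  moreover have "(norm w)\<^sup>2 > (L / c + CARD('d)) * norm w" using gt w1 unfolding power2_eq_square by (intro mult_strict_right_mono) auto
  moreover have "real CARD('d) * norm w \<ge> CARD('d)" using w1 d1 by simp
  ultimately show False unfolding distrib_right by linarith
qed

lemma legendre_bound:
  assumes c: "c > 0" "\<And>\<xi>. R \<xi> \<ge> c * \<rho> \<xi>" and y: "norm y \<le> L"
  shows "y \<bullet> w - R w \<le> L * (L / c + CARD('d))"
proof (cases "y \<bullet> w - R w \<ge> 0")
  case True
  have L: "L \<ge> 0" using y norm_ge_zero order_trans by blast
  have "R w \<ge> 0" using pd by (auto simp: pos_definite_def)
  then have "y \<bullet> w - R w \<le> norm y * norm w" using norm_cauchy_schwarz[of y w] by linarith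
  also have "\<dots> \<le> L * (L / c + CARD('d))" using maximizer_bounded[OF c True y] y L by (intro mult_mono) auto
  finally show ?thesis .
next
  case False
  have L: "L \<ge> 0" using y norm_ge_zero order_trans by blast
  then have "L * (L / c + CARD('d)) \<ge> 0" using c by (intro mult_nonneg_nonneg add_nonneg_nonneg divide_nonneg_nonneg) auto
  then show ?thesis using False by linarith
qed

lemma legendre_bdd: "bdd_above (range (\<lambda>\<xi>. y \<bullet> \<xi> - R \<xi>))"
proof -
  obtain c where c: "c > 0" "\<And>\<xi>. R \<xi> \<ge> c * \<rho> \<xi>" using coercive by metis
  show ?thesis by (rule bdd_aboveI2) (rule legendre_bound[OF c order_refl])
qed

lemma legendre_le:
  assumes "c > 0" "\<And>\<xi>. R \<xi> \<ge> c * \<rho> \<xi>" "norm y \<le> L"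
  shows "leg y \<le> L * (L / c + CARD('d))"
  unfolding legendre_def by (rule cSUP_least) (use legendre_bound[OF assms] in auto)

lemma legendre_ge: "y \<bullet> \<xi> - R \<xi> \<le> leg y"
  unfolding legendre_def by (rule cSUP_upper[OF _ legendre_bdd]) simp

lemma legendre_nonneg: "leg y \<ge> 0"
  using legendre_ge[of y 0] by simp

text \<open>Half the supremum is always reached, also when the supremum is \<open>0\<close>.\<close>

lemma near_maximizer: obtains w where "y \<bullet> w - R w \<ge> leg y / 2"
proof (cases "leg y = 0")
  case True then show thesis using that[of 0] by simp
next
  case False
  then have "leg y / 2 < leg y" using legendre_nonneg[of y] by linarith
  then obtain w where "leg y / 2 < y \<bullet> w - R w"
    using less_cSUP_iff[OF _ legendre_bdd, of "leg y / 2" y] unfolding legendre_def by auto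
  then show thesis using that[of w] by simp
qed

text \<open>Test the supremum at a short multiple of the direction of \<open>y\<close>, where \<open>R\<close> is quadratically small.\<close>

lemma legendre_lower:
  obtains l where "l > 0" "\<And>y. norm y \<ge> 1 \<Longrightarrow> leg y \<ge> l"
proof -
  define Ca where "Ca = (\<Sum>\<beta> | wlen \<beta> m = 2. norm (a \<beta>)) * CARD('d)"
  have Ca: "Ca \<ge> 0" by (simp add: Ca_def sum_nonneg)
  define t where "t = 1 / (2 * Ca + 1)"
  have t: "0 < t" "t \<le> 1" "Ca * t \<le> 1/2" using Ca by (auto simp: t_def divide_simps)
  show thesis
  proof (rule that[of "t / 2"])
    fix y :: "real^'d" assume y: "norm y \<ge> 1"
    define u where "u = (1 / norm y) *\<^sub>R y"
    have u: "norm u = 1" "y \<bullet> u = norm y" using y by (auto simp: u_def dot_square_norm power2_eq_square)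
    have "\<rho> u \<le> (\<Sum>j\<in>(UNIV::'d set). 1)"
      unfolding rho_def using component_le_norm_cart[of u] u by (intro sum_mono) (auto intro!: power_le_one)
    then have ru: "\<rho> u \<le> CARD('d)" by simp
    have "R (t *\<^sub>R u) \<le> norm (hpoly m a (cvec (t *\<^sub>R u)))" by (rule complex_Re_le_cmod)
    also have "\<dots> \<le> (\<Sum>\<beta> | wlen \<beta> m = 2. norm (a \<beta>)) * \<rho> (t *\<^sub>R u)" by (rule hpoly_le_rho[OF m_pos])
    also have "\<dots> \<le> (\<Sum>\<beta> | wlen \<beta> m = 2. norm (a \<beta>)) * (t\<^sup>2 * CARD('d))"
      using rho_scale[of t u] t ru by (intro mult_left_mono sum_nonneg) (auto intro: order_trans mult_left_mono)
    also have "\<dots> = Ca * t * t" by (simp add: Ca_def power2_eq_square)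
    also have "\<dots> \<le> 1/2 * t" using t by (intro mult_right_mono) auto
    finally have "R (t *\<^sub>R u) \<le> t / 2" by simp
    moreover have "y \<bullet> (t *\<^sub>R u) \<ge> t" using u y t by simp
    ultimately show "leg y \<ge> t / 2" using legendre_ge[of y "t *\<^sub>R u"] by linarith
  qed (use t in simp)
qed

end

section \<open>Decay of the attractor\<close>

context semi_elliptic
begin

text \<open>The integrand of the attractor, continued to an entire function of \<open>z\<close>.\<close>

definition osc :: "real \<Rightarrow> real^'d \<Rightarrow> complex^'d \<Rightarrow> complex" where
  "osc n y z = exp (- \<i> * bil y z - of_real n * hpoly m a z)"

lemma norm_osc: "norm (osc n y z) = exp (y \<bullet> imV z - n * Re (hpoly m a z))"
proof -
  have "Re (- \<i> * bil y z - of_real n * hpoly m a z) = y \<bullet> imV z - n * Re (hpoly m a z)"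
    using Re_ii_bil[of y z] by simp
  then show ?thesis unfolding osc_def norm_exp_eq_Re by simp
qed

lemma holomorphic_cn_osc: "holomorphic_cn (osc n y) UNIV"
proof -
  have e: "osc n y = (\<lambda>z. exp ((- \<i>) * bil y z + (- of_real n) * hpoly m a z))"
    by (simp add: osc_def fun_eq_iff)
  show ?thesis unfolding e
    by (intro holomorphic_cn_exp holomorphic_cn_add holomorphic_cn_mult holomorphic_cn_const holomorphic_cn_bil holomorphic_cn_hpoly) auto
qed

lemma reV_shift[simp]: "reV (cvec x - (\<i> * of_real s) *s cvec v) = x"
  and imV_shift[simp]: "imV (cvec x - (\<i> * of_real s) *s cvec v) = - (s *\<^sub>R v)"
  by (simp_all add: reV_def imV_def vec_eq_iff)

lemma reV_shift1[simp]: "reV (cvec x - \<i> *s cvec v) = x"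
  and imV_shift1[simp]: "imV (cvec x - \<i> *s cvec v) = - v"
  and reV_cvec[simp]: "reV (cvec x) = x" and imV_cvec[simp]: "imV (cvec x) = 0"
  by (simp_all add: reV_def imV_def vec_eq_iff)

lemma rho_0[simp]: "rho m 0 = 0" using rho_0_iff[OF m_pos, of 0] by simp

text \<open>The contour is moved by \<open>e *\<^sub>R w\<close> with \<open>w\<close> a near-maximizer of the Legendre functional at \<open>y / n\<close>.  The
  linear term gains \<open>n e (y / n) w\<close>; the growth of the integrand costs \<open>n K \<rho> (e w) \<le> n e\<^sup>2 K \<rho> w \<le> n e R w\<close>.
  The balance is \<open>n e\<close> times the value of the Legendre functional at \<open>w\<close>.\<close>

lemma shift_choice:
  fixes c K e n :: real and y :: "real^'d"
  assumes c: "c > 0" "\<And>\<xi>. R \<xi> \<ge> c * \<rho> \<xi>" and K: "K \<ge> 0" "e * K \<le> c" and e: "0 < e" "e \<le> 1"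
    and n: "n > 0" and w: "((1/n) *\<^sub>R y) \<bullet> w - R w \<ge> l / 2"
  shows "- (y \<bullet> (e *\<^sub>R w)) + n * K * \<rho> (e *\<^sub>R w) \<le> - (n * (e / 2) * l)"
proof -
  have "K * \<rho> (e *\<^sub>R w) \<le> K * (e\<^sup>2 * \<rho> w)" using rho_scale[of e w] e K by (intro mult_left_mono) auto
  also have "\<dots> = e * ((e * K) * \<rho> w)" by (simp add: power2_eq_square)
  also have "\<dots> \<le> e * (c * \<rho> w)" using K e rho_nonneg by (intro mult_left_mono mult_right_mono) auto
  also have "\<dots> \<le> e * R w" using c e by (intro mult_left_mono) auto
  finally have 1: "n * (K * \<rho> (e *\<^sub>R w)) \<le> n * (e * R w)" using n by (intro mult_left_mono) auto
  have "n * e * (((1/n) *\<^sub>R y) \<bullet> w - R w) \<ge> n * e * (l / 2)" using n e w by (intro mult_left_mono) auto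
  then have "e * (y \<bullet> w) - n * (e * R w) \<ge> n * (e / 2) * l" using n by (simp add: right_diff_distrib mult_ac)
  with 1 show ?thesis by (simp add: mult.assoc)
qed

lemma osc_bound:
  assumes "c > 0" "K \<ge> 0" "\<And>z. Re (hpoly m a z) \<ge> c * \<rho> (reV z) - K * \<rho> (imV z)" "n \<ge> 0"
  shows "norm (osc n y z) \<le> exp (y \<bullet> imV z + n * K * \<rho> (imV z)) * exp (- n * c * \<rho> (reV z))"
proof -
  have "n * (c * \<rho> (reV z) - K * \<rho> (imV z)) \<le> n * Re (hpoly m a z)" using assms by (intro mult_left_mono) auto
  then have "y \<bullet> imV z - n * Re (hpoly m a z) \<le> (y \<bullet> imV z + n * K * \<rho> (imV z)) + (- n * c * \<rho> (reV z))"
    by (simp add: right_diff_distrib mult.assoc)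
  then show ?thesis unfolding norm_osc exp_add[symmetric] by simp
qed

lemma continuous_osc[continuous_intros]: "continuous_on S f \<Longrightarrow> continuous_on S (\<lambda>x. osc n y (f x))"
  using continuous_on_compose2[OF holomorphic_cn_continuous[OF holomorphic_cn_osc]] by blast

lemma osc_integrable:
  assumes n: "n > 0"
  shows "integrable lborel (\<lambda>x. osc n y (cvec x - \<i> *s cvec v))"
proof -
  obtain c K where cK: "c > 0" "K \<ge> 0" "\<And>z. Re (hpoly m a z) \<ge> c * \<rho> (reV z) - K * \<rho> (imV z)" "\<And>\<xi>. R \<xi> \<ge> c * \<rho> \<xi>"
    using coercive by metis
  show ?thesis
  proof (rule Bochner_Integration.integrable_bound)
    have "integrable lborel (\<lambda>x. exp (- (n * c) * \<rho> x))" using n cK by (intro integrable_exp_rho) simp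
    then show "integrable lborel (\<lambda>x. exp (y \<bullet> (- v) + n * K * \<rho> (- v)) * exp (- n * c * \<rho> x))" by simp
    show "(\<lambda>x. osc n y (cvec x - \<i> *s cvec v)) \<in> borel_measurable lborel"
      by (simp, intro borel_measurable_continuous_onI continuous_intros)
    show "AE x in lborel. norm (osc n y (cvec x - \<i> *s cvec v)) \<le> norm (exp (y \<bullet> (- v) + n * K * \<rho> (- v)) * exp (- n * c * \<rho> x))"
    proof (intro always_eventually allI)
      fix x show "norm (osc n y (cvec x - \<i> *s cvec v)) \<le> norm (exp (y \<bullet> (- v) + n * K * \<rho> (- v)) * exp (- n * c * \<rho> x))"
        using osc_bound[OF cK(1-3), of n y "cvec x - \<i> *s cvec v"] n by (simp add: abs_mult)
    qed
  qed
qed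

lemma osc_integrable0: "n > 0 \<Longrightarrow> integrable lborel (\<lambda>x. osc n y (cvec x))"
  using osc_integrable[of n y 0] by simp

text \<open>Without cutoff the shift is exact: as the cutoff radius \<open>\<delta>\<close> tends to infinity, the error bound of
  \<open>integral_cutoff_shift\<close> tends to \<open>0\<close> through its factor \<open>norm v / \<delta>\<close>.\<close>

lemma osc_shift:
  assumes n: "n > 0"
  shows "(\<integral>x. osc n y (cvec x - \<i> *s cvec v) \<partial>lborel) = (\<integral>x. osc n y (cvec x) \<partial>lborel)"
proof -
  obtain c K where cK: "c > 0" "K \<ge> 0" "\<And>z. Re (hpoly m a z) \<ge> c * \<rho> (reV z) - K * \<rho> (imV z)" "\<And>\<xi>. R \<xi> \<ge> c * \<rho> \<xi>"
    using coercive by metis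
  define I where "I = (\<integral>x. exp (- (n * c) * \<rho> x) \<partial>lborel)"
  have Ii: "integrable lborel (\<lambda>x. exp (- (n * c) * \<rho> x))" using n cK by (intro integrable_exp_rho) simp
  define B where "B = exp (\<bar>y \<bullet> v\<bar> + n * K * \<rho> v) * I"
  have cut: "(\<lambda>N::nat. \<integral>x. cutoff (real (Suc N)) x *\<^sub>R h x \<partial>lborel) \<longlonglongrightarrow> (\<integral>x. h x \<partial>lborel)"
    if h: "integrable lborel h" for h :: "real^'d \<Rightarrow> complex"
  proof (rule integral_dominated_convergence[where w="\<lambda>x. norm (h x)"])
    have hm: "h \<in> borel_measurable borel" using borel_measurable_integrable[OF h] by simp
    show "(\<lambda>x. cutoff (real (Suc N)) x *\<^sub>R h x) \<in> borel_measurable lborel" for N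
    proof -
      have "cutoff (real (Suc N)) \<in> borel_measurable (borel :: (real^'d) measure)"
        by (intro borel_measurable_continuous_onI continuous_intros) simp
      then show ?thesis using hm by simp
    qed
    show "AE x in lborel. (\<lambda>N. cutoff (real (Suc N)) x *\<^sub>R h x) \<longlonglongrightarrow> h x"
    proof (intro always_eventually allI)
      fix x :: "real^'d"
      have "\<forall>\<^sub>F N in sequentially. real N \<ge> norm x" using filterlim_real_sequentially by (simp add: filterlim_at_top)
      then have "\<forall>\<^sub>F N in sequentially. cutoff (real (Suc N)) x *\<^sub>R h x = h x"
        by eventually_elim (simp add: cutoff_eq_1)
      then show "(\<lambda>N. cutoff (real (Suc N)) x *\<^sub>R h x) \<longlonglongrightarrow> h x" by (rule tendsto_eventually)
    qed
    show "AE x in lborel. norm (cutoff (real (Suc N)) x *\<^sub>R h x) \<le> norm (h x)" for N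
    proof (intro always_eventually allI)
      fix x :: "real^'d" show "norm (cutoff (real (Suc N)) x *\<^sub>R h x) \<le> norm (h x)"
        using cutoff_bounds[of "real (Suc N)" x] by (simp add: mult_left_le_one_le)
    qed
  qed (use h in auto)
  let ?D = "\<lambda>N. (\<integral>x. cutoff (real (Suc N)) x *\<^sub>R osc n y (cvec x - \<i> *s cvec v) \<partial>lborel) - (\<integral>x. cutoff (real (Suc N)) x *\<^sub>R osc n y (cvec x) \<partial>lborel)"
  have "?D \<longlonglongrightarrow> (\<integral>x. osc n y (cvec x - \<i> *s cvec v) \<partial>lborel) - (\<integral>x. osc n y (cvec x) \<partial>lborel)"
    by (intro tendsto_diff cut osc_integrable osc_integrable0 n)
  moreover have "?D \<longlonglongrightarrow> 0"
  proof (rule Lim_null_comparison)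
    have "\<forall>\<^sub>F N in sequentially. real N \<ge> norm v" using filterlim_real_sequentially by (simp add: filterlim_at_top)
    then show "\<forall>\<^sub>F N in sequentially. norm (?D N) \<le> norm v / real (Suc N) * B"
    proof eventually_elim
      case (elim N)
      let ?A = "{x::real^'d. real (Suc N) / 2 \<le> norm x \<and> norm x \<le> 5 / 2 * real (Suc N)}"
      show "norm (?D N) \<le> norm v / real (Suc N) * B"
      proof (rule integral_cutoff_shift[OF holomorphic_cn_osc])
        fix s :: real assume s: "0 \<le> s" "s \<le> 1"
        have "(\<integral>x. indicator ?A x * norm (osc n y (cvec x - (\<i> * of_real s) *s cvec v)) \<partial>lborel)
          \<le> (\<integral>x. exp (\<bar>y \<bullet> v\<bar> + n * K * \<rho> v) * exp (- (n * c) * \<rho> x) \<partial>lborel)"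
        proof (rule integral_mono')
          show "integrable lborel (\<lambda>x. exp (\<bar>y \<bullet> v\<bar> + n * K * \<rho> v) * exp (- (n * c) * \<rho> x))" using Ii by simp
          fix x
          have "norm (osc n y (cvec x - (\<i> * of_real s) *s cvec v)) \<le> exp (y \<bullet> (- (s *\<^sub>R v)) + n * K * \<rho> (- (s *\<^sub>R v))) * exp (- n * c * \<rho> x)"
            using osc_bound[OF cK(1-3), of n y "cvec x - (\<i> * of_real s) *s cvec v"] n by simp
          also have "\<dots> \<le> exp (\<bar>y \<bullet> v\<bar> + n * K * \<rho> v) * exp (- (n * c) * \<rho> x)"
          proof -
            have "- (s * (y \<bullet> v)) \<le> 1 * \<bar>y \<bullet> v\<bar>"
            proof -
              have "- (s * (y \<bullet> v)) \<le> \<bar>s * (y \<bullet> v)\<bar>" by simp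
              also have "\<dots> \<le> 1 * \<bar>y \<bullet> v\<bar>" unfolding abs_mult using s by (intro mult_right_mono) auto
              finally show ?thesis .
            qed
            moreover have "\<rho> (- (s *\<^sub>R v)) \<le> 1 * \<rho> v"
            proof -
              have "\<rho> (s *\<^sub>R v) \<le> s\<^sup>2 * \<rho> v" by (rule rho_scale[OF s])
              also have "\<dots> \<le> 1 * \<rho> v" using s by (intro mult_right_mono rho_nonneg) (simp add: power_le_one)
              finally show ?thesis by (simp only: rho_minus)
            qed
            then have "n * K * \<rho> (- (s *\<^sub>R v)) \<le> n * K * \<rho> v" using n cK by (intro mult_left_mono) auto
            ultimately show ?thesis by simp
          qed
          finally show "indicator ?A x * norm (osc n y (cvec x - (\<i> * of_real s) *s cvec v)) \<le> exp (\<bar>y \<bullet> v\<bar> + n * K * \<rho> v) * exp (- (n * c) * \<rho> x)"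
            by (auto simp: indicator_def)
        qed auto
        then show "(\<integral>x. indicator ?A x * norm (osc n y (cvec x - (\<i> * of_real s) *s cvec v)) \<partial>lborel) \<le> B"
          by (simp add: B_def I_def)
      qed (use elim in auto)
    qed
    show "(\<lambda>N. norm v / real (Suc N) * B) \<longlonglongrightarrow> 0"
      using LIMSEQ_Suc[OF lim_const_over_n[of "norm v"]] by (intro tendsto_mult_left_zero)
  qed
  ultimately show ?thesis using LIMSEQ_unique by fastforce
qed

theorem attractor_bound:
  obtains C M where "C > 0" "M > 0"
    "\<And>n y. n > 0 \<Longrightarrow> norm (\<integral>x. osc n y (cvec x) \<partial>lborel) \<le> C * n powr (- mu) * exp (- n * M * leg ((1/n) *\<^sub>R y))"
proof -
  obtain c K where cK: "c > 0" "K \<ge> 0" "\<And>z. Re (hpoly m a z) \<ge> c * \<rho> (reV z) - K * \<rho> (imV z)" "\<And>\<xi>. R \<xi> \<ge> c * \<rho> \<xi>"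
    using coercive by metis
  define e where "e = min 1 (c / (K + 1))"
  have e: "0 < e" "e \<le> 1" "e * K \<le> c"
  proof -
    show "0 < e" "e \<le> 1" using cK by (auto simp: e_def)
    have "e * K \<le> c / (K + 1) * K" using cK by (intro mult_right_mono) (auto simp: e_def)
    also have "\<dots> \<le> c" using cK by (simp add: field_simps)
    finally show "e * K \<le> c" .
  qed
  define I where "I = (\<integral>x. exp (- c * \<rho> x) \<partial>lborel)"
  have I0: "I \<ge> 0" by (simp add: I_def)
  show thesis
  proof (rule that[of "I + 1" "e / 2"])
    fix n :: real and y :: "real^'d" assume n: "n > 0"
    let ?l = "leg ((1/n) *\<^sub>R y)"
    obtain w where w: "((1/n) *\<^sub>R y) \<bullet> w - R w \<ge> ?l / 2" by (rule near_maximizer)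
    define v where "v = e *\<^sub>R w"
    have v: "- (y \<bullet> v) + n * K * \<rho> v \<le> - (n * (e / 2) * ?l)"
      unfolding v_def by (rule shift_choice[OF cK(1,4,2) e(3,1,2) n w])
    have "norm (\<integral>x. osc n y (cvec x) \<partial>lborel) = norm (\<integral>x. osc n y (cvec x - \<i> *s cvec v) \<partial>lborel)"
      by (simp add: osc_shift[OF n])
    also have "\<dots> \<le> (\<integral>x. exp (- (n * (e / 2) * ?l)) * exp (- n * c * \<rho> x) \<partial>lborel)"
    proof (rule Bochner_Integration.integral_norm_bound_integral[OF osc_integrable[OF n]])
      have "integrable lborel (\<lambda>x. exp (- (n * c) * \<rho> x))" using n cK by (intro integrable_exp_rho) simp
      then show "integrable lborel (\<lambda>x. exp (- (n * (e / 2) * ?l)) * exp (- n * c * \<rho> x))" by simp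
      fix x
      have "norm (osc n y (cvec x - \<i> *s cvec v)) \<le> exp (y \<bullet> (- v) + n * K * \<rho> (- v)) * exp (- n * c * \<rho> x)"
        using osc_bound[OF cK(1-3), of n y "cvec x - \<i> *s cvec v"] n by simp
      also have "\<dots> \<le> exp (- (n * (e / 2) * ?l)) * exp (- n * c * \<rho> x)"
        using v by (simp add: rho_minus)
      finally show "norm (osc n y (cvec x - \<i> *s cvec v)) \<le> exp (- (n * (e / 2) * ?l)) * exp (- n * c * \<rho> x)" .
    qed
    also have "\<dots> = exp (- (n * (e / 2) * ?l)) * (n powr (- mu) * I)"
      using integral_exp_rho_scale[OF n, of c] by (simp add: I_def)
    also have "\<dots> \<le> (I + 1) * n powr (- mu) * exp (- n * (e / 2) * ?l)"
      by (simp add: algebra_simps)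
    finally show "norm (\<integral>x. osc n y (cvec x) \<partial>lborel) \<le> (I + 1) * n powr (- mu) * exp (- n * (e / 2) * ?l)" .
  qed (use I0 e in auto)
qed

lemma cutoff_osc_integrable:
  assumes \<delta>: "\<delta> > 0"
  shows "integrable lborel (\<lambda>x. cutoff \<delta> x *\<^sub>R osc n y (cvec x))"
proof (rule integrable_continuous_cutoff[where r="5/2 * \<delta>"])
  show "continuous_on (cball 0 (5/2 * \<delta>)) (\<lambda>x. cutoff \<delta> x *\<^sub>R osc n y (cvec x))"
    using \<delta> by (intro continuous_intros)
qed (use \<delta> in \<open>auto simp: cutoff_eq_0\<close>)

text \<open>On the region removed by the cutoff, half of the exponent yields \<open>exp (- n * (c * r / 2))\<close> and the other half,
  taken with \<open>n = 1\<close>, keeps the integral finite.\<close>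

lemma osc_tail_bound:
  assumes c: "c > 0" "\<And>\<xi>. R \<xi> \<ge> c * \<rho> \<xi>" and \<delta>: "\<delta> > 0" "\<And>x. norm x \<ge> \<delta> \<Longrightarrow> \<rho> x \<ge> r" and n: "n \<ge> 1"
  shows "norm ((\<integral>x. osc n y (cvec x) \<partial>lborel) - (\<integral>x. cutoff \<delta> x *\<^sub>R osc n y (cvec x) \<partial>lborel))
    \<le> (\<integral>x. exp (- (c / 2) * \<rho> x) \<partial>lborel) * exp (- n * (c * r / 2))"
proof -
  have oi: "integrable lborel (\<lambda>x. osc n y (cvec x))" using n by (intro osc_integrable0) simp
  have ci: "integrable lborel (\<lambda>x. cutoff \<delta> x *\<^sub>R osc n y (cvec x))" by (rule cutoff_osc_integrable[OF \<delta>(1)])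
  have "(\<integral>x. osc n y (cvec x) \<partial>lborel) - (\<integral>x. cutoff \<delta> x *\<^sub>R osc n y (cvec x) \<partial>lborel)
    = (\<integral>x. osc n y (cvec x) - cutoff \<delta> x *\<^sub>R osc n y (cvec x) \<partial>lborel)"
    by (rule Bochner_Integration.integral_diff[OF oi ci, symmetric])
  also have "norm \<dots> \<le> (\<integral>x. exp (- n * (c * r / 2)) * exp (- (c / 2) * \<rho> x) \<partial>lborel)"
  proof (rule Bochner_Integration.integral_norm_bound_integral)
    show "integrable lborel (\<lambda>x. exp (- n * (c * r / 2)) * exp (- (c / 2) * \<rho> x))"
      using c(1) by (intro integrable_mult_right integrable_exp_rho) simp
    show "integrable lborel (\<lambda>x. osc n y (cvec x) - cutoff \<delta> x *\<^sub>R osc n y (cvec x))"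
      by (intro Bochner_Integration.integrable_diff oi ci)
    fix x :: "real^'d"
    have e: "osc n y (cvec x) - cutoff \<delta> x *\<^sub>R osc n y (cvec x) = (1 - cutoff \<delta> x) *\<^sub>R osc n y (cvec x)"
      by (simp add: scaleR_diff_left)
    show "norm (osc n y (cvec x) - cutoff \<delta> x *\<^sub>R osc n y (cvec x)) \<le> exp (- n * (c * r / 2)) * exp (- (c / 2) * \<rho> x)"
    proof (cases "norm x \<le> \<delta>")
      case True then show ?thesis unfolding e using \<delta> by (simp add: cutoff_eq_1)
    next
      case False
      have "norm ((1 - cutoff \<delta> x) *\<^sub>R osc n y (cvec x)) \<le> 1 * norm (osc n y (cvec x))"
        unfolding norm_scaleR using cutoff_bounds[of \<delta> x] by (intro mult_right_mono) auto
      also have "norm (osc n y (cvec x)) = exp (- n * R x)" by (simp add: norm_osc)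
      also have "\<dots> \<le> exp (- n * (c * r / 2) + - (c / 2) * \<rho> x)"
      proof -
        have "n * (c * \<rho> x) \<le> n * R x" using n c(2) by (intro mult_left_mono) auto
        moreover have "n * (c * \<rho> x) = n * (c / 2 * \<rho> x) + n * (c / 2 * \<rho> x)" by simp
        moreover have "n * (c / 2 * \<rho> x) \<ge> 1 * (c / 2 * \<rho> x)" using n c(1) rho_nonneg[of m "cvec x"] by (intro mult_right_mono mult_nonneg_nonneg) auto
        moreover have "n * (c / 2 * \<rho> x) \<ge> n * (c * r / 2)" using \<delta>(2)[of x] False n c(1) by (intro mult_left_mono) auto
        ultimately have "- n * R x \<le> - n * (c * r / 2) + - (c / 2) * \<rho> x" by linarith
        then show ?thesis by simp
      qed
      finally show ?thesis unfolding e by (simp only: exp_add mult_1)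
    qed
  qed
  finally show ?thesis by (simp add: mult.commute)
qed

section \<open>Perturbation of the phase\<close>

definition expo :: "nat \<Rightarrow> real" where "expo g = real g / (2 * real (lcm_of m))"

lemma expo_pos: "g > 0 \<Longrightarrow> expo g > 0"
  using lcm_of_pos[OF m_pos] by (simp add: expo_def)

text \<open>With \<open>p = 2 * lcm_of m\<close> the left-hand side is \<open>n rho\<^bsup>1 + g/p\<^esup> = n\<^bsup>- g/p\<^esup> (n rho)\<^bsup>1 + g/p\<^esup>\<close>, and an
  exponential absorbs the power of \<open>n rho\<close>.\<close>

lemma scaled_remainder:
  fixes \<kappa> :: real
  assumes g: "g > 0" and \<kappa>: "\<kappa> > 0"
  obtains C where "C > 0" "\<And>z n. n > 0 \<Longrightarrow> n * qnorm m z ^ (2 * lcm_of m + g) \<le> C * n powr (- expo g) * exp (\<kappa> * (n * rho m z))"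
proof -
  let ?p = "2 * lcm_of m"
  have p: "?p > 0" using lcm_of_pos[OF m_pos] by simp
  have q: "1 + expo g > 0" using expo_pos[OF g] by simp
  obtain C where C: "C > 0" "\<And>x. x \<ge> 0 \<Longrightarrow> x powr (1 + expo g) \<le> C * exp (\<kappa> * x)"
    using powr_le_exp[OF q \<kappa>] by blast
  show thesis
  proof (rule that[OF C(1)])
    fix z :: "complex^'d" and n :: real assume n: "n > 0"
    let ?N = "qnorm m z"
    have eq: "n * ?N ^ (?p + g) = n powr (- expo g) * (n * rho m z) powr (1 + expo g)"
    proof (cases "?N = 0")
      case True
      then have "rho m z = 0" using qnorm_power[OF m_pos, of z] p by (metis zero_power)
      then show ?thesis using True g by simp
    next
      case False
      then have N: "?N > 0" using qnorm_nonneg[of m z] by simp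
      have "(n * rho m z) powr (1 + expo g) = n powr (1 + expo g) * (?N ^ ?p) powr (1 + expo g)"
        unfolding qnorm_power[OF m_pos, symmetric] using n N by (simp add: powr_mult)
      also have "(?N ^ ?p) powr (1 + expo g) = ?N powr (real ?p * (1 + expo g))"
        using N by (simp add: powr_realpow[symmetric] powr_powr)
      also have "real ?p * (1 + expo g) = real (?p + g)" using p by (simp add: expo_def field_simps)
      also have "?N powr real (?p + g) = ?N ^ (?p + g)" using N by (rule powr_realpow)
      finally have "n powr (- expo g) * (n * rho m z) powr (1 + expo g) = (n powr (- expo g) * n powr (1 + expo g)) * ?N ^ (?p + g)"
        by simp
      also have "n powr (- expo g) * n powr (1 + expo g) = n" using n by (simp add: powr_add[symmetric])
      finally show ?thesis by simp
    qed
    have "(n * rho m z) powr (1 + expo g) \<le> C * exp (\<kappa> * (n * rho m z))" using n by (intro C mult_nonneg_nonneg) (auto simp: rho_nonneg)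
    then have "n powr (- expo g) * (n * rho m z) powr (1 + expo g) \<le> n powr (- expo g) * (C * exp (\<kappa> * (n * rho m z)))"
      by (rule mult_left_mono) simp
    then show "n * ?N ^ (?p + g) \<le> C * n powr (- expo g) * exp (\<kappa> * (n * rho m z))"
      unfolding eq by (simp add: mult_ac)
  qed
qed

text \<open>Use \<open>\<bar>exp w - 1\<bar> \<le> \<bar>w\<bar> exp \<bar>w\<bar>\<close> with \<open>w = n U z\<close>.  Near \<open>0\<close> the factor \<open>qnorm m z ^ g\<close> makes \<open>\<bar>U z\<bar>\<close> a small
  multiple of \<open>rho\<close>, so that \<open>exp \<bar>w\<bar>\<close> uses up only a fraction of the decay of \<open>osc\<close>; the factor \<open>\<bar>w\<bar>\<close> gives
  \<open>n powr (- expo g)\<close> by \<open>scaled_remainder\<close> at the price of another such fraction.\<close>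

lemma difference_bound:
  fixes U :: "complex^'d \<Rightarrow> complex"
  assumes g: "g > 0" and r0: "r0 > 0"
    and U: "\<And>z. norm z < r0 \<Longrightarrow> norm (U z) \<le> CU * qnorm m z ^ (2 * lcm_of m + g)"
    and cK: "c1 > 0" "K1 \<ge> 0" "\<And>z. Re (hpoly m a z) \<ge> c1 * \<rho> (reV z) - K1 * \<rho> (imV z)"
  obtains r1 C0 c K where "0 < r1" "r1 \<le> r0" "C0 > 0" "0 < c" "c \<le> c1" "K \<ge> 0"
    "\<And>z n y. norm z < r1 \<Longrightarrow> n > 0 \<Longrightarrow>
      norm (osc n y z * (exp (of_real n * U z) - 1)) \<le> C0 * n powr (- expo g) * exp (y \<bullet> imV z + n * K * \<rho> (imV z)) * exp (- n * c * \<rho> (reV z))"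
proof -
  let ?p = "2 * lcm_of m"
  define C2 where "C2 = (\<Sum>j\<in>UNIV. 2 ^ m $ j :: real)"
  have C2: "C2 > 0" unfolding C2_def by (intro sum_pos) auto
  have rho_le: "rho m z \<le> C2 * (\<rho> (reV z) + \<rho> (imV z))" for z
    unfolding C2_def by (rule rho_le_re_im)
  define \<kappa> where "\<kappa> = c1 / (4 * C2)"
  have \<kappa>: "\<kappa> > 0" using cK C2 by (simp add: \<kappa>_def)
  define CU' where "CU' = \<bar>CU\<bar> + 1"
  have CU': "CU' > 0" by (simp add: CU'_def)
  have U': "norm (U z) \<le> CU' * qnorm m z ^ (?p + g)" if "norm z < r0" for z
  proof -
    have "CU * qnorm m z ^ (?p + g) \<le> CU' * qnorm m z ^ (?p + g)"
      by (intro mult_right_mono) (auto simp: CU'_def qnorm_nonneg)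
    then show ?thesis using U[OF that] by linarith
  qed
  obtain C3 where C3: "C3 > 0" "\<And>z n. n > 0 \<Longrightarrow> n * qnorm m z ^ (?p + g) \<le> C3 * n powr (- expo g) * exp (\<kappa> * (n * rho m z))"
    using scaled_remainder[OF g \<kappa>] by blast
  have "continuous_on UNIV (\<lambda>z. CU' * qnorm m z ^ g)"
    unfolding qnorm_def using lcm_of_pos[OF m_pos] by (intro continuous_intros)
  then have "((\<lambda>z. CU' * qnorm m z ^ g) \<longlongrightarrow> CU' * qnorm m 0 ^ g) (at 0)"
    by (simp add: continuous_on_def)
  moreover have q0: "qnorm m 0 = 0" by (simp add: qnorm_def)
  ultimately have "((\<lambda>z. CU' * qnorm m z ^ g) \<longlongrightarrow> 0) (at 0)" using g by (simp add: zero_power)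
  then have "\<forall>\<^sub>F z in at 0. CU' * qnorm m z ^ g < \<kappa>" using \<kappa> by (rule order_tendstoD(2))
  then obtain d where d: "d > 0" "\<And>z. z \<noteq> 0 \<Longrightarrow> norm z < d \<Longrightarrow> CU' * qnorm m z ^ g < \<kappa>"
    unfolding eventually_at by (auto simp: dist_norm)
  have d': "CU' * qnorm m z ^ g \<le> \<kappa>" if "norm z < d" for z
    using d(2)[of z] that q0 g \<kappa> by (cases "z = 0") (auto simp: zero_power)
  show thesis
  proof (rule that[of "min d r0" "CU' * C3" "c1 / 2" "K1 + c1 / 2"])
    fix z :: "complex^'d" and n :: real and y :: "real^'d"
    assume z: "norm z < min d r0" and n: "n > 0"
    let ?S = "\<rho> (reV z) + \<rho> (imV z)"
    have kr: "\<kappa> * rho m z \<le> c1 / 4 * ?S"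
    proof -
      have "\<kappa> * rho m z \<le> \<kappa> * (C2 * ?S)" using \<kappa> rho_le by (intro mult_left_mono) auto
      then show ?thesis using C2 by (simp add: \<kappa>_def)
    qed
    have Ub: "norm (U z) \<le> \<kappa> * rho m z"
    proof -
      have "norm (U z) \<le> (CU' * qnorm m z ^ g) * qnorm m z ^ ?p" using U'[of z] z by (simp add: power_add mult_ac)
      also have "\<dots> \<le> \<kappa> * qnorm m z ^ ?p" using d'[of z] z qnorm_nonneg by (intro mult_right_mono) auto
      finally show ?thesis by (simp only: qnorm_power[OF m_pos])
    qed
    have nU: "norm (of_real n * U z) \<le> n * (c1 / 4 * ?S)"
      using Ub kr n by (simp add: norm_mult)
    have nU2: "norm (of_real n * U z) \<le> CU' * (C3 * n powr (- expo g) * exp (n * (c1 / 4 * ?S)))"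
    proof -
      have "norm (of_real n * U z) \<le> n * (CU' * qnorm m z ^ (?p + g))" using U'[of z] z n by (simp add: norm_mult)
      also have "\<dots> = CU' * (n * qnorm m z ^ (?p + g))" by simp
      also have "\<dots> \<le> CU' * (C3 * n powr (- expo g) * exp (\<kappa> * (n * rho m z)))"
        using CU' by (intro mult_left_mono C3 n) auto
      also have "\<dots> \<le> CU' * (C3 * n powr (- expo g) * exp (n * (c1 / 4 * ?S)))"
      proof -
        have "\<kappa> * (n * rho m z) = n * (\<kappa> * rho m z)" by simp
        also have "\<dots> \<le> n * (c1 / 4 * ?S)" using kr n by (intro mult_left_mono) auto
        finally show ?thesis using CU' C3(1) by (intro mult_left_mono) auto
      qed
      finally show ?thesis .
    qed
    have "norm (osc n y z * (exp (of_real n * U z) - 1)) \<le>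
      (exp (y \<bullet> imV z + n * K1 * \<rho> (imV z)) * exp (- n * c1 * \<rho> (reV z))) * (norm (of_real n * U z) * exp (norm (of_real n * U z)))"
      unfolding norm_mult[of "osc n y z"] using n
      by (intro mult_mono osc_bound[OF cK] norm_exp_minus_1_le) auto
    also have "\<dots> \<le> (exp (y \<bullet> imV z + n * K1 * \<rho> (imV z)) * exp (- n * c1 * \<rho> (reV z))) *
      (CU' * (C3 * n powr (- expo g) * exp (n * (c1 / 4 * ?S))) * exp (n * (c1 / 4 * ?S)))"
      using nU nU2 CU' C3(1) by (intro mult_left_mono mult_mono) auto
    also have "\<dots> = CU' * C3 * n powr (- expo g) * exp ((y \<bullet> imV z + n * K1 * \<rho> (imV z)) + (- n * c1 * \<rho> (reV z)) + n * (c1 / 4 * ?S) + n * (c1 / 4 * ?S))"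
      unfolding exp_add by (simp add: mult_ac)
    also have "(y \<bullet> imV z + n * K1 * \<rho> (imV z)) + (- n * c1 * \<rho> (reV z)) + n * (c1 / 4 * ?S) + n * (c1 / 4 * ?S)
      = (y \<bullet> imV z + n * (K1 + c1 / 2) * \<rho> (imV z)) + (- n * (c1 / 2) * \<rho> (reV z))"
      by (simp add: algebra_simps)
    finally show "norm (osc n y z * (exp (of_real n * U z) - 1)) \<le> CU' * C3 * n powr (- expo g) * exp (y \<bullet> imV z + n * (K1 + c1 / 2) * \<rho> (imV z)) * exp (- n * (c1 / 2) * \<rho> (reV z))"
      unfolding exp_add[of "y \<bullet> imV z + n * (K1 + c1 / 2) * \<rho> (imV z)"] by (simp add: mult.assoc)
  qed (use d r0 CU' C3 cK in auto)
qed

text \<open>The difference of the two integrals is \<open>X - T\<close>: \<open>X\<close> is the cut-off integral of the difference of the two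
  integrands, and \<open>T\<close> is the part of the attractor integral that the cutoff removes.  Moving \<open>X\<close> to the
  contour given by \<open>shift_choice\<close> produces the main bound by \<open>difference_bound\<close>.  The error of this shift lives
  on an annulus, where \<open>rho\<close> is bounded below; hence it is exponentially small, like \<open>T\<close>, as soon as the shift
  is short enough.  Exponentially small terms are absorbed since \<open>norm y \<le> n * L\<close> bounds the Legendre transform.\<close>

theorem local_limit:
  fixes U :: "complex^'d \<Rightarrow> complex"
  assumes g: "g > 0" and r0: "r0 > 0" and hol: "holomorphic_cn U (ball 0 r0)"
    and U: "\<And>z. norm z < r0 \<Longrightarrow> norm (U z) \<le> CU * qnorm m z ^ (2 * lcm_of m + g)"
  obtains \<delta>0 where "\<delta>0 > 0" "4 * \<delta>0 \<le> r0" "\<And>\<delta> L. 0 < \<delta> \<Longrightarrow> \<delta> \<le> \<delta>0 \<Longrightarrow> L > 0 \<Longrightarrow>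
    \<exists>C>0. \<exists>M>0. \<forall>n y. n \<ge> 1 \<longrightarrow> norm y \<le> n * L \<longrightarrow>
      norm ((\<integral>x. cutoff \<delta> x *\<^sub>R (osc n y (cvec x) * exp (of_real n * U (cvec x))) \<partial>lborel) - (\<integral>x. osc n y (cvec x) \<partial>lborel))
        \<le> C * n powr (- (mu + expo g)) * exp (- n * M * leg ((1/n) *\<^sub>R y))"
proof -
  obtain c1 K1 where cK: "c1 > 0" "K1 \<ge> 0" "\<And>z. Re (hpoly m a z) \<ge> c1 * \<rho> (reV z) - K1 * \<rho> (imV z)" "\<And>\<xi>. R \<xi> \<ge> c1 * \<rho> \<xi>"
    using coercive by metis
  obtain r1 C0 c K where r1: "0 < r1" "r1 \<le> r0" and C0: "C0 > 0" and c: "0 < c" "c \<le> c1" and K: "K \<ge> 0"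
    and db: "\<And>z n y. norm z < r1 \<Longrightarrow> n > 0 \<Longrightarrow>
      norm (osc n y z * (exp (of_real n * U z) - 1)) \<le> C0 * n powr (- expo g) * exp (y \<bullet> imV z + n * K * \<rho> (imV z)) * exp (- n * c * \<rho> (reV z))"
    using difference_bound[OF g r0 U cK(1-3)] by metis
  have q: "expo g > 0" by (rule expo_pos[OF g])
  have mu0: "mu \<ge> 0" unfolding mu_def by (intro sum_nonneg) auto
  show thesis
  proof (rule that[of "r1 / 4"])
    fix \<delta> L :: real assume \<delta>: "0 < \<delta>" "\<delta> \<le> r1 / 4" and L: "L > 0"
    obtain rm where rm: "rm > 0" "\<And>x. norm x \<ge> \<delta> / 2 \<Longrightarrow> \<rho> x \<ge> rm"
      using rho_lower[of "\<delta> / 2"] \<delta> by (metis half_gt_zero)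
    define W where "W = L / c1 + CARD('d)"
    have W: "W > 0" using L cK by (simp add: W_def add_nonneg_pos)
    \<comment> \<open>the four entries of the minimum serve \<open>e0\<close>, \<open>eK\<close>, \<open>eW\<close> and \<open>eB\<close>: shift within \<open>shift_choice\<close>, of length at most \<open>\<delta>\<close>, and cheap on the annulus\<close>
    define e where "e = min (min 1 (c1 / (K + 1))) (min (\<delta> / W) (c * rm / 2 * c1 / ((K + 1) * L * W)))"
    have e0: "0 < e" "e \<le> 1" using cK(1) c K rm L W \<delta> by (auto simp: e_def intro!: divide_pos_pos mult_pos_pos)
    have eK: "e * K \<le> c1"
    proof -
      have "e * K \<le> c1 / (K + 1) * K" using K by (intro mult_right_mono) (auto simp: e_def)
      also have "\<dots> \<le> c1" using cK(1) K by (simp add: field_simps)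
      finally show ?thesis .
    qed
    have eW: "e * W \<le> \<delta>"
    proof -
      have "e * W \<le> \<delta> / W * W" using W by (intro mult_right_mono) (auto simp: e_def)
      then show ?thesis using W by simp
    qed
    have eB: "K * (e * (L * W / c1)) \<le> c * rm / 2"
    proof -
      have "e \<le> c * rm / 2 * c1 / ((K + 1) * L * W)" by (simp add: e_def)
      then have "e * ((K + 1) * L * W) \<le> c * rm / 2 * c1" using K L W by (simp add: pos_le_divide_eq)
      then have "(K + 1) * (e * (L * W / c1)) \<le> c * rm / 2" using cK(1) by (simp add: field_simps)
      moreover have "K * (e * (L * W / c1)) \<le> (K + 1) * (e * (L * W / c1))"
        using e0 L W cK(1) by (intro mult_right_mono) auto
      ultimately show ?thesis by linarith
    qed
    define I where "I = (\<integral>x. exp (- c * \<rho> x) \<partial>lborel)"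
    have I0: "I \<ge> 0" by (simp add: I_def)
    define I1 where "I1 = (\<integral>x. exp (- (c1 / 2) * \<rho> x) \<partial>lborel)"
    have I10: "I1 \<ge> 0" by (simp add: I1_def)
    let ?A = "{x::real^'d. \<delta>/2 \<le> norm x \<and> norm x \<le> 5/2 * \<delta>}"
    define vol where "vol = measure lborel (cball (0::real^'d) (5/2 * \<delta>))"
    define c' where "c' = c * rm / 2"
    have c': "c' > 0" using c rm by (simp add: c'_def)
    define B where "B = L * W"
    have B: "B > 0" using L W by (simp add: B_def)
    have rate: "mu + expo g > 0" using mu0 q by linarith
    obtain Ce Me where Ce: "Ce > 0" "Me > 0"
      "\<And>n l. n \<ge> 1 \<Longrightarrow> l \<le> B \<Longrightarrow> exp (- n * c') \<le> Ce * n powr (- (mu + expo g)) * exp (- n * Me * l)"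
      using exponential_absorb[OF c' B rate] by (simp add: mult.commute) metis
    define M where "M = min (e / 2) Me"
    have M: "M > 0" "M \<le> e / 2" "M \<le> Me" using e0 Ce(2) by (auto simp: M_def)
    define C where "C = C0 * I + (vol * C0 + I1) * Ce + 1"
    have vol0: "vol \<ge> 0" by (simp add: vol_def)
    have C: "C > 0" unfolding C_def using C0 I0 I10 vol0 Ce(1)
      by (intro add_nonneg_pos add_nonneg_nonneg mult_nonneg_nonneg) auto
    show "\<exists>C>0. \<exists>M>0. \<forall>n y. n \<ge> 1 \<longrightarrow> norm y \<le> n * L \<longrightarrow>
      norm ((\<integral>x. cutoff \<delta> x *\<^sub>R (osc n y (cvec x) * exp (of_real n * U (cvec x))) \<partial>lborel) - (\<integral>x. osc n y (cvec x) \<partial>lborel))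
        \<le> C * n powr (- (mu + expo g)) * exp (- n * M * leg ((1/n) *\<^sub>R y))"
    proof (rule exI[of _ C], rule conjI[OF C], rule exI[of _ M], rule conjI[OF M(1)], intro allI impI)
      fix n :: real and y :: "real^'d" assume n1: "n \<ge> 1" and y: "norm y \<le> n * L"
      have n: "n > 0" using n1 by simp
      let ?y = "(1/n) *\<^sub>R y" let ?l = "leg ?y"
      have yL: "norm ?y \<le> L" using y n by (simp add: divide_le_eq mult.commute)
      have lB: "?l \<le> B" unfolding B_def W_def by (rule legendre_le[OF cK(1,4) yL])
      have l0: "?l \<ge> 0" by (rule legendre_nonneg)
      obtain w where w: "?y \<bullet> w - R w \<ge> ?l / 2" by (rule near_maximizer)
      have w0: "?y \<bullet> w - R w \<ge> 0" using w l0 by linarith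
      have wW: "norm w \<le> W" unfolding W_def by (rule maximizer_bounded[OF cK(1,4) w0 yL])
      have R0: "R w \<ge> 0" using pd by (auto simp: pos_definite_def)
      have yw: "0 \<le> y \<bullet> w"
      proof -
        have "0 \<le> ?y \<bullet> w" using w0 R0 by linarith
        then show ?thesis using n by (simp add: zero_le_divide_iff)
      qed
      have rw: "\<rho> w \<le> L * W / c1"
      proof -
        have "c1 * \<rho> w \<le> R w" by (rule cK(4))
        also have "\<dots> \<le> norm ?y * norm w" using w0 norm_cauchy_schwarz[of ?y w] by linarith
        also have "\<dots> \<le> L * W" using yL wW L by (intro mult_mono) auto
        finally show ?thesis using cK(1) by (simp add: field_simps)
      qed
      define v where "v = e *\<^sub>R w"
      have vn: "norm v \<le> \<delta>"
      proof -
        have "norm v \<le> e * W" using wW e0 by (simp add: v_def mult_left_mono)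
        then show ?thesis using eW by linarith
      qed
      have yv: "y \<bullet> v \<ge> 0" using yw e0 by (simp add: v_def)
      have Kv: "K * \<rho> (s *\<^sub>R v) \<le> c * rm / 2" if "0 \<le> s" "s \<le> 1" for s
      proof -
        have se: "0 \<le> s * e" "s * e \<le> e" using that e0 by (auto intro: mult_left_le_one_le)
        have se1: "s * e \<le> 1" using se(2) e0(2) by linarith
        have "\<rho> (s *\<^sub>R v) = \<rho> ((s * e) *\<^sub>R w)" by (simp add: v_def)
        also have "\<dots> \<le> (s * e)\<^sup>2 * \<rho> w" by (intro rho_scale se(1) se1)
        also have "(s * e)\<^sup>2 \<le> e"
        proof -
          have "(s * e)\<^sup>2 \<le> e * 1" unfolding power2_eq_square using se se1 e0 by (intro mult_mono) auto
          then show ?thesis by simp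
        qed
        then have "(s * e)\<^sup>2 * \<rho> w \<le> e * (L * W / c1)" using rw e0 rho_nonneg by (intro mult_mono) auto
        finally have "K * \<rho> (s *\<^sub>R v) \<le> K * (e * (L * W / c1))" using K by (intro mult_left_mono) auto
        then show ?thesis using eB by linarith
      qed
      let ?G = "\<lambda>z. osc n y z * (exp (of_real n * U z) - 1)"
      have holG: "holomorphic_cn ?G (ball 0 r0)"
      proof -
        have "holomorphic_cn (\<lambda>z. osc n y z * (exp (of_real n * U z) + (-1))) (ball 0 r0)"
          by (intro holomorphic_cn_mult holomorphic_cn_add holomorphic_cn_exp holomorphic_cn_const hol
              holomorphic_cn_subset[OF holomorphic_cn_osc]) auto
        then show ?thesis by simp
      qed
      have holGc: "continuous_on (ball 0 r0) ?G" by (rule holomorphic_cn_continuous[OF holG])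
      have r\<delta>: "4 * \<delta> \<le> r0" using \<delta> r1 by linarith
      have zr: "norm (cvec x - (\<i> * of_real s) *s cvec v) < r1" if "norm x \<le> 5/2 * \<delta>" "0 \<le> s" "s \<le> 1" for x s
      proof -
        have "norm (cvec x - (\<i> * of_real s) *s cvec v) \<le> norm x + s * norm v"
          using norm_triangle_ineq4[of "cvec x" "(\<i> * of_real s) *s cvec v"] that by (simp add: norm_vector_smult norm_mult)
        also have "s * norm v \<le> 1 * \<delta>" using that vn by (intro mult_mono) auto
        finally show ?thesis using that \<delta> by linarith
      qed
      \<comment> \<open>the error of the shift: on the annulus \<open>\<rho> \<ge> rm\<close>, and the shift spends at most half of the decay \<open>c * rm\<close>\<close>
      have sh: "norm ((\<integral>x. cutoff \<delta> x *\<^sub>R ?G (cvec x - \<i> *s cvec v) \<partial>lborel) - (\<integral>x. cutoff \<delta> x *\<^sub>R ?G (cvec x) \<partial>lborel))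
        \<le> norm v / \<delta> * (vol * C0 * exp (- n * c'))"
      proof (rule integral_cutoff_shift[OF holG _ \<delta>(1) vn])
        show "ball 0 (4 * \<delta>) \<subseteq> ball (0::complex^'d) r0" using r\<delta> by auto
        fix s :: real assume s: "0 \<le> s" "s \<le> 1"
        have "(\<integral>x. indicator ?A x * norm (?G (cvec x - (\<i> * of_real s) *s cvec v)) \<partial>lborel)
          \<le> (\<integral>x. (C0 * exp (- n * c')) * indicator (cball (0::real^'d) (5/2 * \<delta>)) x \<partial>lborel)"
        proof (rule integral_mono')
          show "integrable lborel (\<lambda>x. (C0 * exp (- n * c')) * indicator (cball (0::real^'d) (5/2 * \<delta>)) x)"
            by (intro integrable_mult_right integrable_real_indicator) (use emeasure_bounded_finite[OF bounded_cball, of "0::real^'d" "5/2 * \<delta>"] in auto)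
          fix x :: "real^'d"
          show "indicator ?A x * norm (?G (cvec x - (\<i> * of_real s) *s cvec v)) \<le> (C0 * exp (- n * c')) * indicator (cball 0 (5/2 * \<delta>)) x"
          proof (cases "x \<in> ?A")
            case True
            then have x: "\<delta> / 2 \<le> norm x" "norm x \<le> 5/2 * \<delta>" by auto
            have "norm (?G (cvec x - (\<i> * of_real s) *s cvec v)) \<le> C0 * n powr (- expo g) * exp (y \<bullet> (- (s *\<^sub>R v)) + n * K * \<rho> (- (s *\<^sub>R v))) * exp (- n * c * \<rho> x)"
              using db[OF zr[OF x(2) s] n, of y] by (simp only: reV_shift imV_shift)
            also have "\<dots> = C0 * n powr (- expo g) * exp (y \<bullet> (- (s *\<^sub>R v)) + n * K * \<rho> (- (s *\<^sub>R v)) + - n * c * \<rho> x)"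
              by (simp only: exp_add mult.assoc)
            also have "\<dots> \<le> C0 * 1 * exp (- n * c')"
            proof (intro mult_mono)
              show "n powr (- expo g) \<le> 1" using powr_mono[of "- expo g" 0 n] n1 q by simp
              have "n * (c * rm) \<le> n * (c * \<rho> x)" using n c rm(2)[OF x(1)] by (intro mult_left_mono) auto
              moreover have "n * (K * \<rho> (s *\<^sub>R v)) \<le> n * (c * rm / 2)" using n Kv[OF s] by (intro mult_left_mono) auto
              moreover have "s * (y \<bullet> v) \<ge> 0" using s yv by simp
              ultimately have "y \<bullet> (- (s *\<^sub>R v)) + n * K * \<rho> (- (s *\<^sub>R v)) + - n * c * \<rho> x \<le> - n * c'"
                unfolding rho_minus by (simp add: c'_def mult.assoc)
              then show "exp (y \<bullet> (- (s *\<^sub>R v)) + n * K * \<rho> (- (s *\<^sub>R v)) + - n * c * \<rho> x) \<le> exp (- n * c')" by simp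
            qed (use C0 in auto)
            finally show ?thesis using True by simp
          next
            case False then show ?thesis using C0 by simp
          qed
        qed (use C0 in auto)
        also have "\<dots> = vol * C0 * exp (- n * c')" by (simp add: vol_def)
        finally show "(\<integral>x. indicator ?A x * norm (?G (cvec x - (\<i> * of_real s) *s cvec v)) \<partial>lborel) \<le> vol * C0 * exp (- n * c')" .
      qed
      have sh': "norm ((\<integral>x. cutoff \<delta> x *\<^sub>R ?G (cvec x - \<i> *s cvec v) \<partial>lborel) - (\<integral>x. cutoff \<delta> x *\<^sub>R ?G (cvec x) \<partial>lborel))
        \<le> vol * C0 * exp (- n * c')"
      proof -
        have "norm v / \<delta> \<le> 1" using vn \<delta> by simp
        then have "norm v / \<delta> * (vol * C0 * exp (- n * c')) \<le> 1 * (vol * C0 * exp (- n * c'))"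
          using vol0 C0 by (intro mult_right_mono) auto
        then show ?thesis using sh by linarith
      qed
      \<comment> \<open>the integral over the shifted contour, where \<open>shift_choice\<close> provides the spatial decay\<close>
      have main: "norm (\<integral>x. cutoff \<delta> x *\<^sub>R ?G (cvec x - \<i> *s cvec v) \<partial>lborel) \<le> C0 * I * n powr (- (mu + expo g)) * exp (- n * (e / 2) * ?l)"
      proof -
        let ?E = "C0 * n powr (- expo g) * exp (- (n * (e / 2) * ?l))"
        have "norm (\<integral>x. cutoff \<delta> x *\<^sub>R ?G (cvec x - \<i> *s cvec v) \<partial>lborel) \<le> (\<integral>x. ?E * exp (- n * c * \<rho> x) \<partial>lborel)"
        proof (rule Bochner_Integration.integral_norm_bound_integral)
          have "integrable lborel (\<lambda>x. exp (- (n * c) * \<rho> x))" using n c by (intro integrable_exp_rho) simp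
          then show "integrable lborel (\<lambda>x. ?E * exp (- n * c * \<rho> x))" by simp
          have zr1: "norm (cvec x - \<i> *s cvec v) < r1" if "norm x \<le> 5/2 * \<delta>" for x using zr[OF that, of 1] by simp
          show "integrable lborel (\<lambda>x. cutoff \<delta> x *\<^sub>R ?G (cvec x - \<i> *s cvec v))"
          proof (rule integrable_continuous_cutoff[where r="5/2 * \<delta>"])
            have "continuous_on (cball 0 (5/2 * \<delta>)) (\<lambda>x. ?G (cvec x - \<i> *s cvec v))"
              by (rule continuous_on_compose2[OF holGc]) (use less_le_trans[OF zr1 r1(2)] in \<open>auto intro!: continuous_intros\<close>)
            then show "continuous_on (cball 0 (5/2 * \<delta>)) (\<lambda>x. cutoff \<delta> x *\<^sub>R ?G (cvec x - \<i> *s cvec v))"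
              using \<delta> by (intro continuous_on_scaleR continuous_cutoff)
          qed (use \<delta> in \<open>auto simp: cutoff_eq_0\<close>)
          fix x :: "real^'d"
          show "norm (cutoff \<delta> x *\<^sub>R ?G (cvec x - \<i> *s cvec v)) \<le> ?E * exp (- n * c * \<rho> x)"
          proof (cases "norm x \<le> 5/2 * \<delta>")
            case True
            have "norm (cutoff \<delta> x *\<^sub>R ?G (cvec x - \<i> *s cvec v)) \<le> 1 * norm (?G (cvec x - \<i> *s cvec v))"
              unfolding norm_scaleR using cutoff_bounds[of \<delta> x] by (intro mult_right_mono) auto
            also have "norm (?G (cvec x - \<i> *s cvec v)) \<le> C0 * n powr (- expo g) * exp (y \<bullet> (- v) + n * K * \<rho> (- v)) * exp (- n * c * \<rho> x)"
              using db[OF zr1[OF True] n, of y] by (simp only: reV_shift1 imV_shift1)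
            also have "\<dots> \<le> C0 * n powr (- expo g) * exp (- (n * (e / 2) * ?l)) * exp (- n * c * \<rho> x)"
            proof (intro mult_right_mono mult_left_mono)
              have "- (y \<bullet> v) + n * K * \<rho> v \<le> - (n * (e / 2) * ?l)"
                unfolding v_def by (rule shift_choice[OF cK(1,4) K eK e0 n w])
              then show "exp (y \<bullet> (- v) + n * K * \<rho> (- v)) \<le> exp (- (n * (e / 2) * ?l))" unfolding rho_minus by simp
            qed (use C0 in auto)
            finally show ?thesis by simp
          next
            case False
            then have "cutoff \<delta> x = 0" using \<delta> by (intro cutoff_eq_0) auto
            then show ?thesis using C0 by simp
          qed
        qed
        also have "\<dots> = ?E * (n powr (- mu) * I)"
          using integral_exp_rho_scale[OF n, of c] by (simp add: I_def)
        also have "\<dots> = C0 * I * (n powr (- expo g) * n powr (- mu)) * exp (- n * (e / 2) * ?l)" by (simp add: mult_ac)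
        also have "n powr (- expo g) * n powr (- mu) = n powr (- (mu + expo g))" by (simp add: powr_add[symmetric] add.commute)
        finally show ?thesis .
      qed
      have ci: "integrable lborel (\<lambda>x. cutoff \<delta> x *\<^sub>R osc n y (cvec x))" by (rule cutoff_osc_integrable[OF \<delta>(1)])
      have Gi: "integrable lborel (\<lambda>x. cutoff \<delta> x *\<^sub>R ?G (cvec x))"
      proof (rule integrable_continuous_cutoff[where r="5/2 * \<delta>"])
        have "continuous_on (cball 0 (5/2 * \<delta>)) (\<lambda>x. ?G (cvec x))"
          by (rule continuous_on_compose2[OF holGc]) (use r\<delta> \<delta> in \<open>auto intro!: continuous_intros\<close>)
        then show "continuous_on (cball 0 (5/2 * \<delta>)) (\<lambda>x. cutoff \<delta> x *\<^sub>R ?G (cvec x))"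
          using \<delta> by (intro continuous_on_scaleR continuous_cutoff)
      qed (use \<delta> in \<open>auto simp: cutoff_eq_0\<close>)
      let ?X = "\<integral>x. cutoff \<delta> x *\<^sub>R ?G (cvec x) \<partial>lborel" and ?Y = "\<integral>x. cutoff \<delta> x *\<^sub>R ?G (cvec x - \<i> *s cvec v) \<partial>lborel"
        and ?T = "(\<integral>x. osc n y (cvec x) \<partial>lborel) - (\<integral>x. cutoff \<delta> x *\<^sub>R osc n y (cvec x) \<partial>lborel)"
      have tail: "norm ?T \<le> I1 * exp (- n * c')"
      proof -
        have "norm ?T \<le> I1 * exp (- n * (c1 * rm / 2))"
          unfolding I1_def by (rule osc_tail_bound[OF cK(1,4) \<delta>(1) _ n1]) (use rm(2) \<delta> in simp)
        also have "\<dots> \<le> I1 * exp (- n * c')"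
        proof -
          have "c' \<le> c1 * rm / 2" unfolding c'_def using c rm(1) by (simp add: mult_right_mono)
          then have "n * c' \<le> n * (c1 * rm / 2)" using n by (intro mult_left_mono) auto
          then show ?thesis using I10 by (intro mult_left_mono) auto
        qed
        finally show ?thesis .
      qed
      have dec: "(\<integral>x. cutoff \<delta> x *\<^sub>R (osc n y (cvec x) * exp (of_real n * U (cvec x))) \<partial>lborel) - (\<integral>x. osc n y (cvec x) \<partial>lborel) = ?X - ?T"
      proof -
        have "(\<integral>x. cutoff \<delta> x *\<^sub>R (osc n y (cvec x) * exp (of_real n * U (cvec x))) \<partial>lborel)
          = (\<integral>x. cutoff \<delta> x *\<^sub>R ?G (cvec x) + cutoff \<delta> x *\<^sub>R osc n y (cvec x) \<partial>lborel)"
          by (intro Bochner_Integration.integral_cong refl) (simp add: scaleR_conv_of_real algebra_simps)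
        also have "\<dots> = ?X + (\<integral>x. cutoff \<delta> x *\<^sub>R osc n y (cvec x) \<partial>lborel)"
          by (rule Bochner_Integration.integral_add[OF Gi ci])
        finally show ?thesis by simp
      qed
      let ?E = "n powr (- (mu + expo g)) * exp (- n * M * ?l)"
      have small: "exp (- n * c') \<le> Ce * ?E"
      proof -
        have "n * (M * ?l) \<le> n * (Me * ?l)" using n l0 M(3) by (intro mult_left_mono mult_right_mono) auto
        then have "exp (- n * Me * ?l) \<le> exp (- n * M * ?l)" by (simp add: mult.assoc)
        then have "Ce * n powr (- (mu + expo g)) * exp (- n * Me * ?l) \<le> Ce * n powr (- (mu + expo g)) * exp (- n * M * ?l)"
          using Ce(1) by (intro mult_left_mono) auto
        then show ?thesis using Ce(3)[OF n1 lB] by (simp add: mult_ac)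
      qed
      have "norm (?X - ?T) \<le> norm ?Y + norm (?Y - ?X) + norm ?T"
        using norm_triangle_ineq4[of ?X ?T] norm_triangle_ineq4[of ?Y "?Y - ?X"] by simp
      also have "\<dots> \<le> C0 * I * n powr (- (mu + expo g)) * exp (- n * (e / 2) * ?l) + (vol * C0 + I1) * exp (- n * c')"
        using main sh' tail by (simp add: distrib_right)
      also have "\<dots> \<le> C0 * I * ?E + (vol * C0 + I1) * (Ce * ?E)"
      proof (intro add_mono)
        have "n * (M * ?l) \<le> n * (e / 2 * ?l)" using n l0 M by (intro mult_left_mono mult_right_mono) auto
        then have "exp (- n * (e / 2) * ?l) \<le> exp (- n * M * ?l)" by (simp add: mult.assoc)
        then show "C0 * I * n powr (- (mu + expo g)) * exp (- n * (e / 2) * ?l) \<le> C0 * I * ?E"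
          unfolding mult.assoc[of "C0 * I"] using C0 I0 by (intro mult_left_mono) auto
        show "(vol * C0 + I1) * exp (- n * c') \<le> (vol * C0 + I1) * (Ce * ?E)"
          using C0 I10 vol0 small by (intro mult_left_mono) auto
      qed
      also have "\<dots> = (C0 * I + (vol * C0 + I1) * Ce) * ?E" by (simp add: algebra_simps)
      also have "\<dots> \<le> C * ?E" by (intro mult_right_mono) (auto simp: C_def)
      finally show "norm ((\<integral>x. cutoff \<delta> x *\<^sub>R (osc n y (cvec x) * exp (of_real n * U (cvec x))) \<partial>lborel) - (\<integral>x. osc n y (cvec x) \<partial>lborel))
        \<le> C * n powr (- (mu + expo g)) * exp (- n * M * ?l)"
        unfolding dec by (simp add: mult.assoc)
    qed
  qed (use r1 in auto)
qed

end

section \<open>Homogeneous order and linear coordinates\<close>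

lemma matrix_inv_right_mult:
  fixes A :: "real^'d^'d"
  assumes "invertible A" shows "A *v (matrix_inv A *v \<xi>) = \<xi>"
proof -
  have "A ** matrix_inv A = mat 1"
    using assms unfolding invertible_def matrix_inv_def by (rule someI2_ex) simp
  then show ?thesis by (simp add: matrix_vector_mul_assoc)
qed

abbreviation mpow :: "real^'d^'d \<Rightarrow> nat \<Rightarrow> real^'d^'d" where
  "mpow B k \<equiv> ((**) B ^^ k) (mat 1)"

lemma mpow_scaleR: "mpow (s *\<^sub>R B) k = s ^ k *\<^sub>R mpow B k"
  by (induction k) (simp_all add: scalar_matrix_assoc[symmetric] matrix_scalar_ac mult.commute flip: scaleR_scaleR)

lemma mpow_entry_bound:
  fixes B :: "real^'d^'d" and b :: real
  assumes b: "\<And>i j. \<bar>B $ i $ j\<bar> \<le> b" and "b \<ge> 0"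
  shows "\<bar>mpow B k $ i $ j\<bar> \<le> (CARD('d) * b) ^ k"
proof (induction k arbitrary: i j)
  case 0 then show ?case by (simp add: mat_def)
next
  case (Suc k)
  have "\<bar>mpow B (Suc k) $ i $ j\<bar> \<le> (\<Sum>l\<in>UNIV. \<bar>B $ i $ l\<bar> * \<bar>mpow B k $ l $ j\<bar>)"
    by (simp add: matrix_matrix_mult_def sum_abs abs_mult[symmetric])
  also have "\<dots> \<le> (\<Sum>l\<in>(UNIV::'d set). b * (CARD('d) * b) ^ k)"
    using assms Suc.IH by (intro sum_mono mult_mono) auto
  finally show ?case by (simp add: mult.assoc)
qed

text \<open>The entries of \<open>exp (s B)\<close> are everywhere convergent power series in \<open>s\<close> and can be differentiated termwise.\<close>

lemma mat_exp_entry: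
  fixes B :: "real^'d^'d"
  shows "summable (\<lambda>k. mpow B k $ i $ j / fact k * s ^ k)"
    and "mat_exp (s *\<^sub>R B) $ i $ j = (\<Sum>k. mpow B k $ i $ j / fact k * s ^ k)"
proof -
  define b where "b = (\<Sum>i\<in>UNIV. \<Sum>j\<in>UNIV. \<bar>B $ i $ j\<bar>)"
  have b: "\<bar>B $ i $ j\<bar> \<le> b" for i j
  proof -
    have "\<bar>B $ i $ j\<bar> \<le> (\<Sum>j\<in>UNIV. \<bar>B $ i $ j\<bar>)" by (rule member_le_sum) auto
    also have "\<dots> \<le> b" unfolding b_def by (rule member_le_sum) (auto intro: sum_nonneg)
    finally show ?thesis .
  qed
  have b0: "b \<ge> 0" by (auto simp: b_def intro!: sum_nonneg)
  have bd: "\<bar>mpow B k $ i $ j\<bar> \<le> (CARD('d) * b) ^ k" for k i j by (rule mpow_entry_bound[OF b b0])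
  have se: "summable (\<lambda>k. (CARD('d) * b * \<bar>s\<bar>) ^ k / fact k)" for s
    using summable_exp_generic[of "CARD('d) * b * \<bar>s\<bar>"] by (simp add: divide_inverse mult.commute scaleR_conv_of_real)
  have sabs: "summable (\<lambda>k. \<bar>mpow B k $ i $ j / fact k * s ^ k\<bar>)" for i j s
  proof (rule summable_comparison_test[OF _ se[of s]], intro exI[of _ 0] allI impI)
    fix k
    have "\<bar>mpow B k $ i $ j\<bar> * \<bar>s\<bar> ^ k \<le> (CARD('d) * b) ^ k * \<bar>s\<bar> ^ k" by (intro mult_right_mono bd) auto
    then show "norm \<bar>mpow B k $ i $ j / fact k * s ^ k\<bar> \<le> (CARD('d) * b * \<bar>s\<bar>) ^ k / fact k"
      by (simp add: abs_mult power_abs power_mult_distrib[symmetric] divide_right_mono)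
  qed
  then show "summable (\<lambda>k. mpow B k $ i $ j / fact k * s ^ k)" for i j s
    by (rule summable_rabs_cancel)
  let ?T = "\<lambda>k. (1 / fact k) *\<^sub>R mpow (s *\<^sub>R B) k"
  have "summable ?T"
  proof (rule summable_norm_cancel, rule summable_comparison_test, intro exI[of _ 0] allI impI)
    show "summable (\<lambda>k. \<Sum>i\<in>UNIV. \<Sum>j\<in>UNIV. \<bar>mpow B k $ i $ j / fact k * s ^ k\<bar>)"
      by (intro summable_sum sabs)
    fix k
    have n1: "norm X \<le> (\<Sum>i\<in>UNIV. \<Sum>j\<in>UNIV. \<bar>X $ i $ j\<bar>)" for X :: "real^'d^'d"
    proof -
      have "norm X \<le> (\<Sum>i\<in>UNIV. norm (X $ i))" unfolding norm_vec_def by (rule L2_set_le_sum) auto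
      also have "\<dots> \<le> (\<Sum>i\<in>UNIV. \<Sum>j\<in>UNIV. \<bar>X $ i $ j\<bar>)" by (intro sum_mono norm_le_l1_cart)
      finally show ?thesis .
    qed
    show "norm (norm (?T k)) \<le> (\<Sum>i\<in>UNIV. \<Sum>j\<in>UNIV. \<bar>mpow B k $ i $ j / fact k * s ^ k\<bar>)"
      using n1[of "?T k"] unfolding mpow_scaleR by (simp add: mult.commute)
  qed
  then have sT: "?T sums mat_exp (s *\<^sub>R B)" unfolding mat_exp_def by (rule summable_sums)
  have "(\<lambda>k. ?T k $ i) sums (mat_exp (s *\<^sub>R B) $ i)"
    by (rule bounded_linear.sums[OF bounded_linear_vec_nth sT])
  from bounded_linear.sums[OF bounded_linear_vec_nth this, of j]
  have "(\<lambda>k. ?T k $ i $ j) sums (mat_exp (s *\<^sub>R B) $ i $ j)" .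
  then show "mat_exp (s *\<^sub>R B) $ i $ j = (\<Sum>k. mpow B k $ i $ j / fact k * s ^ k)"
    unfolding mpow_scaleR by (simp add: sums_iff mult.commute)
qed

lemma mat_exp_0: "mat_exp (0 *\<^sub>R B) = mat 1" for B :: "real^'d^'d"
proof -
  have "(\<Sum>k. mpow B k $ i $ j / fact k * 0 ^ k) = mat 1 $ i $ j" for i j
    using powser_zero[of "\<lambda>k. mpow B k $ i $ j / fact k"] by simp
  then show ?thesis unfolding vec_eq_iff mat_exp_entry(2) by simp
qed

lemma mat_exp_entry_deriv:
  fixes B :: "real^'d^'d"
  shows "((\<lambda>s. mat_exp (s *\<^sub>R B) $ i $ j) has_real_derivative B $ i $ j) (at 0)"
proof -
  let ?c = "\<lambda>k. mpow B k $ i $ j / fact k"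
  have "DERIV (\<lambda>x. \<Sum>n. ?c n * x ^ n) 0 :> (\<Sum>n. diffs ?c n * 0 ^ n)"
    by (rule termdiffs_strong[of ?c 1]) (use mat_exp_entry(1)[of B i j 1] in auto)
  also have "(\<Sum>n. diffs ?c n * 0 ^ n) = B $ i $ j"
    unfolding powser_zero by (simp add: diffs_def)
  finally show ?thesis unfolding mat_exp_entry(2) .
qed

text \<open>Differentiate the Leibniz formula.  A permutation other than the identity moves at least two indices, so
  each of its products of all but one entry of the identity matrix contains an off-diagonal zero.\<close>

lemma det_deriv_at_id:
  fixes M :: "real \<Rightarrow> real^'d^'d"
  assumes M0: "M 0 = mat 1" and M': "\<And>i j. ((\<lambda>s. M s $ i $ j) has_real_derivative E $ i $ j) (at 0)"
  shows "((\<lambda>s. det (M s)) has_real_derivative trace E) (at 0)"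
proof -
  let ?P = "{p. p permutes (UNIV :: 'd set)}"
  let ?D = "\<lambda>p. \<Sum>i\<in>UNIV. E $ i $ p i * (\<Prod>j\<in>UNIV - {i}. M 0 $ j $ p j)"
  have d: "((\<lambda>s. \<Prod>i\<in>UNIV. M s $ i $ p i) has_real_derivative ?D p) (at 0)" for p
  proof -
    have "((\<lambda>s. \<Prod>i\<in>UNIV. M s $ i $ p i) has_derivative (\<lambda>y. \<Sum>i\<in>UNIV. (E $ i $ p i * y) * (\<Prod>j\<in>UNIV - {i}. M 0 $ j $ p j))) (at 0)"
      by (rule has_derivative_prod) (use M' in \<open>simp add: has_field_derivative_def\<close>)
    then show ?thesis unfolding has_field_derivative_def
      by (rule has_derivative_eq_rhs) (simp add: fun_eq_iff sum_distrib_left sum_distrib_right mult_ac)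
  qed
  have D0: "?D p = (if p = id then trace E else 0)" if p: "p permutes UNIV" for p
  proof (cases "p = id")
    case True
    then show ?thesis by (simp add: M0 mat_def trace_def)
  next
    case False
    have z: "(\<Prod>j\<in>UNIV - {i}. M 0 $ j $ p j) = 0" for i
    proof -
      have "\<exists>j. j \<noteq> i \<and> p j \<noteq> j"
      proof (rule ccontr)
        assume "\<not> ?thesis"
        then have *: "\<And>j. j \<noteq> i \<Longrightarrow> p j = j" by blast
        then have "p i = i" using permutes_inj[OF p] by (metis injD)
        with * have "p x = x" for x by (cases "x = i") auto
        then have "p = id" by (simp add: fun_eq_iff)
        with False show False by simp
      qed
      then obtain j where j: "j \<noteq> i" "p j \<noteq> j" by blast
      then show ?thesis by (intro prod_zero bexI[of _ j]) (auto simp: M0 mat_def)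
    qed
    have "?D p = 0" unfolding z by simp
    with False show ?thesis by simp
  qed
  have "((\<lambda>s. \<Sum>p\<in>?P. of_int (sign p) * (\<Prod>i\<in>UNIV. M s $ i $ p i)) has_real_derivative (\<Sum>p\<in>?P. of_int (sign p) * ?D p)) (at 0)"
    by (intro DERIV_sum DERIV_cmult d)
  also have "(\<Sum>p\<in>?P. of_int (sign p) * ?D p) = (\<Sum>p\<in>?P. if p = id then trace E else 0)"
    by (rule sum.cong[OF refl], subst D0) (auto simp: sign_id)
  also have "\<dots> = trace E" by (simp add: finite_permutations permutes_id)
  finally show ?thesis unfolding det_def .
qed

text \<open>Near \<open>0\<close> the function is positive, so that the absolute value can be dropped.\<close>

lemma real_derivative_of_abs_exp:
  fixes f :: "real \<Rightarrow> real"
  assumes d: "(f has_real_derivative D) (at 0)" and f0: "f 0 = 1" and a: "\<And>s. \<bar>f s\<bar> = exp (s * c)"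
  shows "D = c"
proof -
  have "isCont f 0" using d by (rule DERIV_isCont)
  then have "(f \<longlongrightarrow> 1) (at 0)" using f0 by (simp add: isCont_def)
  then have "\<forall>\<^sub>F s in at 0. 0 < f s" by (rule order_tendstoD(1)) simp
  then have "\<forall>\<^sub>F s in nhds 0. f s = exp (s * c)"
    unfolding eventually_at_filter
  proof eventually_elim
    case (elim s) then show ?case using a[of s] f0 by (cases "s = 0") auto
  qed
  then have "((\<lambda>s. exp (s * c)) has_real_derivative D) (at 0)"
    by (rule DERIV_cong_ev[OF refl _ refl, THEN iffD1, OF _ d])
  moreover have "((\<lambda>s. exp (s * c)) has_real_derivative c) (at 0)" by (auto intro!: derivative_eq_intros)
  ultimately show ?thesis by (rule DERIV_unique)
qed

context semi_elliptic
begin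

lemma measurable_R[measurable]: "(\<lambda>x. R x) \<in> borel_measurable borel"
  by (intro borel_measurable_continuous_onI continuous_intros)

lemma integral_exp_R_scale:
  assumes n: "n > 0"
  shows "(\<integral>x. exp (- n * R x) \<partial>lborel) = n powr (- mu) * (\<integral>x. exp (- R x) \<partial>lborel)"
  by (rule integral_dil_scale[OF n measurable_R]) (simp add: cvec_rdil hpoly_dil[OF m_pos])

lemma integral_exp_R_pos: "(\<integral>x. exp (- R x) \<partial>lborel) > 0"
proof -
  obtain c where c: "c > 0" "\<And>\<xi>. R \<xi> \<ge> c * \<rho> \<xi>" using coercive by metis
  have i: "integrable lborel (\<lambda>x. exp (- R x))"
    by (rule Bochner_Integration.integrable_bound[OF integrable_exp_rho[OF c(1)]]) (use c(2) in auto)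
  have "(\<integral>x. exp (- R x) \<partial>lborel) \<noteq> 0"
  proof
    assume "(\<integral>x. exp (- R x) \<partial>lborel) = 0"
    then have "AE x in (lborel :: (real^'d) measure). exp (- R x) = 0"
      using integral_nonneg_eq_0_iff_AE[OF i] by simp
    then have "AE x in (lborel :: (real^'d) measure). False" by simp
    then have "emeasure (lborel :: (real^'d) measure) UNIV = 0" by (simp add: eventually_False ae_filter_eq_bot_iff)
    then show False by (simp add: emeasure_lborel_UNIV)
  qed
  moreover have "(\<integral>x. exp (- R x) \<partial>lborel) \<ge> 0" by simp
  ultimately show ?thesis by linarith
qed

text \<open>Let \<open>E\<close> be any exponent of \<open>P\<close>.  Substituting \<open>exp (s E) \<xi>\<close> in the integral of \<open>exp (- Re P)\<close> multiplies \<open>Re P\<close> by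
  \<open>exp s\<close>; comparing with the substitution by a dilation gives \<open>\<bar>det (exp (s E))\<bar> = exp (s mu)\<close>, and the derivative
  at \<open>s = 0\<close> is \<open>trace E = mu\<close>.\<close>

theorem hom_order_eq_mu:
  fixes P :: "real^'d \<Rightarrow> complex" and A :: "real^'d^'d"
  assumes P: "pos_homogeneous P" and A: "invertible A" and PA: "\<And>\<zeta>. P (A *v \<zeta>) = hpoly m a (cvec \<zeta>)"
  shows "hom_order P = mu"
proof -
  define E where "E = (SOME E. E \<in> Exp_set P)"
  have E: "E \<in> Exp_set P"
  proof -
    have "\<exists>E. E \<in> Exp_set P" using P by (auto simp: pos_homogeneous_def)
    then show ?thesis unfolding E_def by (rule someI_ex)
  qed
  have dA: "det A \<noteq> 0" using A invertible_det_nz by blast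
  have Rpd: "Re (P \<xi>) = 0 \<Longrightarrow> \<xi> = 0" for \<xi> using P by (auto simp: pos_homogeneous_def pos_definite_def)
  have AI: "A *v (matrix_inv A *v \<xi>) = \<xi>" for \<xi>
    by (rule matrix_inv_right_mult[OF A])
  have PR: "(\<lambda>\<xi>. Re (P \<xi>)) = (\<lambda>\<xi>. R (matrix_inv A *v \<xi>))"
  proof
    fix \<xi> have "P \<xi> = P (A *v (matrix_inv A *v \<xi>))" by (simp only: AI)
    then show "Re (P \<xi>) = R (matrix_inv A *v \<xi>)" by (simp only: PA)
  qed
  have Pm[measurable]: "(\<lambda>\<xi>. Re (P \<xi>)) \<in> borel_measurable borel"
    unfolding PR by (intro borel_measurable_continuous_onI continuous_intros linear_continuous_on linear_conv_bounded_linear[THEN iffD1] matrix_vector_mul_linear)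
  have int: "(\<integral>\<xi>. exp (- t * Re (P \<xi>)) \<partial>lborel) = \<bar>det A\<bar> * (t powr (- mu) * (\<integral>x. exp (- R x) \<partial>lborel))" if "t > 0" for t
  proof -
    have "(\<integral>\<xi>. exp (- t * Re (P \<xi>)) \<partial>lborel) = \<bar>det A\<bar> *\<^sub>R (\<integral>x. exp (- t * Re (P (A *v x))) \<partial>lborel)"
      by (rule integral_linear[OF dA]) measurable
    then show ?thesis unfolding PA using integral_exp_R_scale[OF that] by simp
  qed
  have absdet: "\<bar>det (mat_exp (s *\<^sub>R E))\<bar> = exp (s * mu)" for s
  proof -
    let ?T = "mat_exp (s *\<^sub>R E)"
    have hom: "of_real (exp s) * P \<xi> = P (?T *v \<xi>)" for \<xi>
      using E unfolding Exp_set_def mat_powr_def by (metis (mono_tags, lifting) exp_gt_zero ln_exp mem_Collect_eq)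
    have homR: "Re (P (?T *v \<xi>)) = exp s * Re (P \<xi>)" for \<xi> unfolding hom[symmetric] by simp
    have "inj ((*v) ?T)"
    proof (rule linear_injective_0[THEN iffD2, OF matrix_vector_mul_linear], intro allI impI)
      fix \<xi> assume "?T *v \<xi> = 0"
      then have "exp s * Re (P \<xi>) = Re (P 0)" using homR[of \<xi>] by simp
      moreover have "Re (P 0) = 0" using PA[of 0] by simp
      ultimately show "\<xi> = 0" using Rpd[of \<xi>] by simp
    qed
    then have dT: "det ?T \<noteq> 0" using det_nz_iff_inj[OF matrix_vector_mul_linear, of ?T] by simp
    have "(\<integral>\<xi>. exp (- 1 * Re (P \<xi>)) \<partial>lborel) = \<bar>det ?T\<bar> *\<^sub>R (\<integral>x. exp (- 1 * Re (P (?T *v x))) \<partial>lborel)"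
      by (rule integral_linear[OF dT]) measurable
    also have "(\<integral>x. exp (- 1 * Re (P (?T *v x))) \<partial>lborel) = (\<integral>x. exp (- exp s * Re (P x)) \<partial>lborel)"
      unfolding homR by simp
    finally have "\<bar>det A\<bar> * (1 * (\<integral>x. exp (- R x) \<partial>lborel)) = \<bar>det ?T\<bar> * (\<bar>det A\<bar> * (exp s powr (- mu) * (\<integral>x. exp (- R x) \<partial>lborel)))"
      using int[of 1] int[of "exp s"] by simp
    then have "1 = \<bar>det ?T\<bar> * exp s powr (- mu)" using dA integral_exp_R_pos by simp
    then show ?thesis by (simp add: powr_def exp_minus field_simps)
  qed
  have "((\<lambda>s. det (mat_exp (s *\<^sub>R E))) has_real_derivative trace E) (at 0)"
    by (rule det_deriv_at_id) (simp_all only: mat_exp_0 mat_exp_entry_deriv)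
  then have "trace E = mu"
    by (rule real_derivative_of_abs_exp) (simp_all only: mat_exp_0 det_I absdet)
  then show ?thesis by (simp add: hom_order_def E_def)
qed

lemma legendre_transform:
  fixes P :: "real^'d \<Rightarrow> complex" and A :: "real^'d^'d"
  assumes A: "invertible A" and PA: "\<And>\<zeta>. P (A *v \<zeta>) = hpoly m a (cvec \<zeta>)"
  shows "legendre (\<lambda>\<xi>. Re (P \<xi>)) y = leg (transpose A *v y)"
proof -
  have AI: "A *v (matrix_inv A *v \<xi>) = \<xi>" for \<xi>
    by (rule matrix_inv_right_mult[OF A])
  have "range (\<lambda>\<xi>. y \<bullet> \<xi> - Re (P \<xi>)) = range (\<lambda>\<zeta>. y \<bullet> (A *v \<zeta>) - Re (P (A *v \<zeta>)))"
  proof (intro equalityI subsetI)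
    fix r assume "r \<in> range (\<lambda>\<xi>. y \<bullet> \<xi> - Re (P \<xi>))"
    then obtain \<xi> where "r = y \<bullet> \<xi> - Re (P \<xi>)" by auto
    then have "r = y \<bullet> (A *v (matrix_inv A *v \<xi>)) - Re (P (A *v (matrix_inv A *v \<xi>)))" by (simp only: AI)
    then show "r \<in> range (\<lambda>\<zeta>. y \<bullet> (A *v \<zeta>) - Re (P (A *v \<zeta>)))" by blast
  qed auto
  also have "(\<lambda>\<zeta>. y \<bullet> (A *v \<zeta>) - Re (P (A *v \<zeta>))) = (\<lambda>\<zeta>. (transpose A *v y) \<bullet> \<zeta> - R \<zeta>)"
    unfolding PA by (simp add: dot_lmul_matrix[symmetric] vector_transpose_matrix)
  finally show ?thesis by (simp add: legendre_def)
qed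

lemma attractor_transform:
  fixes P :: "real^'d \<Rightarrow> complex" and A :: "real^'d^'d"
  assumes A: "invertible A" and PA: "\<And>\<zeta>. P (A *v \<zeta>) = hpoly m a (cvec \<zeta>)"
  shows "attractor P n y = of_real (1 / (2 * pi) ^ CARD('d)) * (of_real \<bar>det A\<bar> * (\<integral>x. osc n (transpose A *v y) (cvec x) \<partial>lborel))"
proof -
  have dA: "det A \<noteq> 0" using A invertible_det_nz by blast
  have AI: "A *v (matrix_inv A *v \<xi>) = \<xi>" for \<xi>
    by (rule matrix_inv_right_mult[OF A])
  have PR: "P = (\<lambda>\<xi>. hpoly m a (cvec (matrix_inv A *v \<xi>)))"
  proof
    fix \<xi> have "P \<xi> = P (A *v (matrix_inv A *v \<xi>))" by (simp only: AI)
    then show "P \<xi> = hpoly m a (cvec (matrix_inv A *v \<xi>))" by (simp only: PA)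
  qed
  let ?f = "\<lambda>\<xi>. exp (- complex_of_real n * P \<xi>) * exp (- \<i> * complex_of_real (y \<bullet> \<xi>))"
  have "?f \<in> borel_measurable borel"
    unfolding PR by (intro borel_measurable_continuous_onI continuous_intros linear_continuous_on linear_conv_bounded_linear[THEN iffD1] matrix_vector_mul_linear)
  then have "integral\<^sup>L lborel ?f = \<bar>det A\<bar> *\<^sub>R (\<integral>x. ?f (A *v x) \<partial>lborel)"
    by (rule integral_linear[OF dA])
  also have "(\<lambda>x. ?f (A *v x)) = (\<lambda>x. osc n (transpose A *v y) (cvec x))"
    unfolding PA osc_def bil_cvec exp_add[symmetric]
    by (simp add: dot_lmul_matrix[symmetric] vector_transpose_matrix algebra_simps)
  finally show ?thesis by (simp add: attractor_def scaleR_conv_of_real)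
qed

end

section \<open>Weighted Taylor expansion and the order of the remainder\<close>

text \<open>Absolute convergence at the point \<open>z0\<close> with coordinates \<open>s0 ^ kappa m $ j\<close>, whose monomials are
  \<open>s0 ^ wdeg m \<beta>\<close>, bounds the series at \<open>z\<close> term by term; terms of weight at least \<open>l\<close> gain the factor
  \<open>(qnorm m z / s0) ^ l\<close>.\<close>

lemma power_series_weighted_bound:
  fixes f :: "complex^'d \<Rightarrow> complex"
  assumes m: "\<And>j. m $ j > 0"
    and s: "r > 0" "\<And>z. z \<in> polydisc r \<Longrightarrow> ((\<lambda>\<beta>. b \<beta> * cmonom z \<beta>) has_sum f z) UNIV"
    and b: "\<And>\<beta>. wdeg m \<beta> < l \<Longrightarrow> b \<beta> = 0"
  obtains r0 C where "r0 > 0" "\<And>z. norm z < r0 \<Longrightarrow> norm (f z) \<le> C * qnorm m z ^ l"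
proof -
  define s0 where "s0 = min 1 r / 2"
  have s0: "0 < s0" "s0 < 1" "s0 < r" using s(1) by (auto simp: s0_def)
  have pk: "s0 ^ kappa m $ j < r" for j
  proof -
    have "s0 ^ kappa m $ j \<le> s0 ^ 1" using s0 kappa_pos[OF m, of j] by (intro power_decreasing) auto
    then show ?thesis using s0 by simp
  qed
  define z0 :: "complex^'d" where "z0 = (\<chi> j. of_real (s0 ^ kappa m $ j))"
  have z0: "z0 \<in> polydisc r" using pk s0 by (auto simp: z0_def polydisc_def norm_power)
  have c0: "norm (b \<beta> * cmonom z0 \<beta>) = norm (b \<beta>) * s0 ^ wdeg m \<beta>" for \<beta>
    using s0 by (simp add: norm_mult cmonom_norm z0_def norm_power wdeg_def power_sum power_mult[symmetric] mult.commute)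
  have sum0: "(\<lambda>\<beta>. norm (b \<beta>) * s0 ^ wdeg m \<beta>) summable_on UNIV"
    using has_sum_imp_summable[OF s(2)[OF z0]] unfolding summable_on_iff_abs_summable_on_complex c0 .
  define S where "S = (\<Sum>\<^sub>\<infinity>\<beta>. norm (b \<beta>) * s0 ^ wdeg m \<beta>)"
  have main: "norm (f z) \<le> S / s0 ^ l * qnorm m z ^ l" if z: "qnorm m z \<le> s0" for z
  proof -
    have zp: "z \<in> polydisc r" unfolding polydisc_def
    proof (intro CollectI allI)
      fix j
      have "norm (z $ j) \<le> qnorm m z ^ kappa m $ j" by (rule nth_le_qnorm[OF m])
      also have "\<dots> \<le> s0 ^ kappa m $ j" using z qnorm_nonneg by (intro power_mono) auto
      finally show "norm (z $ j) < r" using pk[of j] by linarith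
    qed
    let ?t = "qnorm m z / s0"
    have t: "0 \<le> ?t" "?t \<le> 1" using z s0 qnorm_nonneg[of m z] by auto
    have "norm (b \<beta> * cmonom z \<beta>) \<le> norm (b \<beta>) * s0 ^ wdeg m \<beta> * ?t ^ l" for \<beta>
    proof (cases "wdeg m \<beta> < l")
      case True then show ?thesis using b by simp
    next
      case False
      have "norm (b \<beta> * cmonom z \<beta>) \<le> norm (b \<beta>) * qnorm m z ^ wdeg m \<beta>"
        unfolding norm_mult by (intro mult_left_mono cmonom_le_qnorm[OF m]) auto
      also have "qnorm m z ^ wdeg m \<beta> = s0 ^ wdeg m \<beta> * ?t ^ wdeg m \<beta>" using s0 by (simp add: power_divide)
      also have "\<dots> \<le> s0 ^ wdeg m \<beta> * ?t ^ l" using False t s0 by (intro mult_left_mono power_decreasing) auto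
      finally show ?thesis by (simp add: mult_left_mono mult.assoc)
    qed
    moreover have "((\<lambda>\<beta>. norm (b \<beta>) * s0 ^ wdeg m \<beta> * ?t ^ l) has_sum S * ?t ^ l) UNIV"
      unfolding S_def by (intro has_sum_cmult_left has_sum_infsum sum0)
    ultimately have "norm (f z) \<le> S * ?t ^ l"
      by (intro norm_infsum_le[OF s(2)[OF zp]]) auto
    then show ?thesis by (simp add: power_divide)
  qed
  have "continuous_on UNIV (qnorm m :: complex^'d \<Rightarrow> real)"
    unfolding qnorm_def using lcm_of_pos[OF m] by (intro continuous_intros)
  then have "((\<lambda>z. qnorm m z) \<longlongrightarrow> qnorm m (0::complex^'d)) (at 0)" by (simp add: continuous_on_def)
  moreover have q0: "qnorm m (0::complex^'d) = 0" using rho_0_iff[OF m, of 0] by (simp add: qnorm_def)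
  ultimately have "\<forall>\<^sub>F z in at (0::complex^'d). qnorm m z < s0" using s0 by (intro order_tendstoD(2)) auto
  then obtain d where d: "d > 0" "\<And>z::complex^'d. z \<noteq> 0 \<Longrightarrow> norm z < d \<Longrightarrow> qnorm m z < s0"
    unfolding eventually_at by (auto simp: dist_norm)
  show thesis
  proof (rule that[OF d(1)])
    fix z :: "complex^'d" assume "norm z < d"
    then have "qnorm m z \<le> s0" using d(2)[of z] q0 s0 by (cases "z = 0") auto
    then show "norm (f z) \<le> S / s0 ^ l * qnorm m z ^ l" by (rule main)
  qed
qed

definition wpart :: "nat^'d \<Rightarrow> (nat^'d \<Rightarrow> complex) \<Rightarrow> nat \<Rightarrow> complex^'d \<Rightarrow> complex" where
  "wpart m b l z = (\<Sum>\<beta> | wdeg m \<beta> = l. b \<beta> * cmonom z \<beta>)"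

lemma wpart_has_sum:
  assumes m: "\<And>j. m $ j > 0"
  shows "((\<lambda>\<beta>. (if wdeg m \<beta> = l then b \<beta> else 0) * cmonom z \<beta>) has_sum wpart m b l z) UNIV"
proof -
  have "((\<lambda>\<beta>. (if wdeg m \<beta> = l then b \<beta> else 0) * cmonom z \<beta>) has_sum wpart m b l z) {\<beta>. wdeg m \<beta> = l}"
    by (rule has_sum_finiteI[OF finite_wdeg[OF m]]) (simp add: wpart_def)
  moreover have "((\<lambda>\<beta>. (if wdeg m \<beta> = l then b \<beta> else 0) * cmonom z \<beta>) has_sum wpart m b l z) {\<beta>. wdeg m \<beta> = l} \<longleftrightarrow>
    ((\<lambda>\<beta>. (if wdeg m \<beta> = l then b \<beta> else 0) * cmonom z \<beta>) has_sum wpart m b l z) UNIV"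
    by (rule has_sum_cong_neutral) auto
  ultimately show ?thesis by simp
qed

lemma wpart_eq_0_iff:
  assumes m: "\<And>j. m $ j > 0"
  shows "(\<forall>\<^sub>F z in nhds 0. wpart m b l z = 0) \<longleftrightarrow> (\<forall>\<beta>. wdeg m \<beta> = l \<longrightarrow> b \<beta> = 0)"
proof
  assume "\<forall>\<^sub>F z in nhds 0. wpart m b l z = 0"
  then have "\<forall>\<^sub>F z in nhds 0. ((\<lambda>\<beta>. (if wdeg m \<beta> = l then b \<beta> else 0) * cmonom z \<beta>) has_sum 0) UNIV"
    by eventually_elim (use wpart_has_sum[OF m] in metis)
  from power_series_unique_0[OF this] show "\<forall>\<beta>. wdeg m \<beta> = l \<longrightarrow> b \<beta> = 0" by metis
qed (simp add: wpart_def)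

lemma holomorphic_cn_wpart: "open U \<Longrightarrow> holomorphic_cn (wpart m b l) U"
  unfolding wpart_def by (intro holomorphic_cn_sum holomorphic_cn_mult holomorphic_cn_const holomorphic_cn_cmonom)

lemma wpart_dil: "wpart m b l (dil m s z) = of_real (s ^ l) * wpart m b l z"
  unfolding wpart_def sum_distrib_left cmonom_dil by (rule sum.cong) auto

context semi_elliptic
begin

lemma qnorm_dil: assumes s: "s \<ge> 0" shows "qnorm m (dil m s z) = s * qnorm m z"
  unfolding qnorm_def rho_dil[OF m_pos s] using lcm_of_pos[OF m_pos] s
  by (simp add: real_root_mult real_root_power_cancel)

text \<open>Let \<open>l\<close> be the least weight of a nonzero coefficient and suppose \<open>l \<le> 2 * lcm_of m\<close>.  Along the dilation curve
  through a real point \<open>x\<close> the function is \<open>s ^ l * (wpart x + O(s))\<close>, but also \<open>o(s ^ (2 * lcm_of m))\<close>.  So the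
  component of weight \<open>l\<close> vanishes at all real points, hence identically, against the choice of \<open>l\<close>.\<close>

lemma low_coefficients_vanish:
  fixes f :: "complex^'d \<Rightarrow> complex"
  assumes s: "r > 0" "\<And>z. z \<in> polydisc r \<Longrightarrow> ((\<lambda>\<beta>. b \<beta> * cmonom z \<beta>) has_sum f z) UNIV"
    and o: "(\<lambda>x. f (cvec x)) \<in> o[at 0](\<lambda>x. complex_of_real (R x))"
    and low: "wdeg m \<beta> \<le> 2 * lcm_of m"
  shows "b \<beta> = 0"
proof (rule ccontr)
  let ?p = "2 * lcm_of m"
  assume "b \<beta> \<noteq> 0"
  then have ex: "\<exists>l. l \<le> ?p \<and> (\<exists>\<beta>. wdeg m \<beta> = l \<and> b \<beta> \<noteq> 0)" using low by blast
  define l where "l = (LEAST l. l \<le> ?p \<and> (\<exists>\<beta>. wdeg m \<beta> = l \<and> b \<beta> \<noteq> 0))"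
  have l: "l \<le> ?p" "\<exists>\<beta>. wdeg m \<beta> = l \<and> b \<beta> \<noteq> 0" using LeastI_ex[OF ex] unfolding l_def by auto
  have less: "b \<beta> = 0" if "wdeg m \<beta> < l" for \<beta>
    using not_less_Least[of "wdeg m \<beta>"] that l(1) unfolding l_def[symmetric] using l_def not_less_Least by fastforce
  have "((\<lambda>\<beta>. (if wdeg m \<beta> = l then 0 else b \<beta>) * cmonom z \<beta>) has_sum (f z - wpart m b l z)) UNIV" if "z \<in> polydisc r" for z
  proof -
    have "((\<lambda>\<beta>. b \<beta> * cmonom z \<beta> + - ((if wdeg m \<beta> = l then b \<beta> else 0) * cmonom z \<beta>)) has_sum (f z + - wpart m b l z)) UNIV"
      by (intro has_sum_add s(2)[OF that] has_sum_uminusI wpart_has_sum[OF m_pos])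
    moreover have "b \<beta> * cmonom z \<beta> + - ((if wdeg m \<beta> = l then b \<beta> else 0) * cmonom z \<beta>) = (if wdeg m \<beta> = l then 0 else b \<beta>) * cmonom z \<beta>" for \<beta>
      by simp
    ultimately show ?thesis by simp
  qed
  then obtain r0 C where r0: "r0 > 0" and C: "\<And>z. norm z < r0 \<Longrightarrow> norm (f z - wpart m b l z) \<le> C * qnorm m z ^ Suc l"
    using power_series_weighted_bound[OF m_pos s(1), where b="\<lambda>\<beta>. if wdeg m \<beta> = l then 0 else b \<beta>" and l="Suc l" and f="\<lambda>z. f z - wpart m b l z"]
      less by (metis (no_types, lifting) less_Suc_eq)
  have T0: "wpart m b l (cvec x) = 0" for x
  \<comment> \<open>the origin is a fixed point of the dilations: for \<open>l > 0\<close> homogeneity gives the value there, for \<open>l = 0\<close> continuity does\<close>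
  proof (cases "x = 0")
    case True
    obtain \<beta> where "wdeg m \<beta> = l" "b \<beta> \<noteq> 0" using l(2) by blast
    show ?thesis
    proof (cases "l = 0")
      case False
      have "dil m 0 (cvec 0) = cvec 0" by (simp add: dil_def vec_eq_iff)
      then have "wpart m b l (cvec 0) = of_real (0 ^ l) * wpart m b l (cvec 0)" using wpart_dil[of m b l 0 "cvec 0"] by simp
      then show ?thesis using False True by (simp add: zero_power)
    next
      case l0: True
      have lim1: "((\<lambda>x. f (cvec x)) \<longlongrightarrow> 0) (at 0)"
      proof (rule Lim_null_comparison)
        show "\<forall>\<^sub>F x in at 0. norm (f (cvec x)) \<le> 1 * norm (complex_of_real (R x))"
          by (rule landau_o.smallD[OF o]) simp
        have "continuous_on UNIV (\<lambda>x. norm (complex_of_real (R x)))" by (intro continuous_intros)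
        from this[unfolded continuous_on_def, rule_format, of 0] show "((\<lambda>x. 1 * norm (complex_of_real (R x))) \<longlongrightarrow> 0) (at 0)" by simp
      qed
      have lim2: "((\<lambda>x. f (cvec x) - wpart m b l (cvec x)) \<longlongrightarrow> 0) (at 0)"
      proof (rule Lim_null_comparison)
        show "\<forall>\<^sub>F x in at 0. norm (f (cvec x) - wpart m b l (cvec x)) \<le> C * qnorm m (cvec x) ^ Suc l"
          unfolding eventually_at using r0 C by (intro exI[of _ r0]) (auto simp: dist_norm)
        have "continuous_on UNIV (\<lambda>x. C * qnorm m (cvec x) ^ Suc l)"
          unfolding qnorm_def using lcm_of_pos[OF m_pos] by (intro continuous_intros)
        from this[unfolded continuous_on_def, rule_format, of 0] show "((\<lambda>x. C * qnorm m (cvec x) ^ Suc l) \<longlongrightarrow> 0) (at 0)" by (simp add: qnorm_def)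
      qed
      have "continuous_on UNIV (\<lambda>x. wpart m b l (cvec x))"
        unfolding wpart_def by (intro continuous_intros)
      from this[unfolded continuous_on_def, rule_format, of 0]
      have "((\<lambda>x. wpart m b l (cvec x)) \<longlongrightarrow> wpart m b l (cvec 0)) (at 0)" by simp
      moreover have "((\<lambda>x. wpart m b l (cvec x)) \<longlongrightarrow> 0 - 0) (at 0)"
        using tendsto_diff[OF lim1 lim2] by simp
      ultimately show ?thesis using True LIM_unique by fastforce
    qed
  next
    case False
    have rd: "filterlim (\<lambda>s. rdil s x) (at 0) (at_right 0)"
    proof -
      have "((\<lambda>s. rdil s x) \<longlongrightarrow> rdil 0 x) (at_right 0)" unfolding rdil_def by (intro tendsto_intros)
      moreover have "rdil 0 x = 0" using kappa_pos[OF m_pos] by (simp add: rdil_def vec_eq_iff zero_power)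
      moreover have "\<forall>\<^sub>F s in at_right (0::real). rdil s x \<noteq> 0"
        unfolding eventually_at_filter
        by (rule always_eventually) (use False in \<open>auto simp: rdil_def vec_eq_iff\<close>)
      ultimately show ?thesis by (simp add: filterlim_at)
    qed
    have "norm (wpart m b l (cvec x)) \<le> \<epsilon> * (1 + R x)" if \<epsilon>: "\<epsilon> > 0" for \<epsilon>
    proof -
      have "\<forall>\<^sub>F s in at_right 0. norm (f (cvec (rdil s x))) \<le> \<epsilon> * norm (complex_of_real (R (rdil s x)))"
        using filterlim_iff[THEN iffD1, OF rd, rule_format, OF landau_o.smallD[OF o \<epsilon>]] by simp
      moreover have "\<forall>\<^sub>F s in at_right 0. norm (rdil s x) < r0"
      proof -
        have "\<forall>\<^sub>F x in at (0::real^'d). norm x < r0" unfolding eventually_at using r0 by (intro exI[of _ r0]) (auto simp: dist_norm)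
        from filterlim_iff[THEN iffD1, OF rd, rule_format, OF this] show ?thesis .
      qed
      moreover have "\<forall>\<^sub>F s in at_right 0. C * s * qnorm m (cvec x) ^ Suc l < \<epsilon>"
      proof -
        have "((\<lambda>s. C * s * qnorm m (cvec x) ^ Suc l) \<longlongrightarrow> C * 0 * qnorm m (cvec x) ^ Suc l) (at_right 0)" by (intro tendsto_intros)
        then show ?thesis using \<epsilon> by (intro order_tendstoD(2)) auto
      qed
      moreover have "\<forall>\<^sub>F s in at_right (0::real). 0 < s \<and> s < 1"
        by (auto simp: eventually_at_right[of 0 1] intro!: exI[of _ "1"])
      ultimately have "\<forall>\<^sub>F s in at_right (0::real). norm (wpart m b l (cvec x)) \<le> \<epsilon> * (1 + R x)"
      proof eventually_elim
        case (elim s)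
        have sp: "s > 0" using elim by simp
        have Rx: "R x \<ge> 0" using pd by (auto simp: pos_definite_def)
        have Rs: "R (rdil s x) = s ^ ?p * R x" unfolding cvec_rdil hpoly_dil[OF m_pos] by simp
        have 1: "norm (f (cvec (rdil s x))) \<le> s ^ l * (\<epsilon> * R x)"
        proof -
          have "norm (f (cvec (rdil s x))) \<le> \<epsilon> * (s ^ ?p * R x)" using elim(1) Rx sp unfolding Rs by (simp add: norm_mult norm_power)
          also have "\<dots> \<le> \<epsilon> * (s ^ l * R x)"
            using elim(4) l(1) Rx \<epsilon> by (intro mult_left_mono mult_right_mono power_decreasing) auto
          finally show ?thesis by (simp add: mult_ac)
        qed
        have 2: "norm (f (cvec (rdil s x)) - wpart m b l (cvec (rdil s x))) \<le> s ^ l * \<epsilon>"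
        proof -
          have "norm (f (cvec (rdil s x)) - wpart m b l (cvec (rdil s x))) \<le> C * (s * qnorm m (cvec x)) ^ Suc l"
            using C[of "cvec (rdil s x)"] elim(2)
            by (simp only: norm_cvec) (simp only: cvec_rdil qnorm_dil[OF less_imp_le[OF sp]])
          also have "\<dots> = s ^ l * (C * s * qnorm m (cvec x) ^ Suc l)" by (simp add: power_mult_distrib mult_ac)
          also have "\<dots> \<le> s ^ l * \<epsilon>" using elim(3) sp by (intro mult_left_mono) auto
          finally show ?thesis .
        qed
        have "s ^ l * norm (wpart m b l (cvec x)) = norm (wpart m b l (cvec (rdil s x)))"
          unfolding cvec_rdil wpart_dil norm_mult norm_of_real using sp by simp
        also have "\<dots> \<le> norm (f (cvec (rdil s x))) + norm (f (cvec (rdil s x)) - wpart m b l (cvec (rdil s x)))"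
          using norm_triangle_ineq4[of "f (cvec (rdil s x))" "f (cvec (rdil s x)) - wpart m b l (cvec (rdil s x))"] by simp
        also have "\<dots> \<le> s ^ l * (\<epsilon> * R x) + s ^ l * \<epsilon>" using 1 2 by linarith
        also have "\<dots> = s ^ l * (\<epsilon> * (1 + R x))" by (simp add: algebra_simps)
        finally show ?case using sp by simp
      qed
      then have "\<exists>s::real. norm (wpart m b l (cvec x)) \<le> \<epsilon> * (1 + R x)"
        by (rule eventually_happens'[rotated]) simp
      then show ?thesis by simp
    qed
    note eps = this
    have Rx: "1 + R x > 0" using pd by (auto simp: pos_definite_def add_pos_nonneg)
    have "norm (wpart m b l (cvec x)) \<le> 0 + \<epsilon>" if "\<epsilon> > 0" for \<epsilon>
      using eps[of "\<epsilon> / (1 + R x)"] that Rx by simp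
    then have "norm (wpart m b l (cvec x)) \<le> 0" by (rule field_le_epsilon)
    then show ?thesis by simp
  qed
  have "\<forall>\<^sub>F z in nhds 0. wpart m b l z = 0"
    by (rule holomorphic_cn_identity[OF holomorphic_cn_wpart[OF open_UNIV]]) (auto simp: T0)
  then have "\<forall>\<beta>. wdeg m \<beta> = l \<longrightarrow> b \<beta> = 0" by (simp add: wpart_eq_0_iff[OF m_pos])
  then show False using l(2) by blast
qed

text \<open>Since coefficients of weight at most \<open>2 * lcm_of m\<close> vanish and some coefficient does not, the least excess
  weight exists; all terms of lower weight are absent and \<open>power_series_weighted_bound\<close> applies.\<close>

theorem gamma_ord_properties:
  fixes \<Upsilon> :: "complex^'d \<Rightarrow> complex" and A :: "real^'d^'d"
  defines "U \<equiv> \<lambda>w. \<Upsilon> (cmat A *v w)"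
  assumes hol: "holomorphic_cn U W" "0 \<in> W"
    and o: "(\<lambda>x. U (cvec x)) \<in> o[at 0](\<lambda>x. complex_of_real (R x))"
    and nz: "\<not> (\<forall>\<^sub>F z in nhds 0. U z = 0)"
  obtains r0 C where "gamma_ord \<Upsilon> A m > 0" "r0 > 0"
    "\<And>z. norm z < r0 \<Longrightarrow> norm (U z) \<le> C * qnorm m z ^ (2 * lcm_of m + gamma_ord \<Upsilon> A m)"
proof -
  let ?p = "2 * lcm_of m"
  obtain b s where s: "s > 0" and bs: "\<And>z. z \<in> polydisc s \<Longrightarrow> ((\<lambda>\<beta>. b \<beta> * cmonom z \<beta>) has_sum U z) UNIV"
    using holomorphic_cn_power_series[OF hol] by blast
  have bc: "maclaurin_coeff U = b"
  proof (rule maclaurin_coeff_eqI)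
    show "\<forall>\<^sub>F z in nhds 0. ((\<lambda>\<beta>. b \<beta> * cmonom z \<beta>) has_sum U z) UNIV"
      using polydisc_eventually[OF s] by eventually_elim (rule bs)
  qed
  have low: "b \<beta> = 0" if "wdeg m \<beta> \<le> ?p" for \<beta>
    by (rule low_coefficients_vanish[OF s bs o that])
  have Lam_eq: "Lam m \<beta> = int l \<longleftrightarrow> wdeg m \<beta> = ?p + l" for \<beta> l
    unfolding Lam_wdeg by linarith
  have S: "S_poly \<Upsilon> A m l = (\<lambda>z. fact l * wpart m b (?p + l) z)" for l
    unfolding S_poly_def Lam_eq U_def[symmetric] bc wpart_def by (simp add: fun_eq_iff)
  have S0: "S_poly \<Upsilon> A m l = (\<lambda>z. 0) \<longleftrightarrow> (\<forall>\<beta>. wdeg m \<beta> = ?p + l \<longrightarrow> b \<beta> = 0)" for l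
  proof
    assume "S_poly \<Upsilon> A m l = (\<lambda>z. 0)"
    then have "wpart m b (?p + l) z = 0" for z unfolding S by (metis fact_nonzero mult_eq_0_iff)
    then show "\<forall>\<beta>. wdeg m \<beta> = ?p + l \<longrightarrow> b \<beta> = 0" using wpart_eq_0_iff[OF m_pos, of b "?p + l"] by simp
  qed (simp add: S wpart_def)
  have "\<exists>\<beta>. b \<beta> \<noteq> 0"
  proof (rule ccontr)
    assume "\<not> ?thesis"
    then have "U z = 0" if "z \<in> polydisc s" for z using bs[OF that] by (simp add: has_sum_0_simp has_sum_unique[OF _ has_sum_0_simp])
    then have "\<forall>\<^sub>F z in nhds 0. U z = 0" using polydisc_eventually[OF s] by (auto elim: eventually_mono)
    then show False using nz by simp
  qed
  then obtain \<beta> where \<beta>: "b \<beta> \<noteq> 0" by blast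
  have "wdeg m \<beta> > ?p" using low \<beta> not_le by blast
  then have "S_poly \<Upsilon> A m (wdeg m \<beta> - ?p) \<noteq> (\<lambda>z. 0)" unfolding S0 using \<beta> by (auto intro!: exI[of _ \<beta>])
  then have ex: "\<exists>g. g > 0 \<and> S_poly \<Upsilon> A m g \<noteq> (\<lambda>z. 0)" using \<open>wdeg m \<beta> > ?p\<close> by (intro exI[of _ "wdeg m \<beta> - ?p"]) auto
  let ?g = "gamma_ord \<Upsilon> A m"
  have g: "?g > 0" using LeastI_ex[OF ex] unfolding gamma_ord_def by blast
  have "b \<beta> = 0" if "wdeg m \<beta> < ?p + ?g" for \<beta>
  proof (cases "wdeg m \<beta> \<le> ?p")
    case False
    then have "\<not> (wdeg m \<beta> - ?p > 0 \<and> S_poly \<Upsilon> A m (wdeg m \<beta> - ?p) \<noteq> (\<lambda>z. 0))"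
      using that unfolding gamma_ord_def by (intro not_less_Least) linarith
    then have "S_poly \<Upsilon> A m (wdeg m \<beta> - ?p) = (\<lambda>z. 0)" using False by auto
    then show ?thesis unfolding S0 using False by auto
  qed (rule low)
  then obtain r0 C where "r0 > 0" "\<And>z. norm z < r0 \<Longrightarrow> norm (U z) \<le> C * qnorm m z ^ (?p + ?g)"
    using power_series_weighted_bound[OF m_pos s bs] by blast
  with g show thesis by (rule that)
qed

end

section \<open>Analytic continuation along real lines\<close>

lemma reduce_to_torus:
  fixes \<xi> :: "real^'d"
  obtains k :: "int^'d" where "\<xi> - (2 * pi) *\<^sub>R rvec k \<in> torus"
proof (rule that)
  show "\<xi> - (2 * pi) *\<^sub>R rvec (\<chi> j. \<lceil>(\<xi> $ j - pi) / (2 * pi)\<rceil>) \<in> torus"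
    unfolding torus_def
  proof (intro CollectI allI)
    fix j
    let ?k = "\<lceil>(\<xi> $ j - pi) / (2 * pi)\<rceil>"
    have "(\<xi> $ j - pi) / (2 * pi) \<le> of_int ?k" "of_int ?k - 1 < (\<xi> $ j - pi) / (2 * pi)" by linarith+
    then have "\<xi> $ j - pi \<le> of_int ?k * (2 * pi)" "(of_int ?k - 1) * (2 * pi) < \<xi> $ j - pi"
      by (simp_all only: pos_divide_le_eq pos_less_divide_eq pi_gt_zero zero_less_mult_iff zero_less_numeral simp_thms)
    moreover have "(of_int ?k - 1) * (2 * pi) = of_int ?k * (2 * pi) - 2 * pi" by (simp add: left_diff_distrib)
    moreover have "(\<xi> - (2 * pi) *\<^sub>R rvec (\<chi> j. \<lceil>(\<xi> $ j - pi) / (2 * pi)\<rceil>)) $ j = \<xi> $ j - of_int ?k * (2 * pi)"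
      by (simp add: rvec_def)
    ultimately show "- pi < (\<xi> - (2 * pi) *\<^sub>R rvec (\<chi> j. \<lceil>(\<xi> $ j - pi) / (2 * pi)\<rceil>)) $ j \<and>
      (\<xi> - (2 * pi) *\<^sub>R rvec (\<chi> j. \<lceil>(\<xi> $ j - pi) / (2 * pi)\<rceil>)) $ j \<le> pi"
      by linarith
  qed
qed

lemma fhat_shift: "fhat \<phi> (\<xi> - (2 * pi) *\<^sub>R rvec k) = fhat \<phi> \<xi>"
  using fhat_periodic[of \<phi> "\<xi> - (2 * pi) *\<^sub>R rvec k" k] by simp

text \<open>Periodicity carries the holomorphic extension near the torus to a neighbourhood of any real point.\<close>

lemma fhat_line_holomorphic:
  fixes \<phi> :: "int^'d \<Rightarrow> complex"
  assumes "\<phi> \<in> H_class"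
  obtains \<delta> h where "\<delta> > 0" "h holomorphic_on ball 0 \<delta>" "\<And>t. \<bar>t\<bar> < \<delta> \<Longrightarrow> fhat \<phi> (\<xi> + t *\<^sub>R e) = h (of_real t)"
proof -
  obtain U F where F: "holomorphic_cn F U" "cvec ` torus \<subseteq> U" "\<And>\<xi>. cvec \<xi> \<in> U \<Longrightarrow> F (cvec \<xi>) = fhat \<phi> \<xi>"
    using assms by (auto simp: H_class_def)
  obtain k :: "int^'d" where k: "\<xi> - (2 * pi) *\<^sub>R rvec k \<in> torus" by (rule reduce_to_torus)
  let ?x = "\<xi> - (2 * pi) *\<^sub>R rvec k"
  let ?S = "{w. cvec ?x + w *s cvec e \<in> U}"
  have U: "open U" using F(1) by (simp add: holomorphic_cn_def)
  have "open ?S"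
    using continuous_open_vimage[OF U, of "\<lambda>w. cvec ?x + w *s cvec e"]
      continuous_on_eq_continuous_at[OF open_UNIV, of "\<lambda>w. cvec ?x + w *s cvec e"]
    by (auto simp: vimage_def intro!: continuous_intros)
  moreover have "0 \<in> ?S" using F(2) k by auto
  ultimately obtain \<delta> where \<delta>: "\<delta> > 0" "ball 0 \<delta> \<subseteq> ?S" using openE by blast
  show thesis
  proof (rule that[OF \<delta>(1)])
    show "(\<lambda>w. F (cvec ?x + w *s cvec e)) holomorphic_on ball 0 \<delta>"
      by (rule holomorphic_on_subset[OF holomorphic_line[OF F(1)] \<delta>(2)])
    fix t :: real assume t: "\<bar>t\<bar> < \<delta>"
    then have "complex_of_real t \<in> ?S" by (intro subsetD[OF \<delta>(2)]) simp
    moreover have eq: "cvec ?x + of_real t *s cvec e = cvec (?x + t *\<^sub>R e)" by (simp add: vec_eq_iff)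
    ultimately have "F (cvec ?x + of_real t *s cvec e) = fhat \<phi> (?x + t *\<^sub>R e)" using F(3) by simp
    also have "?x + t *\<^sub>R e = (\<xi> + t *\<^sub>R e) - (2 * pi) *\<^sub>R rvec k" by simp
    finally show "fhat \<phi> (\<xi> + t *\<^sub>R e) = F (cvec ?x + of_real t *s cvec e)" by (simp only: fhat_shift)
  qed
qed

text \<open>The set of points near which \<open>g\<close> vanishes is open and closed.\<close>

lemma real_analytic_identity:
  fixes g :: "real \<Rightarrow> complex"
  assumes an: "\<And>t0. \<exists>\<delta>>0. \<exists>h. h holomorphic_on ball 0 \<delta> \<and> (\<forall>t. \<bar>t\<bar> < \<delta> \<longrightarrow> g (t0 + t) = h (of_real t))"
    and 0: "\<forall>\<^sub>F t in nhds 0. g t = 0"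
  shows "g t = 0"
proof -
  let ?Z = "{t. \<forall>\<^sub>F s in nhds t. g s = 0}"
  have "open ?Z"
  proof (rule openI)
    fix t assume "t \<in> ?Z"
    then have "\<forall>\<^sub>F s in nhds t. s \<in> ?Z" by (simp add: eventually_eventually)
    then show "\<exists>e>0. ball t e \<subseteq> ?Z" by (auto simp: eventually_nhds_metric subset_iff dist_commute)
  qed
  moreover have "closed ?Z"
    unfolding closed_limpt
  proof (intro allI impI)
    fix t0 assume lim: "t0 islimpt ?Z"
    obtain \<delta> h where \<delta>: "\<delta> > 0" "h holomorphic_on ball 0 \<delta>" "\<And>t. \<bar>t\<bar> < \<delta> \<Longrightarrow> g (t0 + t) = h (of_real t)"
      using an[of t0] by blast
    obtain t1 where t1: "t1 \<in> ?Z" "dist t1 t0 < \<delta>" using lim \<delta>(1) unfolding islimpt_approachable by blast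
    define u where "u = t1 - t0"
    have u: "\<bar>u\<bar> < \<delta>" using t1 by (simp add: u_def dist_real_def)
    obtain e where e: "e > 0" "\<And>s. dist s t1 < e \<Longrightarrow> g s = 0" using t1(1) by (auto simp: eventually_nhds_metric)
    have h0: "h z = 0" if z: "z \<in> ball 0 \<delta>" for z
    proof (rule analytic_continuation[OF \<delta>(2), where U="of_real ` {s. \<bar>s\<bar> < \<delta> \<and> \<bar>s - u\<bar> < e}" and \<xi>="of_real u"])
      show "complex_of_real u islimpt of_real ` {s. \<bar>s\<bar> < \<delta> \<and> \<bar>s - u\<bar> < e}"
      proof (rule islimptI)
        fix T :: "complex set" assume "of_real u \<in> T" "open T"
        then obtain \<epsilon> where \<epsilon>: "\<epsilon> > 0" "ball (of_real u) \<epsilon> \<subseteq> T" using openE by blast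
        define d where "d = min (min \<epsilon> e) (\<delta> - \<bar>u\<bar>) / 2"
        have d: "0 < d" "d < \<epsilon>" "d < e" "d < \<delta> - \<bar>u\<bar>" using \<epsilon> e u by (auto simp: d_def)
        have "complex_of_real (u + d) \<in> T" using d by (intro subsetD[OF \<epsilon>(2)]) (simp add: dist_norm)
        moreover have "\<bar>u + d\<bar> < \<delta>" using d by linarith
        moreover have "\<bar>(u + d) - u\<bar> < e" using d by simp
        moreover have "complex_of_real (u + d) \<noteq> of_real u" using d by simp
        ultimately show "\<exists>y\<in>complex_of_real ` {s. \<bar>s\<bar> < \<delta> \<and> \<bar>s - u\<bar> < e}. y \<in> T \<and> y \<noteq> complex_of_real u" by blast
      qed
      show "h y = 0" if y: "y \<in> complex_of_real ` {s. \<bar>s\<bar> < \<delta> \<and> \<bar>s - u\<bar> < e}" for y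
      proof -
        obtain s where s: "y = of_real s" "\<bar>s\<bar> < \<delta>" "\<bar>s - u\<bar> < e" using y by blast
        have "g (t0 + s) = 0" by (rule e(2)) (use s in \<open>simp add: dist_real_def u_def\<close>)
        then show ?thesis using \<delta>(3)[OF s(2)] s(1) by simp
      qed
    qed (use z u \<delta> in auto)
    have "\<forall>s. dist s t0 < \<delta> \<longrightarrow> g s = 0"
    proof (intro allI impI)
      fix s assume "dist s t0 < \<delta>"
      then have "\<bar>s - t0\<bar> < \<delta>" by (simp add: dist_real_def)
      then have "g (t0 + (s - t0)) = h (of_real (s - t0))" "of_real (s - t0) \<in> ball (0::complex) \<delta>"
        using \<delta>(3)[of "s - t0"] by (simp_all del: of_real_diff)
      then show "g s = 0" using h0 by simp
    qed
    then show "t0 \<in> ?Z" using \<delta>(1) unfolding mem_Collect_eq eventually_nhds_metric by blast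
  qed
  moreover have "?Z \<noteq> {}" using 0 by blast
  ultimately have "?Z = UNIV" using clopen[of ?Z] by blast
  then have "\<forall>\<^sub>F s in nhds t. g s = 0" by blast
  then show ?thesis by (rule eventually_nhds_x_imp_x)
qed

section \<open>Points of positive-homogeneous type\<close>

lemma isCont_tendsto_nhds: "isCont f a \<Longrightarrow> (f \<longlongrightarrow> f a) (nhds a)"
  by (simp add: isCont_def tendsto_at_iff_tendsto_nhds)

lemma cmat_cvec: "cmat A *v cvec x = cvec (A *v x)"
  by (simp add: vec_eq_iff cmat_def matrix_vector_mult_def)

lemma matrix_vector_smult: "B *v (c *s z) = c *s (B *v z)" for B :: "complex^'d^'e"
  by (simp add: vec_eq_iff matrix_vector_mult_def sum_distrib_left mult_ac)

lemma bounded_linear_cmat: "bounded_linear ((*v) (B :: complex^'d^'e))"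
  unfolding linear_conv_bounded_linear[symmetric]
  by (rule linearI) (auto simp: vec_eq_iff matrix_vector_mult_def algebra_simps sum.distrib scaleR_sum_right)

lemma holomorphic_cn_matrix_comp:
  fixes B :: "complex^'d^'d"
  assumes "holomorphic_cn F V"
  shows "holomorphic_cn (\<lambda>z. F (B *v z)) {z. B *v z \<in> V}"
proof (rule holomorphic_cnI)
  have V: "open V" using assms by (simp add: holomorphic_cn_def)
  show "open {z. B *v z \<in> V}"
    using continuous_open_vimage[OF V, of "(*v) B"] linear_continuous_at[OF bounded_linear_cmat[of B]]
    by (simp add: vimage_def)
  fix z assume "z \<in> {z. B *v z \<in> V}"
  then obtain D where D: "(F has_derivative D) (at (B *v z))" "\<And>c v. D (c *s v) = c * D v"
    using assms by (auto simp: holomorphic_cn_def)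
  have "((\<lambda>z. F (B *v z)) has_derivative (\<lambda>v. D (B *v v))) (at z)"
    using has_derivative_compose[OF bounded_linear_imp_has_derivative[OF bounded_linear_cmat] D(1)] .
  then show "\<exists>D. ((\<lambda>z. F (B *v z)) has_derivative D) (at z) \<and> (\<forall>c v. D (c *s v) = c * D v)"
    using D(2) by (intro exI[of _ "\<lambda>v. D (B *v v)"]) (simp add: matrix_vector_smult)
qed

lemma matrix_inv_left_mult:
  fixes A :: "real^'d^'d"
  assumes "invertible A" shows "matrix_inv A *v (A *v \<xi>) = \<xi>"
proof -
  have "matrix_inv A ** A = mat 1"
    using assms unfolding invertible_def matrix_inv_def by (rule someI2_ex) simp
  then show ?thesis by (simp add: matrix_vector_mul_assoc)
qed

lemma matrix_bound:
  fixes A :: "real^'d^'e"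
  obtains K where "K > 0" "\<And>x. norm (A *v x) \<le> K * norm x"
proof -
  have "bounded_linear ((*v) A)" unfolding linear_conv_bounded_linear[symmetric] by (rule matrix_vector_mul_linear)
  from bounded_linear.pos_bounded[OF this] show thesis using that by (auto simp: mult.commute)
qed

lemma continuous_matrix_mult[continuous_intros]:
  fixes A :: "real^'d^'e" shows "continuous_on S f \<Longrightarrow> continuous_on S (\<lambda>x. A *v f x)"
  unfolding matrix_vector_mult_def by (intro continuous_intros)

text \<open>One point \<open>\<eta>\<close> of maximal modulus with its data.  The inherited polynomial \<open>hpoly m a\<close> is \<open>P\<close> in the linear
  coordinates given by \<open>A\<close>, and \<open>U\<close> is the remainder \<open>\<Upsilon>\<close> in these coordinates.\<close>

locale point_data = semi_elliptic m a for m :: "nat^'d" and a +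
  fixes \<phi> :: "int^'d \<Rightarrow> complex" and \<eta> \<alpha> :: "real^'d" and P :: "real^'d \<Rightarrow> complex"
    and \<Upsilon> :: "complex^'d \<Rightarrow> complex" and A :: "real^'d^'d"
  assumes H: "\<phi> \<in> H_class" and eta: "norm (fhat \<phi> \<eta>) = 1"
    and type: "pos_hom_type_with \<phi> \<eta> \<alpha> P \<Upsilon>" and A: "invertible A"
    and PA: "\<And>\<zeta>. P (A *v \<zeta>) = hpoly m a (cvec \<zeta>)"
begin

abbreviation U :: "complex^'d \<Rightarrow> complex" where "U \<equiv> \<lambda>w. \<Upsilon> (cmat A *v w)"
abbreviation g :: nat where "g \<equiv> gamma_ord \<Upsilon> A m"

lemma l1_phi: "l1 \<phi>" using H by (simp add: H_class_def)

lemma P_pos: "\<xi> \<noteq> 0 \<Longrightarrow> Re (P \<xi>) > 0" and P_hom: "pos_homogeneous P"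
proof -
  show "pos_homogeneous P" using type by (simp add: pos_hom_type_with_def)
  then show "\<xi> \<noteq> 0 \<Longrightarrow> Re (P \<xi>) > 0" unfolding pos_homogeneous_def pos_definite_def by (metis less_le)
qed

lemma local_form:
  "\<forall>\<^sub>F \<xi> in nhds 0. fhat \<phi> (\<xi> + \<eta>) = fhat \<phi> \<eta> * exp (\<i> * complex_of_real (\<alpha> \<bullet> \<xi>) - P \<xi> + \<Upsilon> (cvec \<xi>))"
proof -
  have nz: "fhat \<phi> \<eta> \<noteq> 0" using eta by auto
  have "continuous_on UNIV (\<lambda>\<xi>. fhat \<phi> (\<xi> + \<eta>))"
    by (intro continuous_on_compose2[OF continuous_fhat[OF l1_phi]] continuous_intros) auto
  then have "((\<lambda>\<xi>. fhat \<phi> (\<xi> + \<eta>)) \<longlongrightarrow> fhat \<phi> (0 + \<eta>)) (nhds 0)"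
    using continuous_on_eq_continuous_at[OF open_UNIV] by (metis UNIV_I isCont_def tendsto_at_iff_tendsto_nhds)
  then have "\<forall>\<^sub>F \<xi> in nhds 0. fhat \<phi> (\<xi> + \<eta>) \<noteq> 0" using nz by (intro tendsto_imp_eventually_ne) auto
  moreover have "\<forall>\<^sub>F \<xi> in nhds 0. Gam \<phi> \<eta> \<xi> = \<i> * complex_of_real (\<alpha> \<bullet> \<xi>) - P \<xi> + \<Upsilon> (cvec \<xi>)"
    using type by (simp add: pos_hom_type_with_def)
  ultimately show ?thesis
  proof eventually_elim
    case (elim \<xi>)
    have "exp (Gam \<phi> \<eta> \<xi>) = fhat \<phi> (\<xi> + \<eta>) / fhat \<phi> \<eta>"
      unfolding Gam_def using elim(1) nz by (intro exp_Ln) simp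
    then show ?case using nz unfolding elim(2)[symmetric] by simp
  qed
qed

lemma small_o: "(\<lambda>\<xi>. \<Upsilon> (cvec \<xi>)) \<in> o[at 0](\<lambda>\<xi>. complex_of_real (Re (P \<xi>)))"
  using type by (simp add: pos_hom_type_with_def)

text \<open>Near \<open>\<eta>\<close> the modulus of the transform is \<open>exp (- Re P + Re \<Upsilon>)\<close>, and \<open>\<Upsilon>\<close> is at most half of \<open>Re P > 0\<close>.\<close>

lemma isolated: "\<forall>\<^sub>F \<xi> in at \<eta>. norm (fhat \<phi> \<xi>) \<noteq> 1"
proof -
  have "\<forall>\<^sub>F \<xi> in at 0. norm (\<Upsilon> (cvec \<xi>)) \<le> 1/2 * norm (complex_of_real (Re (P \<xi>)))"
    by (rule landau_o.smallD[OF small_o]) simp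
  moreover have "\<forall>\<^sub>F \<xi> in at (0::real^'d). \<xi> \<noteq> 0" by (simp add: eventually_at_filter)
  moreover have "\<forall>\<^sub>F \<xi> in at 0. fhat \<phi> (\<xi> + \<eta>) = fhat \<phi> \<eta> * exp (\<i> * complex_of_real (\<alpha> \<bullet> \<xi>) - P \<xi> + \<Upsilon> (cvec \<xi>))"
    using local_form by (auto simp: eventually_at_filter elim: eventually_mono)
  ultimately have "\<forall>\<^sub>F \<xi> in at 0. norm (fhat \<phi> (\<xi> + \<eta>)) \<noteq> 1"
  proof eventually_elim
    case (elim \<xi>)
    have p: "Re (P \<xi>) > 0" using P_pos elim by simp
    have "norm (fhat \<phi> (\<xi> + \<eta>)) = exp (- Re (P \<xi>) + Re (\<Upsilon> (cvec \<xi>)))"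
      unfolding elim(3) norm_mult eta norm_exp_eq_Re by simp
    moreover have "Re (\<Upsilon> (cvec \<xi>)) \<le> Re (P \<xi>) / 2" using elim(1) p complex_Re_le_cmod[of "\<Upsilon> (cvec \<xi>)"] by simp
    ultimately show ?case using p by simp
  qed
  then show ?thesis unfolding at_to_0[of \<eta>] eventually_filtermap .
qed

lemma upsilon_domain: obtains W where "holomorphic_cn U W" "0 \<in> W"
proof -
  obtain V where V: "0 \<in> V" "holomorphic_cn \<Upsilon> V" using type by (auto simp: pos_hom_type_with_def)
  show thesis using that[OF holomorphic_cn_matrix_comp[OF V(2)]] V(1) by simp
qed

lemma U_small_o: "(\<lambda>x. U (cvec x)) \<in> o[at 0](\<lambda>x. complex_of_real (R x))"
proof -
  have "filterlim ((*v) A) (at 0) (at 0)"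
  proof -
    have "continuous_on UNIV ((*v) A)" by (intro continuous_intros)
    from this[unfolded continuous_on_def, rule_format, of 0]
    have "((*v) A \<longlongrightarrow> 0) (at 0)" by simp
    moreover have "\<forall>\<^sub>F x in at 0. A *v x \<noteq> 0"
      unfolding eventually_at_filter
    proof (rule always_eventually, intro allI impI)
      fix x :: "real^'d" assume "x \<noteq> 0"
      then show "A *v x \<noteq> 0" using matrix_inv_left_mult[OF A, of x] by auto
    qed
    ultimately show ?thesis by (simp add: filterlim_at)
  qed
  from landau_o.small.compose[OF small_o this]
  show ?thesis by (simp add: cmat_cvec PA)
qed

text \<open>If the remainder vanished, then \<open>fhat \<phi> (\<eta> + t e) = fhat \<phi> \<eta> * exp (i \<alpha> (t e) - P (t e))\<close> for small \<open>t\<close>, and by analytic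
  continuation for all \<open>t\<close>, where \<open>e\<close> is a coordinate vector.  At \<open>t = 2 \<pi>\<close> the left-hand side has modulus \<open>1\<close> by
  periodicity, whereas \<open>Re P\<close> is positive there.\<close>

lemma U_nonzero: "\<not> (\<forall>\<^sub>F z in nhds 0. U z = 0)"
proof
  assume U0: "\<forall>\<^sub>F z in nhds 0. U z = 0"
  have "filterlim (\<lambda>\<xi>. cvec (matrix_inv A *v \<xi>)) (nhds 0) (nhds 0)"
  proof -
    have "continuous_on UNIV (\<lambda>\<xi>. cvec (matrix_inv A *v \<xi>))" by (intro continuous_intros)
    then have "isCont (\<lambda>\<xi>. cvec (matrix_inv A *v \<xi>)) 0" by (simp add: continuous_on_eq_continuous_at)
    from isCont_tendsto_nhds[OF this] show ?thesis by simp
  qed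
  from filterlim_iff[THEN iffD1, OF this, rule_format, OF U0]
  have "\<forall>\<^sub>F \<xi> in nhds 0. \<Upsilon> (cvec \<xi>) = 0"
    by (simp add: cmat_cvec matrix_inv_right_mult[OF A])
  with local_form have ev: "\<forall>\<^sub>F \<xi> in nhds 0. fhat \<phi> (\<xi> + \<eta>) = fhat \<phi> \<eta> * exp (\<i> * complex_of_real (\<alpha> \<bullet> \<xi>) - P \<xi>)"
    by eventually_elim simp
  \<comment> \<open>an arbitrary coordinate\<close>
  obtain j :: 'd where True by simp
  define e :: "real^'d" where "e = axis j 1"
  let ?g = "\<lambda>t. fhat \<phi> (\<eta> + t *\<^sub>R e) - fhat \<phi> \<eta> * exp (\<i> * complex_of_real (\<alpha> \<bullet> (t *\<^sub>R e)) - P (t *\<^sub>R e))"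
  have PI: "P \<xi> = hpoly m a (cvec (matrix_inv A *v \<xi>))" for \<xi>
    using PA[of "matrix_inv A *v \<xi>"] by (simp add: matrix_inv_right_mult[OF A])
  have "?g (2 * pi) = 0"
  proof (rule real_analytic_identity)
    fix t0 :: real
    obtain \<delta> h where h: "\<delta> > 0" "h holomorphic_on ball 0 \<delta>" "\<And>t. \<bar>t\<bar> < \<delta> \<Longrightarrow> fhat \<phi> ((\<eta> + t0 *\<^sub>R e) + t *\<^sub>R e) = h (of_real t)"
      using fhat_line_holomorphic[OF H, of "\<eta> + t0 *\<^sub>R e" e] by metis
    let ?B = "matrix_inv A"
    let ?h = "\<lambda>w. h w - fhat \<phi> \<eta> * exp (\<i> * ((of_real t0 + w) * of_real (\<alpha> \<bullet> e)) - hpoly m a (cvec (?B *v (t0 *\<^sub>R e)) + w *s cvec (?B *v e)))"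
    have "(\<lambda>w. hpoly m a (cvec (?B *v (t0 *\<^sub>R e)) + w *s cvec (?B *v e))) holomorphic_on ball 0 \<delta>"
      by (rule holomorphic_on_subset[OF holomorphic_line[OF holomorphic_cn_hpoly[OF open_UNIV]]]) auto
    then have "?h holomorphic_on ball 0 \<delta>" by (intro holomorphic_intros h(2))
    moreover have "?g (t0 + t) = ?h (of_real t)" if "\<bar>t\<bar> < \<delta>" for t
    proof -
      have 1: "fhat \<phi> (\<eta> + (t0 + t) *\<^sub>R e) = h (of_real t)" using h(3)[OF that] by (simp add: scaleR_add_left add.assoc)
      have 2: "cvec (?B *v ((t0 + t) *\<^sub>R e)) = cvec (?B *v (t0 *\<^sub>R e)) + of_real t *s cvec (?B *v e)"
        by (simp add: vec_eq_iff matrix_vector_mult_def sum_distrib_left sum.distrib algebra_simps flip: sum.distrib)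
      show ?thesis unfolding 1 PI 2 by (simp add: distrib_right)
    qed
    ultimately show "\<exists>\<delta>>0. \<exists>h. h holomorphic_on ball 0 \<delta> \<and> (\<forall>t. \<bar>t\<bar> < \<delta> \<longrightarrow> ?g (t0 + t) = h (of_real t))"
      using h(1) by blast
  next
    have "filterlim (\<lambda>t. t *\<^sub>R e) (nhds 0) (nhds (0::real))"
    proof -
      have "isCont (\<lambda>t. t *\<^sub>R e) 0" by (intro continuous_intros)
      from isCont_tendsto_nhds[OF this] show ?thesis by simp
    qed
    from filterlim_iff[THEN iffD1, OF this, rule_format, OF ev]
    show "\<forall>\<^sub>F t in nhds 0. ?g t = 0" by eventually_elim (simp add: add.commute)
  qed
  moreover have "fhat \<phi> (\<eta> + (2 * pi) *\<^sub>R e) = fhat \<phi> \<eta>"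
  proof -
    have "e = rvec (axis j 1)" by (simp add: e_def rvec_def vec_eq_iff axis_def)
    then show ?thesis by (simp add: fhat_periodic)
  qed
  ultimately have "fhat \<phi> \<eta> = fhat \<phi> \<eta> * exp (\<i> * complex_of_real (\<alpha> \<bullet> ((2 * pi) *\<^sub>R e)) - P ((2 * pi) *\<^sub>R e))" by simp
  then have "norm (fhat \<phi> \<eta>) = norm (fhat \<phi> \<eta>) * norm (exp (\<i> * complex_of_real (\<alpha> \<bullet> ((2 * pi) *\<^sub>R e)) - P ((2 * pi) *\<^sub>R e)))"
    by (metis norm_mult)
  then have "Re (P ((2 * pi) *\<^sub>R e)) = 0" unfolding eta norm_exp_eq_Re by simp
  moreover have "(2 * pi) *\<^sub>R e \<noteq> 0" by (simp add: e_def axis_eq_0_iff)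
  ultimately show False using P_pos by fastforce
qed

lemma remainder_bound:
  obtains r0 C where "g > 0" "r0 > 0" "holomorphic_cn U (ball 0 r0)"
    "\<And>z. norm z < r0 \<Longrightarrow> norm (U z) \<le> C * qnorm m z ^ (2 * lcm_of m + g)"
proof -
  obtain W where W: "holomorphic_cn U W" "0 \<in> W" by (rule upsilon_domain)
  obtain r0 C where r: "g > 0" "r0 > 0" "\<And>z. norm z < r0 \<Longrightarrow> norm (U z) \<le> C * qnorm m z ^ (2 * lcm_of m + g)"
    using gamma_ord_properties[OF W U_small_o U_nonzero] by blast
  have "open W" using W by (simp add: holomorphic_cn_def)
  then obtain r1 where r1: "r1 > 0" "ball 0 r1 \<subseteq> W" using W(2) openE by blast
  show thesis
  proof (rule that[of "min r0 r1" C])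
    show "holomorphic_cn U (ball 0 (min r0 r1))"
      by (rule holomorphic_cn_subset[OF W(1)]) (use r1 in auto)
  qed (use r r1 in auto)
qed

lemma hom_order_P: "hom_order P = mu" by (rule hom_order_eq_mu[OF P_hom A PA])

lemma legendre_P: "legendre (\<lambda>\<xi>. Re (P \<xi>)) y = leg (transpose A *v y)"
  by (rule legendre_transform[OF A PA])

lemma attractor_P_bound:
  obtains C M where "C > 0" "M > 0"
    "\<And>n y. n > 0 \<Longrightarrow> norm (attractor P n y) \<le> C * n powr (- hom_order P) * exp (- n * M * legendre (\<lambda>\<xi>. Re (P \<xi>)) ((1/n) *\<^sub>R y))"
proof -
  obtain C M where CM: "C > 0" "M > 0"
    "\<And>n y. n > 0 \<Longrightarrow> norm (\<integral>x. osc n y (cvec x) \<partial>lborel) \<le> C * n powr (- mu) * exp (- n * M * leg ((1/n) *\<^sub>R y))"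
    using attractor_bound by blast
  define D where "D = 1 / (2 * pi) ^ CARD('d) * \<bar>det A\<bar>"
  have "det A \<noteq> 0" using A invertible_det_nz by blast
  then have D: "D > 0" by (simp add: D_def)
  show thesis
  proof (rule that[of "D * C" M])
    fix n :: real and y :: "real^'d" assume n: "n > 0"
    have "norm (attractor P n y) = D * norm (\<integral>x. osc n (transpose A *v y) (cvec x) \<partial>lborel)"
      unfolding attractor_transform[OF A PA] D_def by (simp add: norm_mult norm_divide norm_power)
    also have "\<dots> \<le> D * (C * n powr (- mu) * exp (- n * M * leg ((1/n) *\<^sub>R (transpose A *v y))))"
      using D by (intro mult_left_mono CM(3) n) auto
    also have "(1/n) *\<^sub>R (transpose A *v y) = transpose A *v ((1/n) *\<^sub>R y)" by (simp add: matrix_vector_mult_scaleR)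
    finally show "norm (attractor P n y) \<le> D * C * n powr (- hom_order P) * exp (- n * M * legendre (\<lambda>\<xi>. Re (P \<xi>)) ((1/n) *\<^sub>R y))"
      unfolding hom_order_P legendre_P by (simp add: mult_ac)
  qed (use D CM in auto)
qed

lemma legendre_P_nonneg: "legendre (\<lambda>\<xi>. Re (P \<xi>)) y \<ge> 0"
  unfolding legendre_P by (rule legendre_nonneg)

lemma legendre_P_bounded: obtains B where "B > 0" "\<And>y. norm y \<le> L \<Longrightarrow> legendre (\<lambda>\<xi>. Re (P \<xi>)) y \<le> B"
proof -
  obtain K where K: "K > 0" "\<And>x. norm (transpose A *v x) \<le> K * norm x" using matrix_bound[of "transpose A"] by blast
  obtain c where c: "c > 0" "\<And>\<xi>. R \<xi> \<ge> c * \<rho> \<xi>" using coercive by metis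
  define B where "B = K * L * (K * L / c + CARD('d))"
  show thesis
  proof (rule that[of "max 1 B"])
    fix y :: "real^'d" assume "norm y \<le> L"
    then have "norm (transpose A *v y) \<le> K * L" using K(2)[of y] K(1) by (meson mult_left_mono less_imp_le order_trans)
    from legendre_le[OF c this] show "legendre (\<lambda>\<xi>. Re (P \<xi>)) y \<le> max 1 B" unfolding legendre_P B_def by simp
  qed simp
qed

lemma legendre_P_lower: obtains D l where "D > 0" "l > 0" "\<And>y. norm y \<ge> D \<Longrightarrow> legendre (\<lambda>\<xi>. Re (P \<xi>)) y \<ge> l"
proof -
  have iT: "invertible (transpose A)" using A by (simp add: invertible_det_nz det_transpose)
  obtain K where K: "K > 0" "\<And>x. norm (matrix_inv (transpose A) *v x) \<le> K * norm x" using matrix_bound[of "matrix_inv (transpose A)"] by blast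
  obtain l where l: "l > 0" "\<And>y. norm y \<ge> 1 \<Longrightarrow> leg y \<ge> l" using legendre_lower by blast
  show thesis
  proof (rule that[of K l])
    fix y :: "real^'d" assume y: "norm y \<ge> K"
    have "norm y \<le> K * norm (transpose A *v y)" using K(2)[of "transpose A *v y"] by (simp only: matrix_inv_left_mult[OF iT])
    then have "K * 1 \<le> K * norm (transpose A *v y)" using y by simp
    then have "1 \<le> norm (transpose A *v y)" using K(1) by (simp only: mult_le_cancel_left_pos)
    then show "legendre (\<lambda>\<xi>. Re (P \<xi>)) y \<ge> l" unfolding legendre_P by (rule l(2))
  qed (use K l in auto)
qed

text \<open>Substitute \<open>\<xi> = \<eta> + A \<zeta>\<close> in \<open>local_limit\<close>.  The support of the cutoff shrinks to \<open>\<eta>\<close> with \<open>\<sigma>\<close>, which leaves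
  room for finitely many disjoint supports.\<close>

theorem point_estimate:
  assumes \<sigma>: "\<sigma> > 0"
  obtains \<theta> :: "real^'d \<Rightarrow> real" and \<sigma>' where "continuous_on UNIV \<theta>" "\<And>\<xi>. 0 \<le> \<theta> \<xi> \<and> \<theta> \<xi> \<le> 1"
    "\<And>\<xi>. dist \<xi> \<eta> \<ge> \<sigma> \<Longrightarrow> \<theta> \<xi> = 0" "\<sigma>' > 0" "\<And>\<xi>. dist \<xi> \<eta> < \<sigma>' \<Longrightarrow> \<theta> \<xi> = 1"
    "\<And>L. L > 0 \<Longrightarrow> \<exists>C>0. \<exists>M>0. \<forall>n\<ge>1. \<forall>x. norm (rvec x) \<le> real n * L \<longrightarrow>
      norm ((\<integral>\<xi>. \<theta> \<xi> *\<^sub>R (fhat \<phi> \<xi> ^ n * chr (- x) \<xi>) \<partial>lborel) -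
        (2 * pi) ^ CARD('d) * (chr (- x) \<eta> * fhat \<phi> \<eta> ^ n * attractor P (real n) (rvec x - real n *\<^sub>R \<alpha>)))
      \<le> C * real n powr (- (hom_order P + expo g)) *
        exp (- real n * M * legendre (\<lambda>\<xi>. Re (P \<xi>)) ((1 / real n) *\<^sub>R (rvec x - real n *\<^sub>R \<alpha>)))"
proof -
  obtain r0 CU where r0: "g > 0" "r0 > 0" "holomorphic_cn U (ball 0 r0)"
    "\<And>z. norm z < r0 \<Longrightarrow> norm (U z) \<le> CU * qnorm m z ^ (2 * lcm_of m + g)"
    using remainder_bound by blast
  obtain \<delta>0 where \<delta>0: "\<delta>0 > 0" "4 * \<delta>0 \<le> r0" "\<And>\<delta> L. 0 < \<delta> \<Longrightarrow> \<delta> \<le> \<delta>0 \<Longrightarrow> L > 0 \<Longrightarrow>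
    \<exists>C>0. \<exists>M>0. \<forall>n y. n \<ge> 1 \<longrightarrow> norm y \<le> n * L \<longrightarrow>
      norm ((\<integral>x. cutoff \<delta> x *\<^sub>R (osc n y (cvec x) * exp (of_real n * U (cvec x))) \<partial>lborel) - (\<integral>x. osc n y (cvec x) \<partial>lborel))
        \<le> C * n powr (- (mu + expo g)) * exp (- n * M * leg ((1/n) *\<^sub>R y))"
    using local_limit[OF r0] by blast
  obtain \<rho>0 where \<rho>0: "\<rho>0 > 0" "\<And>\<xi>. norm \<xi> < \<rho>0 \<Longrightarrow> fhat \<phi> (\<xi> + \<eta>) = fhat \<phi> \<eta> * exp (\<i> * complex_of_real (\<alpha> \<bullet> \<xi>) - P \<xi> + \<Upsilon> (cvec \<xi>))"
    using local_form by (auto simp: eventually_nhds_metric)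
  obtain K where K: "K > 0" "\<And>x. norm (A *v x) \<le> K * norm x" using matrix_bound[of "A"] by blast
  obtain K' where K': "K' > 0" "\<And>x. norm (matrix_inv A *v x) \<le> K' * norm x" using matrix_bound[of "matrix_inv A"] by blast
  obtain KT where KT: "KT > 0" "\<And>x. norm (transpose A *v x) \<le> KT * norm x" using matrix_bound[of "transpose A"] by blast
  define \<delta> where "\<delta> = min \<delta>0 (min \<rho>0 \<sigma> / (2 * K))"
  have \<delta>: "\<delta> > 0" "\<delta> \<le> \<delta>0" using \<delta>0 \<rho>0 \<sigma> K by (auto simp: \<delta>_def)
  have \<delta>K: "2 * \<delta> * K \<le> min \<rho>0 \<sigma>"
  proof -
    have "2 * \<delta> * K \<le> 2 * (min \<rho>0 \<sigma> / (2 * K)) * K" using K(1) by (intro mult_right_mono mult_left_mono) (auto simp: \<delta>_def)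
    then show ?thesis using K(1) by simp
  qed
  define \<theta> where "\<theta> \<xi> = cutoff \<delta> (matrix_inv A *v (\<xi> - \<eta>))" for \<xi>
  have \<theta>c: "continuous_on UNIV \<theta>" unfolding \<theta>_def
    using \<delta> by (intro continuous_on_compose2[OF continuous_cutoff[of \<delta> UNIV]] continuous_intros) auto
  have dA: "det A \<noteq> 0" using A invertible_det_nz by blast
  have est: "\<exists>C>0. \<exists>M>0. \<forall>n\<ge>1. \<forall>x. norm (rvec x) \<le> real n * L \<longrightarrow>
      norm ((\<integral>\<xi>. \<theta> \<xi> *\<^sub>R (fhat \<phi> \<xi> ^ n * chr (- x) \<xi>) \<partial>lborel) -
        (2 * pi) ^ CARD('d) * (chr (- x) \<eta> * fhat \<phi> \<eta> ^ n * attractor P (real n) (rvec x - real n *\<^sub>R \<alpha>)))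
      \<le> C * real n powr (- (hom_order P + expo g)) *
        exp (- real n * M * legendre (\<lambda>\<xi>. Re (P \<xi>)) ((1 / real n) *\<^sub>R (rvec x - real n *\<^sub>R \<alpha>)))" if L: "L > 0" for L
  proof -
    define L' where "L' = KT * (L + norm \<alpha>)"
    have L': "L' > 0" using L KT by (simp add: L'_def add_pos_nonneg)
    obtain C M where CM: "C > 0" "M > 0" "\<And>n y. n \<ge> 1 \<Longrightarrow> norm y \<le> n * L' \<Longrightarrow>
      norm ((\<integral>x. cutoff \<delta> x *\<^sub>R (osc n y (cvec x) * exp (of_real n * U (cvec x))) \<partial>lborel) - (\<integral>x. osc n y (cvec x) \<partial>lborel))
        \<le> C * n powr (- (mu + expo g)) * exp (- n * M * leg ((1/n) *\<^sub>R y))"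
      using \<delta>0(3)[OF \<delta> L'] by blast
    show ?thesis
    proof (rule exI[of _ "\<bar>det A\<bar> * C"], rule conjI, use dA CM in simp, rule exI[of _ M], rule conjI[OF CM(2)], intro allI impI)
      fix n :: nat and x :: "int^'d" assume n: "n \<ge> 1" and x: "norm (rvec x) \<le> real n * L"
      define y0 where "y0 = rvec x - real n *\<^sub>R \<alpha>"
      define y where "y = transpose A *v y0"
      have yL: "norm y \<le> real n * L'"
      proof -
        have "norm y0 \<le> norm (rvec x) + real n * norm \<alpha>" unfolding y0_def using norm_triangle_ineq4[of "rvec x" "real n *\<^sub>R \<alpha>"] by simp
        also have "\<dots> \<le> real n * (L + norm \<alpha>)" using x by (simp add: distrib_left)
        finally have "KT * norm y0 \<le> KT * (real n * (L + norm \<alpha>))" using KT by (intro mult_left_mono) auto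
        then show ?thesis using KT(2)[of y0] by (simp add: y_def L'_def mult_ac)
      qed
      let ?f = "\<lambda>\<xi>. \<theta> \<xi> *\<^sub>R (fhat \<phi> \<xi> ^ n * chr (- x) \<xi>)"
      let ?pre = "chr (- x) \<eta> * fhat \<phi> \<eta> ^ n"
      have fc: "continuous_on UNIV ?f" by (intro continuous_intros \<theta>c continuous_fhat l1_phi)
      have fc2: "continuous_on UNIV (\<lambda>\<xi>. ?f (\<xi> + \<eta>))"
        by (rule continuous_on_compose2[OF fc]) (auto intro!: continuous_intros)
      have "integral\<^sup>L lborel ?f = (\<integral>\<xi>. ?f (\<xi> + \<eta>) \<partial>lborel)"
        by (rule integral_translate[symmetric]) (intro borel_measurable_continuous_onI fc)
      also have "\<dots> = \<bar>det A\<bar> *\<^sub>R (\<integral>\<zeta>. ?f (A *v \<zeta> + \<eta>) \<partial>lborel)"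
        by (rule integral_linear[OF dA]) (intro borel_measurable_continuous_onI fc2)
      also have "(\<lambda>\<zeta>. ?f (A *v \<zeta> + \<eta>)) = (\<lambda>\<zeta>. ?pre * (cutoff \<delta> \<zeta> *\<^sub>R (osc n y (cvec \<zeta>) * exp (of_real n * U (cvec \<zeta>)))))"
      proof
        fix \<zeta> :: "real^'d"
        have ch: "\<theta> (A *v \<zeta> + \<eta>) = cutoff \<delta> \<zeta>" by (simp add: \<theta>_def matrix_inv_left_mult[OF A])
        show "?f (A *v \<zeta> + \<eta>) = ?pre * (cutoff \<delta> \<zeta> *\<^sub>R (osc n y (cvec \<zeta>) * exp (of_real n * U (cvec \<zeta>))))"
        proof (cases "norm \<zeta> < 2 * \<delta>")
          case True
          have "norm (A *v \<zeta>) \<le> K * norm \<zeta>" by (rule K(2))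
          also have "\<dots> < K * (2 * \<delta>)" using True K(1) by (rule mult_strict_left_mono)
          also have "\<dots> \<le> \<rho>0" using \<delta>K by (simp add: mult_ac)
          finally have f: "fhat \<phi> (A *v \<zeta> + \<eta>) = fhat \<phi> \<eta> * exp (\<i> * complex_of_real (\<alpha> \<bullet> (A *v \<zeta>)) - hpoly m a (cvec \<zeta>) + U (cvec \<zeta>))"
            using \<rho>0(2) by (simp add: PA cmat_cvec)
          have c: "chr (- x) (A *v \<zeta> + \<eta>) = chr (- x) \<eta> * exp (- \<i> * complex_of_real (rvec x \<bullet> (A *v \<zeta>)))"
            by (simp add: chr_minus inner_add_right exp_add[symmetric] algebra_simps)
          have yz: "y \<bullet> \<zeta> = rvec x \<bullet> (A *v \<zeta>) - real n * (\<alpha> \<bullet> (A *v \<zeta>))"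
            unfolding y_def y0_def by (simp add: dot_lmul_matrix vector_transpose_matrix inner_diff_left flip: vector_transpose_matrix)
          have "exp (\<i> * complex_of_real (\<alpha> \<bullet> (A *v \<zeta>)) - hpoly m a (cvec \<zeta>) + U (cvec \<zeta>)) ^ n * exp (- \<i> * complex_of_real (rvec x \<bullet> (A *v \<zeta>)))
            = osc n y (cvec \<zeta>) * exp (of_real n * U (cvec \<zeta>))"
            unfolding osc_def bil_cvec yz exp_of_nat_mult[symmetric] exp_add[symmetric] by (simp add: algebra_simps)
          then have "(fhat \<phi> \<eta> * exp (\<i> * complex_of_real (\<alpha> \<bullet> (A *v \<zeta>)) - hpoly m a (cvec \<zeta>) + U (cvec \<zeta>))) ^ n * (chr (- x) \<eta> * exp (- \<i> * complex_of_real (rvec x \<bullet> (A *v \<zeta>))))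
            = ?pre * (osc n y (cvec \<zeta>) * exp (of_real n * U (cvec \<zeta>)))"
            by (simp add: power_mult_distrib mult_ac)
          then show ?thesis unfolding ch f c by (simp only: mult_scaleR_right)
        next
          case False
          then have "cutoff \<delta> \<zeta> = 0" using \<delta> by (intro cutoff_eq_0) auto
          then show ?thesis unfolding ch by simp
        qed
      qed
      finally have I1: "integral\<^sup>L lborel ?f = of_real \<bar>det A\<bar> * (?pre * (\<integral>\<zeta>. cutoff \<delta> \<zeta> *\<^sub>R (osc n y (cvec \<zeta>) * exp (of_real n * U (cvec \<zeta>))) \<partial>lborel))"
        by (simp add: scaleR_conv_of_real)
      have I2: "(2 * pi) ^ CARD('d) * (?pre * attractor P (real n) y0) = of_real \<bar>det A\<bar> * (?pre * (\<integral>x. osc n y (cvec x) \<partial>lborel))"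
        unfolding attractor_transform[OF A PA] y_def by simp
      have pre1: "norm ?pre = 1" by (simp add: norm_mult norm_power eta)
      have "norm (integral\<^sup>L lborel ?f - (2 * pi) ^ CARD('d) * (?pre * attractor P (real n) y0))
        = norm (of_real \<bar>det A\<bar> * (?pre * ((\<integral>\<zeta>. cutoff \<delta> \<zeta> *\<^sub>R (osc n y (cvec \<zeta>) * exp (of_real n * U (cvec \<zeta>))) \<partial>lborel) - (\<integral>x. osc n y (cvec x) \<partial>lborel))))"
        unfolding I1 I2 by (simp only: right_diff_distrib)
      also have "\<dots> = \<bar>det A\<bar> * norm ((\<integral>\<zeta>. cutoff \<delta> \<zeta> *\<^sub>R (osc n y (cvec \<zeta>) * exp (of_real n * U (cvec \<zeta>))) \<partial>lborel) - (\<integral>x. osc n y (cvec x) \<partial>lborel))"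
        unfolding norm_mult[of "of_real \<bar>det A\<bar>"] norm_mult[of ?pre] pre1 by simp
      also have "\<dots> \<le> \<bar>det A\<bar> * (C * real n powr (- (mu + expo g)) * exp (- real n * M * leg ((1/real n) *\<^sub>R y)))"
        using CM(3)[of "real n" y] n yL by (intro mult_left_mono) auto
      also have "leg ((1/real n) *\<^sub>R y) = legendre (\<lambda>\<xi>. Re (P \<xi>)) ((1 / real n) *\<^sub>R y0)"
        unfolding legendre_P y_def by (simp add: matrix_vector_mult_scaleR)
      finally show "norm (integral\<^sup>L lborel ?f - (2 * pi) ^ CARD('d) * (?pre * attractor P (real n) (rvec x - real n *\<^sub>R \<alpha>)))
        \<le> \<bar>det A\<bar> * C * real n powr (- (hom_order P + expo g)) * exp (- real n * M * legendre (\<lambda>\<xi>. Re (P \<xi>)) ((1 / real n) *\<^sub>R (rvec x - real n *\<^sub>R \<alpha>)))"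
        unfolding hom_order_P y0_def by (simp add: mult.assoc)
    qed
  qed
  show thesis
  proof (rule that[OF \<theta>c _ _ _ _ est])
    show "0 \<le> \<theta> \<xi> \<and> \<theta> \<xi> \<le> 1" for \<xi> by (simp add: \<theta>_def cutoff_bounds)
    show "\<theta> \<xi> = 0" if "dist \<xi> \<eta> \<ge> \<sigma>" for \<xi>
    proof -
      have "\<sigma> \<le> norm (A *v (matrix_inv A *v (\<xi> - \<eta>)))" using that by (simp add: matrix_inv_right_mult[OF A] dist_norm)
      also have "\<dots> \<le> K * norm (matrix_inv A *v (\<xi> - \<eta>))" by (rule K(2))
      finally have "2 * \<delta> * K \<le> norm (matrix_inv A *v (\<xi> - \<eta>)) * K" using \<delta>K by (simp add: mult.commute)
      then have "2 * \<delta> \<le> norm (matrix_inv A *v (\<xi> - \<eta>))" using K(1) by (simp only: mult_le_cancel_right_pos)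
      then show ?thesis unfolding \<theta>_def using \<delta> by (intro cutoff_eq_0)
    qed
    show "\<delta> / K' > 0" using \<delta> K' by simp
    show "\<theta> \<xi> = 1" if "dist \<xi> \<eta> < \<delta> / K'" for \<xi>
    proof -
      have "norm (matrix_inv A *v (\<xi> - \<eta>)) \<le> K' * norm (\<xi> - \<eta>)" by (rule K'(2))
      also have "\<dots> \<le> K' * (\<delta> / K')" using that K'(1) by (intro mult_left_mono) (auto simp: dist_norm)
      finally show ?thesis unfolding \<theta>_def using \<delta> K'(1) by (intro cutoff_eq_1) auto
    qed
  qed
qed

end

section \<open>Localization of the inversion integral\<close>

lemma point_dataI:
  fixes \<phi> :: "int^'d \<Rightarrow> complex"
  assumes "\<phi> \<in> H_star" "\<eta> \<in> Omega \<phi>" "pos_hom_type_with \<phi> \<eta> \<alpha> P \<Upsilon>" "invertible A"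
    and ps: "pos_semi_elliptic (\<lambda>\<xi>. P (A *v \<xi>)) m"
  obtains a where "point_data m a \<phi> \<eta> \<alpha> P \<Upsilon> A"
proof -
  obtain a where a: "\<And>\<xi>. P (A *v \<xi>) = hpoly m a (cvec \<xi>)"
    using ps unfolding pos_semi_elliptic_def hpoly_def by blast
  have "point_data m a \<phi> \<eta> \<alpha> P \<Upsilon> A"
  proof
    show "m $ j > 0" for j using ps by (simp add: pos_semi_elliptic_def)
    show "pos_definite (\<lambda>\<xi>. Re (hpoly m a (cvec \<xi>)))" using ps by (simp add: pos_semi_elliptic_def a)
    show "\<phi> \<in> H_class" using assms(1) by (simp add: H_star_def)
    show "norm (fhat \<phi> \<eta>) = 1" using assms(2) by (simp add: Omega_def)
  qed (use assms a in auto)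
  then show thesis by (rule that)
qed

lemma H_star_l1: "\<phi> \<in> H_star \<Longrightarrow> l1 \<phi>" by (simp add: H_star_def H_class_def)

lemma norm_fhat_bdd:
  assumes "l1 \<phi>" shows "norm (fhat \<phi> \<xi>) \<le> (\<Sum>\<^sub>\<infinity>x. norm (\<phi> x))"
proof -
  have "norm (fhat \<phi> \<xi>) \<le> (\<Sum>\<^sub>\<infinity>x. norm (\<phi> x * chr x \<xi>))"
    unfolding fhat_chr by (rule norm_infsum_bound) (use assms in \<open>simp add: norm_mult\<close>)
  then show ?thesis by (simp add: norm_mult)
qed

lemma norm_fhat_le_1:
  assumes "\<phi> \<in> H_star" shows "norm (fhat \<phi> \<xi>) \<le> 1"
proof -
  obtain k where k: "\<xi> - (2 * pi) *\<^sub>R rvec k \<in> torus" by (rule reduce_to_torus)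
  have "norm (fhat \<phi> (\<xi> - (2 * pi) *\<^sub>R rvec k)) \<le> (SUP \<xi>\<in>torus. norm (fhat \<phi> \<xi>))"
    by (rule cSUP_upper[OF k]) (intro bdd_aboveI2[of _ _ "\<Sum>\<^sub>\<infinity>x. norm (\<phi> x)"] norm_fhat_bdd H_star_l1 assms)
  then show ?thesis using assms by (simp add: fhat_shift H_star_def)
qed

lemma torus_subset_cube: "torus \<subseteq> cube 0"
  by (auto simp: torus_def cube_def less_imp_le)

lemma Omega_nonempty:
  fixes \<phi> :: "int^'d \<Rightarrow> complex"
  assumes "\<phi> \<in> H_star" shows "Omega \<phi> \<noteq> {}"
proof -
  have ne: "cube 0 \<noteq> ({} :: (real^'d) set)" by (auto simp: cube_def intro!: exI[of _ 0])
  have "continuous_on (cube 0) (\<lambda>\<xi>. norm (fhat \<phi> \<xi>))" by (intro continuous_intros continuous_fhat H_star_l1 assms)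
  from continuous_attains_sup[OF compact_cube ne this] obtain \<zeta> where
    \<zeta>: "\<zeta> \<in> cube 0" "\<And>\<xi>. \<xi> \<in> cube 0 \<Longrightarrow> norm (fhat \<phi> \<xi>) \<le> norm (fhat \<phi> \<zeta>)" by blast
  obtain k where k: "\<zeta> - (2 * pi) *\<^sub>R rvec k \<in> torus" by (rule reduce_to_torus)
  have "(SUP \<xi>\<in>torus. norm (fhat \<phi> \<xi>)) \<le> norm (fhat \<phi> \<zeta>)"
    by (rule cSUP_least) (use k \<zeta>(2) torus_subset_cube in auto)
  then have "norm (fhat \<phi> \<zeta>) = 1" using norm_fhat_le_1[OF assms, of \<zeta>] assms by (simp add: H_star_def)
  then have "\<zeta> - (2 * pi) *\<^sub>R rvec k \<in> Omega \<phi>" using k by (simp add: Omega_def fhat_shift)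
  then show ?thesis by blast
qed

lemma Omega_finite:
  fixes \<phi> :: "int^'d \<Rightarrow> complex"
  assumes H: "\<phi> \<in> H_star" and iso: "\<And>\<eta>. \<eta> \<in> Omega \<phi> \<Longrightarrow> \<forall>\<^sub>F \<xi> in at \<eta>. norm (fhat \<phi> \<xi>) \<noteq> 1"
  shows "finite (Omega \<phi>)"
proof -
  let ?B = "{\<xi>. norm (fhat \<phi> \<xi>) = 1}"
  have "finite (cube 0 \<inter> ?B)"
  proof (rule finite_not_islimpt_in_compact[OF compact_cube])
    fix z :: "real^'d" assume "z \<in> cube 0"
    obtain k where k: "z - (2 * pi) *\<^sub>R rvec k \<in> torus" by (rule reduce_to_torus)
    let ?z = "z - (2 * pi) *\<^sub>R rvec k"
    show "\<not> z islimpt ?B"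
    proof (cases "norm (fhat \<phi> z) = 1")
      case True
      then have "?z \<in> Omega \<phi>" using k by (simp add: Omega_def fhat_shift)
      from iso[OF this] obtain d where d: "d > 0" "\<And>\<xi>. \<xi> \<noteq> ?z \<Longrightarrow> dist \<xi> ?z < d \<Longrightarrow> norm (fhat \<phi> \<xi>) \<noteq> 1"
        unfolding eventually_at by auto
      show ?thesis unfolding islimpt_approachable
      proof (intro notI)
        assume "\<forall>e>0. \<exists>x'\<in>?B. x' \<noteq> z \<and> dist x' z < e"
        then obtain x' where x': "x' \<in> ?B" "x' \<noteq> z" "dist x' z < d" using d(1) by blast
        have "norm (fhat \<phi> (x' - (2 * pi) *\<^sub>R rvec k)) \<noteq> 1"
          by (rule d(2)) (use x' in \<open>auto simp: dist_norm\<close>)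
        then show False using x'(1) by (simp add: fhat_shift)
      qed
    next
      case False
      have "closed ?B"
        by (intro closed_Collect_eq continuous_intros continuous_fhat H_star_l1 H)
      then show ?thesis using False closed_limpt by blast
    qed
  qed
  then show ?thesis by (rule finite_subset[rotated]) (use torus_subset_cube in \<open>auto simp: Omega_def\<close>)
qed

text \<open>Points of the torus have coordinates in the interval from \<open>- pi\<close>, excluded, to \<open>pi\<close>, included.  The coordinates of finitely many of
  them keep a distance \<open>2 * e\<close> from \<open>- pi\<close>; so in the cell moved by \<open>e\<close> they lie at distance \<open>e\<close> from the
  boundary, and no other translate of them by a period lies in this cell.\<close>

lemma Omega_in_cube:
  fixes \<phi> :: "int^'d \<Rightarrow> complex"
  assumes "finite (Omega \<phi>)"
  obtains e d where "d > 0" "\<And>\<eta> \<xi>. \<eta> \<in> Omega \<phi> \<Longrightarrow> dist \<xi> \<eta> < d \<Longrightarrow> \<xi> \<in> cube e"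
    "\<And>\<xi>. \<xi> \<in> cube e \<Longrightarrow> norm (fhat \<phi> \<xi>) = 1 \<Longrightarrow> \<xi> \<in> Omega \<phi>"
proof -
  define S where "S = insert pi ((\<lambda>(\<eta>, j). (\<eta> $ j + pi)) ` (Omega \<phi> \<times> UNIV))"
  have fS: "finite S" using assms by (simp add: S_def)
  define e where "e = Min S / 2"
  have Sp: "s > 0" if "s \<in> S" for s
  proof -
    from that consider "s = pi" | \<eta> j where "\<eta> \<in> Omega \<phi>" "s = \<eta> $ j + pi" by (auto simp: S_def)
    then show ?thesis
    proof cases
      case 2
      then have "- pi < \<eta> $ j" by (simp add: Omega_def torus_def)
      then show ?thesis using 2 by simp
    qed simp
  qed
  have "Min S \<in> S" using fS by (intro Min_in) (auto simp: S_def)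
  then have e0: "e > 0" using Sp by (simp add: e_def)
  have el: "2 * e \<le> s" if "s \<in> S" for s using Min_le[OF fS that] by (simp add: e_def)
  have epi: "e < pi" using el[of pi] e0 by (simp add: S_def)
  have ej: "\<eta> $ j \<ge> 2 * e - pi" if "\<eta> \<in> Omega \<phi>" for \<eta> j
    using el[of "\<eta> $ j + pi"] that by (force simp: S_def)
  show thesis
  proof (rule that[of e e])
    show "e > 0" by (rule e0)
    fix \<eta> \<xi> :: "real^'d" assume \<eta>: "\<eta> \<in> Omega \<phi>" and d: "dist \<xi> \<eta> < e"
    show "\<xi> \<in> cube e" unfolding cube_def
    proof (intro CollectI allI)
      fix j
      have "\<bar>\<xi> $ j - \<eta> $ j\<bar> < e" using component_le_norm_cart[of "\<xi> - \<eta>" j] d by (simp add: dist_norm)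
      moreover have "\<eta> $ j \<le> pi" using \<eta> by (simp add: Omega_def torus_def)
      ultimately show "e - pi \<le> \<xi> $ j \<and> \<xi> $ j \<le> e + pi" using ej[OF \<eta>, of j] by linarith
    qed
  next
    fix \<xi> :: "real^'d" assume c: "\<xi> \<in> cube e" and n: "norm (fhat \<phi> \<xi>) = 1"
    define k :: "int^'d" where "k = (\<chi> j. if \<xi> $ j > pi then 1 else 0)"
    let ?z = "\<xi> - (2 * pi) *\<^sub>R rvec k"
    have zj: "?z $ j = (if \<xi> $ j > pi then \<xi> $ j - 2 * pi else \<xi> $ j)" for j by (simp add: k_def rvec_def)
    have cj: "e - pi \<le> \<xi> $ j" "\<xi> $ j \<le> e + pi" for j using c by (auto simp: cube_def)
    have "?z \<in> torus" unfolding torus_def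
    proof (intro CollectI allI)
      fix j show "- pi < ?z $ j \<and> ?z $ j \<le> pi" unfolding zj using cj[of j] e0 epi by auto
    qed
    then have z: "?z \<in> Omega \<phi>" using n by (simp add: Omega_def fhat_shift)
    have le: "\<xi> $ j \<le> pi" for j
    proof (rule ccontr)
      assume "\<not> \<xi> $ j \<le> pi"
      then have "?z $ j \<le> e - pi" unfolding zj using cj[of j] by simp
      then show False using ej[OF z, of j] e0 by linarith
    qed
    have "?z $ j = \<xi> $ j" for j unfolding zj using le[of j] by simp
    then have "?z = \<xi>" unfolding vec_eq_iff by blast
    then show "\<xi> \<in> Omega \<phi>" using z by simp
  qed
qed

lemma finite_separated:
  fixes S :: "'a::metric_space set"
  assumes "finite S"
  obtains s where "s > 0" "\<And>x y. x \<in> S \<Longrightarrow> y \<in> S \<Longrightarrow> x \<noteq> y \<Longrightarrow> s \<le> dist x y"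
proof -
  define D where "D = insert 1 ((\<lambda>(x, y). dist x y) ` (S \<times> S - Id))"
  have D: "finite D" using assms by (simp add: D_def)
  show thesis
  proof (rule that[of "Min D"])
    show "Min D > 0" using D by (subst Min_gr_iff) (auto simp: D_def)
    fix x y assume "x \<in> S" "y \<in> S" "x \<noteq> y"
    then have "dist x y \<in> D" unfolding D_def by (intro insertI2 image_eqI[of _ _ "(x, y)"]) auto
    with D show "Min D \<le> dist x y" by (rule Min_le)
  qed
qed

locale llt_data =
  fixes \<phi> :: "int^'d \<Rightarrow> complex" and \<alpha> :: "real^'d \<Rightarrow> real^'d" and P :: "real^'d \<Rightarrow> real^'d \<Rightarrow> complex"
    and \<Upsilon> :: "real^'d \<Rightarrow> complex^'d \<Rightarrow> complex" and A :: "real^'d \<Rightarrow> real^'d^'d"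
    and m :: "real^'d \<Rightarrow> nat^'d" and a :: "real^'d \<Rightarrow> nat^'d \<Rightarrow> complex"
  assumes star: "\<phi> \<in> H_star"
    and point: "\<And>\<eta>. \<eta> \<in> Omega \<phi> \<Longrightarrow> point_data (m \<eta>) (a \<eta>) \<phi> \<eta> (\<alpha> \<eta>) (P \<eta>) (\<Upsilon> \<eta>) (A \<eta>)"
begin

abbreviation \<gamma> :: "real^'d \<Rightarrow> nat" where "\<gamma> \<equiv> \<lambda>\<eta>. gamma_ord (\<Upsilon> \<eta>) (A \<eta>) (m \<eta>)"

definition rate :: "real^'d \<Rightarrow> real" where
  "rate \<eta> = hom_order (P \<eta>) + real (\<gamma> \<eta>) / (2 * real (lcm_of (m \<eta>)))"

definition Rsharp :: "real^'d \<Rightarrow> real^'d \<Rightarrow> real" where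
  "Rsharp \<eta> y = legendre (\<lambda>\<xi>. Re (P \<eta> \<xi>)) y"

definition drift :: "real^'d \<Rightarrow> nat \<Rightarrow> int^'d \<Rightarrow> real^'d" where
  "drift \<eta> n x = (1 / real n) *\<^sub>R (rvec x - real n *\<^sub>R \<alpha> \<eta>)"

definition envelope :: "real^'d \<Rightarrow> real \<Rightarrow> nat \<Rightarrow> int^'d \<Rightarrow> real" where
  "envelope \<eta> M n x = real n powr (- rate \<eta>) * exp (- real n * M * Rsharp \<eta> (drift \<eta> n x))"

definition lead :: "real^'d \<Rightarrow> nat \<Rightarrow> int^'d \<Rightarrow> complex" where
  "lead \<eta> n x = chr (- x) \<eta> * fhat \<phi> \<eta> ^ n * attractor (P \<eta>) (real n) (rvec x - real n *\<^sub>R \<alpha> \<eta>)"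

definition local_integral :: "(real^'d \<Rightarrow> real) \<Rightarrow> nat \<Rightarrow> int^'d \<Rightarrow> complex" where
  "local_integral \<theta> n x = (\<integral>\<xi>. \<theta> \<xi> *\<^sub>R (fhat \<phi> \<xi> ^ n * chr (- x) \<xi>) \<partial>lborel)"

lemma l1_phi: "l1 \<phi>" by (rule H_star_l1[OF star])

lemma finite_Omega: "finite (Omega \<phi>)"
  by (rule Omega_finite[OF star]) (rule point_data.isolated[OF point])

lemma gamma_pos: "\<eta> \<in> Omega \<phi> \<Longrightarrow> \<gamma> \<eta> > 0"
  using point_data.remainder_bound[OF point] by blast

lemma Rsharp_nonneg: "\<eta> \<in> Omega \<phi> \<Longrightarrow> Rsharp \<eta> y \<ge> 0"
  unfolding Rsharp_def by (rule point_data.legendre_P_nonneg[OF point])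

lemma rate_split:
  assumes "\<eta> \<in> Omega \<phi>"
  shows "hom_order (P \<eta>) \<ge> 0" "rate \<eta> - hom_order (P \<eta>) > 0"
proof -
  interpret pt: point_data "m \<eta>" "a \<eta>" \<phi> \<eta> "\<alpha> \<eta>" "P \<eta>" "\<Upsilon> \<eta>" "A \<eta>" by (rule point[OF assms])
  show "hom_order (P \<eta>) \<ge> 0" unfolding pt.hom_order_P pt.mu_def by (intro sum_nonneg) auto
  show "rate \<eta> - hom_order (P \<eta>) > 0"
    using pt.expo_pos[OF gamma_pos[OF assms]] by (simp add: rate_def pt.expo_def)
qed

lemma envelope_nonneg: "envelope \<eta> M n x \<ge> 0" by (simp add: envelope_def)

lemma envelope_antimono:
  assumes "\<eta> \<in> Omega \<phi>" "M \<le> M'" shows "envelope \<eta> M' n x \<le> envelope \<eta> M n x"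
proof -
  have "real n * M * Rsharp \<eta> (drift \<eta> n x) \<le> real n * M' * Rsharp \<eta> (drift \<eta> n x)"
    using assms Rsharp_nonneg by (intro mult_right_mono mult_left_mono) auto
  then show ?thesis by (simp add: envelope_def mult_left_mono)
qed

lemma llt_error_lead: "llt_error \<phi> \<alpha> P n x = norm (conv_pow \<phi> n x - (\<Sum>\<eta>\<in>Omega \<phi>. lead \<eta> n x))"
  unfolding llt_error_def lead_def chr_minus by simp

lemma llt_bound_envelope: "llt_bound \<phi> \<alpha> P m \<gamma> C M n x = (\<Sum>\<eta>\<in>Omega \<phi>. C \<eta> * envelope \<eta> (M \<eta>) n x)"
  unfolding llt_bound_def envelope_def rate_def Rsharp_def drift_def
  by (intro sum.cong refl) (simp only: powr_minus divide_inverse mult.assoc)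

lemma llt_bound_gamma_le:
  assumes C: "\<And>\<eta>. \<eta> \<in> Omega \<phi> \<Longrightarrow> C \<eta> > 0" and n: "n \<ge> 1"
  shows "llt_bound \<phi> \<alpha> P m \<gamma> C M n x \<le> llt_bound \<phi> \<alpha> P m (\<lambda>\<eta>. 1) C M n x"
  unfolding llt_bound_def
proof (intro sum_mono mult_right_mono divide_left_mono)
  fix \<eta> assume \<eta>: "\<eta> \<in> Omega \<phi>"
  show "real n powr (hom_order (P \<eta>) + real 1 / (2 * real (lcm_of (m \<eta>)))) \<le> real n powr (hom_order (P \<eta>) + real (\<gamma> \<eta>) / (2 * real (lcm_of (m \<eta>))))"
    using n gamma_pos[OF \<eta>] by (intro powr_mono add_left_mono divide_right_mono) auto
  show "C \<eta> \<ge> 0" using C[OF \<eta>] by simp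
  show "0 < real n powr (hom_order (P \<eta>) + real (\<gamma> \<eta>) / (2 * real (lcm_of (m \<eta>)))) * real n powr (hom_order (P \<eta>) + real 1 / (2 * real (lcm_of (m \<eta>))))"
    using n by simp
qed simp

lemma choose_constants:
  fixes f :: "real^'d \<Rightarrow> nat \<Rightarrow> int^'d \<Rightarrow> real" and X :: "real^'d \<Rightarrow> nat \<Rightarrow> int^'d \<Rightarrow> bool"
  assumes "\<And>\<eta>. \<eta> \<in> Omega \<phi> \<Longrightarrow> \<exists>C>0. \<exists>M>0. \<forall>n\<ge>1. \<forall>x. X \<eta> n x \<longrightarrow> f \<eta> n x \<le> C * envelope \<eta> M n x"
  obtains C M where "\<And>\<eta>. \<eta> \<in> Omega \<phi> \<Longrightarrow> C \<eta> > 0" "\<And>\<eta>. \<eta> \<in> Omega \<phi> \<Longrightarrow> M \<eta> > 0"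
    "\<And>\<eta> n x. \<eta> \<in> Omega \<phi> \<Longrightarrow> n \<ge> 1 \<Longrightarrow> X \<eta> n x \<Longrightarrow> f \<eta> n x \<le> C \<eta> * envelope \<eta> (M \<eta>) n x"
proof -
  have "\<forall>\<eta>\<in>Omega \<phi>. \<exists>C. C > 0 \<and> (\<exists>M>0. \<forall>n\<ge>1. \<forall>x. X \<eta> n x \<longrightarrow> f \<eta> n x \<le> C * envelope \<eta> M n x)"
    using assms by blast
  from bchoice[OF this] obtain C where C: "\<forall>\<eta>\<in>Omega \<phi>. C \<eta> > 0 \<and> (\<exists>M>0. \<forall>n\<ge>1. \<forall>x. X \<eta> n x \<longrightarrow> f \<eta> n x \<le> C \<eta> * envelope \<eta> M n x)" ..
  then have "\<forall>\<eta>\<in>Omega \<phi>. \<exists>M. M > 0 \<and> (\<forall>n\<ge>1. \<forall>x. X \<eta> n x \<longrightarrow> f \<eta> n x \<le> C \<eta> * envelope \<eta> M n x)" by blast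
  from bchoice[OF this] obtain M where "\<forall>\<eta>\<in>Omega \<phi>. M \<eta> > 0 \<and> (\<forall>n\<ge>1. \<forall>x. X \<eta> n x \<longrightarrow> f \<eta> n x \<le> C \<eta> * envelope \<eta> (M \<eta>) n x)" ..
  with C show thesis by (intro that[of C M]) auto
qed

lemma local_cutoff:
  assumes \<eta>: "\<eta> \<in> Omega \<phi>" and \<sigma>: "\<sigma> > 0"
  shows "\<exists>\<theta> \<tau>. continuous_on UNIV \<theta> \<and> (\<forall>\<xi>. 0 \<le> \<theta> \<xi> \<and> \<theta> \<xi> \<le> 1) \<and> (\<forall>\<xi>. dist \<xi> \<eta> \<ge> \<sigma> \<longrightarrow> \<theta> \<xi> = 0) \<and>
    \<tau> > 0 \<and> (\<forall>\<xi>. dist \<xi> \<eta> < \<tau> \<longrightarrow> \<theta> \<xi> = 1) \<and>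
    (\<forall>L>0. \<exists>C>0. \<exists>M>0. \<forall>n\<ge>1. \<forall>x. norm (rvec x) \<le> real n * L \<longrightarrow>
      norm (local_integral \<theta> n x - (2 * pi) ^ CARD('d) * lead \<eta> n x) \<le> C * envelope \<eta> M n x)"
proof -
  interpret pt: point_data "m \<eta>" "a \<eta>" \<phi> \<eta> "\<alpha> \<eta>" "P \<eta>" "\<Upsilon> \<eta>" "A \<eta>" by (rule point[OF \<eta>])
  have rate: "hom_order (P \<eta>) + pt.expo (\<gamma> \<eta>) = rate \<eta>" by (simp add: rate_def pt.expo_def)
  show ?thesis
    using pt.point_estimate[OF \<sigma>]
    unfolding rate local_integral_def[symmetric] lead_def[symmetric] Rsharp_def[symmetric] drift_def[symmetric] mult.assoc[of _ "_ powr _"] envelope_def[symmetric]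
    by metis
qed

text \<open>The cutoffs \<open>\<theta> \<eta>\<close> have disjoint supports inside the cell and equal \<open>1\<close> near their points, so that
  \<open>\<psi> = 1 - (\<Sum>\<eta>. \<theta> \<eta>)\<close> vanishes near \<open>Omega \<phi>\<close>.  On the rest of the cell compactness bounds the transform by
  some \<open>q < 1\<close>.\<close>

lemma localization:
  obtains W q :: real and \<theta> :: "real^'d \<Rightarrow> real^'d \<Rightarrow> real" where "W \<ge> 0" "0 < q" "q < 1"
    "\<And>n x. n \<ge> 1 \<Longrightarrow> norm ((2 * pi) ^ CARD('d) * conv_pow \<phi> n x - (\<Sum>\<eta>\<in>Omega \<phi>. local_integral (\<theta> \<eta>) n x)) \<le> W * q ^ n"
    "\<And>\<eta> L. \<eta> \<in> Omega \<phi> \<Longrightarrow> L > 0 \<Longrightarrow> \<exists>C>0. \<exists>M>0. \<forall>n\<ge>1. \<forall>x. norm (rvec x) \<le> real n * L \<longrightarrow>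
      norm (local_integral (\<theta> \<eta>) n x - (2 * pi) ^ CARD('d) * lead \<eta> n x) \<le> C * envelope \<eta> M n x"
proof -
  let ?O = "Omega \<phi>"
  obtain e d where e: "d > 0" "\<And>\<eta> \<xi>. \<eta> \<in> ?O \<Longrightarrow> dist \<xi> \<eta> < d \<Longrightarrow> \<xi> \<in> cube e"
    "\<And>\<xi>. \<xi> \<in> cube e \<Longrightarrow> norm (fhat \<phi> \<xi>) = 1 \<Longrightarrow> \<xi> \<in> ?O"
    using Omega_in_cube[OF finite_Omega] by metis
  obtain s where s: "s > 0" "\<And>\<eta> \<eta>'. \<eta> \<in> ?O \<Longrightarrow> \<eta>' \<in> ?O \<Longrightarrow> \<eta> \<noteq> \<eta>' \<Longrightarrow> s \<le> dist \<eta> \<eta>'"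
    using finite_separated[OF finite_Omega] by metis
  \<comment> \<open>small enough for the supports of the cutoffs to be disjoint and to lie in the cell\<close>
  define \<sigma> where "\<sigma> = min d (s / 2)"
  have \<sigma>: "\<sigma> > 0" "\<sigma> \<le> d" "2 * \<sigma> \<le> s" using e(1) s(1) by (auto simp: \<sigma>_def)
  have "\<forall>\<eta>\<in>?O. \<exists>\<theta> \<tau>. continuous_on UNIV \<theta> \<and> (\<forall>\<xi>. 0 \<le> \<theta> \<xi> \<and> \<theta> \<xi> \<le> 1) \<and> (\<forall>\<xi>. dist \<xi> \<eta> \<ge> \<sigma> \<longrightarrow> \<theta> \<xi> = 0) \<and>
    \<tau> > 0 \<and> (\<forall>\<xi>. dist \<xi> \<eta> < \<tau> \<longrightarrow> \<theta> \<xi> = 1) \<and>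
    (\<forall>L>0. \<exists>C>0. \<exists>M>0. \<forall>n\<ge>1. \<forall>x. norm (rvec x) \<le> real n * L \<longrightarrow>
      norm (local_integral \<theta> n x - (2 * pi) ^ CARD('d) * lead \<eta> n x) \<le> C * envelope \<eta> M n x)"
    using local_cutoff[OF _ \<sigma>(1)] by blast
  from bchoice[OF this] obtain \<theta> where "\<forall>\<eta>\<in>?O. \<exists>\<tau>. continuous_on UNIV (\<theta> \<eta>) \<and> (\<forall>\<xi>. 0 \<le> \<theta> \<eta> \<xi> \<and> \<theta> \<eta> \<xi> \<le> 1) \<and>
    (\<forall>\<xi>. dist \<xi> \<eta> \<ge> \<sigma> \<longrightarrow> \<theta> \<eta> \<xi> = 0) \<and> \<tau> > 0 \<and> (\<forall>\<xi>. dist \<xi> \<eta> < \<tau> \<longrightarrow> \<theta> \<eta> \<xi> = 1) \<and>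
    (\<forall>L>0. \<exists>C>0. \<exists>M>0. \<forall>n\<ge>1. \<forall>x. norm (rvec x) \<le> real n * L \<longrightarrow>
      norm (local_integral (\<theta> \<eta>) n x - (2 * pi) ^ CARD('d) * lead \<eta> n x) \<le> C * envelope \<eta> M n x)" ..
  from bchoice[OF this] obtain \<tau> where \<theta>\<tau>: "\<forall>\<eta>\<in>?O. continuous_on UNIV (\<theta> \<eta>) \<and> (\<forall>\<xi>. 0 \<le> \<theta> \<eta> \<xi> \<and> \<theta> \<eta> \<xi> \<le> 1) \<and>
    (\<forall>\<xi>. dist \<xi> \<eta> \<ge> \<sigma> \<longrightarrow> \<theta> \<eta> \<xi> = 0) \<and> \<tau> \<eta> > 0 \<and> (\<forall>\<xi>. dist \<xi> \<eta> < \<tau> \<eta> \<longrightarrow> \<theta> \<eta> \<xi> = 1) \<and>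
    (\<forall>L>0. \<exists>C>0. \<exists>M>0. \<forall>n\<ge>1. \<forall>x. norm (rvec x) \<le> real n * L \<longrightarrow>
      norm (local_integral (\<theta> \<eta>) n x - (2 * pi) ^ CARD('d) * lead \<eta> n x) \<le> C * envelope \<eta> M n x)" ..
  have t: "continuous_on UNIV (\<theta> \<eta>)" "\<And>\<xi>. 0 \<le> \<theta> \<eta> \<xi>" "\<And>\<xi>. \<theta> \<eta> \<xi> \<le> 1" "\<And>\<xi>. dist \<xi> \<eta> \<ge> \<sigma> \<Longrightarrow> \<theta> \<eta> \<xi> = 0" "\<tau> \<eta> > 0"
    "\<And>\<xi>. dist \<xi> \<eta> < \<tau> \<eta> \<Longrightarrow> \<theta> \<eta> \<xi> = 1" if "\<eta> \<in> ?O" for \<eta>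
    using bspec[OF \<theta>\<tau> that] by blast+
  define \<psi> where "\<psi> \<xi> = 1 - (\<Sum>\<eta>\<in>?O. \<theta> \<eta> \<xi>)" for \<xi>
  define B where "B = 1 + real (card ?O)"
  have B: "B > 0" by (simp add: B_def)
  have \<psi>b: "\<bar>\<psi> \<xi>\<bar> \<le> B" for \<xi>
  proof -
    have "0 \<le> (\<Sum>\<eta>\<in>?O. \<theta> \<eta> \<xi>)" by (intro sum_nonneg t)
    moreover have "(\<Sum>\<eta>\<in>?O. \<theta> \<eta> \<xi>) \<le> (\<Sum>\<eta>\<in>?O. 1)" by (intro sum_mono t)
    ultimately show ?thesis by (simp add: \<psi>_def B_def)
  qed
  have \<psi>0: "\<psi> \<xi> = 0" if \<eta>: "\<eta> \<in> ?O" "dist \<xi> \<eta> < min \<sigma> (\<tau> \<eta>)" for \<xi> \<eta>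
  proof -
    have "(\<Sum>\<eta>'\<in>?O. \<theta> \<eta>' \<xi>) = (\<Sum>\<eta>'\<in>?O. if \<eta>' = \<eta> then 1 else 0)"
    proof (rule sum.cong[OF refl])
      fix \<eta>' assume \<eta>': "\<eta>' \<in> ?O"
      show "\<theta> \<eta>' \<xi> = (if \<eta>' = \<eta> then 1 else 0)"
      proof (cases "\<eta>' = \<eta>")
        case True then show ?thesis using t(6)[OF \<eta>(1)] \<eta>(2) by simp
      next
        case False
        have "s \<le> dist \<eta> \<eta>'" using s(2)[OF \<eta>(1) \<eta>'] False by blast
        also have "\<dots> \<le> dist \<xi> \<eta> + dist \<xi> \<eta>'" by (metis dist_commute dist_triangle)
        finally have "dist \<xi> \<eta>' \<ge> \<sigma>" using \<eta>(2) \<sigma> by simp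
        then show ?thesis using t(4)[OF \<eta>'] False by simp
      qed
    qed
    then show ?thesis using finite_Omega \<eta>(1) by (simp add: \<psi>_def)
  qed
  have \<psi>c: "continuous_on UNIV \<psi>" unfolding \<psi>_def by (intro continuous_intros t(1))
  \<comment> \<open>compactness of the cell without small balls about Omega bounds the transform away from 1\<close>
  obtain q where q: "0 < q" "q < 1" "\<And>\<xi>. \<xi> \<in> cube e \<Longrightarrow> \<psi> \<xi> \<noteq> 0 \<Longrightarrow> norm (fhat \<phi> \<xi>) \<le> q"
  proof -
    let ?K = "cube e - (\<Union>\<eta>\<in>?O. ball \<eta> (min \<sigma> (\<tau> \<eta>)))"
    have K: "compact ?K" by (intro compact_diff compact_cube open_UN ballI open_ball)
    have inK: "\<xi> \<in> ?K" if "\<xi> \<in> cube e" "\<psi> \<xi> \<noteq> 0" for \<xi>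
      using that \<psi>0[of _ \<xi>] by (auto simp: dist_commute)
    show thesis
    proof (cases "?K = {}")
      case True
      show ?thesis
      proof (rule that[of "1/2"])
        fix \<xi> assume "\<xi> \<in> cube e" "\<psi> \<xi> \<noteq> 0"
        from inK[OF this] show "norm (fhat \<phi> \<xi>) \<le> 1/2" unfolding True by blast
      qed simp_all
    next
      case False
      have "continuous_on ?K (\<lambda>\<xi>. norm (fhat \<phi> \<xi>))" by (intro continuous_intros continuous_fhat l1_phi)
      from continuous_attains_sup[OF K False this] obtain z where z: "z \<in> ?K" "\<And>\<xi>. \<xi> \<in> ?K \<Longrightarrow> norm (fhat \<phi> \<xi>) \<le> norm (fhat \<phi> z)" by blast
      have "norm (fhat \<phi> z) \<noteq> 1"
      proof
        assume "norm (fhat \<phi> z) = 1"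
        then have "z \<in> ?O" using e(3) z(1) by blast
        then have "z \<in> ball z (min \<sigma> (\<tau> z))" using \<sigma>(1) t(5) by simp
        then show False using z(1) \<open>z \<in> ?O\<close> by blast
      qed
      then have "norm (fhat \<phi> z) < 1" using norm_fhat_le_1[OF star, of z] by linarith
      then show ?thesis using that[of "max (1/2) (norm (fhat \<phi> z))"] z(2) inK by fastforce
    qed
  qed
  have cubefin: "integrable lborel (indicator (cube e :: (real^'d) set) :: _ \<Rightarrow> real)"
  proof -
    have "compact (cube e :: (real^'d) set)" by (rule compact_cube)
    then show ?thesis
      by (intro integrable_real_indicator) (use emeasure_bounded_finite[OF compact_imp_bounded] in \<open>auto simp: compact_imp_closed\<close>)
  qed
  define vol where "vol = (\<integral>\<xi>. indicator (cube e :: (real^'d) set) \<xi> \<partial>lborel :: real)"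
  have vol: "vol \<ge> 0" unfolding vol_def by simp
  have int: "integrable lborel (\<lambda>\<xi>. indicator (cube e) \<xi> *\<^sub>R h \<xi>)" if "continuous_on UNIV h" for h :: "real^'d \<Rightarrow> complex"
    using borel_integrable_compact[OF compact_cube continuous_on_subset[OF that]] by simp
  have dec: "norm ((2 * pi) ^ CARD('d) * conv_pow \<phi> n x - (\<Sum>\<eta>\<in>?O. local_integral (\<theta> \<eta>) n x)) \<le> vol * B * q ^ n"
    if n: "n \<ge> 1" for n x
  proof -
    let ?h = "\<lambda>\<xi>. fhat \<phi> \<xi> ^ n * chr (- x) \<xi>"
    have hc: "continuous_on UNIV ?h" by (intro continuous_intros continuous_fhat l1_phi)
    have \<theta>i: "(\<lambda>\<xi>. \<theta> \<eta> \<xi> *\<^sub>R ?h \<xi>) = (\<lambda>\<xi>. indicator (cube e) \<xi> *\<^sub>R (\<theta> \<eta> \<xi> *\<^sub>R ?h \<xi>))" if \<eta>: "\<eta> \<in> ?O" for \<eta>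
    proof
      fix \<xi>
      show "\<theta> \<eta> \<xi> *\<^sub>R ?h \<xi> = indicator (cube e) \<xi> *\<^sub>R (\<theta> \<eta> \<xi> *\<^sub>R ?h \<xi>)"
      proof (cases "dist \<xi> \<eta> < \<sigma>")
        case True
        then have "\<xi> \<in> cube e" using e(2)[OF \<eta>] \<sigma> by simp
        then show ?thesis by simp
      qed (use t(4)[OF \<eta>] in simp)
    qed
    have \<theta>int: "integrable lborel (\<lambda>\<xi>. \<theta> \<eta> \<xi> *\<^sub>R ?h \<xi>)" if \<eta>: "\<eta> \<in> ?O" for \<eta>
      unfolding \<theta>i[OF \<eta>] by (intro int continuous_on_scaleR t(1)[OF \<eta>] hc)
    have "(2 * pi) ^ CARD('d) * conv_pow \<phi> n x = (\<integral>\<xi>. indicator (cube e) \<xi> *\<^sub>R ?h \<xi> \<partial>lborel)"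
      using fourier_inversion[OF l1_conv_pow[OF l1_phi n], of e x] by (simp add: fhat_conv_pow[OF l1_phi n])
    also have "\<dots> = (\<integral>\<xi>. (\<Sum>\<eta>\<in>?O. \<theta> \<eta> \<xi> *\<^sub>R ?h \<xi>) + indicator (cube e) \<xi> *\<^sub>R (\<psi> \<xi> *\<^sub>R ?h \<xi>) \<partial>lborel)"
    proof (intro Bochner_Integration.integral_cong refl)
      fix \<xi>
      have "(\<Sum>\<eta>\<in>?O. \<theta> \<eta> \<xi> *\<^sub>R ?h \<xi>) = (\<Sum>\<eta>\<in>?O. indicator (cube e) \<xi> *\<^sub>R (\<theta> \<eta> \<xi> *\<^sub>R ?h \<xi>))"
        by (rule sum.cong[OF refl]) (metis \<theta>i)
      also have "\<dots> = indicator (cube e) \<xi> *\<^sub>R ((\<Sum>\<eta>\<in>?O. \<theta> \<eta> \<xi>) *\<^sub>R ?h \<xi>)"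
        by (simp only: scaleR_sum_right scaleR_sum_left)
      finally show "indicator (cube e) \<xi> *\<^sub>R ?h \<xi> = (\<Sum>\<eta>\<in>?O. \<theta> \<eta> \<xi> *\<^sub>R ?h \<xi>) + indicator (cube e) \<xi> *\<^sub>R (\<psi> \<xi> *\<^sub>R ?h \<xi>)"
        by (simp add: \<psi>_def algebra_simps)
    qed
    also have "\<dots> = (\<Sum>\<eta>\<in>?O. local_integral (\<theta> \<eta>) n x) + (\<integral>\<xi>. indicator (cube e) \<xi> *\<^sub>R (\<psi> \<xi> *\<^sub>R ?h \<xi>) \<partial>lborel)"
      unfolding local_integral_def
      by (subst Bochner_Integration.integral_add, intro Bochner_Integration.integrable_sum \<theta>int, assumption, intro int continuous_on_scaleR \<psi>c hc)
         (simp add: Bochner_Integration.integral_sum \<theta>int)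
    finally have "(2 * pi) ^ CARD('d) * conv_pow \<phi> n x - (\<Sum>\<eta>\<in>?O. local_integral (\<theta> \<eta>) n x) = (\<integral>\<xi>. indicator (cube e) \<xi> *\<^sub>R (\<psi> \<xi> *\<^sub>R ?h \<xi>) \<partial>lborel)"
      by simp
    also have "norm \<dots> \<le> (\<integral>\<xi>. (B * q ^ n) * indicator (cube e :: (real^'d) set) \<xi> \<partial>lborel)"
    proof (rule Bochner_Integration.integral_norm_bound_integral)
      show "integrable lborel (\<lambda>\<xi>. indicator (cube e) \<xi> *\<^sub>R (\<psi> \<xi> *\<^sub>R ?h \<xi>))" by (intro int continuous_on_scaleR \<psi>c hc)
      show "integrable lborel (\<lambda>\<xi>. (B * q ^ n) * indicator (cube e :: (real^'d) set) \<xi>)" by (intro integrable_mult_right cubefin)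
      fix \<xi>
      show "norm (indicator (cube e) \<xi> *\<^sub>R (\<psi> \<xi> *\<^sub>R ?h \<xi>)) \<le> (B * q ^ n) * indicator (cube e :: (real^'d) set) \<xi>"
      proof (cases "\<xi> \<in> cube e \<and> \<psi> \<xi> \<noteq> 0")
        case True
        then have "norm (fhat \<phi> \<xi>) ^ n \<le> q ^ n" using q(3) by (intro power_mono) auto
        then have "\<bar>\<psi> \<xi>\<bar> * norm (fhat \<phi> \<xi>) ^ n \<le> B * q ^ n" using \<psi>b[of \<xi>] B by (intro mult_mono) auto
        then show ?thesis using True by (simp add: norm_mult norm_power)
      next
        case False then show ?thesis using B q(1) by auto
      qed
    qed
    also have "\<dots> = vol * B * q ^ n" by (simp add: vol_def)
    finally show ?thesis .
  qed
  show thesis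
  proof (rule that[of "vol * B" q \<theta>])
    show "vol * B \<ge> 0" using vol B by simp
    show "\<exists>C>0. \<exists>M>0. \<forall>n\<ge>1. \<forall>x. norm (rvec x) \<le> real n * L \<longrightarrow>
      norm (local_integral (\<theta> \<eta>) n x - (2 * pi) ^ CARD('d) * lead \<eta> n x) \<le> C * envelope \<eta> M n x"
      if "\<eta> \<in> ?O" "L > 0" for \<eta> L
      using bspec[OF \<theta>\<tau> that(1)] that(2) by blast
  qed (use q dec in auto)
qed

lemma geometric_le_envelope:
  assumes \<eta>: "\<eta> \<in> Omega \<phi>" and q: "0 < q" "q < 1"
  shows "\<exists>C>0. \<exists>M>0. \<forall>n\<ge>1. \<forall>x. norm (rvec x) \<le> real n * L \<longrightarrow> q ^ n \<le> C * envelope \<eta> M n x"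
proof -
  define \<kappa> where "\<kappa> = - ln q"
  have \<kappa>: "\<kappa> > 0" using q by (simp add: \<kappa>_def ln_less_zero)
  have qn: "q ^ n = exp (- \<kappa> * real n)" for n
    using q(1) by (simp add: \<kappa>_def mult.commute[of "ln q"] exp_of_nat_mult)
  have rate: "rate \<eta> > 0" using rate_split[OF \<eta>] by linarith
  obtain B where B: "B > 0" "\<And>y. norm y \<le> L + norm (\<alpha> \<eta>) \<Longrightarrow> Rsharp \<eta> y \<le> B"
    using point_data.legendre_P_bounded[OF point[OF \<eta>]] unfolding Rsharp_def by metis
  obtain C M where CM: "C > 0" "M > 0" "\<And>n l. n \<ge> 1 \<Longrightarrow> l \<le> B \<Longrightarrow> exp (- \<kappa> * n) \<le> C * n powr (- rate \<eta>) * exp (- n * M * l)"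
    using exponential_absorb[OF \<kappa> B(1) rate] by metis
  have "q ^ n \<le> C * envelope \<eta> M n x" if "n \<ge> 1" "norm (rvec x) \<le> real n * L" for n x
  proof -
    have "drift \<eta> n x = (1 / real n) *\<^sub>R rvec x - \<alpha> \<eta>" using that by (simp add: drift_def scaleR_diff_right)
    then have "norm (drift \<eta> n x) \<le> norm ((1 / real n) *\<^sub>R rvec x) + norm (\<alpha> \<eta>)" by (metis norm_triangle_ineq4)
    also have "norm ((1 / real n) *\<^sub>R rvec x) \<le> L" using that by (simp add: divide_le_eq mult.commute)
    finally have "Rsharp \<eta> (drift \<eta> n x) \<le> B" by (intro B(2)) simp
    then show ?thesis unfolding qn envelope_def using CM(3)[of "real n"] that by (simp add: mult.assoc)
  qed
  then show ?thesis using CM(1,2) by blast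
qed

text \<open>Sum the local estimates.  The error \<open>W * q ^ n\<close> of the localization is charged to the envelopes, of which
  there is at least one because the transform attains its maximum modulus.\<close>

theorem estimate_in_ball:
  assumes L: "L > 0"
  obtains M C where "\<And>\<eta>. \<eta> \<in> Omega \<phi> \<Longrightarrow> M \<eta> > 0" "\<And>\<eta>. \<eta> \<in> Omega \<phi> \<Longrightarrow> C \<eta> > 0"
    "\<And>n x. n \<ge> 1 \<Longrightarrow> norm (rvec x) \<le> real n * L \<Longrightarrow> llt_error \<phi> \<alpha> P n x \<le> llt_bound \<phi> \<alpha> P m \<gamma> C M n x"
proof (rule localization)
  let ?O = "Omega \<phi>" let ?V = "(2 * pi) ^ CARD('d)"
  fix W q :: real and \<theta> :: "real^'d \<Rightarrow> real^'d \<Rightarrow> real"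
  assume loc: "W \<ge> 0" "0 < q" "q < 1"
    "\<And>n x. n \<ge> 1 \<Longrightarrow> norm (?V * conv_pow \<phi> n x - (\<Sum>\<eta>\<in>?O. local_integral (\<theta> \<eta>) n x)) \<le> W * q ^ n"
    "\<And>\<eta> L. \<eta> \<in> ?O \<Longrightarrow> L > 0 \<Longrightarrow> \<exists>C>0. \<exists>M>0. \<forall>n\<ge>1. \<forall>x. norm (rvec x) \<le> real n * L \<longrightarrow>
      norm (local_integral (\<theta> \<eta>) n x - ?V * lead \<eta> n x) \<le> C * envelope \<eta> M n x"
  obtain C1 M1 where 1: "\<And>\<eta>. \<eta> \<in> ?O \<Longrightarrow> C1 \<eta> > 0" "\<And>\<eta>. \<eta> \<in> ?O \<Longrightarrow> M1 \<eta> > 0"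
    "\<And>\<eta> n x. \<eta> \<in> ?O \<Longrightarrow> n \<ge> 1 \<Longrightarrow> norm (rvec x) \<le> real n * L \<Longrightarrow>
      norm (local_integral (\<theta> \<eta>) n x - ?V * lead \<eta> n x) \<le> C1 \<eta> * envelope \<eta> (M1 \<eta>) n x"
    by (rule choose_constants[where X="\<lambda>\<eta> n x. norm (rvec x) \<le> real n * L" and f="\<lambda>\<eta> n x. norm (local_integral (\<theta> \<eta>) n x - ?V * lead \<eta> n x)"]) (use loc(5) L in blast)+
  obtain C2 M2 where 2: "\<And>\<eta>. \<eta> \<in> ?O \<Longrightarrow> C2 \<eta> > 0" "\<And>\<eta>. \<eta> \<in> ?O \<Longrightarrow> M2 \<eta> > 0"
    "\<And>\<eta> n x. \<eta> \<in> ?O \<Longrightarrow> n \<ge> 1 \<Longrightarrow> norm (rvec x) \<le> real n * L \<Longrightarrow> q ^ n \<le> C2 \<eta> * envelope \<eta> (M2 \<eta>) n x"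
    by (rule choose_constants[where X="\<lambda>\<eta> n x. norm (rvec x) \<le> real n * L" and f="\<lambda>\<eta> n x. q ^ n"]) (use geometric_le_envelope[OF _ loc(2,3)] in blast)+
  define M where "M \<eta> = min (M1 \<eta>) (M2 \<eta>)" for \<eta>
  define C where "C \<eta> = (C1 \<eta> + W * C2 \<eta>) / ?V" for \<eta>
  show thesis
  proof (rule that[of M C])
    show "M \<eta> > 0" "C \<eta> > 0" if "\<eta> \<in> ?O" for \<eta>
      using 1(1,2)[OF that] 2(1,2)[OF that] loc(1) by (auto simp: M_def C_def intro!: divide_pos_pos add_pos_nonneg)
    fix n :: nat and x :: "int^'d" assume n: "n \<ge> 1" and x: "norm (rvec x) \<le> real n * L"
    let ?E = "\<lambda>\<eta>. envelope \<eta> (M \<eta>) n x" and ?I = "\<lambda>\<eta>. local_integral (\<theta> \<eta>) n x"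
    have le: "C' * envelope \<eta> M' n x \<le> C' * ?E \<eta>" if "\<eta> \<in> ?O" "C' > 0" "M \<eta> \<le> M'" for \<eta> C' M'
      using that by (intro mult_left_mono envelope_antimono) auto
    have a: "norm (?I \<eta> - ?V * lead \<eta> n x) \<le> C1 \<eta> * ?E \<eta>" if "\<eta> \<in> ?O" for \<eta>
      by (rule order_trans[OF 1(3)[OF that n x] le]) (use 1 that in \<open>auto simp: M_def\<close>)
    have b: "q ^ n \<le> (\<Sum>\<eta>\<in>?O. C2 \<eta> * ?E \<eta>)"
    proof -
      obtain \<eta> where \<eta>: "\<eta> \<in> ?O" using Omega_nonempty[OF star] by blast
      have "q ^ n \<le> C2 \<eta> * ?E \<eta>"
        by (rule order_trans[OF 2(3)[OF \<eta> n x] le]) (use 2 \<eta> in \<open>auto simp: M_def\<close>)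
      also have "\<dots> \<le> (\<Sum>\<eta>\<in>?O. C2 \<eta> * ?E \<eta>)"
        by (rule member_le_sum[OF \<eta> _ finite_Omega]) (auto intro!: mult_nonneg_nonneg envelope_nonneg simp: less_imp_le[OF 2(1)])
      finally show ?thesis .
    qed
    have "?V * llt_error \<phi> \<alpha> P n x = norm (?V * conv_pow \<phi> n x - (\<Sum>\<eta>\<in>?O. ?V * lead \<eta> n x))"
    proof -
      have "?V * conv_pow \<phi> n x - (\<Sum>\<eta>\<in>?O. ?V * lead \<eta> n x) = of_real ?V * (conv_pow \<phi> n x - (\<Sum>\<eta>\<in>?O. lead \<eta> n x))"
        by (simp add: sum_distrib_left right_diff_distrib)
      then show ?thesis unfolding llt_error_lead by (simp only: norm_mult norm_of_real) simp
    qed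
    also have "\<dots> = norm ((?V * conv_pow \<phi> n x - (\<Sum>\<eta>\<in>?O. ?I \<eta>)) + (\<Sum>\<eta>\<in>?O. ?I \<eta> - ?V * lead \<eta> n x))"
      by (simp add: sum_subtractf)
    also have "\<dots> \<le> W * q ^ n + (\<Sum>\<eta>\<in>?O. C1 \<eta> * ?E \<eta>)"
      by (intro order_trans[OF norm_triangle_ineq] add_mono loc(4)[OF n] sum_norm_le a)
    also have "\<dots> \<le> W * (\<Sum>\<eta>\<in>?O. C2 \<eta> * ?E \<eta>) + (\<Sum>\<eta>\<in>?O. C1 \<eta> * ?E \<eta>)"
      using loc(1) b by (intro add_right_mono mult_left_mono)
    also have "\<dots> = (\<Sum>\<eta>\<in>?O. (C1 \<eta> + W * C2 \<eta>) * ?E \<eta>)"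
      by (simp add: sum_distrib_left sum.distrib[symmetric] distrib_right mult.assoc add.commute)
    also have "\<dots> = ?V * llt_bound \<phi> \<alpha> P m \<gamma> C M n x"
      unfolding llt_bound_envelope C_def sum_distrib_left by (intro sum.cong refl) simp
    finally show "llt_error \<phi> \<alpha> P n x \<le> llt_bound \<phi> \<alpha> P m \<gamma> C M n x"
      by (rule mult_left_le_imp_le) simp
  qed
qed

text \<open>Far out the Legendre transform is bounded below, so that half of the exponential decay of the attractor
  supplies the missing power \<open>n powr - (rate \<eta> - hom_order (P \<eta>))\<close>.\<close>

lemma attractor_far:
  assumes \<eta>: "\<eta> \<in> Omega \<phi>"
  shows "\<exists>D>0. \<exists>C>0. \<exists>M>0. \<forall>n\<ge>1. \<forall>x. norm (drift \<eta> n x) \<ge> D \<longrightarrow> norm (lead \<eta> n x) \<le> C * envelope \<eta> M n x"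
proof -
  interpret pt: point_data "m \<eta>" "a \<eta>" \<phi> \<eta> "\<alpha> \<eta>" "P \<eta>" "\<Upsilon> \<eta>" "A \<eta>" by (rule point[OF \<eta>])
  obtain D l where D: "D > 0" "l > 0" "\<And>y. norm y \<ge> D \<Longrightarrow> Rsharp \<eta> y \<ge> l"
    using pt.legendre_P_lower unfolding Rsharp_def by metis
  obtain C M where CM: "C > 0" "M > 0" "\<And>n y. n > 0 \<Longrightarrow>
    norm (attractor (P \<eta>) n y) \<le> C * n powr (- hom_order (P \<eta>)) * exp (- n * M * Rsharp \<eta> ((1/n) *\<^sub>R y))"
    using pt.attractor_P_bound unfolding Rsharp_def by metis
  let ?q = "rate \<eta> - hom_order (P \<eta>)"
  have "M * l / 2 > 0" using CM(2) D(2) by simp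
  from exp_absorbs_powr[OF rate_split(2)[OF \<eta>] this] obtain Ce where
    Ce: "Ce > 0" "\<And>n. n \<ge> 1 \<Longrightarrow> exp (- (M * l / 2) * n) \<le> Ce * n powr (- ?q)" by blast
  have "norm (lead \<eta> n x) \<le> (C * Ce) * envelope \<eta> (M / 2) n x" if n: "n \<ge> 1" and x: "norm (drift \<eta> n x) \<ge> D" for n x
  proof -
    let ?l = "Rsharp \<eta> (drift \<eta> n x)"
    let ?e = "exp (- real n * (M / 2) * ?l)"
    have n1: "real n \<ge> 1" using n by simp
    have "norm (lead \<eta> n x) = norm (attractor (P \<eta>) (real n) (rvec x - real n *\<^sub>R \<alpha> \<eta>))"
      using pt.eta by (simp add: lead_def norm_mult norm_power)
    also have "\<dots> \<le> C * real n powr (- hom_order (P \<eta>)) * exp (- real n * M * ?l)"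
      using CM(3)[of "real n"] n1 by (simp add: drift_def)
    also have "exp (- real n * M * ?l) = ?e * ?e" by (simp add: exp_add[symmetric])
    also have "C * real n powr (- hom_order (P \<eta>)) * (?e * ?e) \<le> C * real n powr (- hom_order (P \<eta>)) * (?e * (Ce * real n powr (- ?q)))"
    proof (intro mult_left_mono)
      have "real n * (M/2) * l \<le> real n * (M/2) * ?l" using D(3)[OF x] CM(2) by (intro mult_left_mono) auto
      then have "?e \<le> exp (- (M * l / 2) * real n)" by (simp add: mult_ac)
      also have "\<dots> \<le> Ce * real n powr (- ?q)" by (rule Ce(2)[OF n1])
      finally show "?e \<le> Ce * real n powr (- ?q)" .
    qed (use CM(1) in auto)
    also have "\<dots> = (C * Ce) * ((real n powr (- hom_order (P \<eta>)) * real n powr (- ?q)) * ?e)" by (simp add: mult_ac)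
    also have "real n powr (- hom_order (P \<eta>)) * real n powr (- ?q) = real n powr (- rate \<eta>)" by (simp add: powr_add[symmetric])
    finally show ?thesis by (simp only: envelope_def)
  qed
  moreover have "C * Ce > 0" "M / 2 > 0" using CM(1,2) Ce(1) by auto
  ultimately show ?thesis using D(1) by blast
qed

text \<open>Inside a large ball this is \<open>estimate_in_ball\<close>.  Outside, the convolution power vanishes and the attractors
  alone satisfy the bound.\<close>

theorem estimate_finite_support:
  assumes supp: "finite {x. \<phi> x \<noteq> 0}"
  obtains M C where "\<And>\<eta>. \<eta> \<in> Omega \<phi> \<Longrightarrow> M \<eta> > 0" "\<And>\<eta>. \<eta> \<in> Omega \<phi> \<Longrightarrow> C \<eta> > 0"
    "\<And>n x. n \<ge> 1 \<Longrightarrow> llt_error \<phi> \<alpha> P n x \<le> llt_bound \<phi> \<alpha> P m \<gamma> C M n x"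
proof -
  let ?O = "Omega \<phi>"
  define r where "r = Max (insert 0 ((\<lambda>x. norm (rvec x)) ` {x. \<phi> x \<noteq> 0}))"
  have r: "norm (rvec x) \<le> r" if "\<phi> x \<noteq> 0" for x unfolding r_def using supp that by (intro Max_ge) auto
  have "\<forall>\<eta>\<in>?O. \<exists>D. D > 0 \<and> (\<exists>C>0. \<exists>M>0. \<forall>n\<ge>1. \<forall>x. norm (drift \<eta> n x) \<ge> D \<longrightarrow> norm (lead \<eta> n x) \<le> C * envelope \<eta> M n x)"
    using attractor_far by blast
  from bchoice[OF this] obtain D where D: "\<forall>\<eta>\<in>?O. D \<eta> > 0 \<and> (\<exists>C>0. \<exists>M>0. \<forall>n\<ge>1. \<forall>x. norm (drift \<eta> n x) \<ge> D \<eta> \<longrightarrow> norm (lead \<eta> n x) \<le> C * envelope \<eta> M n x)" ..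
  obtain C2 M2 where 2: "\<And>\<eta>. \<eta> \<in> ?O \<Longrightarrow> C2 \<eta> > 0" "\<And>\<eta>. \<eta> \<in> ?O \<Longrightarrow> M2 \<eta> > 0"
    "\<And>\<eta> n x. \<eta> \<in> ?O \<Longrightarrow> n \<ge> 1 \<Longrightarrow> norm (drift \<eta> n x) \<ge> D \<eta> \<Longrightarrow> norm (lead \<eta> n x) \<le> C2 \<eta> * envelope \<eta> (M2 \<eta>) n x"
    by (rule choose_constants[where X="\<lambda>\<eta> n x. norm (drift \<eta> n x) \<ge> D \<eta>" and f="\<lambda>\<eta> n x. norm (lead \<eta> n x)"]) (use D in blast)+
  \<comment> \<open>beyond the radius n L both the convolution power vanishes and every attractor is far out\<close>
  define L where "L = 1 + \<bar>r\<bar> + (\<Sum>\<eta>\<in>?O. norm (\<alpha> \<eta>) + D \<eta>)"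
  have nonneg: "0 \<le> norm (\<alpha> \<eta>) + D \<eta>" if "\<eta> \<in> ?O" for \<eta> using D that by (auto intro: add_nonneg_nonneg less_imp_le)
  have LD: "norm (\<alpha> \<eta>) + D \<eta> \<le> L" if "\<eta> \<in> ?O" for \<eta>
  proof -
    have "norm (\<alpha> \<eta>) + D \<eta> \<le> (\<Sum>\<eta>\<in>?O. norm (\<alpha> \<eta>) + D \<eta>)"
      by (rule member_le_sum[OF that _ finite_Omega]) (use nonneg in blast)
    then show ?thesis by (simp add: L_def)
  qed
  have "0 \<le> (\<Sum>\<eta>\<in>?O. norm (\<alpha> \<eta>) + D \<eta>)" by (rule sum_nonneg[OF nonneg])
  then have L: "L > 0" "r \<le> L" by (auto simp: L_def)
  obtain M1 C1 where 1: "\<And>\<eta>. \<eta> \<in> ?O \<Longrightarrow> M1 \<eta> > 0" "\<And>\<eta>. \<eta> \<in> ?O \<Longrightarrow> C1 \<eta> > 0"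
    "\<And>n x. n \<ge> 1 \<Longrightarrow> norm (rvec x) \<le> real n * L \<Longrightarrow> llt_error \<phi> \<alpha> P n x \<le> llt_bound \<phi> \<alpha> P m \<gamma> C1 M1 n x"
    using estimate_in_ball[OF L(1)] by blast
  define M where "M \<eta> = min (M1 \<eta>) (M2 \<eta>)" for \<eta>
  define C where "C \<eta> = max (C1 \<eta>) (C2 \<eta>)" for \<eta>
  have le: "C' * envelope \<eta> M' n x \<le> C \<eta> * envelope \<eta> (M \<eta>) n x"
    if "\<eta> \<in> ?O" "C' > 0" "C' \<le> C \<eta>" "M \<eta> \<le> M'" for \<eta> C' M' n x
    using that by (intro mult_mono envelope_antimono envelope_nonneg) auto
  show thesis
  proof (rule that[of M C])
    show "M \<eta> > 0" "C \<eta> > 0" if "\<eta> \<in> ?O" for \<eta>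
      using 1(1,2)[OF that] 2(1,2)[OF that] by (auto simp: M_def C_def)
    fix n :: nat and x :: "int^'d" assume n: "n \<ge> 1"
    show "llt_error \<phi> \<alpha> P n x \<le> llt_bound \<phi> \<alpha> P m \<gamma> C M n x"
    proof (cases "norm (rvec x) \<le> real n * L")
      case True
      have "llt_error \<phi> \<alpha> P n x \<le> llt_bound \<phi> \<alpha> P m \<gamma> C1 M1 n x" by (rule 1(3)[OF n True])
      also have "\<dots> \<le> llt_bound \<phi> \<alpha> P m \<gamma> C M n x"
        unfolding llt_bound_envelope by (intro sum_mono le 1) (auto simp: C_def M_def)
      finally show ?thesis .
    next
      case False
      have "conv_pow \<phi> n x = 0"
      proof (rule ccontr)
        assume "conv_pow \<phi> n x \<noteq> 0"
        from conv_pow_support[OF r n this] have "norm (rvec x) \<le> real n * r" .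
        also have "\<dots> \<le> real n * L" using L by (intro mult_left_mono) auto
        finally show False using False by simp
      qed
      then have "llt_error \<phi> \<alpha> P n x \<le> (\<Sum>\<eta>\<in>?O. norm (lead \<eta> n x))"
        unfolding llt_error_lead by (simp add: norm_sum)
      also have "\<dots> \<le> (\<Sum>\<eta>\<in>?O. C2 \<eta> * envelope \<eta> (M2 \<eta>) n x)"
      proof (intro sum_mono 2(3) n)
        fix \<eta> assume \<eta>: "\<eta> \<in> ?O"
        have "drift \<eta> n x = (1 / real n) *\<^sub>R rvec x - \<alpha> \<eta>" using n by (simp add: drift_def scaleR_diff_right)
        then have "norm (drift \<eta> n x) \<ge> norm ((1 / real n) *\<^sub>R rvec x) - norm (\<alpha> \<eta>)" by (metis norm_triangle_ineq2)
        moreover have "norm ((1 / real n) *\<^sub>R rvec x) \<ge> L" using False n by (simp add: le_divide_eq mult.commute)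
        ultimately show "norm (drift \<eta> n x) \<ge> D \<eta>" using LD[OF \<eta>] by linarith
      qed
      also have "\<dots> \<le> llt_bound \<phi> \<alpha> P m \<gamma> C M n x"
        unfolding llt_bound_envelope by (intro sum_mono le 2(1)) (auto simp: C_def M_def)
      finally show ?thesis .
    qed
  qed
qed

end

theorem corollary1p12:
  fixes \<phi> :: "int ^ 'd \<Rightarrow> complex"
    and \<alpha> :: "real ^ 'd \<Rightarrow> real ^ 'd"
    and P :: "real ^ 'd \<Rightarrow> real ^ 'd \<Rightarrow> complex"
    and \<Upsilon> :: "real ^ 'd \<Rightarrow> complex ^ 'd \<Rightarrow> complex"
    and A :: "real ^ 'd \<Rightarrow> real ^ 'd ^ 'd"
    and m :: "real ^ 'd \<Rightarrow> nat ^ 'd"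
  defines "\<gamma> \<equiv> \<lambda>\<eta>. gamma_ord (\<Upsilon> \<eta>) (A \<eta>) (m \<eta>)"
  assumes "\<phi> \<in> H_star"
    and "\<And>\<eta>. \<eta> \<in> Omega \<phi> \<Longrightarrow> pos_hom_type_with \<phi> \<eta> (\<alpha> \<eta>) (P \<eta>) (\<Upsilon> \<eta>)"
    and "\<And>\<eta>. \<eta> \<in> Omega \<phi> \<Longrightarrow> invertible (A \<eta>)"
    and "\<And>\<eta>. \<eta> \<in> Omega \<phi> \<Longrightarrow> pos_semi_elliptic (\<lambda>\<xi>. P \<eta> (A \<eta> *v \<xi>)) (m \<eta>)"
  shows "finite (Omega \<phi>) \<and>
    (\<forall>L>0. \<exists>M C. (\<forall>\<eta>\<in>Omega \<phi>. M \<eta> > 0 \<and> C \<eta> > 0) \<and>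
       (\<forall>n\<ge>1. \<forall>x. norm (rvec x) \<le> real n * L \<longrightarrow>
          llt_error \<phi> \<alpha> P n x \<le> llt_bound \<phi> \<alpha> P m \<gamma> C M n x \<and>
          llt_bound \<phi> \<alpha> P m \<gamma> C M n x \<le> llt_bound \<phi> \<alpha> P m (\<lambda>\<eta>. 1) C M n x)) \<and>
    (finite {x. \<phi> x \<noteq> 0} \<longrightarrow>
       (\<exists>M C. (\<forall>\<eta>\<in>Omega \<phi>. M \<eta> > 0 \<and> C \<eta> > 0) \<and>
         (\<forall>n\<ge>1. \<forall>x.
            llt_error \<phi> \<alpha> P n x \<le> llt_bound \<phi> \<alpha> P m \<gamma> C M n x \<and>
            llt_bound \<phi> \<alpha> P m \<gamma> C M n x \<le> llt_bound \<phi> \<alpha> P m (\<lambda>\<eta>. 1) C M n x)))"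
proof -
  have "\<forall>\<eta>\<in>Omega \<phi>. \<exists>a. point_data (m \<eta>) a \<phi> \<eta> (\<alpha> \<eta>) (P \<eta>) (\<Upsilon> \<eta>) (A \<eta>)"
    using point_dataI[OF assms(2) _ assms(3,4,5)] by metis
  from bchoice[OF this] obtain a where
    a: "\<forall>\<eta>\<in>Omega \<phi>. point_data (m \<eta>) (a \<eta>) \<phi> \<eta> (\<alpha> \<eta>) (P \<eta>) (\<Upsilon> \<eta>) (A \<eta>)" ..
  interpret llt_data \<phi> \<alpha> P \<Upsilon> A m a by (rule llt_data.intro[OF assms(2)]) (use a in blast)
  let ?g = "\<lambda>\<eta>. gamma_ord (\<Upsilon> \<eta>) (A \<eta>) (m \<eta>)"
  show ?thesis unfolding \<gamma>_def
  proof (intro conjI allI impI finite_Omega)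
    fix L :: real assume L: "L > 0"
    show "\<exists>M C. (\<forall>\<eta>\<in>Omega \<phi>. M \<eta> > 0 \<and> C \<eta> > 0) \<and>
       (\<forall>n\<ge>1. \<forall>x. norm (rvec x) \<le> real n * L \<longrightarrow>
          llt_error \<phi> \<alpha> P n x \<le> llt_bound \<phi> \<alpha> P m ?g C M n x \<and>
          llt_bound \<phi> \<alpha> P m ?g C M n x \<le> llt_bound \<phi> \<alpha> P m (\<lambda>\<eta>. 1) C M n x)"
    proof (rule estimate_in_ball[OF L])
      fix M C
      assume MC: "\<And>\<eta>. \<eta> \<in> Omega \<phi> \<Longrightarrow> M \<eta> > 0" "\<And>\<eta>. \<eta> \<in> Omega \<phi> \<Longrightarrow> C \<eta> > 0"
        "\<And>n x. n \<ge> 1 \<Longrightarrow> norm (rvec x) \<le> real n * L \<Longrightarrow> llt_error \<phi> \<alpha> P n x \<le> llt_bound \<phi> \<alpha> P m ?g C M n x"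
      show ?thesis
      proof (rule exI[of _ M], rule exI[of _ C], intro conjI ballI allI impI MC(1,2))
        fix n :: nat and x :: "int^'d"
        assume n: "n \<ge> 1" and x: "norm (rvec x) \<le> real n * L"
        show "llt_error \<phi> \<alpha> P n x \<le> llt_bound \<phi> \<alpha> P m ?g C M n x" by (rule MC(3)[OF n x])
        show "llt_bound \<phi> \<alpha> P m ?g C M n x \<le> llt_bound \<phi> \<alpha> P m (\<lambda>\<eta>. 1) C M n x"
          by (rule llt_bound_gamma_le[OF MC(2) n])
      qed
    qed
  next
    assume supp: "finite {x. \<phi> x \<noteq> 0}"
    show "\<exists>M C. (\<forall>\<eta>\<in>Omega \<phi>. M \<eta> > 0 \<and> C \<eta> > 0) \<and>
       (\<forall>n\<ge>1. \<forall>x. llt_error \<phi> \<alpha> P n x \<le> llt_bound \<phi> \<alpha> P m ?g C M n x \<and>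
          llt_bound \<phi> \<alpha> P m ?g C M n x \<le> llt_bound \<phi> \<alpha> P m (\<lambda>\<eta>. 1) C M n x)"
    proof (rule estimate_finite_support[OF supp])
      fix M C
      assume MC: "\<And>\<eta>. \<eta> \<in> Omega \<phi> \<Longrightarrow> M \<eta> > 0" "\<And>\<eta>. \<eta> \<in> Omega \<phi> \<Longrightarrow> C \<eta> > 0"
        "\<And>n x. n \<ge> 1 \<Longrightarrow> llt_error \<phi> \<alpha> P n x \<le> llt_bound \<phi> \<alpha> P m ?g C M n x"
      show ?thesis
      proof (rule exI[of _ M], rule exI[of _ C], intro conjI ballI allI impI MC(1,2))
        fix n :: nat and x :: "int^'d"
        assume n: "n \<ge> 1"
        show "llt_error \<phi> \<alpha> P n x \<le> llt_bound \<phi> \<alpha> P m ?g C M n x" by (rule MC(3)[OF n])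
        show "llt_bound \<phi> \<alpha> P m ?g C M n x \<le> llt_bound \<phi> \<alpha> P m (\<lambda>\<eta>. 1) C M n x"
          by (rule llt_bound_gamma_le[OF MC(2) n])
      qed
    qed
  qed
qed

end
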